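(* Let $(M,g)$ be an Einstein manifold of cohomogeneity one under the action of a compact, connected group $G$ with principal isotropy group $K$, such that the isotropy representation has at most $r$ equivalent orthogonal summands $\mathfrak p_1\simeq\dots\simeq\mathfrak p_r$ of dimension $d$, with all other summands distinct. The Einstein metric can be diagonalized globally if $$\dim\big(\mathrm{span}\{Z_{ij}\mid 1\le i<j\le r\}\big)=\frac{r(r-1)}{2},\qquad Z_{ij}=\sum_{k=1}^{d}[Y^i_k,Y^j_k]_{\mathfrak p}.$$
   Context: $(M^n,g)$ is of cohomogeneity one under $G$: $G$ acts by isometries and the principal orbits $G/K$ have codimension one. On the union of principal orbits $g=dt^2+g_t$, where $g_t$ is a one-parameter family of $G$-invariant metrics on $G/K$. Fix a bi-invariant inner product $Q$ on $\mathfrak g$ and an $\mathrm{Ad}(K)$-invariant decomposition $\mathfrak g=\mathfrak k\oplus\mathfrak p$, $\mathfrak p=\mathfrak p_1\oplus\dots\oplus\mathfrak p_m$, with the $\mathfrak p_i$ irreducible, $Q(\mathfrak k,\mathfrak p)=0$ and $Q(\mathfrak p_i,\mathfrak p_j)=0$ for $i\ne j$; $\mathfrak p$ is identified with the tangent space of $G/K$ and $[\cdot,\cdot]_{\mathfrak p}$ is the $\mathfrak p$-component of the bracket. Here $\mathfrak p_i\simeq\mathfrak p_j$ for $1\le i,j\le r$ and the $\mathfrak p_l$ with $l>r$ are pairwise inequivalent and inequivalent to $\mathfrak p_1$. A real irreducible representation $\mathfrak p_1$ is called orthogonal if $\mathfrak p_1\otimes\mathbb C$ is irreducible. $\{Y^i_k\}_{k=1,\dots,d}$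 ($1\le i\le r$) are $Q$-orthonormal bases of $\mathfrak p_i$ corresponding to each other under equivalences of the $\mathfrak p_i$, so that on $\mathfrak p_1\oplus\dots\oplus\mathfrak p_r$ every invariant metric has matrix $(h_{ij}\mathrm{Id}_d)_{1\le i,j\le r}$, $h_{ij}=h_{ij}(t)$, while on each $\mathfrak p_l$, $l>r$, it is a multiple $A_l(t)Q|_{\mathfrak p_l}$. "The metric can be diagonalized globally" means that, for a suitable such choice of decomposition and bases (independent of $t$), $h_{ij}(t)\equiv 0$ for all $i\ne j$. *)

theory Defs
  imports "HOL-Analysis.Analysis" "HOL-Algebra.Group_Action"
begin

section \<open>Smooth maps and manifolds\<close>

text \<open>On an open set this is the class of \<open>k\<close> times continuously differentiable maps: all iterated
  directional derivatives up to order \<open>k\<close> exist and are continuous.\<close>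

fun Ck_on :: "nat \<Rightarrow> 'a::euclidean_space set \<Rightarrow> ('a \<Rightarrow> 'b::euclidean_space) \<Rightarrow> bool" where
  "Ck_on 0 S f \<longleftrightarrow> continuous_on S f"
| "Ck_on (Suc k) S f \<longleftrightarrow> (\<forall>x\<in>S. f differentiable (at x)) \<and>
     (\<forall>v. Ck_on k S (\<lambda>x. frechet_derivative f (at x) v))"

definition smooth_on :: "'a::euclidean_space set \<Rightarrow> ('a \<Rightarrow> 'b::euclidean_space) \<Rightarrow> bool" where
  "smooth_on S f \<longleftrightarrow> (\<forall>k. Ck_on k S f)"

text \<open>A chart is a domain together with a coordinate map. The values of the coordinate map outside
  the domain carry no meaning.\<close>

type_synonym ('m, 'e) chart = "'m set \<times> ('m \<Rightarrow> 'e)"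

abbreviation cdom :: "('m, 'e) chart \<Rightarrow> 'm set" where "cdom \<equiv> fst"
abbreviation cmap :: "('m, 'e) chart \<Rightarrow> 'm \<Rightarrow> 'e" where "cmap \<equiv> snd"

definition cinv :: "('m, 'e) chart \<Rightarrow> 'e \<Rightarrow> 'm" where
  "cinv \<kappa> = inv_into (cdom \<kappa>) (cmap \<kappa>)"

definition is_chart :: "('m::topological_space, 'e::euclidean_space) chart \<Rightarrow> bool" where
  "is_chart \<kappa> \<longleftrightarrow> open (cdom \<kappa>) \<and> open (cmap \<kappa> ` cdom \<kappa>) \<and>
     homeomorphism (cdom \<kappa>) (cmap \<kappa> ` cdom \<kappa>) (cmap \<kappa>) (cinv \<kappa>)"

definition smooth_atlas :: "('m::topological_space, 'e::euclidean_space) chart set \<Rightarrow> bool" where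
  "smooth_atlas A \<longleftrightarrow> (\<Union>\<kappa>\<in>A. cdom \<kappa>) = UNIV \<and> (\<forall>\<kappa>\<in>A. is_chart \<kappa>) \<and>
     (\<forall>\<kappa>\<in>A. \<forall>\<mu>\<in>A. smooth_on (cmap \<kappa> ` (cdom \<kappa> \<inter> cdom \<mu>)) (cmap \<mu> \<circ> cinv \<kappa>))"

definition smooth_map_on ::
  "('m::topological_space, 'e::euclidean_space) chart set \<Rightarrow> 'm set \<Rightarrow>
   ('n::topological_space, 'f::euclidean_space) chart set \<Rightarrow> ('m \<Rightarrow> 'n) \<Rightarrow> bool" where
  "smooth_map_on A S B f \<longleftrightarrow> continuous_on S f \<and>
     (\<forall>\<kappa>\<in>A. \<forall>\<mu>\<in>B. smooth_on (cmap \<kappa> ` (S \<inter> cdom \<kappa> \<inter> f -` cdom \<mu>)) (cmap \<mu> \<circ> f \<circ> cinv \<kappa>))"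

abbreviation "smooth_map A B f \<equiv> smooth_map_on A UNIV B f"

definition prod_atlas ::
  "('m, 'e) chart set \<Rightarrow> ('n, 'f) chart set \<Rightarrow> ('m \<times> 'n, 'e \<times> 'f) chart set" where
  "prod_atlas A B = {(cdom \<kappa> \<times> cdom \<mu>, map_prod (cmap \<kappa>) (cmap \<mu>)) | \<kappa> \<mu>. \<kappa> \<in> A \<and> \<mu> \<in> B}"

definition real_atlas :: "(real, real) chart set" where
  "real_atlas = {(UNIV, id)}"

text \<open>The tangent space at a point \<open>p\<close> is the model space, a tangent vector being represented by its
  coordinates in the chart \<open>chart_at A p\<close>, one fixed choice of a chart of the atlas around \<open>p\<close>.\<close>

definition chart_at :: "('m, 'e) chart set \<Rightarrow> 'm \<Rightarrow> ('m, 'e) chart" where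
  "chart_at A p = (SOME \<kappa>. \<kappa> \<in> A \<and> p \<in> cdom \<kappa>)"

definition mfderiv ::
  "('m, 'e::euclidean_space) chart set \<Rightarrow> ('n, 'f::euclidean_space) chart set \<Rightarrow>
   ('m \<Rightarrow> 'n) \<Rightarrow> 'm \<Rightarrow> 'e \<Rightarrow> 'f" where
  "mfderiv A B f p =
     frechet_derivative (cmap (chart_at B (f p)) \<circ> f \<circ> cinv (chart_at A p)) (at (cmap (chart_at A p) p))"

definition velocity :: "('m, 'e::euclidean_space) chart set \<Rightarrow> (real \<Rightarrow> 'm) \<Rightarrow> real \<Rightarrow> 'e" where
  "velocity A c t = vector_derivative (cmap (chart_at A (c t)) \<circ> c) (at t)"


section \<open>Riemannian metrics and the Ricci tensor\<close>

definition inner_product_form :: "('e::euclidean_space \<Rightarrow> 'e \<Rightarrow> real) \<Rightarrow> bool" where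
  "inner_product_form B \<longleftrightarrow> bilinear B \<and> (\<forall>u v. B u v = B v u) \<and> (\<forall>u. u \<noteq> 0 \<longrightarrow> B u u > 0)"

text \<open>The metric \<open>g\<close> in the coordinates of the chart \<open>\<kappa>\<close>, as a field of forms on the image of \<open>\<kappa>\<close>.
  The vectors \<open>u\<close> and \<open>v\<close> are given in the coordinates of \<open>\<kappa>\<close> and have to be converted to those of
  the chart that represents the tangent space.\<close>

definition coord_metric ::
  "('m, 'e::euclidean_space) chart set \<Rightarrow> ('m \<Rightarrow> 'e \<Rightarrow> 'e \<Rightarrow> real) \<Rightarrow> ('m, 'e) chart \<Rightarrow>
   'e \<Rightarrow> 'e \<Rightarrow> 'e \<Rightarrow> real" where
  "coord_metric A g \<kappa> x u v =
     (let p = cinv \<kappa> x; D = frechet_derivative (cmap (chart_at A p) \<circ> cinv \<kappa>) (at x)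
      in g p (D u) (D v))"

definition riemannian_metric ::
  "('m, 'e::euclidean_space) chart set \<Rightarrow> ('m \<Rightarrow> 'e \<Rightarrow> 'e \<Rightarrow> real) \<Rightarrow> bool" where
  "riemannian_metric A g \<longleftrightarrow> (\<forall>p. inner_product_form (g p)) \<and>
     (\<forall>\<kappa>\<in>A. \<forall>u v. smooth_on (cmap \<kappa> ` cdom \<kappa>) (\<lambda>x. coord_metric A g \<kappa> x u v))"

text \<open>For a metric \<open>\<gamma>\<close> on an open subset of a Euclidean space, \<open>christoffel \<gamma> x u v\<close> is the
  Levi-Civita derivative at \<open>x\<close> of the constant vector field \<open>v\<close> in the direction \<open>u\<close>, given by the
  Koszul formula.\<close>

definition christoffel ::
  "('e::euclidean_space \<Rightarrow> 'e \<Rightarrow> 'e \<Rightarrow> real) \<Rightarrow> 'e \<Rightarrow> 'e \<Rightarrow> 'e \<Rightarrow> 'e" where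
  "christoffel \<gamma> x u v = (THE z. \<forall>w. 2 * \<gamma> x z w =
       frechet_derivative (\<lambda>y. \<gamma> y v w) (at x) u
     + frechet_derivative (\<lambda>y. \<gamma> y u w) (at x) v
     - frechet_derivative (\<lambda>y. \<gamma> y u v) (at x) w)"

text \<open>\<open>R(u,v)w = \<nabla>\<^sub>u \<nabla>\<^sub>v w - \<nabla>\<^sub>v \<nabla>\<^sub>u w\<close> for constant fields \<open>u\<close>, \<open>v\<close>, \<open>w\<close>.\<close>

definition curvature ::
  "('e::euclidean_space \<Rightarrow> 'e \<Rightarrow> 'e \<Rightarrow> real) \<Rightarrow> 'e \<Rightarrow> 'e \<Rightarrow> 'e \<Rightarrow> 'e \<Rightarrow> 'e" where
  "curvature \<gamma> x u v w =
       frechet_derivative (\<lambda>y. christoffel \<gamma> y v w) (at x) u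
     - frechet_derivative (\<lambda>y. christoffel \<gamma> y u w) (at x) v
     + christoffel \<gamma> x u (christoffel \<gamma> x v w)
     - christoffel \<gamma> x v (christoffel \<gamma> x u w)"

text \<open>The trace of \<open>u \<mapsto> R(u,v)w\<close>. A trace may be computed in any basis, here in the standard one of
  the model space, which is unrelated to the metric.\<close>

definition coord_ricci ::
  "('e::euclidean_space \<Rightarrow> 'e \<Rightarrow> 'e \<Rightarrow> real) \<Rightarrow> 'e \<Rightarrow> 'e \<Rightarrow> 'e \<Rightarrow> real" where
  "coord_ricci \<gamma> x v w = (\<Sum>b\<in>Basis. curvature \<gamma> x b v w \<bullet> b)"

definition ricci ::
  "('m, 'e::euclidean_space) chart set \<Rightarrow> ('m \<Rightarrow> 'e \<Rightarrow> 'e \<Rightarrow> real) \<Rightarrow> 'm \<Rightarrow> 'e \<Rightarrow> 'e \<Rightarrow> real" where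
  "ricci A g p = coord_ricci (coord_metric A g (chart_at A p)) (cmap (chart_at A p) p)"

definition einstein ::
  "('m, 'e::euclidean_space) chart set \<Rightarrow> ('m \<Rightarrow> 'e \<Rightarrow> 'e \<Rightarrow> real) \<Rightarrow> bool" where
  "einstein A g \<longleftrightarrow> (\<exists>\<Lambda>. \<forall>p v w. ricci A g p v w = \<Lambda> * g p v w)"


section \<open>Lie groups\<close>

definition lie_group ::
  "('g::topological_space, 'l::euclidean_space) chart set \<Rightarrow> 'g monoid \<Rightarrow> bool" where
  "lie_group A G \<longleftrightarrow> group G \<and> carrier G = UNIV \<and> smooth_atlas A \<and>
     smooth_map (prod_atlas A A) A (\<lambda>(a, b). a \<otimes>\<^bsub>G\<^esub> b) \<and> smooth_map A A (\<lambda>a. inv\<^bsub>G\<^esub> a)"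

text \<open>The Lie algebra is the tangent space at the identity, hence the whole type \<open>'l\<close>.\<close>

definition Ad ::
  "('g, 'l::euclidean_space) chart set \<Rightarrow> 'g monoid \<Rightarrow> 'g \<Rightarrow> 'l \<Rightarrow> 'l" where
  "Ad A G a = mfderiv A A (\<lambda>b. a \<otimes>\<^bsub>G\<^esub> b \<otimes>\<^bsub>G\<^esub> inv\<^bsub>G\<^esub> a) \<one>\<^bsub>G\<^esub>"

text \<open>\<open>[X,Y]\<close> is the derivative of \<open>a \<mapsto> Ad a Y\<close> at the identity in the direction \<open>X\<close>.\<close>

definition lie_bracket ::
  "('g, 'l::euclidean_space) chart set \<Rightarrow> 'g monoid \<Rightarrow> 'l \<Rightarrow> 'l \<Rightarrow> 'l" where
  "lie_bracket A G X Y =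
     (let \<kappa> = chart_at A \<one>\<^bsub>G\<^esub>
      in frechet_derivative (\<lambda>x. Ad A G (cinv \<kappa> x) Y) (at (cmap \<kappa> \<one>\<^bsub>G\<^esub>)) X)"

text \<open>The Lie algebra of a closed subgroup \<open>K\<close>: initial velocities of the one-parameter groups
  contained in \<open>K\<close>.\<close>

definition lie_algebra_of ::
  "('g::topological_space, 'l::euclidean_space) chart set \<Rightarrow> 'g monoid \<Rightarrow> 'g set \<Rightarrow> 'l set" where
  "lie_algebra_of A G K = {velocity A \<gamma> 0 | \<gamma>. smooth_map real_atlas A \<gamma> \<and> range \<gamma> \<subseteq> K \<and>
     (\<forall>s t. \<gamma> (s + t) = \<gamma> s \<otimes>\<^bsub>G\<^esub> \<gamma> t)}"

definition bi_invariant ::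
  "('g, 'l::euclidean_space) chart set \<Rightarrow> 'g monoid \<Rightarrow> ('l \<Rightarrow> 'l \<Rightarrow> real) \<Rightarrow> bool" where
  "bi_invariant A G Q \<longleftrightarrow> inner_product_form Q \<and>
     (\<forall>a\<in>carrier G. \<forall>X Y. Q (Ad A G a X) (Ad A G a Y) = Q X Y)"


section \<open>Cohomogeneity one actions\<close>

definition smooth_isometric_action ::
  "('g::topological_space, 'l::euclidean_space) chart set \<Rightarrow> 'g monoid \<Rightarrow>
   ('m::topological_space, 'e::euclidean_space) chart set \<Rightarrow> ('m \<Rightarrow> 'e \<Rightarrow> 'e \<Rightarrow> real) \<Rightarrow>
   ('g \<Rightarrow> 'm \<Rightarrow> 'm) \<Rightarrow> bool" where
  "smooth_isometric_action A G B g \<phi> \<longleftrightarrow> group_action G UNIV \<phi> \<and>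
     smooth_map (prod_atlas A B) B (\<lambda>(a, p). \<phi> a p) \<and>
     (\<forall>a\<in>carrier G. \<forall>p u v. g (\<phi> a p) (mfderiv B B (\<phi> a) p u) (mfderiv B B (\<phi> a) p v) = g p u v)"

text \<open>The value at \<open>p\<close> of the action field of the Lie algebra element \<open>X\<close>.\<close>

definition action_field ::
  "('g, 'l::euclidean_space) chart set \<Rightarrow> 'g monoid \<Rightarrow> ('m, 'e::euclidean_space) chart set \<Rightarrow>
   ('g \<Rightarrow> 'm \<Rightarrow> 'm) \<Rightarrow> 'm \<Rightarrow> 'l \<Rightarrow> 'e" where
  "action_field A G B \<phi> p X = mfderiv A B (\<lambda>a. \<phi> a p) \<one>\<^bsub>G\<^esub> X"

text \<open>A point lies on a principal orbit if its isotropy group is, up to conjugation, contained in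
  every other isotropy group.\<close>

definition principal_point :: "'g monoid \<Rightarrow> ('g \<Rightarrow> 'm \<Rightarrow> 'm) \<Rightarrow> 'm \<Rightarrow> bool" where
  "principal_point G \<phi> p \<longleftrightarrow> (\<forall>q. \<exists>a\<in>carrier G.
     (\<lambda>b. a \<otimes>\<^bsub>G\<^esub> b \<otimes>\<^bsub>G\<^esub> inv\<^bsub>G\<^esub> a) ` stabilizer G \<phi> p \<subseteq> stabilizer G \<phi> q)"

text \<open>The tangent space of the orbit through \<open>p\<close> is the range of \<open>action_field A G B \<phi> p\<close>.\<close>

definition cohomogeneity_one ::
  "('g::topological_space, 'l::euclidean_space) chart set \<Rightarrow> 'g monoid \<Rightarrow>
   ('m::topological_space, 'e::euclidean_space) chart set \<Rightarrow> ('m \<Rightarrow> 'e \<Rightarrow> 'e \<Rightarrow> real) \<Rightarrow>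
   ('g \<Rightarrow> 'm \<Rightarrow> 'm) \<Rightarrow> bool" where
  "cohomogeneity_one A G B g \<phi> \<longleftrightarrow> smooth_isometric_action A G B g \<phi> \<and>
     (\<forall>p. principal_point G \<phi> p \<longrightarrow> dim (range (action_field A G B \<phi> p)) + 1 = DIM('e))"

text \<open>The description \<open>g = dt\<^sup>2 + g\<^sub>t\<close> on the union of the principal orbits: \<open>(t, aK) \<mapsto> \<phi> a (c t)\<close>
  maps \<open>I \<times> G/K\<close> onto that union, where \<open>c\<close> is a unit speed curve orthogonal to the orbits all of
  whose points have the isotropy group \<open>K\<close>. The map is not required to be injective, because the
  orbit space of \<open>M\<close> may be a circle.\<close>

definition normal_curve ::
  "('g::topological_space, 'l::euclidean_space) chart set \<Rightarrow> 'g monoid \<Rightarrow>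
   ('m::topological_space, 'e::euclidean_space) chart set \<Rightarrow> ('m \<Rightarrow> 'e \<Rightarrow> 'e \<Rightarrow> real) \<Rightarrow>
   ('g \<Rightarrow> 'm \<Rightarrow> 'm) \<Rightarrow> 'g set \<Rightarrow> real set \<Rightarrow> (real \<Rightarrow> 'm) \<Rightarrow> bool" where
  "normal_curve A G B g \<phi> K I c \<longleftrightarrow> open I \<and> is_interval I \<and> I \<noteq> {} \<and> smooth_map_on real_atlas I B c \<and>
     (\<forall>t\<in>I. stabilizer G \<phi> (c t) = K \<and>
        g (c t) (velocity B c t) (velocity B c t) = 1 \<and>
        (\<forall>X. g (c t) (velocity B c t) (action_field A G B \<phi> (c t) X) = 0)) \<and>
     (\<Union>t\<in>I. orbit G \<phi> (c t)) = {p. principal_point G \<phi> p}"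

text \<open>The metric \<open>g\<^sub>t\<close> on \<open>G/K\<close>, evaluated on elements of the Lie algebra; on a complement of the Lie
  algebra of \<open>K\<close>, identified with the tangent space of \<open>G/K\<close>, it is an inner product.\<close>

definition orbit_metric ::
  "('g, 'l::euclidean_space) chart set \<Rightarrow> 'g monoid \<Rightarrow> ('m, 'e::euclidean_space) chart set \<Rightarrow>
   ('m \<Rightarrow> 'e \<Rightarrow> 'e \<Rightarrow> real) \<Rightarrow> ('g \<Rightarrow> 'm \<Rightarrow> 'm) \<Rightarrow> (real \<Rightarrow> 'm) \<Rightarrow> real \<Rightarrow> 'l \<Rightarrow> 'l \<Rightarrow> real" where
  "orbit_metric A G B g \<phi> c t X Y =
     g (c t) (action_field A G B \<phi> (c t) X) (action_field A G B \<phi> (c t) Y)"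


section \<open>The isotropy representation\<close>

definition invariant_subspace :: "('g \<Rightarrow> 'v \<Rightarrow> 'v) \<Rightarrow> 'g set \<Rightarrow> 'v::real_vector set \<Rightarrow> bool" where
  "invariant_subspace \<rho> K V \<longleftrightarrow> subspace V \<and> (\<forall>a\<in>K. \<rho> a ` V \<subseteq> V)"

definition irreducible_rep :: "('g \<Rightarrow> 'v \<Rightarrow> 'v) \<Rightarrow> 'g set \<Rightarrow> 'v::real_vector set \<Rightarrow> bool" where
  "irreducible_rep \<rho> K V \<longleftrightarrow> invariant_subspace \<rho> K V \<and> V \<noteq> {0} \<and>
     (\<forall>W. invariant_subspace \<rho> K W \<and> W \<subseteq> V \<longrightarrow> W = {0} \<or> W = V)"

definition equivalence_map ::
  "('g \<Rightarrow> 'v \<Rightarrow> 'v) \<Rightarrow> 'g set \<Rightarrow> 'v::real_vector set \<Rightarrow> 'v set \<Rightarrow> ('v \<Rightarrow> 'v) \<Rightarrow> bool" where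
  "equivalence_map \<rho> K V W T \<longleftrightarrow> linear T \<and> bij_betw T V W \<and> (\<forall>a\<in>K. \<forall>x\<in>V. T (\<rho> a x) = \<rho> a (T x))"

definition equivalent_reps ::
  "('g \<Rightarrow> 'v \<Rightarrow> 'v) \<Rightarrow> 'g set \<Rightarrow> 'v::real_vector set \<Rightarrow> 'v set \<Rightarrow> bool" where
  "equivalent_reps \<rho> K V W \<longleftrightarrow> (\<exists>T. equivalence_map \<rho> K V W T)"

text \<open>The complexification of \<open>V\<close> is \<open>V \<times> V\<close>, the pair \<open>(x, y)\<close> standing for \<open>x + i y\<close>. Its complex
  subspaces are the real subspaces closed under \<open>(x, y) \<mapsto> (- y, x)\<close>.\<close>

definition orthogonal_rep :: "('g \<Rightarrow> 'v \<Rightarrow> 'v) \<Rightarrow> 'g set \<Rightarrow> 'v::real_vector set \<Rightarrow> bool" where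
  "orthogonal_rep \<rho> K V \<longleftrightarrow> irreducible_rep \<rho> K V \<and>
     (\<forall>W. invariant_subspace (\<lambda>a. map_prod (\<rho> a) (\<rho> a)) K W \<and> W \<subseteq> V \<times> V \<and>
          (\<forall>(x, y)\<in>W. (- y, x) \<in> W) \<longrightarrow> W = {0} \<or> W = V \<times> V)"

text \<open>The summands are \<open>P 1, \<dots>, P m\<close>; the first \<open>r\<close> of them are equivalent, of orthogonal type and
  of dimension \<open>d\<close>, and \<open>Y i 1, \<dots>, Y i d\<close> are corresponding orthonormal bases of \<open>P i\<close> for
  \<open>i \<le> r\<close>. That the sum is direct follows from the orthogonality relations.\<close>

definition isotropy_decomposition ::
  "('g::topological_space, 'l::euclidean_space) chart set \<Rightarrow> 'g monoid \<Rightarrow> 'g set \<Rightarrow>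
   ('l \<Rightarrow> 'l \<Rightarrow> real) \<Rightarrow> nat \<Rightarrow> nat \<Rightarrow> nat \<Rightarrow> (nat \<Rightarrow> 'l set) \<Rightarrow> (nat \<Rightarrow> nat \<Rightarrow> 'l) \<Rightarrow> bool" where
  "isotropy_decomposition A G K Q m r d P Y \<longleftrightarrow>
     1 \<le> r \<and> r \<le> m \<and>
     (\<forall>i\<in>{1..m}. irreducible_rep (Ad A G) K (P i)) \<and>
     (\<forall>i\<in>{1..m}. \<forall>X\<in>lie_algebra_of A G K. \<forall>Z\<in>P i. Q X Z = 0) \<and>
     (\<forall>i\<in>{1..m}. \<forall>j\<in>{1..m}. i \<noteq> j \<longrightarrow> (\<forall>X\<in>P i. \<forall>Z\<in>P j. Q X Z = 0)) \<and>
     span (lie_algebra_of A G K \<union> (\<Union>i\<in>{1..m}. P i)) = UNIV \<and>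
     (\<forall>i\<in>{1..r}. \<forall>j\<in>{1..r}. equivalent_reps (Ad A G) K (P i) (P j)) \<and>
     (\<forall>l\<in>{r<..m}. \<not> equivalent_reps (Ad A G) K (P 1) (P l)) \<and>
     (\<forall>l\<in>{r<..m}. \<forall>l'\<in>{r<..m}. l \<noteq> l' \<longrightarrow> \<not> equivalent_reps (Ad A G) K (P l) (P l')) \<and>
     (\<forall>i\<in>{1..r}. orthogonal_rep (Ad A G) K (P i) \<and> dim (P i) = d) \<and>
     (\<forall>i\<in>{1..r}. \<forall>k\<in>{1..d}. \<forall>l\<in>{1..d}. Q (Y i k) (Y i l) = (if k = l then 1 else 0)) \<and>
     (\<forall>i\<in>{1..r}. span (Y i ` {1..d}) = P i) \<and>
     (\<forall>i\<in>{1..r}. \<forall>j\<in>{1..r}. \<exists>T. equivalence_map (Ad A G) K (P i) (P j) T \<and>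
        (\<forall>k\<in>{1..d}. T (Y i k) = Y j k))"

definition p_part ::
  "('g::topological_space, 'l::euclidean_space) chart set \<Rightarrow> 'g monoid \<Rightarrow> 'g set \<Rightarrow>
   nat \<Rightarrow> (nat \<Rightarrow> 'l set) \<Rightarrow> 'l \<Rightarrow> 'l" where
  "p_part A G K m P X = (THE Z. Z \<in> span (\<Union>i\<in>{1..m}. P i) \<and> X - Z \<in> lie_algebra_of A G K)"

definition Zvec ::
  "('g::topological_space, 'l::euclidean_space) chart set \<Rightarrow> 'g monoid \<Rightarrow> 'g set \<Rightarrow>
   nat \<Rightarrow> nat \<Rightarrow> (nat \<Rightarrow> 'l set) \<Rightarrow> (nat \<Rightarrow> nat \<Rightarrow> 'l) \<Rightarrow> nat \<Rightarrow> nat \<Rightarrow> 'l" where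
  "Zvec A G K m d P Y i j = (\<Sum>k=1..d. p_part A G K m P (lie_bracket A G (Y i k) (Y j k)))"

text \<open>For one choice of decomposition and bases, independent of \<open>t\<close>, the matrix of \<open>g\<^sub>t\<close> on the sum
  of the \<open>r\<close> equivalent summands is \<open>(h i j t Id)\<close>, with \<open>h i j\<close> identically zero for
  \<open>i \<noteq> j\<close>.\<close>

definition globally_diagonalizable ::
  "('g::topological_space, 'l::euclidean_space) chart set \<Rightarrow> 'g monoid \<Rightarrow>
   ('m::topological_space, 'e::euclidean_space) chart set \<Rightarrow> ('m \<Rightarrow> 'e \<Rightarrow> 'e \<Rightarrow> real) \<Rightarrow>
   ('g \<Rightarrow> 'm \<Rightarrow> 'm) \<Rightarrow> 'g set \<Rightarrow> real set \<Rightarrow> (real \<Rightarrow> 'm) \<Rightarrow>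
   ('l \<Rightarrow> 'l \<Rightarrow> real) \<Rightarrow> nat \<Rightarrow> nat \<Rightarrow> nat \<Rightarrow> bool" where
  "globally_diagonalizable A G B g \<phi> K I c Q m r d \<longleftrightarrow>
     (\<exists>P Y h. isotropy_decomposition A G K Q m r d P Y \<and>
        (\<forall>t\<in>I. \<forall>i\<in>{1..r}. \<forall>j\<in>{1..r}. \<forall>k\<in>{1..d}. \<forall>l\<in>{1..d}.
           orbit_metric A G B g \<phi> c t (Y i k) (Y j l) = (if k = l then h i j t else 0)) \<and>
        (\<forall>t\<in>I. \<forall>i\<in>{1..r}. \<forall>j\<in>{1..r}. i \<noteq> j \<longrightarrow> h i j t = 0))"

end

theory Submission
  imports Defs
begin

text \<open>By Schur's lemma, an invariant metric is a symmetric matrix \<open>h\<close> on the sum of the equivalent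
  summands and a multiple of \<open>Q\<close> on every other summand. The mixed component of the Einstein equation,
  in the directions \<open>c'\<close> and \<open>Z\<close>, says that the trace of \<open>(X, X') \<mapsto> h'([Z,X], X')\<close> over an orthonormal
  frame of the orbit vanishes. This trace is the \<open>Q\<close>-product of \<open>Z\<close> with \<open>\<Sum> N i j Z i j\<close>, where
  \<open>N = h\<inverse> h'\<close>. As \<open>Z i j\<close> is skew in \<open>i\<close> and \<open>j\<close>, its independence makes \<open>N\<close> symmetric, so that
  \<open>h\<close> and \<open>h'\<close> commute at every time.

  The tangential components express \<open>h''\<close> as a polynomial in the entries of \<open>h\<close>, \<open>h'\<close> and the inverse
  matrix, hence \<open>h\<close> is real analytic. A real analytic curve of symmetric matrices that commutes with
  its derivative at every time consists of pairwise commuting matrices: this holds to all orders at a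
  time of maximal rank of \<open>ad h\<close>. A constant orthogonal matrix diagonalizing all of them rotates the
  equivalent summands into the required decomposition.\<close>

section \<open>Calculus of \<open>C\<^sup>k\<close> maps\<close>

text \<open>Commuting with its derivative at every time does not make a smooth curve of symmetric
  matrices commute with itself: eigenvectors may turn at a time where eigenvalues coincide to
  infinite order. This is why the tangential equations are needed although the mixed one alone gives
  the algebraic condition. They contain sums over orthonormal frames of the orbit, which are chosen
  anew at every time; rewriting these sums with the inverse of the metric removes the frames, and
  since the derivative of an inverse is polynomial in the inverse and \<open>h'\<close>, adjoining
  the inverse to the unknowns gives a polynomial system. No curvature is computed in a moving frame:
  action fields are Killing, and Kostant's identity turns the Ricci components into derivatives of
  Koszul's formula. In the mixed equation a second term occurs, built from traces of adjoint maps;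
  it vanishes because these are skew for \<open>Q\<close>. To treat \<open>h\<close> as a metric on
  the complement of the isotropy algebra one must know that this algebra is the kernel of the action
  field, which requires a one-parameter group for every Lie algebra element.\<close>

abbreviation Dv :: "('a::real_normed_vector \<Rightarrow> 'b::real_normed_vector) \<Rightarrow> 'a \<Rightarrow> 'a \<Rightarrow> 'b" where
  "Dv f x v \<equiv> frechet_derivative f (at x) v"

lemma frechet_derivative_cong_open:
  assumes "open S" "x \<in> S" "\<And>y. y \<in> S \<Longrightarrow> f y = g y"
  shows "frechet_derivative f (at x) = frechet_derivative g (at x)"
proof -
  have "(f has_derivative f') (at x) = (g has_derivative f') (at x)" for f'
    using assms has_derivative_transform_within_open[of f f' x UNIV S g]
      has_derivative_transform_within_open[of g f' x UNIV S f] by auto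
  then show ?thesis unfolding frechet_derivative_def by simp
qed

lemma differentiable_cong_open:
  assumes "open S" "x \<in> S" "\<And>y. y \<in> S \<Longrightarrow> f y = g y"
  shows "f differentiable (at x) \<longleftrightarrow> g differentiable (at x)"
  unfolding differentiable_def
  using assms has_derivative_transform_within_open[of f _ x UNIV S g]
      has_derivative_transform_within_open[of g _ x UNIV S f] by metis

lemma linear_frechet_derivative': "f differentiable (at x) \<Longrightarrow> linear (frechet_derivative f (at x))"
  by (metis frechet_derivative_works has_derivative_linear)

lemma Ck_on_cong:
  assumes "open S" "\<And>y. y \<in> S \<Longrightarrow> f y = g y"
  shows "Ck_on k S f \<longleftrightarrow> Ck_on k S g"
  using assms(2)
proof (induction k arbitrary: f g)
  case 0
  then show ?case by (auto intro: continuous_on_cong[THEN iffD1])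
next
  case (Suc k)
  have "f differentiable (at x) \<longleftrightarrow> g differentiable (at x)" if "x \<in> S" for x
    using differentiable_cong_open[OF assms(1) that, of f g] Suc.prems by auto
  moreover have "Ck_on k S (\<lambda>x. Dv f x v) \<longleftrightarrow> Ck_on k S (\<lambda>x. Dv g x v)" for v
    by (rule Suc.IH) (simp add: frechet_derivative_cong_open[OF assms(1) _ Suc.prems])
  ultimately show ?case by auto
qed

lemma Ck_on_subset: "Ck_on k S f \<Longrightarrow> T \<subseteq> S \<Longrightarrow> Ck_on k T f"
  by (induction k arbitrary: f) (auto intro: continuous_on_subset)

lemma Ck_on_continuous: "Ck_on k S f \<Longrightarrow> continuous_on S f"
proof (cases k)
  case (Suc n)
  assume "Ck_on k S f"
  with Suc show ?thesis
    by (auto intro!: continuous_at_imp_continuous_on differentiable_imp_continuous_within)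
qed simp

lemma Ck_on_Suc_imp: "Ck_on (Suc k) S f \<Longrightarrow> Ck_on k S f"
proof (induction k arbitrary: f)
  case 0
  then show ?case using Ck_on_continuous[OF 0] by simp
next
  case (Suc k)
  then show ?case by auto
qed

text \<open>The global one-parameter group is glued from translates of a local integral curve, so
  its smoothness has to be checked near each point separately.\<close>

lemma Ck_on_local:
  assumes "\<And>x. x \<in> S \<Longrightarrow> \<exists>T. open T \<and> x \<in> T \<and> Ck_on k T f"
  shows "Ck_on k S f"
  using assms
proof (induction k arbitrary: f)
  case 0
  show ?case
  proof (simp, intro continuous_at_imp_continuous_on ballI)
    fix x assume "x \<in> S"
    with 0 obtain T where "open T" "x \<in> T" "continuous_on T f" by auto
    then show "isCont f x" by (metis continuous_on_eq_continuous_at)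
  qed
next
  case (Suc k)
  show ?case
  proof (simp, intro conjI ballI allI)
    fix x assume "x \<in> S"
    with Suc.prems show "f differentiable at x" by auto
  next
    fix v
    show "Ck_on k S (\<lambda>x. Dv f x v)"
      by (rule Suc.IH) (use Suc.prems in force)
  qed
qed

lemma Ck_on_const: "Ck_on k S (\<lambda>x. c)"
  by (induction k arbitrary: c) (auto simp: frechet_derivative_const)

lemma Ck_on_add:
  assumes "open S" "Ck_on k S f" "Ck_on k S g"
  shows "Ck_on k S (\<lambda>x. f x + g x)"
  using assms(2,3)
proof (induction k arbitrary: f g)
  case (Suc k)
  have D: "Dv (\<lambda>x. f x + g x) x v = Dv f x v + Dv g x v" if "x \<in> S" for x v
    using has_derivative_add[of f "frechet_derivative f (at x)" "at x" g "frechet_derivative g (at x)",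
        THEN frechet_derivative_at] Suc.prems that
    by (simp add: frechet_derivative_works[symmetric] fun_eq_iff)
  have "Ck_on k S (\<lambda>x. Dv (\<lambda>x. f x + g x) x v)" for v
    by (subst Ck_on_cong[OF assms(1), of _ "\<lambda>x. Dv f x v + Dv g x v"])
      (use Suc in \<open>auto simp: D\<close>)
  then show ?case using Suc by auto
qed (auto intro: continuous_intros)

lemma Ck_on_linear_comp:
  assumes "open S" "Ck_on k S f" "bounded_linear L"
  shows "Ck_on k S (\<lambda>x. L (f x))"
  using assms(2)
proof (induction k arbitrary: f)
  case 0
  then show ?case using assms(3) by (auto intro: bounded_linear.continuous_on)
next
  case (Suc k)
  have D: "((\<lambda>x. L (f x)) has_derivative (\<lambda>v. L (Dv f x v))) (at x)" if "x \<in> S" for x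
    using Suc.prems that
    by (auto intro!: bounded_linear.has_derivative[OF assms(3)] simp: frechet_derivative_works[symmetric])
  have "Ck_on k S (\<lambda>x. Dv (\<lambda>x. L (f x)) x v)" for v
    by (subst Ck_on_cong[OF assms(1), of _ "\<lambda>x. L (Dv f x v)"])
      (use Suc D in \<open>auto simp: frechet_derivative_at[OF D, symmetric]\<close>)
  then show ?case using D by (auto simp: differentiable_def)
qed

lemma Ck_on_sum:
  assumes "open S" "finite J" "\<And>j. j \<in> J \<Longrightarrow> Ck_on k S (f j)"
  shows "Ck_on k S (\<lambda>x. \<Sum>j\<in>J. f j x)"
  using assms(2,3)
  by (induction J rule: finite_induct) (auto intro!: Ck_on_const Ck_on_add[OF assms(1)])

lemma Ck_on_bilinear:
  assumes "open S" "Ck_on k S f" "Ck_on k S g" "bounded_bilinear B"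
  shows "Ck_on k S (\<lambda>x. B (f x) (g x))"
  using assms(2,3)
proof (induction k arbitrary: f g)
  case 0
  then show ?case using assms(4) by (auto intro: bounded_bilinear.continuous_on)
next
  case (Suc k)
  have D: "((\<lambda>x. B (f x) (g x)) has_derivative (\<lambda>v. B (f x) (Dv g x v) + B (Dv f x v) (g x))) (at x)"
    if "x \<in> S" for x
    using Suc.prems that
    by (auto intro!: bounded_bilinear.FDERIV[OF assms(4)] simp: frechet_derivative_works[symmetric])
  have k: "Ck_on k S f" "Ck_on k S g"
    using Suc.prems Ck_on_Suc_imp by blast+
  have "Ck_on k S (\<lambda>x. Dv (\<lambda>x. B (f x) (g x)) x v)" for v
    by (subst Ck_on_cong[OF assms(1), of _ "\<lambda>x. B (f x) (Dv g x v) + B (Dv f x v) (g x)"])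
      (use Suc D k in \<open>auto simp: frechet_derivative_at[OF D, symmetric] intro!: Ck_on_add[OF assms(1)]\<close>)
  then show ?case using D by (auto simp: differentiable_def)
qed

lemma Ck_on_Pair:
  assumes "open S" "Ck_on k S f" "Ck_on k S g"
  shows "Ck_on k S (\<lambda>x. (f x, g x))"
proof -
  have "Ck_on k S (\<lambda>x. (f x, 0) + (0, g x))"
    by (intro Ck_on_add[OF assms(1)] Ck_on_linear_comp[OF assms(1) assms(2), of "\<lambda>x. (x, 0)"]
         Ck_on_linear_comp[OF assms(1) assms(3), of "\<lambda>x. (0, x)"])
      (auto intro!: bounded_linear_intros bounded_linear_Pair)
  then show ?thesis by simp
qed

lemma Ck_on_bounded_linear: "bounded_linear L \<Longrightarrow> Ck_on k S L"
proof (cases k)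
  case (Suc n)
  assume "bounded_linear L"
  then have "(L has_derivative L) (at x)" for x by (rule bounded_linear_imp_has_derivative)
  then have "Dv L x v = L v" "L differentiable (at x)" for x v
    using frechet_derivative_at by (metis, auto simp: differentiable_def)
  then show ?thesis using Suc by (auto simp: Ck_on_const)
qed (auto intro: linear_continuous_on)

lemma Ck_on_ident: "Ck_on k S (\<lambda>x. x)"
  by (rule Ck_on_bounded_linear) (rule bounded_linear_ident)

lemma frechet_derivative_basis_sum:
  fixes f :: "'a::euclidean_space \<Rightarrow> 'b::real_normed_vector"
  assumes "f differentiable (at x)"
  shows "Dv f x v = (\<Sum>b\<in>Basis. (v \<bullet> b) *\<^sub>R Dv f x b)"
proof -
  interpret linear "frechet_derivative f (at x)" by (rule linear_frechet_derivative'[OF assms])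
  have "Dv f x v = Dv f x (\<Sum>b\<in>Basis. (v \<bullet> b) *\<^sub>R b)" by (simp add: euclidean_representation)
  then show ?thesis by (simp add: sum scale)
qed

lemma frechet_derivative_compose':
  assumes "g differentiable (at x)" "f differentiable (at (g x))"
  shows "((\<lambda>x. f (g x)) has_derivative (\<lambda>v. Dv f (g x) (Dv g x v))) (at x)"
  using diff_chain_at[of g "frechet_derivative g (at x)" x f "frechet_derivative f (at (g x))"] assms
  by (auto simp: frechet_derivative_works[symmetric] o_def)

text \<open>The chain rule makes a directional derivative of the composite a finite sum of products
  of coordinates of the derivative of \<open>g\<close> with partial derivatives of \<open>f\<close>
  along \<open>g\<close>. These partials meet the same \<open>g\<close>, hence the induction
  generalizes over \<open>f\<close> alone.\<close>

lemma Ck_on_compose: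
  fixes f :: "'b::euclidean_space \<Rightarrow> 'c::euclidean_space" and g :: "'a::euclidean_space \<Rightarrow> 'b"
  assumes "open S" "open T" "g ` S \<subseteq> T" "Ck_on k T f" "Ck_on k S g"
  shows "Ck_on k S (\<lambda>x. f (g x))"
  using assms(4,5)
proof (induction k arbitrary: f)
  case 0
  then show ?case using assms(3) by (auto intro: continuous_on_compose2)
next
  case (Suc k)
  have D: "((\<lambda>x. f (g x)) has_derivative (\<lambda>v. Dv f (g x) (Dv g x v))) (at x)" if "x \<in> S" for x
    by (rule frechet_derivative_compose') (use Suc.prems assms(3) that in auto)
  have gk: "Ck_on k S g" using Suc.prems Ck_on_Suc_imp by blast
  have "Ck_on k S (\<lambda>x. Dv (\<lambda>x. f (g x)) x v)" for v
  proof (subst Ck_on_cong[OF assms(1), of _ "\<lambda>x. \<Sum>b\<in>Basis. (Dv g x v \<bullet> b) *\<^sub>R Dv f (g x) b"])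
    fix y assume "y \<in> S"
    then show "Dv (\<lambda>x. f (g x)) y v = (\<Sum>b\<in>Basis. (Dv g y v \<bullet> b) *\<^sub>R Dv f (g y) b)"
      using Suc.prems assms(3) frechet_derivative_basis_sum[of f "g y" "Dv g y v"]
      by (auto simp: frechet_derivative_at[OF D, symmetric])
  next
    have "Ck_on k S (\<lambda>x. Dv f (g x) b)" for b
      by (rule Suc.IH[of "\<lambda>x. Dv f x b"]) (use Suc.prems gk in auto)
    moreover have "Ck_on k S (\<lambda>x. Dv g x v \<bullet> b)" for b
      using Suc.prems by (auto intro!: Ck_on_linear_comp[OF assms(1) _ bounded_linear_inner_left, of _ "\<lambda>x. Dv g x v"])
    ultimately show "Ck_on k S (\<lambda>x. \<Sum>b\<in>Basis. (Dv g x v \<bullet> b) *\<^sub>R Dv f (g x) b)"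
      by (intro Ck_on_sum[OF assms(1)] Ck_on_bilinear[OF assms(1) _ _ bounded_bilinear_scaleR]) auto
  qed
  then show ?case using D by (auto simp: differentiable_def)
qed

lemma Ck_on_differentiable: "Ck_on (Suc k) S f \<Longrightarrow> x \<in> S \<Longrightarrow> f differentiable (at x)"
  by simp

lemma smooth_on_Ck: "smooth_on S f \<Longrightarrow> Ck_on k S f"
  by (simp add: smooth_on_def)

lemma smooth_on_differentiable: "smooth_on S f \<Longrightarrow> x \<in> S \<Longrightarrow> f differentiable (at x)"
  using Ck_on_differentiable[of 0] smooth_on_Ck by blast

lemma smooth_on_Dv: "smooth_on S f \<Longrightarrow> smooth_on S (\<lambda>x. Dv f x v)"
  unfolding smooth_on_def using Ck_on.simps(2) by blast

lemma smooth_on_cong: "open S \<Longrightarrow> (\<And>y. y \<in> S \<Longrightarrow> f y = g y) \<Longrightarrow> smooth_on S f \<longleftrightarrow> smooth_on S g"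
  unfolding smooth_on_def using Ck_on_cong by blast

lemma smooth_on_subset: "smooth_on S f \<Longrightarrow> T \<subseteq> S \<Longrightarrow> smooth_on T f"
  unfolding smooth_on_def using Ck_on_subset by blast

lemma smooth_on_compose:
  assumes "open S" "open T" "g ` S \<subseteq> T" "smooth_on T f" "smooth_on S g"
  shows "smooth_on S (\<lambda>x. f (g x))"
  using assms(4,5) Ck_on_compose[OF assms(1-3)] unfolding smooth_on_def by blast

lemma smooth_on_Pair:
  "open S \<Longrightarrow> smooth_on S f \<Longrightarrow> smooth_on S g \<Longrightarrow> smooth_on S (\<lambda>x. (f x, g x))"
  unfolding smooth_on_def by (auto intro!: Ck_on_Pair)

lemma smooth_on_bounded_linear: "bounded_linear L \<Longrightarrow> smooth_on S L"
  unfolding smooth_on_def by (auto intro!: Ck_on_bounded_linear)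

lemma smooth_on_const: "smooth_on S (\<lambda>x. c)"
  unfolding smooth_on_def by (auto intro!: Ck_on_const)

text \<open>Both mixed difference quotients of the second difference along \<open>u\<close> and \<open>v\<close> are
  evaluated by the mean value theorem.\<close>

lemma second_difference_mean_value:
  fixes f :: "'a::euclidean_space \<Rightarrow> real"
  assumes U: "open U" and f: "Ck_on 2 U f" and h: "0 < h"
    and sub: "\<And>s t. 0 \<le> s \<Longrightarrow> s \<le> h \<Longrightarrow> 0 \<le> t \<Longrightarrow> t \<le> h \<Longrightarrow> x + s *\<^sub>R u + t *\<^sub>R v \<in> U"
  shows "\<exists>s t. 0 \<le> s \<and> s \<le> h \<and> 0 \<le> t \<and> t \<le> h \<and>
    f (x + h *\<^sub>R u + h *\<^sub>R v) - f (x + h *\<^sub>R u) - f (x + h *\<^sub>R v) + f x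
      = h * h * Dv (\<lambda>y. Dv f y u) (x + s *\<^sub>R u + t *\<^sub>R v) v"
proof -
  have f1: "Ck_on (Suc 0) U f" "\<And>w. Ck_on (Suc 0) U (\<lambda>y. Dv f y w)"
    using f by (simp_all add: numeral_2_eq_2) (metis Ck_on_Suc_imp Ck_on.simps)
  have df: "(f has_derivative frechet_derivative f (at y)) (at y)" if "y \<in> U" for y
    using f1(1) that by (auto simp: frechet_derivative_works[symmetric])
  have ddf: "((\<lambda>y. Dv f y w) has_derivative frechet_derivative (\<lambda>y. Dv f y w) (at y)) (at y)" if "y \<in> U" for y w
    using f1(2)[of w] that by (auto simp: frechet_derivative_works[symmetric])
  have along: "((\<lambda>s. g (a + s *\<^sub>R w)) has_real_derivative Dv g (a + s *\<^sub>R w) w) (at s)"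
    if "(g has_derivative frechet_derivative g (at (a + s *\<^sub>R w))) (at (a + s *\<^sub>R w))" for g :: "'a \<Rightarrow> real" and a w s
  proof -
    have "((\<lambda>s. a + s *\<^sub>R w) has_derivative (\<lambda>k. k *\<^sub>R w)) (at s)"
      by (auto intro!: derivative_eq_intros)
    from diff_chain_at[OF this that]
    have "((\<lambda>s. g (a + s *\<^sub>R w)) has_derivative (\<lambda>k. Dv g (a + s *\<^sub>R w) (k *\<^sub>R w))) (at s)"
      by (simp add: o_def)
    moreover have "(\<lambda>k. Dv g (a + s *\<^sub>R w) (k *\<^sub>R w)) = (*) (Dv g (a + s *\<^sub>R w) w)"
      using linear_cmul[OF has_derivative_linear[OF that]] by (simp add: fun_eq_iff mult.commute)
    ultimately show ?thesis by (simp add: has_field_derivative_def)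
  qed
  define \<psi> where "\<psi> s = f ((x + h *\<^sub>R v) + s *\<^sub>R u) - f (x + s *\<^sub>R u)" for s
  have in1: "(x + h *\<^sub>R v) + s *\<^sub>R u \<in> U" "x + s *\<^sub>R u \<in> U" if "0 \<le> s" "s \<le> h" for s
    using sub[of s h] sub[of s 0] that h by (auto simp: algebra_simps)
  have "\<exists>s. 0 < s \<and> s < h \<and> \<psi> h - \<psi> 0 = (h - 0) * (Dv f ((x + h *\<^sub>R v) + s *\<^sub>R u) u - Dv f (x + s *\<^sub>R u) u)"
    using h in1 unfolding \<psi>_def
    by (intro MVT2 DERIV_diff along df) auto
  then obtain s where s: "0 < s" "s < h"
    "\<psi> h - \<psi> 0 = h * (Dv f ((x + h *\<^sub>R v) + s *\<^sub>R u) u - Dv f (x + s *\<^sub>R u) u)" by auto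
  have in2: "x + s *\<^sub>R u + t *\<^sub>R v \<in> U" if "0 \<le> t" "t \<le> h" for t
    using sub[of s t] that s by auto
  have "\<exists>t. 0 < t \<and> t < h \<and> Dv f ((x + s *\<^sub>R u) + h *\<^sub>R v) u - Dv f ((x + s *\<^sub>R u) + 0 *\<^sub>R v) u
     = (h - 0) * Dv (\<lambda>y. Dv f y u) ((x + s *\<^sub>R u) + t *\<^sub>R v) v"
    using h in2 by (intro MVT2 along ddf) auto
  then obtain t where t: "0 < t" "t < h" "Dv f ((x + s *\<^sub>R u) + h *\<^sub>R v) u - Dv f (x + s *\<^sub>R u) u
     = h * Dv (\<lambda>y. Dv f y u) ((x + s *\<^sub>R u) + t *\<^sub>R v) v" by auto
  have "f (x + h *\<^sub>R u + h *\<^sub>R v) - f (x + h *\<^sub>R u) - f (x + h *\<^sub>R v) + f x = \<psi> h - \<psi> 0"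
    by (simp add: \<psi>_def algebra_simps)
  also have "\<dots> = h * (h * Dv (\<lambda>y. Dv f y u) ((x + s *\<^sub>R u) + t *\<^sub>R v) v)"
    using s(3) t(3) by (simp add: algebra_simps)
  finally show ?thesis using s t by (intro exI[of _ s] exI[of _ t]) auto
qed

text \<open>The second difference is symmetric in \<open>u\<close> and \<open>v\<close>. Its mean
  value form in both orders gives equal values of the two mixed derivatives at points close to
  \<open>x\<close>, and continuity excludes a gap at \<open>x\<close> itself.\<close>

lemma second_derivative_symmetric_real:
  fixes f :: "'a::euclidean_space \<Rightarrow> real"
  assumes U: "open U" "x \<in> U" and f: "Ck_on 2 U f"
  shows "Dv (\<lambda>y. Dv f y u) x v = Dv (\<lambda>y. Dv f y v) x u"
proof (rule ccontr)
  assume neq: "\<not> ?thesis"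
  define e where "e = \<bar>Dv (\<lambda>y. Dv f y u) x v - Dv (\<lambda>y. Dv f y v) x u\<bar> / 2"
  have e: "e > 0" using neq by (simp add: e_def)
  have cont: "isCont (\<lambda>y. Dv (\<lambda>y. Dv f y a) y b) x" for a b
    using f U by (auto simp: numeral_2_eq_2 continuous_on_eq_continuous_at)
  obtain d1 where d1: "d1 > 0" "\<And>y. dist y x < d1 \<Longrightarrow> dist (Dv (\<lambda>y. Dv f y u) y v) (Dv (\<lambda>y. Dv f y u) x v) < e"
    using cont[of u v] e unfolding continuous_at_eps_delta by blast
  obtain d2 where d2: "d2 > 0" "\<And>y. dist y x < d2 \<Longrightarrow> dist (Dv (\<lambda>y. Dv f y v) y u) (Dv (\<lambda>y. Dv f y v) x u) < e"
    using cont[of v u] e unfolding continuous_at_eps_delta by blast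
  obtain d3 where d3: "d3 > 0" "ball x d3 \<subseteq> U" using U openE by blast
  define d where "d = min d1 (min d2 d3)"
  have d: "d > 0" using d1 d2 d3 by (simp add: d_def)
  \<comment> \<open>The parallelogram with edges \<open>h\<close> times \<open>u\<close> and
    \<open>h\<close> times \<open>v\<close> stays within \<open>d / 2\<close> of \<open>x\<close>;
    the summand 1 keeps the denominator positive when both vectors vanish.\<close>
  define h where "h = d / (2 * (norm u + norm v + 1))"
  have h: "h > 0" using d by (auto simp: h_def intro!: divide_pos_pos add_nonneg_pos)
  have near: "dist (x + s *\<^sub>R u + t *\<^sub>R v) x < d" if "0 \<le> s" "s \<le> h" "0 \<le> t" "t \<le> h" for s t
  proof -
    have "dist (x + s *\<^sub>R u + t *\<^sub>R v) x \<le> s * norm u + t * norm v"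
      using that by (auto simp: dist_norm intro: norm_triangle_le)
    also have "\<dots> \<le> h * norm u + h * norm v"
      using that by (intro add_mono mult_right_mono) auto
    also have "\<dots> \<le> h * (norm u + norm v + 1)" using h by (simp add: algebra_simps)
    also have "\<dots> = d / 2"
      using norm_ge_zero[of u] norm_ge_zero[of v] unfolding h_def
      by (simp add: field_simps add_nonneg_eq_0_iff) 
    finally show ?thesis using d by simp
  qed
  have sub: "x + s *\<^sub>R u + t *\<^sub>R v \<in> U" if "0 \<le> s" "s \<le> h" "0 \<le> t" "t \<le> h" for s t
    using near[OF that] d3 by (auto simp: d_def dist_commute)
  have sub': "x + s *\<^sub>R v + t *\<^sub>R u \<in> U" if "0 \<le> s" "s \<le> h" "0 \<le> t" "t \<le> h" for s t
    using sub[of t s] that by (simp add: algebra_simps)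
  obtain s t where st: "0 \<le> s" "s \<le> h" "0 \<le> t" "t \<le> h"
    "f (x + h *\<^sub>R u + h *\<^sub>R v) - f (x + h *\<^sub>R u) - f (x + h *\<^sub>R v) + f x
      = h * h * Dv (\<lambda>y. Dv f y u) (x + s *\<^sub>R u + t *\<^sub>R v) v"
    using second_difference_mean_value[OF U(1) f h sub] by blast
  obtain s' t' where st': "0 \<le> s'" "s' \<le> h" "0 \<le> t'" "t' \<le> h"
    "f (x + h *\<^sub>R v + h *\<^sub>R u) - f (x + h *\<^sub>R v) - f (x + h *\<^sub>R u) + f x
      = h * h * Dv (\<lambda>y. Dv f y v) (x + s' *\<^sub>R v + t' *\<^sub>R u) u"
    using second_difference_mean_value[OF U(1) f h sub'] by blast
  have "h * h * Dv (\<lambda>y. Dv f y u) (x + s *\<^sub>R u + t *\<^sub>R v) v = h * h * Dv (\<lambda>y. Dv f y v) (x + s' *\<^sub>R v + t' *\<^sub>R u) u"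
    unfolding st(5)[symmetric] st'(5)[symmetric] by (simp add: algebra_simps)
  then have "Dv (\<lambda>y. Dv f y u) (x + s *\<^sub>R u + t *\<^sub>R v) v = Dv (\<lambda>y. Dv f y v) (x + s' *\<^sub>R v + t' *\<^sub>R u) u"
    using h by simp
  moreover have "dist (Dv (\<lambda>y. Dv f y u) (x + s *\<^sub>R u + t *\<^sub>R v) v) (Dv (\<lambda>y. Dv f y u) x v) < e"
    using near[OF st(1-4)] by (intro d1) (simp add: d_def)
  moreover have "dist (Dv (\<lambda>y. Dv f y v) (x + s' *\<^sub>R v + t' *\<^sub>R u) u) (Dv (\<lambda>y. Dv f y v) x u) < e"
    using near[OF st'(3,4,1,2)] by (intro d2) (simp add: d_def algebra_simps)
  ultimately show False by (auto simp: e_def dist_real_def abs_if split: if_splits)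
qed

lemma second_derivative_symmetric:
  fixes f :: "'a::euclidean_space \<Rightarrow> 'b::euclidean_space"
  assumes U: "open U" "x \<in> U" and f: "Ck_on 2 U f"
  shows "Dv (\<lambda>y. Dv f y u) x v = Dv (\<lambda>y. Dv f y v) x u"
proof (rule euclidean_eqI)
  fix b :: 'b
  have bl: "bounded_linear (\<lambda>z::'b. z \<bullet> b)" by (rule bounded_linear_inner_left)
  have fb: "Ck_on 2 U (\<lambda>y. f y \<bullet> b)" by (rule Ck_on_linear_comp[OF U(1) f bl])
  have comp: "Dv (\<lambda>y. g y \<bullet> b) y w = Dv g y w \<bullet> b" if "g differentiable (at y)" for g :: "'a \<Rightarrow> 'b" and y w
  proof -
    have "((\<lambda>y. g y \<bullet> b) has_derivative (\<lambda>w. Dv g y w \<bullet> b)) (at y)"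
      by (rule bounded_linear.has_derivative[OF bl]) (use that frechet_derivative_works in blast)
    from frechet_derivative_at[OF this] show ?thesis by metis
  qed
  have d1: "\<And>y. y \<in> U \<Longrightarrow> f differentiable (at y)" "\<And>w. (\<lambda>y. Dv f y w) differentiable (at x)"
    using f U by (auto simp: numeral_2_eq_2)
  have "Dv (\<lambda>y. Dv (\<lambda>y. f y \<bullet> b) y a) x c = Dv (\<lambda>y. Dv f y a) x c \<bullet> b" for a c
  proof -
    have "frechet_derivative (\<lambda>y. Dv (\<lambda>y. f y \<bullet> b) y a) (at x) = frechet_derivative (\<lambda>y. Dv f y a \<bullet> b) (at x)"
      by (rule frechet_derivative_cong_open[OF U]) (use comp d1 in auto)
    then show ?thesis using comp[of "\<lambda>y. Dv f y a" x c] d1 by simp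
  qed
  then show "Dv (\<lambda>y. Dv f y u) x v \<bullet> b = Dv (\<lambda>y. Dv f y v) x u \<bullet> b"
    using second_derivative_symmetric_real[OF U fb, of u v] by metis
qed

section \<open>Families of forms and linear systems\<close>

lemma bilinear_expand:
  fixes F :: "'a::euclidean_space \<Rightarrow> 'b::euclidean_space \<Rightarrow> 'c::real_vector"
  assumes "bilinear F"
  shows "F a b = (\<Sum>i\<in>Basis. \<Sum>j\<in>Basis. ((a \<bullet> i) * (b \<bullet> j)) *\<^sub>R F i j)"
proof -
  have "F a b = F (\<Sum>i\<in>Basis. (a \<bullet> i) *\<^sub>R i) (\<Sum>j\<in>Basis. (b \<bullet> j) *\<^sub>R j)"
    by (simp add: euclidean_representation)
  also have "\<dots> = (\<Sum>(i,j)\<in>Basis \<times> Basis. F ((a \<bullet> i) *\<^sub>R i) ((b \<bullet> j) *\<^sub>R j))"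
    by (rule bilinear_sum[OF assms])
  also have "\<dots> = (\<Sum>i\<in>Basis. \<Sum>j\<in>Basis. ((a \<bullet> i) * (b \<bullet> j)) *\<^sub>R F i j)"
    by (simp add: sum.cartesian_product bilinear_lmul[OF assms] bilinear_rmul[OF assms] mult.commute)
  finally show ?thesis .
qed

lemma linear_expand:
  fixes F :: "'a::euclidean_space \<Rightarrow> 'c::real_vector"
  assumes "linear F"
  shows "F a = (\<Sum>i\<in>Basis. (a \<bullet> i) *\<^sub>R F i)"
proof -
  have "F a = F (\<Sum>i\<in>Basis. (a \<bullet> i) *\<^sub>R i)" by (simp add: euclidean_representation)
  then show ?thesis by (simp add: linear_sum[OF assms] linear_cmul[OF assms])
qed

text \<open>Differentiability is assumed for constant arguments only; in finite dimension the
  expansion in a basis extends the product rule to moving arguments.\<close>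

lemma has_derivative_bilinear_field:
  fixes F :: "'x::real_normed_vector \<Rightarrow> 'a::euclidean_space \<Rightarrow> 'b::euclidean_space \<Rightarrow> 'c::real_normed_vector"
  assumes U: "open U" "x \<in> U" and bil: "\<And>y. y \<in> U \<Longrightarrow> bilinear (F y)"
    and F: "\<And>a b. ((\<lambda>y. F y a b) has_derivative F' a b) (at x)"
    and p: "(p has_derivative p') (at x)" and q: "(q has_derivative q') (at x)"
  shows "((\<lambda>y. F y (p y) (q y)) has_derivative
    (\<lambda>v. F' (p x) (q x) v + F x (p' v) (q x) + F x (p x) (q' v))) (at x)"
proof -
  \<comment> \<open>Uniqueness of the derivative transfers bilinearity from \<open>F\<close> to
    \<open>F'\<close>.\<close>
  have "((\<lambda>y. \<Sum>i\<in>Basis. \<Sum>j\<in>Basis. ((a \<bullet> i) * (b \<bullet> j)) *\<^sub>R F y i j) has_derivative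
      (\<lambda>v. \<Sum>i\<in>Basis. \<Sum>j\<in>Basis. ((a \<bullet> i) * (b \<bullet> j)) *\<^sub>R F' i j v)) (at x)" for a b
    by (intro has_derivative_sum has_derivative_scaleR_right F)
  then have "((\<lambda>y. F y a b) has_derivative (\<lambda>v. \<Sum>i\<in>Basis. \<Sum>j\<in>Basis. ((a \<bullet> i) * (b \<bullet> j)) *\<^sub>R F' i j v)) (at x)" for a b
    by (rule has_derivative_transform_within_open[OF _ U]) (simp add: bilinear_expand[OF bil, symmetric])
  from has_derivative_unique[OF F this]
  have F': "F' a b v = (\<Sum>i\<in>Basis. \<Sum>j\<in>Basis. ((a \<bullet> i) * (b \<bullet> j)) *\<^sub>R F' i j v)" for a b v
    by (rule fun_cong)
  have "((\<lambda>y. \<Sum>i\<in>Basis. \<Sum>j\<in>Basis. ((p y \<bullet> i) * (q y \<bullet> j)) *\<^sub>R F y i j) has_derivative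
      (\<lambda>v. \<Sum>i\<in>Basis. \<Sum>j\<in>Basis. ((p x \<bullet> i) * (q x \<bullet> j)) *\<^sub>R F' i j v +
        ((p x \<bullet> i) * (q' v \<bullet> j) + (p' v \<bullet> i) * (q x \<bullet> j)) *\<^sub>R F x i j)) (at x)"
    by (intro has_derivative_sum has_derivative_scaleR F has_derivative_mult
        bounded_linear.has_derivative[OF bounded_linear_inner_left] p q)
  then have D: "((\<lambda>y. F y (p y) (q y)) has_derivative
      (\<lambda>v. \<Sum>i\<in>Basis. \<Sum>j\<in>Basis. ((p x \<bullet> i) * (q x \<bullet> j)) *\<^sub>R F' i j v +
        ((p x \<bullet> i) * (q' v \<bullet> j) + (p' v \<bullet> i) * (q x \<bullet> j)) *\<^sub>R F x i j)) (at x)"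
    by (rule has_derivative_transform_within_open[OF _ U]) (simp add: bilinear_expand[OF bil, symmetric])
  have "(\<Sum>i\<in>Basis. \<Sum>j\<in>Basis. ((p x \<bullet> i) * (q x \<bullet> j)) *\<^sub>R F' i j v +
        ((p x \<bullet> i) * (q' v \<bullet> j) + (p' v \<bullet> i) * (q x \<bullet> j)) *\<^sub>R F x i j)
      = F' (p x) (q x) v + F x (p' v) (q x) + F x (p x) (q' v)" for v
    by (subst F', subst (2) bilinear_expand[OF bil[OF U(2)]], subst (3) bilinear_expand[OF bil[OF U(2)]])
      (simp add: sum.distrib algebra_simps)
  with D show ?thesis by (simp add: fun_eq_iff)
qed

lemma has_derivative_linear_field:
  fixes F :: "'x::real_normed_vector \<Rightarrow> 'a::euclidean_space \<Rightarrow> 'c::real_normed_vector"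
  assumes U: "open U" "x \<in> U" and lin: "\<And>y. y \<in> U \<Longrightarrow> linear (F y)"
    and F: "\<And>a. ((\<lambda>y. F y a) has_derivative F' a) (at x)"
    and p: "(p has_derivative p') (at x)"
  shows "((\<lambda>y. F y (p y)) has_derivative (\<lambda>v. F' (p x) v + F x (p' v))) (at x)"
proof -
  \<comment> \<open>A linear field is treated as a bilinear one whose second argument is a real
    number, kept equal to 1.\<close>
  have bil: "bilinear (\<lambda>a (b::real). b *\<^sub>R F y a)" if "y \<in> U" for y
    using lin[OF that] unfolding bilinear_def
    by (auto intro!: linearI simp: linear_add linear_cmul algebra_simps)
  have "((\<lambda>y. (1::real) *\<^sub>R F y (p y)) has_derivative
     (\<lambda>v. 1 *\<^sub>R F' (p x) v + 1 *\<^sub>R F x (p' v) + 0 *\<^sub>R F x (p x))) (at x)"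
    by (rule has_derivative_bilinear_field[OF U bil _ p has_derivative_const])
      (auto intro!: has_derivative_scaleR_right F)
  then show ?thesis by simp
qed

text \<open>Since \<open>g\<close> vanishes at \<open>x\<close> to first order, the change of
  \<open>f\<close> contributes a term of smaller order than \<open>y - x\<close>, so continuity of
  \<open>f\<close> takes the place of differentiability.\<close>

lemma has_derivative_scaleR_zero:
  fixes f :: "'x::real_normed_vector \<Rightarrow> real" and g :: "'x \<Rightarrow> 'b::real_normed_vector"
  assumes f: "isCont f x" and g: "(g has_derivative g') (at x)" and "g x = 0"
  shows "((\<lambda>y. f y *\<^sub>R g y) has_derivative (\<lambda>v. f x *\<^sub>R g' v)) (at x)"
proof -
  have "((\<lambda>y. (f y - f x) *\<^sub>R g y) has_derivative (\<lambda>v. 0)) (at x)"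
    unfolding has_derivative_at_alt
  proof (intro conjI allI impI bounded_linear_zero)
    fix e :: real assume e: "e > 0"
    obtain B where B: "B > 0" "\<And>v. norm (g' v) \<le> norm v * B"
      using bounded_linear.pos_bounded[OF has_derivative_bounded_linear[OF g]] by auto
    obtain d1 where d1: "d1 > 0" "\<And>y. norm (y - x) < d1 \<Longrightarrow> norm (g y - g x - g' (y - x)) \<le> 1 * norm (y - x)"
      using g unfolding has_derivative_at_alt by (meson zero_less_one)
    obtain d2 where d2: "d2 > 0" "\<And>y. dist y x < d2 \<Longrightarrow> dist (f y) (f x) < e / (B + 1)"
    proof -
      have "e / (B + 1) > 0" using e B by simp
      then show ?thesis using f that unfolding continuous_at_eps_delta by blast
    qed
    show "\<exists>d>0. \<forall>y. norm (y - x) < d \<longrightarrow>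
        norm ((f y - f x) *\<^sub>R g y - (f x - f x) *\<^sub>R g x - 0) \<le> e * norm (y - x)"
    proof (intro exI[of _ "min d1 d2"] conjI allI impI)
      fix y assume y: "norm (y - x) < min d1 d2"
      have "norm (g y) \<le> norm (g y - g x - g' (y - x)) + norm (g' (y - x))"
        using \<open>g x = 0\<close> norm_triangle_ineq[of "g y - g' (y - x)" "g' (y - x)"] by simp
      also have "\<dots> \<le> (B + 1) * norm (y - x)"
        using d1(2)[of y] B(2)[of "y - x"] y by (simp add: algebra_simps)
      finally have gy: "norm (g y) \<le> (B + 1) * norm (y - x)" .
      have "\<bar>f y - f x\<bar> \<le> e / (B + 1)" using d2(2)[of y] y by (simp add: dist_norm)
      then have "\<bar>f y - f x\<bar> * norm (g y) \<le> e / (B + 1) * ((B + 1) * norm (y - x))"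
        using gy e B by (intro mult_mono) auto
      then show "norm ((f y - f x) *\<^sub>R g y - (f x - f x) *\<^sub>R g x - 0) \<le> e * norm (y - x)"
        using B by simp
    qed (use d1 d2 in auto)
  qed
  from has_derivative_add[OF this has_derivative_scaleR_right[OF g, of "f x"]]
  show ?thesis by (simp add: algebra_simps)
qed

text \<open>Here \<open>L x (z y) = F y - (L y - L x) (z y)\<close> has a differentiable right hand side as soon as \<open>z\<close>
  is continuous, since \<open>L y - L x\<close> vanishes at \<open>y = x\<close>.\<close>

lemma linear_system_differentiable:
  fixes L :: "'x::real_normed_vector \<Rightarrow> 'e::euclidean_space \<Rightarrow> 'f::euclidean_space"
  assumes U: "open U" "x \<in> U" and lin: "\<And>y. y \<in> U \<Longrightarrow> linear (L y)"
    and L: "\<And>v. (\<lambda>y. L y v) differentiable (at x)" and inj: "inj (L x)"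
    and z: "\<And>y. y \<in> U \<Longrightarrow> L y (z y) = F y" and F: "F differentiable (at x)"
  shows "z differentiable (at x)"
proof -
  have linx: "linear (L x)" using lin U by auto
  obtain c where c: "c > 0" "\<And>v. c * norm v \<le> norm (L x v)"
    using linear_inj_bounded_below_pos[OF linx inj] by (metis mult.commute)
  define \<epsilon> where "\<epsilon> y = (\<Sum>b\<in>Basis. norm (L y b - L x b))" for y
  have diff: "norm (L y v - L x v) \<le> \<epsilon> y * norm v" if "y \<in> U" for y v
  proof -
    have "L y v - L x v = (\<Sum>b\<in>Basis. (v \<bullet> b) *\<^sub>R (L y b - L x b))"
      by (subst linear_expand[OF lin[OF that]], subst linear_expand[OF linx])
        (simp add: sum_subtractf scaleR_diff_right)
    also have "norm \<dots> \<le> (\<Sum>b\<in>Basis. norm v * norm (L y b - L x b))"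
      by (rule sum_norm_le) (simp add: Basis_le_norm mult_right_mono)
    also have "\<dots> = \<epsilon> y * norm v" by (simp add: \<epsilon>_def sum_distrib_left mult.commute)
    finally show ?thesis .
  qed
  have contL: "isCont (\<lambda>y. L y v) x" for v using L by (rule differentiable_imp_continuous_within)
  have eps0: "(\<epsilon> \<longlongrightarrow> 0) (at x)"
  proof -
    have "(\<epsilon> \<longlongrightarrow> (\<Sum>b\<in>Basis. norm (L x b - L x b))) (at x)"
      unfolding \<epsilon>_def using contL by (intro tendsto_intros) (auto simp: isCont_def)
    then show ?thesis by simp
  qed
  have contF: "isCont F x" using F by (rule differentiable_imp_continuous_within)
  \<comment> \<open>Obtained by solving
    \<open>c * norm (z y) \<le> norm (F x) + 1 + c / 2 * norm (z y)\<close> for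
    \<open>norm (z y)\<close>: the solutions stay bounded near \<open>x\<close> before any
    continuity of \<open>z\<close> is known.\<close>
  define M where "M = 2 * (norm (F x) + 1) / c"
  have "\<forall>\<^sub>F y in at x. \<epsilon> y < c / 2" using order_tendstoD(2)[OF eps0, of "c/2"] c by simp
  moreover have "\<forall>\<^sub>F y in at x. norm (F y) < norm (F x) + 1"
    using contF unfolding isCont_def by (intro order_tendstoD(2)[OF tendsto_norm]) auto
  moreover have inU: "\<forall>\<^sub>F y in at x. y \<in> U" using U eventually_at_topological by blast
  ultimately have bound: "\<forall>\<^sub>F y in at x. norm (L x (z y - z x)) \<le> norm (F y - F x) + \<epsilon> y * M"
  proof eventually_elim
    case (elim y)
    have e0: "\<epsilon> y \<ge> 0" by (simp add: \<epsilon>_def sum_nonneg)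
    have "c * norm (z y) \<le> norm (L x (z y))" by (rule c)
    also have "\<dots> \<le> norm (F y) + norm (L y (z y) - L x (z y))"
      using z[OF elim(3)] norm_triangle_ineq4[of "L y (z y)" "L y (z y) - L x (z y)"] by simp
    also have "\<dots> \<le> (norm (F x) + 1) + c / 2 * norm (z y)"
      using diff[OF elim(3), of "z y"] elim(1,2) mult_right_mono[of "\<epsilon> y" "c/2" "norm (z y)"] by simp
    finally have "norm (z y) \<le> M" using c by (simp add: M_def field_simps)
    then have 1: "\<epsilon> y * norm (z y) \<le> \<epsilon> y * M" using e0 by (rule mult_left_mono)
    have "L x (z y - z x) = (F y - F x) - (L y (z y) - L x (z y))"
      using z[OF elim(3)] z[OF U(2)] by (simp add: linear_diff[OF linx])
    also have "norm \<dots> \<le> norm (F y - F x) + norm (L y (z y) - L x (z y))" by (rule norm_triangle_ineq4)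
    finally show ?case using diff[OF elim(3), of "z y"] 1 by simp
  qed
  have lim0: "((\<lambda>y. norm (F y - F x) + \<epsilon> y * M) \<longlongrightarrow> 0) (at x)"
  proof -
    have "((\<lambda>y. norm (F y - F x) + \<epsilon> y * M) \<longlongrightarrow> norm (F x - F x) + 0 * M) (at x)"
      using contF unfolding isCont_def by (intro tendsto_intros eps0)
    then show ?thesis by simp
  qed
  have "((\<lambda>y. norm (z y - z x)) \<longlongrightarrow> 0) (at x)"
  proof (rule tendsto_sandwich[OF _ _ tendsto_const])
    show "\<forall>\<^sub>F y in at x. norm (z y - z x) \<le> (norm (F y - F x) + \<epsilon> y * M) / c"
      using bound by eventually_elim (use c in \<open>metis (no_types, lifting) order_trans mult.commute pos_le_divide_eq\<close>)
    show "((\<lambda>y. (norm (F y - F x) + \<epsilon> y * M) / c) \<longlongrightarrow> 0) (at x)"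
      using tendsto_divide[OF lim0 tendsto_const, of c] c by simp
  qed auto
  then have contz: "isCont z x" unfolding isCont_def
    by (metis tendsto_norm_zero_cancel Lim_null)
  have contzb: "isCont (\<lambda>y. z y \<bullet> b) x" for b using contz by (intro continuous_intros)
  define G where "G y = F y - (\<Sum>b\<in>Basis. (z y \<bullet> b) *\<^sub>R (L y b - L x b))" for y
  have "((\<lambda>y. (z y \<bullet> b) *\<^sub>R (L y b - L x b)) has_derivative
      (\<lambda>v. (z x \<bullet> b) *\<^sub>R (Dv (\<lambda>y. L y b) x v - 0))) (at x)" for b
    using L contzb by (intro has_derivative_scaleR_zero has_derivative_diff has_derivative_const)
      (auto simp: frechet_derivative_works[symmetric])
  then have "(\<lambda>y. (z y \<bullet> b) *\<^sub>R (L y b - L x b)) differentiable (at x)" for b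
    unfolding differentiable_def by blast
  then have "(\<lambda>y. \<Sum>b\<in>Basis. (z y \<bullet> b) *\<^sub>R (L y b - L x b)) differentiable (at x)"
    by (intro differentiable_sum) auto
  then have dG: "G differentiable (at x)"
    unfolding G_def using F by (intro differentiable_diff)
  obtain g where g: "linear g" "g \<circ> L x = id"
    using linear_injective_left_inverse[OF linx inj] by blast
  have "(\<lambda>y. g (G y)) differentiable (at x)"
    using dG bounded_linear.has_derivative[OF g(1)[unfolded linear_conv_bounded_linear]]
    unfolding differentiable_def by blast
  moreover have "g (G y) = z y" if "y \<in> U" for y
  proof -
    have "G y = L x (z y)"
      using z[OF that] linear_expand[OF lin[OF that], of "z y"] linear_expand[OF linx, of "z y"]
      by (simp add: G_def sum_subtractf scaleR_diff_right)
    then show ?thesis using g(2) by (metis comp_apply id_apply)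
  qed
  ultimately show ?thesis using differentiable_cong_open[OF U, of "\<lambda>y. g (G y)" z] by blast
qed

section \<open>Inner product forms\<close>

text \<open>\<open>L\<close> represents the form in the standard inner product. Positivity makes it
  injective, and equality of dimensions makes it surjective.\<close>

lemma inner_product_form_riesz:
  fixes B :: "'e::euclidean_space \<Rightarrow> 'e \<Rightarrow> real"
  assumes B: "inner_product_form B" and f: "linear f"
  shows "\<exists>!z. \<forall>w. B z w = f w"
proof -
  have bil: "bilinear B" and pos: "\<And>u. u \<noteq> 0 \<Longrightarrow> B u u > 0"
    using B by (auto simp: inner_product_form_def)
  define L where "L z = (\<Sum>b\<in>Basis. B z b *\<^sub>R b)" for z
  have linL: "linear L" unfolding L_def
    by (intro linear_compose_sum ballI linearI) (auto simp: bilinear_ladd[OF bil] bilinear_lmul[OF bil] algebra_simps)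
  have Lb: "L z \<bullet> w = B z w" for z w
  proof -
    have "B z w = (\<Sum>b\<in>Basis. (w \<bullet> b) *\<^sub>R B z b)"
      using bil by (intro linear_expand) (auto simp: bilinear_def)
    then show ?thesis by (simp add: L_def inner_sum_left inner_commute[of w] mult.commute)
  qed
  have "inj L" unfolding linear_injective_0[OF linL]
    using pos Lb by (metis inner_zero_left less_irrefl)
  then have "surj L" using linear_injective_imp_surjective linL by blast
  then obtain z where "L z = (\<Sum>b\<in>Basis. f b *\<^sub>R b)" by (metis surjD)
  then have "B z w = f w" for w
    using Lb[of z w] linear_expand[OF f, of w] by (simp add: inner_sum_left inner_commute[of w] mult.commute)
  moreover have "z1 = z2" if "\<forall>w. B z1 w = f w" "\<forall>w. B z2 w = f w" for z1 z2
    using that \<open>inj L\<close> by (simp add: L_def inj_def)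
  ultimately show ?thesis by blast
qed

lemma inner_product_form_eqI:
  assumes B: "inner_product_form B" and "\<And>w. B z w = B z' w"
  shows "z = z'"
proof -
  have "linear (B z)" using B by (auto simp: inner_product_form_def bilinear_def)
  from inner_product_form_riesz[OF B this] show ?thesis using assms(2) by metis
qed

text \<open>The Ricci tensor is a trace in the standard basis; this moves it to a frame adapted to
  the metric, given through its expansion property.\<close>

lemma inner_product_form_trace:
  fixes B :: "'e::euclidean_space \<Rightarrow> 'e \<Rightarrow> real"
  assumes F: "linear F" and J: "finite J"
    and bil: "bilinear B"
    and exp: "\<And>v. v = (\<Sum>j\<in>J. B v (e j) *\<^sub>R (e j :: 'e))"
  shows "(\<Sum>b\<in>Basis. F b \<bullet> b) = (\<Sum>j\<in>J. B (F (e j)) (e j))"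
proof -
  have lB: "linear (\<lambda>v. B v (e j))" for j using bil by (auto simp: bilinear_def)
  have lBF: "linear (\<lambda>v. B (F v) (e j))" for j
    using linear_compose[OF F lB[of j]] by (simp add: o_def)
  have "(\<Sum>b\<in>Basis. F b \<bullet> b) = (\<Sum>b\<in>Basis. \<Sum>j\<in>J. B (F b) (e j) * (e j \<bullet> b))"
    by (subst exp) (simp add: inner_sum_left)
  also have "\<dots> = (\<Sum>j\<in>J. \<Sum>b\<in>Basis. (e j \<bullet> b) *\<^sub>R B (F b) (e j))"
    by (subst sum.swap) (simp add: mult.commute)
  also have "\<dots> = (\<Sum>j\<in>J. B (F (e j)) (e j))"
    by (rule sum.cong[OF refl]) (rule linear_expand[OF lBF, symmetric])
  finally show ?thesis .
qed

section \<open>Killing fields of a metric on an open set\<close>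

locale local_metric =
  fixes \<gamma> :: "'e::euclidean_space \<Rightarrow> 'e \<Rightarrow> 'e \<Rightarrow> real" and U :: "'e set"
  assumes open_U: "open U"
    and ipf: "\<And>x. x \<in> U \<Longrightarrow> inner_product_form (\<gamma> x)"
    and C2: "\<And>u v. Ck_on 2 U (\<lambda>x. \<gamma> x u v)"
begin

abbreviation "dg x u v w \<equiv> Dv (\<lambda>y. \<gamma> y v w) x u"
abbreviation "\<Gamma> \<equiv> christoffel \<gamma>"

lemma bil: "x \<in> U \<Longrightarrow> bilinear (\<gamma> x)"
  using ipf by (auto simp: inner_product_form_def)

lemma sym: "x \<in> U \<Longrightarrow> \<gamma> x u v = \<gamma> x v u"
  using ipf by (auto simp: inner_product_form_def)

lemma g_simps:
  assumes "x \<in> U"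
  shows "\<gamma> x (a + b) w = \<gamma> x a w + \<gamma> x b w" "\<gamma> x w (a + b) = \<gamma> x w a + \<gamma> x w b"
    "\<gamma> x (a - b) w = \<gamma> x a w - \<gamma> x b w" "\<gamma> x w (a - b) = \<gamma> x w a - \<gamma> x w b"
    "\<gamma> x (- a) w = - \<gamma> x a w" "\<gamma> x w (- a) = - \<gamma> x w a"
    "\<gamma> x (k *\<^sub>R a) w = k * \<gamma> x a w" "\<gamma> x w (k *\<^sub>R a) = k * \<gamma> x w a"
    "\<gamma> x 0 w = 0" "\<gamma> x w 0 = 0"
  using bil[OF assms]
  by (simp_all add: bilinear_ladd bilinear_radd bilinear_lsub bilinear_rsub bilinear_lneg bilinear_rneg
      bilinear_lmul bilinear_rmul bilinear_lzero bilinear_rzero)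

lemma g_eqI: "x \<in> U \<Longrightarrow> (\<And>w. \<gamma> x z w = \<gamma> x z' w) \<Longrightarrow> z = z'"
  using inner_product_form_eqI[OF ipf] by blast

lemma has_d: "x \<in> U \<Longrightarrow> ((\<lambda>y. \<gamma> y v w) has_derivative (\<lambda>u. dg x u v w)) (at x)"
  using C2[of v w] by (auto simp: numeral_2_eq_2 frechet_derivative_works[symmetric])

lemma has_dd: "x \<in> U \<Longrightarrow> ((\<lambda>y. dg y u v w) has_derivative (\<lambda>a. Dv (\<lambda>y. dg y u v w) x a)) (at x)"
  using C2[of v w] by (auto simp: numeral_2_eq_2 frechet_derivative_works[symmetric])

lemma dg_linear: "x \<in> U \<Longrightarrow> linear (\<lambda>u. dg x u v w)"
  using has_d has_derivative_linear by blast

lemma dg_sym: "x \<in> U \<Longrightarrow> dg x u v w = dg x u w v"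
  by (subst frechet_derivative_cong_open[OF open_U]) (auto intro: sym)

lemma dg_simps:
  assumes x: "x \<in> U"
  shows "dg x u (a + b) w = dg x u a w + dg x u b w" "dg x u w (a + b) = dg x u w a + dg x u w b"
    "dg x u (k *\<^sub>R a) w = k * dg x u a w" "dg x u w (k *\<^sub>R a) = k * dg x u w a"
    "dg x (a + b) v w = dg x a v w + dg x b v w" "dg x (k *\<^sub>R a) v w = k * dg x a v w"
proof -
  show 1: "dg x u (a + b) w = dg x u a w + dg x u b w" for a b w
  proof -
    have "((\<lambda>y. \<gamma> y (a + b) w) has_derivative (\<lambda>u. dg x u a w + dg x u b w)) (at x)"
      by (rule has_derivative_transform_within_open[OF has_derivative_add[OF has_d[OF x] has_d[OF x]] open_U x])
        (simp add: g_simps)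
    from frechet_derivative_at[OF this] show ?thesis by metis
  qed
  show 2: "dg x u (k *\<^sub>R a) w = k * dg x u a w" for k a w
  proof -
    have "((\<lambda>y. \<gamma> y (k *\<^sub>R a) w) has_derivative (\<lambda>u. k * dg x u a w)) (at x)"
      by (rule has_derivative_transform_within_open[OF has_derivative_mult_right[OF has_d[OF x]] open_U x])
        (simp add: g_simps)
    from frechet_derivative_at[OF this] show ?thesis by metis
  qed
  show "dg x u w (a + b) = dg x u w a + dg x u w b" "dg x u w (k *\<^sub>R a) = k * dg x u w a"
    using 1 2 dg_sym[OF x] by metis+
  show "dg x (a + b) v w = dg x a v w + dg x b v w" "dg x (k *\<^sub>R a) v w = k * dg x a v w"
    using linear_add[OF dg_linear[OF x]] linear_cmul[OF dg_linear[OF x]] by auto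
qed

definition "kz x u v w = dg x u v w + dg x v u w - dg x w u v"

lemma kz_linear: "x \<in> U \<Longrightarrow> linear (\<lambda>w. kz x u v w / 2)"
  by (rule linearI) (simp_all add: kz_def dg_simps field_simps)

lemma christoffel_unique: "x \<in> U \<Longrightarrow> \<exists>!z. \<forall>w. 2 * \<gamma> x z w = kz x u v w"
  using inner_product_form_riesz[OF ipf kz_linear, of x x u v] by (simp add: field_simps)

lemma koszul: "x \<in> U \<Longrightarrow> 2 * \<gamma> x (\<Gamma> x u v) w = dg x u v w + dg x v u w - dg x w u v"
  using theI'[OF christoffel_unique[of x u v]] unfolding christoffel_def kz_def by blast

lemma christoffel_eqI:
  assumes "x \<in> U" "\<And>w. 2 * \<gamma> x z w = dg x u v w + dg x v u w - dg x w u v"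
  shows "\<Gamma> x u v = z"
proof (rule g_eqI[OF assms(1)])
  show "\<gamma> x (\<Gamma> x u v) w = \<gamma> x z w" for w using koszul[OF assms(1), of u v w] assms(2)[of w] by linarith
qed

lemma christoffel_sym: "x \<in> U \<Longrightarrow> \<Gamma> x u v = \<Gamma> x v u"
  by (rule christoffel_eqI, assumption) (metis koszul dg_sym add.commute)

lemma christoffel_bilinear: assumes x: "x \<in> U" shows "bilinear (\<Gamma> x)"
proof -
  have 1: "linear (\<lambda>u. \<Gamma> x u v)" for v
    by (rule linearI; rule christoffel_eqI[OF x])
      (auto simp: g_simps[OF x] dg_simps[OF x] koszul[OF x] algebra_simps)
  have "linear (\<lambda>u. \<Gamma> x v u)" for v using 1[of v] by (subst christoffel_sym[OF x])
  with 1 show ?thesis by (auto simp: bilinear_def)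
qed

lemma G_simps:
  assumes "x \<in> U"
  shows "\<Gamma> x (a + b) w = \<Gamma> x a w + \<Gamma> x b w" "\<Gamma> x w (a + b) = \<Gamma> x w a + \<Gamma> x w b"
    "\<Gamma> x (k *\<^sub>R a) w = k *\<^sub>R \<Gamma> x a w" "\<Gamma> x w (k *\<^sub>R a) = k *\<^sub>R \<Gamma> x w a"
    "\<Gamma> x (a - b) w = \<Gamma> x a w - \<Gamma> x b w" "\<Gamma> x w (a - b) = \<Gamma> x w a - \<Gamma> x w b"
  using christoffel_bilinear[OF assms]
  by (simp_all add: bilinear_ladd bilinear_radd bilinear_lmul bilinear_rmul bilinear_lsub bilinear_rsub)

text \<open>The Christoffel symbols solve the linear system given by the Koszul formula, whose
  coefficients are differentiable; no explicit inverse of the metric enters.\<close>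

lemma christoffel_differentiable: assumes x: "x \<in> U" shows "(\<lambda>y. \<Gamma> y u v) differentiable (at x)"
proof (rule linear_system_differentiable[OF open_U x])
  let ?L = "\<lambda>y z. \<Sum>b\<in>Basis. \<gamma> y z b *\<^sub>R b"
  let ?F = "\<lambda>y. \<Sum>b\<in>Basis. ((1/2) * (dg y u v b + dg y v u b - dg y b u v)) *\<^sub>R b"
  show lin: "linear (?L y)" if "y \<in> U" for y
    by (intro linear_compose_sum ballI linearI) (auto simp: g_simps[OF that] algebra_simps)
  show "(\<lambda>y. ?L y w) differentiable at x" for w
    by (intro differentiable_sum ballI differentiable_scaleR differentiable_const)
      (simp_all add: differentiableI[OF has_d[OF x]])
  show "inj (?L x)"
    unfolding linear_injective_0[OF lin[OF x]]
  proof (intro allI impI)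
    fix z assume z: "?L x z = 0"
    have "\<gamma> x z w = \<gamma> x 0 w" for w
    proof -
      have "\<gamma> x z w = (\<Sum>b\<in>Basis. (w \<bullet> b) *\<^sub>R \<gamma> x z b)"
        using bil[OF x] by (intro linear_expand) (auto simp: bilinear_def)
      also have "\<dots> = ?L x z \<bullet> w" by (simp add: inner_sum_left inner_commute[of w] mult.commute)
      finally show ?thesis using z g_simps[OF x] by simp
    qed
    then show "z = 0" by (rule g_eqI[OF x])
  qed
  have *: "2 * (\<gamma> y (\<Gamma> y u v) b) = dg y u v b + dg y v u b - dg y b u v" if "y \<in> U" for y b
    using koszul[OF that] by simp
  show "?L y (\<Gamma> y u v) = ?F y" if "y \<in> U" for y
    by (simp add: *[OF that, symmetric])
  show "?F differentiable at x"
    by (intro differentiable_sum ballI differentiable_scaleR differentiable_mult differentiable_add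
        differentiable_diff differentiable_const) (simp_all add: differentiableI[OF has_dd[OF x]])
qed

lemma has_dG: "x \<in> U \<Longrightarrow> ((\<lambda>y. \<Gamma> y u v) has_derivative (\<lambda>a. Dv (\<lambda>y. \<Gamma> y u v) x a)) (at x)"
  using christoffel_differentiable frechet_derivative_works by blast

lemma dG_sym: "x \<in> U \<Longrightarrow> Dv (\<lambda>y. \<Gamma> y u v) x a = Dv (\<lambda>y. \<Gamma> y v u) x a"
  by (subst frechet_derivative_cong_open[OF open_U]) (auto intro: christoffel_sym)

text \<open>Add the Koszul formulas for \<open>(v, w)\<close> and \<open>(w, v)\<close>; the terms
  that differentiate along \<open>v\<close> and \<open>w\<close> cancel.\<close>

lemma metric_compatible:
  assumes x: "x \<in> U" shows "dg x u v w = \<gamma> x (\<Gamma> x u v) w + \<gamma> x v (\<Gamma> x u w)"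
  using koszul[OF x, of u v w] koszul[OF x, of u w v] sym[OF x, of v "\<Gamma> x u w"] dg_sym[OF x, where u=u and v=v and w=w]
    dg_sym[OF x, where u=v and v=u and w=w] dg_sym[OF x, where u=w and v=u and w=v] by linarith

text \<open>The parameter space is arbitrary because the rule is applied to curves, to the identity
  map, and to points moved by group elements near the identity.\<close>

lemma has_derivative_metric:
  fixes c :: "'x::real_normed_vector \<Rightarrow> 'e"
  assumes c: "(c has_derivative c') (at t)" "c t \<in> U"
    and p: "(p has_derivative p') (at t)" and q: "(q has_derivative q') (at t)"
  shows "((\<lambda>s. \<gamma> (c s) (p s) (q s)) has_derivative
    (\<lambda>s. \<gamma> (c t) (p' s + \<Gamma> (c t) (c' s) (p t)) (q t) + \<gamma> (c t) (p t) (q' s + \<Gamma> (c t) (c' s) (q t)))) (at t)"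
proof -
  have "isCont c t" using c(1) has_derivative_continuous by blast
  then obtain V where V: "open V" "t \<in> V" "\<And>s. s \<in> V \<Longrightarrow> c s \<in> U"
    using c(2) open_U unfolding continuous_at_open by metis
  have 1: "((\<lambda>s. \<gamma> (c s) a b) has_derivative (\<lambda>s. dg (c t) (c' s) a b)) (at t)" for a b
    using diff_chain_at[OF c(1) has_d[OF c(2)]] by (simp add: o_def)
  have "((\<lambda>s. \<gamma> (c s) (p s) (q s)) has_derivative
      (\<lambda>s. dg (c t) (c' s) (p t) (q t) + \<gamma> (c t) (p' s) (q t) + \<gamma> (c t) (p t) (q' s))) (at t)"
    by (rule has_derivative_bilinear_field[OF V(1,2) _ 1 p q]) (rule bil[OF V(3)])
  then show ?thesis
    by (rule has_derivative_eq_rhs) (simp add: metric_compatible[OF c(2)] g_simps[OF c(2)] fun_eq_iff)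
qed

text \<open>The covariant derivative of the field \<open>X\<close> at \<open>x\<close> in the
  direction \<open>u\<close>.\<close>

definition nab :: "('e \<Rightarrow> 'e) \<Rightarrow> 'e \<Rightarrow> 'e \<Rightarrow> 'e" where
  "nab X x u = Dv X x u + \<Gamma> x u (X x)"

text \<open>The equation says in coordinates that the Lie derivative of the metric along
  \<open>X\<close> vanishes.\<close>

definition killing :: "('e \<Rightarrow> 'e) \<Rightarrow> bool" where
  "killing X \<longleftrightarrow> Ck_on 2 U X \<and>
     (\<forall>x\<in>U. \<forall>v w. dg x (X x) v w + \<gamma> x (Dv X x v) w + \<gamma> x v (Dv X x w) = 0)"

lemma C2_field:
  assumes "Ck_on 2 U X" "x \<in> U"
  shows "(X has_derivative (\<lambda>u. Dv X x u)) (at x)"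
    "((\<lambda>y. Dv X y v) has_derivative (\<lambda>u. Dv (\<lambda>y. Dv X y v) x u)) (at x)"
  using assms by (auto simp: numeral_2_eq_2 frechet_derivative_works[symmetric])

lemma nab_linear:
  assumes "X differentiable (at x)" "x \<in> U" shows "linear (nab X x)"
  using linear_add[OF linear_frechet_derivative'[OF assms(1)]]
    linear_cmul[OF linear_frechet_derivative'[OF assms(1)]]
  by (intro linearI) (auto simp: nab_def G_simps[OF assms(2)] algebra_simps)

lemma killing_differentiable: "killing X \<Longrightarrow> x \<in> U \<Longrightarrow> X differentiable (at x)"
  using C2_field(1) by (auto simp: killing_def differentiable_def)

text \<open>Metric compatibility replaces the derivative of the metric in the Killing equation by
  Christoffel symbols, and their symmetry combines these with the derivative of
  \<open>X\<close>.\<close>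

lemma nab_skew:
  assumes "killing X" "x \<in> U" shows "\<gamma> x (nab X x v) w + \<gamma> x v (nab X x w) = 0"
proof -
  have "dg x (X x) v w + \<gamma> x (Dv X x v) w + \<gamma> x v (Dv X x w) = 0"
    using assms by (auto simp: killing_def)
  then show ?thesis using metric_compatible[OF assms(2), where u="X x" and v=v and w=w]
    unfolding nab_def g_simps[OF assms(2)] christoffel_sym[OF assms(2), of v "X x"]
      christoffel_sym[OF assms(2), of w "X x"] by linarith
qed

text \<open>The flow of a Killing field preserves the Levi-Civita connection.\<close>

lemma killing_lie_derivative_christoffel:
  assumes X: "killing X" and x: "x \<in> U"
  shows "Dv (\<lambda>y. \<Gamma> y u v) x (X x) =
    Dv X x (\<Gamma> x u v) - Dv (\<lambda>y. Dv X y v) x u - \<Gamma> x (Dv X x u) v - \<Gamma> x u (Dv X x v)"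
proof (rule g_eqI[OF x])
  fix w
  have X2: "Ck_on 2 U X" using X by (simp add: killing_def)
  note dX = C2_field(1)[OF X2 x] and ddX = C2_field(2)[OF X2 x]
  define d2 where "d2 a b p q = Dv (\<lambda>y. dg y b p q) x a" for a b p q
  define D2 where "D2 a b = Dv (\<lambda>y. Dv X y b) x a" for a b
  have D2s: "D2 a b = D2 b a" for a b
    unfolding D2_def by (rule second_derivative_symmetric[OF open_U x X2])
  have d2s: "d2 a b p q = d2 b a p q" for a b p q
    unfolding d2_def by (rule second_derivative_symmetric[OF open_U x C2])
  have kill: "dg x (X x) p q + \<gamma> x (Dv X x p) q + \<gamma> x p (Dv X x q) = 0" for p q
    using X x by (auto simp: killing_def)
  \<comment> \<open>The Killing equation differentiated in the direction \<open>a\<close>.\<close>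
  have E1: "d2 a (X x) p q + dg x (Dv X x a) p q + (dg x a (Dv X x p) q + \<gamma> x (D2 a p) q)
      + (dg x a p (Dv X x q) + \<gamma> x p (D2 a q)) = 0" for a p q
  proof -
    have "((\<lambda>y. dg y (X y) p q) has_derivative (\<lambda>a. d2 a (X x) p q + dg x (Dv X x a) p q)) (at x)"
      unfolding d2_def by (rule has_derivative_linear_field[OF open_U x dg_linear has_dd[OF x] dX])
    moreover have "((\<lambda>y. \<gamma> y (Dv X y p) q) has_derivative
        (\<lambda>a. dg x a (Dv X x p) q + \<gamma> x (D2 a p) q + \<gamma> x (Dv X x p) 0)) (at x)"
      unfolding D2_def by (rule has_derivative_bilinear_field[OF open_U x bil has_d[OF x] ddX has_derivative_const])
    moreover have "((\<lambda>y. \<gamma> y p (Dv X y q)) has_derivative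
        (\<lambda>a. dg x a p (Dv X x q) + \<gamma> x 0 (Dv X x q) + \<gamma> x p (D2 a q))) (at x)"
      unfolding D2_def by (rule has_derivative_bilinear_field[OF open_U x bil has_d[OF x] has_derivative_const ddX])
    ultimately have "((\<lambda>y. dg y (X y) p q + \<gamma> y (Dv X y p) q + \<gamma> y p (Dv X y q)) has_derivative
      (\<lambda>a. (d2 a (X x) p q + dg x (Dv X x a) p q) + (dg x a (Dv X x p) q + \<gamma> x (D2 a p) q + \<gamma> x (Dv X x p) 0)
        + (dg x a p (Dv X x q) + \<gamma> x 0 (Dv X x q) + \<gamma> x p (D2 a q)))) (at x)"
      by (intro has_derivative_add)
    moreover have "((\<lambda>y. dg y (X y) p q + \<gamma> y (Dv X y p) q + \<gamma> y p (Dv X y q)) has_derivative (\<lambda>a. 0)) (at x)"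
      by (rule has_derivative_transform_within_open[OF has_derivative_const[of 0] open_U x])
        (use X in \<open>auto simp: killing_def\<close>)
    from has_derivative_unique[OF calculation this, THEN fun_cong, of a] show ?thesis
      by (simp add: g_simps[OF x])
  qed
  \<comment> \<open>The Koszul formula differentiated in the direction \<open>a\<close>.\<close>
  have E2: "2 * (dg x a (\<Gamma> x u v) w + \<gamma> x (Dv (\<lambda>y. \<Gamma> y u v) x a) w)
      = d2 a u v w + d2 a v u w - d2 a w u v" for a
  proof -
    have "((\<lambda>y. 2 * \<gamma> y (\<Gamma> y u v) w) has_derivative
        (\<lambda>a. 2 * (dg x a (\<Gamma> x u v) w + \<gamma> x (Dv (\<lambda>y. \<Gamma> y u v) x a) w + \<gamma> x (\<Gamma> x u v) 0))) (at x)"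
      by (intro has_derivative_mult_right has_derivative_bilinear_field[OF open_U x bil has_d[OF x] has_dG[OF x] has_derivative_const])
    moreover have "((\<lambda>y. 2 * \<gamma> y (\<Gamma> y u v) w) has_derivative (\<lambda>a. d2 a u v w + d2 a v u w - d2 a w u v)) (at x)"
      unfolding d2_def
      by (rule has_derivative_transform_within_open[OF _ open_U x, of "\<lambda>y. dg y u v w + dg y v u w - dg y w u v"])
        (auto intro!: has_derivative_add has_derivative_diff has_dd[OF x] simp: koszul)
    from has_derivative_unique[OF calculation this, THEN fun_cong, of a] show ?thesis
      by (simp add: g_simps[OF x])
  qed
  \<comment> \<open>Three instances of \<open>E1\<close>, combined with the signs of the Koszul
    formula, replace the second derivatives of the metric in \<open>E2\<close> by derivatives of
    \<open>X\<close>; undifferentiated Koszul formulas and the Killing equation account for the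
    remaining terms.\<close>
  show "\<gamma> x (Dv (\<lambda>y. \<Gamma> y u v) x (X x)) w = \<gamma> x (Dv X x (\<Gamma> x u v) - Dv (\<lambda>y. Dv X y v) x u - \<Gamma> x (Dv X x u) v - \<Gamma> x u (Dv X x v)) w"
    using E2[of "X x"] E1[of u v w] E1[of v u w, unfolded D2s[of v u]] E1[of w u v, unfolded D2s[of w u] D2s[of w v]]
      d2s[of "X x" u v w] d2s[of "X x" v u w] d2s[of "X x" w u v]
      kill[of "\<Gamma> x u v" w] koszul[OF x, of "Dv X x u" v w] koszul[OF x, of u "Dv X x v" w]
      koszul[OF x, of u v "Dv X x w"] sym[OF x, of v "D2 u w"]
    unfolding g_simps[OF x] D2_def[symmetric] by argo
qed

text \<open>Kostant's identity.\<close>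

lemma killing_second_derivative:
  assumes X: "killing X" and x: "x \<in> U" and Y: "Y differentiable (at x)"
  shows "((\<lambda>y. nab X y (Y y)) has_derivative
    (\<lambda>u. curvature \<gamma> x u (X x) (Y x) + nab X x (nab Y x u) - \<Gamma> x u (nab X x (Y x)))) (at x)"
proof -
  have X2: "Ck_on 2 U X" using X by (simp add: killing_def)
  note dX = C2_field(1)[OF X2 x] and ddX = C2_field(2)[OF X2 x]
  have dY: "(Y has_derivative (\<lambda>u. Dv Y x u)) (at x)" using Y frechet_derivative_works by blast
  have lX: "linear (Dv X y)" if "y \<in> U" for y
    using C2_field(1)[OF X2 that] has_derivative_linear by blast
  have D2s: "Dv (\<lambda>y. Dv X y a) x b = Dv (\<lambda>y. Dv X y b) x a" for a b
    by (rule second_derivative_symmetric[OF open_U x X2])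
  have "((\<lambda>y. Dv X y (Y y) + \<Gamma> y (Y y) (X y)) has_derivative
    (\<lambda>u. (Dv (\<lambda>y. Dv X y (Y x)) x u + Dv X x (Dv Y x u))
       + (Dv (\<lambda>y. \<Gamma> y (Y x) (X x)) x u + \<Gamma> x (Dv Y x u) (X x) + \<Gamma> x (Y x) (Dv X x u)))) (at x)"
    by (intro has_derivative_add has_derivative_linear_field[OF open_U x lX ddX dY]
        has_derivative_bilinear_field[OF open_U x christoffel_bilinear has_dG[OF x] dY dX])
  \<comment> \<open>The curvature contains the derivative of the Christoffel symbols along
    \<open>X\<close>. Its replacement by the Lie derivative formula produces precisely the second
    derivatives of \<open>X\<close> on the left.\<close>
  moreover have "(Dv (\<lambda>y. Dv X y (Y x)) x u + Dv X x (Dv Y x u))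
       + (Dv (\<lambda>y. \<Gamma> y (Y x) (X x)) x u + \<Gamma> x (Dv Y x u) (X x) + \<Gamma> x (Y x) (Dv X x u))
     = curvature \<gamma> x u (X x) (Y x) + nab X x (nab Y x u) - \<Gamma> x u (nab X x (Y x))" for u
    unfolding curvature_def nab_def killing_lie_derivative_christoffel[OF X x]
    using christoffel_sym[OF x, of "X x" "\<Gamma> x u (Y x)"] christoffel_sym[OF x, of "Y x" "Dv X x u"]
      christoffel_sym[OF x, of "Y x" "X x"] dG_sym[OF x, of "Y x" "X x"]
    by (simp add: G_simps[OF x] linear_add[OF lX[OF x]] D2s[of "Y x" u])
  ultimately show ?thesis unfolding nab_def by (simp add: nab_def)
qed

end

context local_metric begin

lemma curvature_antisym: "curvature \<gamma> x u v w = - curvature \<gamma> x v u w"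
  by (simp add: curvature_def)

text \<open>Linearity in this slot is what allows the Ricci trace to be taken in another
  frame.\<close>

lemma curvature_linear: assumes x: "x \<in> U" shows "linear (\<lambda>u. curvature \<gamma> x u v w)"
proof -
  have 1: "Dv (\<lambda>y. \<Gamma> y (a + b) w) x v = Dv (\<lambda>y. \<Gamma> y a w) x v + Dv (\<lambda>y. \<Gamma> y b w) x v" for a b
  proof -
    have "((\<lambda>y. \<Gamma> y (a + b) w) has_derivative (\<lambda>v. Dv (\<lambda>y. \<Gamma> y a w) x v + Dv (\<lambda>y. \<Gamma> y b w) x v)) (at x)"
      by (rule has_derivative_transform_within_open[OF has_derivative_add[OF has_dG[OF x] has_dG[OF x]] open_U x])
        (simp add: G_simps)
    from frechet_derivative_at[OF this] show ?thesis by metis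
  qed
  have 2: "Dv (\<lambda>y. \<Gamma> y (k *\<^sub>R a) w) x v = k *\<^sub>R Dv (\<lambda>y. \<Gamma> y a w) x v" for k a
  proof -
    have "((\<lambda>y. \<Gamma> y (k *\<^sub>R a) w) has_derivative (\<lambda>v. k *\<^sub>R Dv (\<lambda>y. \<Gamma> y a w) x v)) (at x)"
      by (rule has_derivative_transform_within_open[OF has_derivative_scaleR_right[OF has_dG[OF x]] open_U x])
        (simp add: G_simps)
    from frechet_derivative_at[OF this] show ?thesis by metis
  qed
  have l: "linear (\<lambda>u. Dv (\<lambda>y. \<Gamma> y v w) x u)" using has_dG[OF x] has_derivative_linear by blast
  show ?thesis unfolding curvature_def
    by (rule linearI) (auto simp: 1 2 linear_add[OF l] linear_cmul[OF l] G_simps[OF x] algebra_simps)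
qed

end

text \<open>A curve \<open>c\<close> of unit speed orthogonal to a Lie algebra of Killing fields \<open>V X\<close>, which together
  with \<open>c'\<close> span the tangent space at \<open>c t0\<close>. There \<open>V (E i)\<close> is an orthonormal basis of the
  hyperplane orthogonal to \<open>c'\<close>.\<close>

locale cohom_local = local_metric \<gamma> U for \<gamma> :: "'e::euclidean_space \<Rightarrow> 'e \<Rightarrow> 'e \<Rightarrow> real" and U +
  fixes V :: "'l::real_vector \<Rightarrow> 'e \<Rightarrow> 'e" and br :: "'l \<Rightarrow> 'l \<Rightarrow> 'l"
    and c c' c'' :: "real \<Rightarrow> 'e" and t0 :: real and J :: "real set"
    and E :: "'i \<Rightarrow> 'l" and S :: "'i set"
  assumes V_killing: "\<And>X. killing (V X)"
    and V_linear: "\<And>x. x \<in> U \<Longrightarrow> linear (\<lambda>X. V X x)"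
    and V_bracket: "\<And>x X Z. x \<in> U \<Longrightarrow> Dv (V X) x (V Z x) - Dv (V Z) x (V X x) = - V (br Z X) x"
    and open_J: "open J" and t0: "t0 \<in> J"
    and cU: "\<And>t. t \<in> J \<Longrightarrow> c t \<in> U"
    and c': "\<And>t. t \<in> J \<Longrightarrow> (c has_vector_derivative c' t) (at t)"
    and c'': "\<And>t. t \<in> J \<Longrightarrow> (c' has_vector_derivative c'' t) (at t)"
    and unit: "\<And>t. t \<in> J \<Longrightarrow> \<gamma> (c t) (c' t) (c' t) = 1"
    and orth: "\<And>t X. t \<in> J \<Longrightarrow> \<gamma> (c t) (c' t) (V X (c t)) = 0"
    and finite_S: "finite S"
    and frame: "\<And>v. v = \<gamma> (c t0) v (c' t0) *\<^sub>R c' t0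
        + (\<Sum>i\<in>S. \<gamma> (c t0) v (V (E i) (c t0)) *\<^sub>R V (E i) (c t0))"
begin

section \<open>Connection and second fundamental form along the normal curve\<close>

abbreviation "x0 \<equiv> c t0"
abbreviation "T \<equiv> c' t0"

lemma x0: "x0 \<in> U" using cU t0 .

definition f :: "'l \<Rightarrow> 'l \<Rightarrow> 'e \<Rightarrow> real" where "f X Y x = \<gamma> x (V X x) (V Y x)"
definition h :: "'l \<Rightarrow> 'l \<Rightarrow> real \<Rightarrow> real" where "h X Y t = f X Y (c t)"
text \<open>This is -2 times the second fundamental form of the orbit with normal \<open>c'\<close>,
  and by \<open>h_deriv\<close> the derivative of \<open>h\<close>. Written with \<open>nab\<close>,
  it can be differentiated once more by Kostant's identity.\<close>

definition dh :: "'l \<Rightarrow> 'l \<Rightarrow> real \<Rightarrow> real" where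
  "dh X Y t = - 2 * \<gamma> (c t) (nab (V X) (c t) (V Y (c t))) (c' t)"

lemma frame_pair: "\<gamma> x0 v w = \<gamma> x0 v T * \<gamma> x0 w T + (\<Sum>i\<in>S. \<gamma> x0 v (V (E i) x0) * \<gamma> x0 w (V (E i) x0))"
proof -
  have "\<gamma> x0 v w = \<gamma> x0 (\<gamma> x0 v T *\<^sub>R T + (\<Sum>i\<in>S. \<gamma> x0 v (V (E i) x0) *\<^sub>R V (E i) x0)) w"
    using frame[of v] by simp
  also have "\<dots> = \<gamma> x0 v T * \<gamma> x0 T w + (\<Sum>i\<in>S. \<gamma> x0 v (V (E i) x0) * \<gamma> x0 (V (E i) x0) w)"
  proof -
    have l: "linear (\<lambda>v. \<gamma> x0 v w)" using bil[OF x0] by (auto simp: bilinear_def)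
    show ?thesis by (simp add: linear_add[OF l] linear_cmul[OF l] linear_sum[OF l])
  qed
  also have "\<gamma> x0 T w = \<gamma> x0 w T" by (rule sym[OF x0])
  also have "(\<Sum>i\<in>S. \<gamma> x0 v (V (E i) x0) * \<gamma> x0 (V (E i) x0) w) = (\<Sum>i\<in>S. \<gamma> x0 v (V (E i) x0) * \<gamma> x0 w (V (E i) x0))"
    by (intro sum.cong refl arg_cong2[where f="(*)"] sym[OF x0])
  finally show ?thesis .
qed

lemma V_diff: "x \<in> U \<Longrightarrow> V X differentiable (at x)"
  using killing_differentiable V_killing by blast

lemma nab_lin: "x \<in> U \<Longrightarrow> linear (nab (V X) x)"
  using nab_linear V_diff by blast

lemma torsion_free: "x \<in> U \<Longrightarrow> nab (V X) x (V Y x) - nab (V Y) x (V X x) = - V (br Y X) x"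
  using V_bracket[of x X Y] christoffel_sym[of x "V X x" "V Y x"] by (simp add: nab_def)

lemma br_skew: assumes "x \<in> U" shows "V (br X Z) x = - V (br Z X) x"
  using V_bracket[OF assms, of X Z] V_bracket[OF assms, of Z X] by (metis minus_diff_eq minus_minus)

lemma f_sym: "x \<in> U \<Longrightarrow> f X Y x = f Y X x"
  by (simp add: f_def sym)

text \<open>Let \<open>F Y X Z\<close> be the product with \<open>V Z\<close> of the covariant
  derivative of \<open>V X\<close> along \<open>V Y\<close>. The Killing property makes it skew in
  \<open>Y\<close> and \<open>Z\<close>, and vanishing torsion gives the part antisymmetric in
  \<open>X\<close> and \<open>Y\<close>; three instances of each relation determine it.\<close>

lemma koszul_killing:
  assumes x: "x \<in> U"
  shows "\<gamma> x (nab (V X) x (V Y x)) (V Z x) = (- f (br Y X) Z x + f (br Z Y) X x - f (br X Z) Y x) / 2"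
proof -
  define F where "F Y X Z = \<gamma> x (nab (V X) x (V Y x)) (V Z x)" for X Y Z
  have sk: "F Y X Z = - F Z X Y" for X Y Z
    using nab_skew[OF V_killing x, of X "V Y x" "V Z x"] sym[OF x, of "V Y x"] unfolding F_def by simp
  have to: "F Y X Z - F X Y Z = - f (br Y X) Z x" for X Y Z
    using torsion_free[OF x, of X Y] g_simps(3)[OF x, of "nab (V X) x (V Y x)" "nab (V Y) x (V X x)" "V Z x"]
    by (simp add: F_def f_def g_simps[OF x])
  show ?thesis
    using to[of Y X Z] sk[of X Y Z] to[of Z Y X] sk[of Y Z X] to[of X Z Y] sk[of Z X Y]
    unfolding F_def[symmetric] by argo
qed

text \<open>The case \<open>Z = X\<close> of Koszul's formula, where \<open>br X X\<close> acts as
  zero. Both its value and its derivative along the curve enter the mixed Ricci component.\<close>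

lemma nab_diag:
  assumes x: "x \<in> U"
  shows "\<gamma> x (nab (V X) x (V Y x)) (V X x) = - f (br Y X) X x"
proof -
  have "V (br X X) x = 0" using V_bracket[OF x, of X X] by simp
  then show ?thesis using koszul_killing[OF x, of X Y X]
    unfolding f_def br_skew[OF x, of X Y] by (simp add: g_simps[OF x])
qed

lemma f_derivative:
  assumes x: "x \<in> U"
  shows "((f X Y) has_derivative (\<lambda>u. \<gamma> x (nab (V X) x u) (V Y x) + \<gamma> x (V X x) (nab (V Y) x u))) (at x)"
  unfolding f_def nab_def
  using has_derivative_metric[OF has_derivative_ident x V_diff[OF x, THEN frechet_derivative_works[THEN iffD1]]
      V_diff[OF x, THEN frechet_derivative_works[THEN iffD1]]] by simp

text \<open>By \<open>f_derivative\<close> the left hand side is the derivative of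
  \<open>f X Y\<close> along \<open>V Z\<close>. The right hand side is the infinitesimal invariance
  of the metric, so derivatives along the orbit become algebraic.\<close>

lemma f_derivative_V:
  assumes x: "x \<in> U"
  shows "\<gamma> x (nab (V X) x (V Z x)) (V Y x) + \<gamma> x (V X x) (nab (V Y) x (V Z x)) = - f (br Z X) Y x - f X (br Z Y) x"
  using koszul_killing[OF x, of X Z Y] koszul_killing[OF x, of Y Z X] sym[OF x, of "V X x"]
    br_skew[OF x, of X Y] br_skew[OF x, of Z X] br_skew[OF x, of Z Y]
  by (simp add: f_def g_simps[OF x] sym[OF x, of "V X x"] field_simps)

lemma field_along_c:
  assumes "t \<in> J" "(A has_derivative A') (at (c t))"
  shows "((\<lambda>s. A (c s)) has_vector_derivative A' (c' t)) (at t)"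
proof -
  have "((\<lambda>s. A (c s)) has_derivative (\<lambda>s. A' (s *\<^sub>R c' t))) (at t)"
    using diff_chain_at[OF c'[OF assms(1), unfolded has_vector_derivative_def] assms(2)] by (simp add: o_def)
  then show ?thesis
    by (simp add: has_vector_derivative_def linear_cmul[OF has_derivative_linear[OF assms(2)]])
qed

lemma metric_along_c:
  assumes t: "t \<in> J" and p: "(p has_vector_derivative p') (at t)" and q: "(q has_vector_derivative q') (at t)"
  shows "((\<lambda>s. \<gamma> (c s) (p s) (q s)) has_real_derivative
     \<gamma> (c t) (p' + \<Gamma> (c t) (c' t) (p t)) (q t) + \<gamma> (c t) (p t) (q' + \<Gamma> (c t) (c' t) (q t))) (at t)"
  using has_derivative_metric[OF c'[OF t, unfolded has_vector_derivative_def] cU[OF t]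
      p[unfolded has_vector_derivative_def] q[unfolded has_vector_derivative_def]]
  unfolding has_field_derivative_def
  by (rule has_derivative_eq_rhs) (auto simp: G_simps[OF cU[OF t]] g_simps[OF cU[OF t]] algebra_simps fun_eq_iff)

lemma V_along_c: "t \<in> J \<Longrightarrow> ((\<lambda>s. V X (c s)) has_vector_derivative Dv (V X) (c t) (c' t)) (at t)"
  using field_along_c V_diff cU frechet_derivative_works by metis

lemma V_normal: "t \<in> J \<Longrightarrow> \<gamma> (c t) (V X (c t)) (c' t) = 0"
  using orth sym cU by metis

text \<open>The two covariant derivatives differ by an action field, which is orthogonal to
  \<open>c'\<close>.\<close>

lemma dh_sym: assumes t: "t \<in> J" shows "dh X Y t = dh Y X t"
proof -
  have "\<gamma> (c t) (nab (V X) (c t) (V Y (c t)) - nab (V Y) (c t) (V X (c t))) (c' t) = 0"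
    unfolding torsion_free[OF cU[OF t]] using V_normal[OF t] by (simp add: g_simps[OF cU[OF t]])
  then show ?thesis by (simp add: dh_def g_simps[OF cU[OF t]])
qed

lemma nab_normal: assumes t: "t \<in> J" shows "\<gamma> (c t) (nab (V X) (c t) (V Y (c t))) (c' t) = - dh X Y t / 2"
  by (simp add: dh_def)

lemma nab_T: assumes t: "t \<in> J" shows "\<gamma> (c t) (nab (V X) (c t) (c' t)) (V Y (c t)) = dh X Y t / 2"
  using nab_skew[OF V_killing cU[OF t], of X "c' t" "V Y (c t)"]
    sym[OF cU[OF t], of "c' t" "nab (V X) (c t) (V Y (c t))"] by (simp add: dh_def)

lemma nab_TT: assumes t: "t \<in> J" shows "\<gamma> (c t) (nab (V X) (c t) (c' t)) (c' t) = 0"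
  using nab_skew[OF V_killing cU[OF t], of X "c' t" "c' t"]
    sym[OF cU[OF t], of "c' t" "nab (V X) (c t) (c' t)"] by simp

lemma h_deriv: assumes t: "t \<in> J" shows "(h X Y has_real_derivative dh X Y t) (at t)"
proof -
  have "(h X Y has_real_derivative \<gamma> (c t) (nab (V X) (c t) (c' t)) (V Y (c t))
      + \<gamma> (c t) (V X (c t)) (nab (V Y) (c t) (c' t))) (at t)"
    using metric_along_c[OF t V_along_c[OF t] V_along_c[OF t], of X Y]
    unfolding h_def[abs_def] f_def nab_def by simp
  moreover have "\<gamma> (c t) (V X (c t)) (nab (V Y) (c t) (c' t)) = dh X Y t / 2"
    using nab_T[OF t, of Y X] dh_sym[OF t, of X Y] sym[OF cU[OF t]] by metis
  ultimately show ?thesis using nab_T[OF t, of X Y] by simp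
qed

text \<open>The acceleration has no component along \<open>c'\<close> because the speed is constant,
  and none along an action field because orthogonality persists in time and \<open>nab_TT\<close>
  vanishes. Together these directions span.\<close>

lemma geodesic: "c'' t0 + \<Gamma> x0 T T = 0"
proof -
  let ?a = "c'' t0 + \<Gamma> x0 T T"
  have "((\<lambda>s. \<gamma> (c s) (c' s) (c' s)) has_real_derivative \<gamma> x0 ?a T + \<gamma> x0 T ?a) (at t0)"
    using metric_along_c[OF t0 c''[OF t0] c''[OF t0]] .
  moreover have "((\<lambda>s. \<gamma> (c s) (c' s) (c' s)) has_real_derivative 0) (at t0)"
    by (rule has_field_derivative_transform_within_open[OF DERIV_const[of 1] open_J t0]) (simp add: unit)
  ultimately have 1: "\<gamma> x0 ?a T = 0"
    using DERIV_unique[of _ _ t0 0] sym[OF x0, of T ?a] by fastforce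
  have 2: "\<gamma> x0 ?a (V X x0) = 0" for X
  proof -
    have "((\<lambda>s. \<gamma> (c s) (c' s) (V X (c s))) has_real_derivative \<gamma> x0 ?a (V X x0) + \<gamma> x0 T (nab (V X) x0 T)) (at t0)"
      using metric_along_c[OF t0 c''[OF t0] V_along_c[OF t0]] unfolding nab_def .
    moreover have "((\<lambda>s. \<gamma> (c s) (c' s) (V X (c s))) has_real_derivative 0) (at t0)"
      by (rule has_field_derivative_transform_within_open[OF DERIV_const[of 0] open_J t0]) (simp add: orth)
    ultimately have "\<gamma> x0 ?a (V X x0) + \<gamma> x0 T (nab (V X) x0 T) = 0" using DERIV_unique by blast
    then show ?thesis using nab_TT[OF t0, of X] sym[OF x0, of T "nab (V X) x0 T"] by simp
  qed
  show ?thesis using frame[of ?a] by (simp add: 1 2)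
qed

section \<open>The Ricci tensor at a point of the curve\<close>

lemma ricci_trace:
  "coord_ricci \<gamma> x0 v w = \<gamma> x0 (curvature \<gamma> x0 T v w) T
     + (\<Sum>i\<in>S. \<gamma> x0 (curvature \<gamma> x0 (V (E i) x0) v w) (V (E i) x0))"
proof -
  \<comment> \<open>\<open>None\<close> stands for the normal direction, so that \<open>T\<close>
    and the frame of the orbit form one indexed family.\<close>
  define e where "e j = (case j of None \<Rightarrow> T | Some i \<Rightarrow> V (E i) x0)" for j
  have split: "(\<Sum>j\<in>insert None (Some ` S). g j) = g None + (\<Sum>i\<in>S. g (Some i))" for g :: "'i option \<Rightarrow> 'b::comm_monoid_add"
    using finite_S by (subst sum.insert) (auto simp: sum.reindex)
  have "coord_ricci \<gamma> x0 v w = (\<Sum>j\<in>insert None (Some ` S). \<gamma> x0 (curvature \<gamma> x0 (e j) v w) (e j))"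
    unfolding coord_ricci_def
    by (rule inner_product_form_trace[OF curvature_linear[OF x0] _ bil[OF x0]])
      (use finite_S frame in \<open>auto simp: split e_def\<close>)
  then show ?thesis by (simp add: split e_def)
qed

text \<open>By \<open>f_derivative_V\<close> and \<open>koszul_killing\<close>, the connection on
  the orbit and its derivatives along the orbit are algebraic expressions in the values of
  \<open>h\<close> at \<open>t0\<close>. The three definitions name them: \<open>Dkos W\<close> is
  the derivative of \<open>kos\<close> along \<open>V W\<close>.\<close>

definition Dh :: "'l \<Rightarrow> 'l \<Rightarrow> 'l \<Rightarrow> real" where
  "Dh W X Y = - h (br W X) Y t0 - h X (br W Y) t0"
definition kos :: "'l \<Rightarrow> 'l \<Rightarrow> 'l \<Rightarrow> real" where
  "kos Y X Z = (- h (br Y X) Z t0 + h (br Z Y) X t0 - h (br X Z) Y t0) / 2"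
definition Dkos :: "'l \<Rightarrow> 'l \<Rightarrow> 'l \<Rightarrow> 'l \<Rightarrow> real" where
  "Dkos W Y X Z = (- Dh W (br Y X) Z + Dh W (br Z Y) X - Dh W (br X Z) Y) / 2"

lemma kos: "\<gamma> x0 (nab (V X) x0 (V Y x0)) (V Z x0) = kos Y X Z"
  using koszul_killing[OF x0] by (simp add: kos_def h_def)

lemma nab_expand:
  "\<gamma> x0 (nab (V X) x0 v) w = \<gamma> x0 v T * \<gamma> x0 (nab (V X) x0 T) w
     + (\<Sum>j\<in>S. \<gamma> x0 v (V (E j) x0) * \<gamma> x0 (nab (V X) x0 (V (E j) x0)) w)"
proof -
  have l: "linear (\<lambda>v. \<gamma> x0 (nab (V X) x0 v) w)"
    using linear_compose[OF nab_lin[OF x0], of "\<lambda>v. \<gamma> x0 v w"] bil[OF x0] by (auto simp: bilinear_def o_def)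
  show ?thesis
    by (subst frame[of v]) (simp add: linear_add[OF l] linear_cmul[OF l] linear_sum[OF l])
qed

text \<open>Kostant's identity, applied to the derivative of \<open>nab_diag\<close> along the
  curve, gives the curvature terms. The product of covariant derivatives that remains is symmetrized
  over the frame and cancels half of the trace of \<open>dh (br Z (E i)) (E i)\<close>. The last sum
  involves traces of adjoint maps.\<close>

lemma ricci_normal:
  "coord_ricci \<gamma> x0 T (V Z x0) = (\<Sum>i\<in>S. dh (br Z (E i)) (E i) t0) / 2
     - (\<Sum>j\<in>S. dh Z (E j) t0 * (\<Sum>i\<in>S. h (br (E j) (E i)) (E i) t0)) / 2"
proof -
  let ?nZ = "\<lambda>X. nab (V X) x0 (V Z x0)" and ?nT = "\<lambda>X. nab (V X) x0 T"
  have cur: "\<gamma> x0 (curvature \<gamma> x0 T (V X x0) (V Z x0)) (V X x0)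
      = - dh (br Z X) X t0 - \<gamma> x0 (?nZ X) (?nT X) + (\<Sum>j\<in>S. dh Z (E j) t0 * h (br (E j) X) X t0) / 2" for X
  proof -
    have "((\<lambda>s. \<gamma> (c s) (nab (V X) (c s) (V Z (c s))) (V X (c s))) has_real_derivative
       \<gamma> x0 (curvature \<gamma> x0 T (V X x0) (V Z x0) + nab (V X) x0 (nab (V Z) x0 T)) (V X x0)
         + \<gamma> x0 (?nZ X) (?nT X)) (at t0)"
      using metric_along_c[OF t0 field_along_c[OF t0 killing_second_derivative[OF V_killing x0 V_diff[OF x0]]] V_along_c[OF t0], of X Z X]
      by (simp add: nab_def)
    moreover have "((\<lambda>s. \<gamma> (c s) (nab (V X) (c s) (V Z (c s))) (V X (c s))) has_real_derivative - dh (br Z X) X t0) (at t0)"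
      by (rule has_field_derivative_transform_within_open[OF DERIV_minus[OF h_deriv[OF t0]] open_J t0])
        (simp add: nab_diag cU h_def)
    ultimately have "\<gamma> x0 (curvature \<gamma> x0 T (V X x0) (V Z x0) + nab (V X) x0 (nab (V Z) x0 T)) (V X x0)
         + \<gamma> x0 (?nZ X) (?nT X) = - dh (br Z X) X t0" using DERIV_unique by blast
    moreover have "\<gamma> x0 (nab (V X) x0 (nab (V Z) x0 T)) (V X x0) = - (\<Sum>j\<in>S. dh Z (E j) t0 * h (br (E j) X) X t0) / 2"
      by (subst nab_expand) (simp add: nab_TT[OF t0] nab_T[OF t0] nab_diag[OF x0] h_def sum_negf sum_divide_distrib)
    ultimately show ?thesis by (simp add: g_simps[OF x0])
  qed
  \<comment> \<open>The covariant derivative of an action field along \<open>T\<close> has no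
    component along \<open>T\<close>, so the frame of the orbit reproduces it completely.\<close>
  have dh_expand: "(\<Sum>j\<in>S. dh X (E j) t0 * h W (E j) t0) = dh X W t0" for X W
    using frame_pair[of "?nT X" "V W x0"]
    by (simp add: nab_TT[OF t0] nab_T[OF t0] h_def f_def sum_divide_distrib[symmetric])
  have "(\<Sum>i\<in>S. \<gamma> x0 (?nZ (E i)) (?nT (E i))) = (\<Sum>i\<in>S. \<Sum>j\<in>S. kos Z (E i) (E j) * (dh (E i) (E j) t0 / 2))"
    by (intro sum.cong refl, subst frame_pair) (simp add: nab_TT[OF t0] nab_T[OF t0] kos)
  \<comment> \<open>Against the symmetric \<open>dh\<close> only the part of \<open>kos\<close>
    symmetric in \<open>i\<close> and \<open>j\<close> counts, and on that part Koszul's formula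
    reduces to the invariance of the metric.\<close>
  also have "\<dots> = (\<Sum>i\<in>S. \<Sum>j\<in>S. (kos Z (E i) (E j) + kos Z (E j) (E i)) * (dh (E i) (E j) t0 / 4))"
  proof -
    have "(\<Sum>i\<in>S. \<Sum>j\<in>S. kos Z (E j) (E i) * (dh (E i) (E j) t0 / 4)) = (\<Sum>i\<in>S. \<Sum>j\<in>S. kos Z (E i) (E j) * (dh (E i) (E j) t0 / 4))"
      by (subst sum.swap) (simp add: dh_sym[OF t0])
    moreover have "(\<Sum>i\<in>S. \<Sum>j\<in>S. (kos Z (E i) (E j) + kos Z (E j) (E i)) * (dh (E i) (E j) t0 / 4))
        = (\<Sum>i\<in>S. \<Sum>j\<in>S. kos Z (E i) (E j) * (dh (E i) (E j) t0 / 4))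
          + (\<Sum>i\<in>S. \<Sum>j\<in>S. kos Z (E j) (E i) * (dh (E i) (E j) t0 / 4))"
      by (simp only: distrib_right sum.distrib)
    moreover have "(\<Sum>i\<in>S. \<Sum>j\<in>S. kos Z (E i) (E j) * (dh (E i) (E j) t0 / 2))
        = (\<Sum>i\<in>S. \<Sum>j\<in>S. kos Z (E i) (E j) * (dh (E i) (E j) t0 / 4))
          + (\<Sum>i\<in>S. \<Sum>j\<in>S. kos Z (E i) (E j) * (dh (E i) (E j) t0 / 4))"
      by (simp only: sum.distrib[symmetric]) (simp add: field_simps)
    ultimately show ?thesis by linarith
  qed
  also have "\<dots> = (\<Sum>i\<in>S. \<Sum>j\<in>S. (- h (br Z (E i)) (E j) t0 - h (br Z (E j)) (E i) t0) * (dh (E i) (E j) t0 / 4))"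
  proof (intro sum.cong refl arg_cong2[where f="(*)"])
    fix i j
    show "kos Z (E i) (E j) + kos Z (E j) (E i) = - h (br Z (E i)) (E j) t0 - h (br Z (E j)) (E i) t0"
      using f_derivative_V[OF x0, of "E i" Z "E j"] sym[OF x0, of "V (E i) x0" "nab (V (E j)) x0 (V Z x0)"]
        f_sym[OF x0, of "E i" "br Z (E j)"] by (simp add: kos h_def)
  qed
  also have "\<dots> = - (\<Sum>i\<in>S. dh (br Z (E i)) (E i) t0) / 2"
  proof -
    have 1: "(\<Sum>i\<in>S. \<Sum>j\<in>S. h (br Z (E i)) (E j) t0 * dh (E i) (E j) t0) = (\<Sum>i\<in>S. dh (br Z (E i)) (E i) t0)"
    proof (intro sum.cong refl)
      fix i
      show "(\<Sum>j\<in>S. h (br Z (E i)) (E j) t0 * dh (E i) (E j) t0) = dh (br Z (E i)) (E i) t0"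
        using dh_expand[of "E i" "br Z (E i)"] dh_sym[OF t0, of "E i" "br Z (E i)"] by (simp add: mult.commute)
    qed
    have 2: "(\<Sum>i\<in>S. \<Sum>j\<in>S. h (br Z (E j)) (E i) t0 * dh (E i) (E j) t0) = (\<Sum>i\<in>S. dh (br Z (E i)) (E i) t0)"
      by (subst sum.swap, subst dh_sym[OF t0]) (rule 1)
    have "(\<Sum>i\<in>S. \<Sum>j\<in>S. (- h (br Z (E i)) (E j) t0 - h (br Z (E j)) (E i) t0) * (dh (E i) (E j) t0 / 4))
      = - ((\<Sum>i\<in>S. \<Sum>j\<in>S. h (br Z (E i)) (E j) t0 * dh (E i) (E j) t0)
        + (\<Sum>i\<in>S. \<Sum>j\<in>S. h (br Z (E j)) (E i) t0 * dh (E i) (E j) t0)) / 4"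
      by (simp add: left_diff_distrib sum.distrib sum_subtractf sum_negf sum_divide_distrib[symmetric] field_simps)
    then show ?thesis using 1 2 by simp
  qed
  finally have mid: "(\<Sum>i\<in>S. \<gamma> x0 (?nZ (E i)) (?nT (E i))) = - (\<Sum>i\<in>S. dh (br Z (E i)) (E i) t0) / 2" .
  have "coord_ricci \<gamma> x0 T (V Z x0) = - (\<Sum>i\<in>S. \<gamma> x0 (curvature \<gamma> x0 T (V (E i) x0) (V Z x0)) (V (E i) x0))"
  proof -
    have "curvature \<gamma> x0 T T (V Z x0) = 0" by (simp add: curvature_def)
    then show ?thesis
      by (subst ricci_trace, subst (2) curvature_antisym) (simp add: g_simps[OF x0] sum_negf)
  qed
  also have "\<dots> = (\<Sum>i\<in>S. dh (br Z (E i)) (E i) t0) + (\<Sum>i\<in>S. \<gamma> x0 (?nZ (E i)) (?nT (E i)))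
     - (\<Sum>i\<in>S. \<Sum>j\<in>S. dh Z (E j) t0 * h (br (E j) (E i)) (E i) t0) / 2"
    by (simp add: cur sum.distrib sum_subtractf sum_negf sum_divide_distrib)
  also have "(\<Sum>i\<in>S. \<Sum>j\<in>S. dh Z (E j) t0 * h (br (E j) (E i)) (E i) t0)
     = (\<Sum>j\<in>S. dh Z (E j) t0 * (\<Sum>i\<in>S. h (br (E j) (E i)) (E i) t0))"
    by (subst sum.swap) (simp add: sum_distrib_left)
  finally show ?thesis unfolding mid by simp
qed

text \<open>The Gauss and Riccati equations for the tangential components of the Ricci tensor, solved for the
  second derivative of \<open>h\<close>.\<close>

lemma dh_deriv:
  "(dh X Y has_real_derivative
     2 * (\<Sum>i\<in>S. Dkos (E i) Y X (E i) - (\<Sum>j\<in>S. kos Y X (E j) * kos (E i) (E i) (E j))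
         - dh X Y t0 * dh (E i) (E i) t0 / 4
         - (\<Sum>j\<in>S. kos (E i) Y (E j) * kos (E j) X (E i)) + dh Y (E i) t0 * dh X (E i) t0 / 4)
     + (\<Sum>i\<in>S. dh Y (E i) t0 * dh X (E i) t0) / 2
     - 2 * coord_ricci \<gamma> x0 (V X x0) (V Y x0)) (at t0)"
proof -
  let ?R = "\<lambda>u. curvature \<gamma> x0 u (V X x0) (V Y x0)" and ?A = "nab (V X) x0 (V Y x0)"
  have e: "\<gamma> x0 (?R (V Z x0)) (V Z x0) = Dkos Z Y X Z - (\<Sum>j\<in>S. kos Y X (E j) * kos Z Z (E j)) - dh X Y t0 * dh Z Z t0 / 4
      - (\<Sum>j\<in>S. kos Z Y (E j) * kos (E j) X Z) + dh Y Z t0 * dh X Z t0 / 4" for Z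
  proof -
    have "((\<lambda>y. \<gamma> y (nab (V X) y (V Y y)) (V Z y)) has_derivative
       (\<lambda>u. \<gamma> x0 (?R u + nab (V X) x0 (nab (V Y) x0 u)) (V Z x0) + \<gamma> x0 ?A (nab (V Z) x0 u))) (at x0)"
      using has_derivative_metric[OF has_derivative_ident x0 killing_second_derivative[OF V_killing x0 V_diff[OF x0]]
          V_diff[OF x0, THEN frechet_derivative_works[THEN iffD1]], of X Y Z]
      by (simp add: nab_def)
    note 1 = this
    \<comment> \<open>The same function differentiated through its algebraic expression; comparison
      with Kostant's identity is the Gauss equation.\<close>
    have "((\<lambda>y. \<gamma> y (nab (V X) y (V Y y)) (V Z y)) has_derivative
       (\<lambda>u. (- (\<gamma> x0 (nab (V (br Y X)) x0 u) (V Z x0) + \<gamma> x0 (V (br Y X) x0) (nab (V Z) x0 u))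
             + (\<gamma> x0 (nab (V (br Z Y)) x0 u) (V X x0) + \<gamma> x0 (V (br Z Y) x0) (nab (V X) x0 u))
             - (\<gamma> x0 (nab (V (br X Z)) x0 u) (V Y x0) + \<gamma> x0 (V (br X Z) x0) (nab (V Y) x0 u))) / 2)) (at x0)"
      by (rule has_derivative_transform_within_open[OF _ open_U x0,
            of "\<lambda>y. (- f (br Y X) Z y + f (br Z Y) X y - f (br X Z) Y y) / 2"],
          intro bounded_linear.has_derivative[OF bounded_linear_divide] has_derivative_add has_derivative_diff
            has_derivative_minus f_derivative[OF x0])
        (simp add: koszul_killing)
    from has_derivative_unique[OF 1 this, THEN fun_cong, of "V Z x0"]
    have "\<gamma> x0 (?R (V Z x0) + nab (V X) x0 (nab (V Y) x0 (V Z x0))) (V Z x0) + \<gamma> x0 ?A (nab (V Z) x0 (V Z x0))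
      = Dkos Z Y X Z"
      by (simp add: f_derivative_V[OF x0] Dkos_def Dh_def h_def)
    moreover have "\<gamma> x0 (nab (V X) x0 (nab (V Y) x0 (V Z x0))) (V Z x0)
        = - dh Y Z t0 * dh X Z t0 / 4 + (\<Sum>j\<in>S. kos Z Y (E j) * kos (E j) X Z)"
      by (subst nab_expand) (simp add: nab_normal[OF t0] nab_T[OF t0] kos)
    moreover have "\<gamma> x0 ?A (nab (V Z) x0 (V Z x0)) = dh X Y t0 * dh Z Z t0 / 4 + (\<Sum>j\<in>S. kos Y X (E j) * kos Z Z (E j))"
      by (subst frame_pair) (simp add: nab_normal[OF t0] kos)
    ultimately show ?thesis by (simp add: g_simps[OF x0])
  qed
  \<comment> \<open>The normal component along the curve. As \<open>c\<close> is a geodesic, only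
    the first factor is differentiated; the curvature entry in the direction \<open>T\<close> is
    then traded for the Ricci tensor minus the trace over the orbit.\<close>
  have "((\<lambda>s. \<gamma> (c s) (nab (V X) (c s) (V Y (c s))) (c' s)) has_real_derivative
       \<gamma> x0 (?R T + nab (V X) x0 (nab (V Y) x0 T)) T + \<gamma> x0 ?A 0) (at t0)"
    using metric_along_c[OF t0 field_along_c[OF t0 killing_second_derivative[OF V_killing x0 V_diff[OF x0]]] c''[OF t0], of X Y]
    unfolding geodesic by simp
  moreover have "\<gamma> x0 (nab (V X) x0 (nab (V Y) x0 T)) T = - (\<Sum>i\<in>S. dh Y (E i) t0 * dh X (E i) t0) / 4"
    by (subst nab_expand) (simp add: nab_normal[OF t0] nab_T[OF t0] nab_TT[OF t0] sum_negf sum_divide_distrib)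
  moreover have "\<gamma> x0 (?R T) T = coord_ricci \<gamma> x0 (V X x0) (V Y x0) - (\<Sum>i\<in>S. \<gamma> x0 (?R (V (E i) x0)) (V (E i) x0))"
    by (simp add: ricci_trace)
  ultimately have "((\<lambda>s. \<gamma> (c s) (nab (V X) (c s) (V Y (c s))) (c' s)) has_real_derivative
      coord_ricci \<gamma> x0 (V X x0) (V Y x0) - (\<Sum>i\<in>S. \<gamma> x0 (?R (V (E i) x0)) (V (E i) x0))
       - (\<Sum>i\<in>S. dh Y (E i) t0 * dh X (E i) t0) / 4) (at t0)"
    by (simp add: g_simps[OF x0])
  from DERIV_cmult[OF this, of "- 2"] show ?thesis
    unfolding dh_def[abs_def] e[unfolded dh_def] by (rule DERIV_cong) (simp add: field_simps sum_distrib_left)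
qed

end

section \<open>Derivatives in charts\<close>

lemma chart_inv:
  assumes "is_chart \<kappa>"
  shows "p \<in> cdom \<kappa> \<Longrightarrow> cinv \<kappa> (cmap \<kappa> p) = p"
    and "x \<in> cmap \<kappa> ` cdom \<kappa> \<Longrightarrow> cmap \<kappa> (cinv \<kappa> x) = x"
    and "x \<in> cmap \<kappa> ` cdom \<kappa> \<Longrightarrow> cinv \<kappa> x \<in> cdom \<kappa>"
  using assms unfolding is_chart_def homeomorphism_def by auto

lemma chart_open: "is_chart \<kappa> \<Longrightarrow> open (cdom \<kappa>)" "is_chart \<kappa> \<Longrightarrow> open (cmap \<kappa> ` cdom \<kappa>)"
  by (auto simp: is_chart_def)

lemma chart_image_eq:
  assumes "is_chart \<kappa>"
  shows "cmap \<kappa> ` (W \<inter> cdom \<kappa>) = {x \<in> cmap \<kappa> ` cdom \<kappa>. cinv \<kappa> x \<in> W}"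
  using chart_inv[OF assms] by auto

lemma chart_isCont:
  assumes "is_chart \<kappa>"
  shows "p \<in> cdom \<kappa> \<Longrightarrow> isCont (cmap \<kappa>) p" "x \<in> cmap \<kappa> ` cdom \<kappa> \<Longrightarrow> isCont (cinv \<kappa>) x"
    "p \<in> cdom \<kappa> \<Longrightarrow> isCont (cinv \<kappa>) (cmap \<kappa> p)"
  using assms unfolding is_chart_def homeomorphism_def
  by (auto simp: continuous_on_eq_continuous_at)

lemma chart_open_image:
  assumes "is_chart \<kappa>" "open W"
  shows "open (cmap \<kappa> ` (W \<inter> cdom \<kappa>))"
proof -
  have "continuous_on (cmap \<kappa> ` cdom \<kappa>) (cinv \<kappa>)"
    using assms(1) unfolding is_chart_def homeomorphism_def by auto
  then have "open (cinv \<kappa> -` W \<inter> cmap \<kappa> ` cdom \<kappa>)"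
    using chart_open(2)[OF assms(1)] assms(2) continuous_on_open_vimage by blast
  moreover have "cmap \<kappa> ` (W \<inter> cdom \<kappa>) = cinv \<kappa> -` W \<inter> cmap \<kappa> ` cdom \<kappa>"
    unfolding chart_image_eq[OF assms(1)] by auto
  ultimately show ?thesis by simp
qed

text \<open>A relation between a map and its derivative in two chosen charts rather than an
  operator: it carries the side conditions consumed by the chain rule, and two computations of one
  derivative are compared by \<open>md_unique\<close>.\<close>

definition md :: "('m::t2_space, 'e::euclidean_space) chart \<Rightarrow> ('n::t2_space, 'f::euclidean_space) chart \<Rightarrow>
    ('m \<Rightarrow> 'n) \<Rightarrow> 'm \<Rightarrow> ('e \<Rightarrow> 'f) \<Rightarrow> bool" where
  "md \<kappa> \<mu> f p L \<longleftrightarrow> is_chart \<kappa> \<and> is_chart \<mu> \<and> p \<in> cdom \<kappa> \<and> f p \<in> cdom \<mu> \<and> isCont f p \<and>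
     ((\<lambda>x. cmap \<mu> (f (cinv \<kappa> x))) has_derivative L) (at (cmap \<kappa> p))"

lemma isCont_nbhd:
  assumes "isCont f p" "open W" "f p \<in> W"
  obtains V where "open V" "p \<in> V" "\<And>x. x \<in> V \<Longrightarrow> f x \<in> W"
  using assms unfolding continuous_at_open by metis

text \<open>Continuity of \<open>f\<close> at \<open>p\<close>, which is part of \<open>md\<close>,
  keeps nearby values in the domain of the middle chart, where its coordinate map and inverse
  cancel.\<close>

lemma md_chain:
  assumes "md \<kappa> \<mu> f p L" "md \<mu> \<nu> g (f p) L'"
  shows "md \<kappa> \<nu> (\<lambda>q. g (f q)) p (\<lambda>v. L' (L v))"
proof -
  note a = assms[unfolded md_def]
  have inv: "cinv \<kappa> (cmap \<kappa> p) = p" using chart_inv a by blast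
  have "isCont (\<lambda>x. f (cinv \<kappa> x)) (cmap \<kappa> p)"
    using a inv by (intro isCont_o2[OF chart_isCont(3)]) auto
  then obtain V where V: "open V" "cmap \<kappa> p \<in> V" "\<And>x. x \<in> V \<Longrightarrow> f (cinv \<kappa> x) \<in> cdom \<mu>"
    using isCont_nbhd[where f="\<lambda>x. f (cinv \<kappa> x)" and p="cmap \<kappa> p" and W="cdom \<mu>"] a inv chart_open(1) by metis
  have "((\<lambda>x. cmap \<nu> (g (cinv \<mu> (cmap \<mu> (f (cinv \<kappa> x)))))) has_derivative (\<lambda>v. L' (L v))) (at (cmap \<kappa> p))"
    using diff_chain_at[of "\<lambda>x. cmap \<mu> (f (cinv \<kappa> x))" L "cmap \<kappa> p" "\<lambda>x. cmap \<nu> (g (cinv \<mu> x))" L'] a inv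
    by (simp add: o_def)
  then have "((\<lambda>x. cmap \<nu> (g (f (cinv \<kappa> x)))) has_derivative (\<lambda>v. L' (L v))) (at (cmap \<kappa> p))"
    by (rule has_derivative_transform_within_open[OF _ V(1,2)]) (use V(3) a chart_inv(1)[of \<mu>] in auto)
  then show ?thesis using a unfolding md_def by (auto intro: isCont_o2)
qed

lemma md_unique: "md \<kappa> \<mu> f p L \<Longrightarrow> md \<kappa> \<mu> f p L' \<Longrightarrow> L = L'"
  unfolding md_def using has_derivative_unique by blast

lemma md_linear: "md \<kappa> \<mu> f p L \<Longrightarrow> linear L"
  unfolding md_def using has_derivative_linear by blast

lemma md_ident: "is_chart \<kappa> \<Longrightarrow> p \<in> cdom \<kappa> \<Longrightarrow> md \<kappa> \<kappa> (\<lambda>q. q) p (\<lambda>v. v)"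
  unfolding md_def
  using has_derivative_transform_within_open[OF has_derivative_ident chart_open(2), of \<kappa> "cmap \<kappa> p"]
  by (auto simp: chart_inv)

lemma md_mfderiv: "md (chart_at A p) (chart_at B (f p)) f p L \<Longrightarrow> mfderiv A B f p = L"
  unfolding md_def mfderiv_def o_def using frechet_derivative_at by metis

lemma md_smooth:
  assumes "smooth_map_on A S B f" "open S" "p \<in> S" "\<kappa> \<in> A" "\<mu> \<in> B" "is_chart \<kappa>" "is_chart \<mu>"
    "p \<in> cdom \<kappa>" "f p \<in> cdom \<mu>"
  shows "\<exists>L. md \<kappa> \<mu> f p L"
proof -
  have cont: "continuous_on S f" using assms(1) by (simp add: smooth_map_on_def)
  have "cmap \<kappa> p \<in> cmap \<kappa> ` (S \<inter> cdom \<kappa> \<inter> f -` cdom \<mu>)" using assms by auto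
  moreover have "smooth_on (cmap \<kappa> ` (S \<inter> cdom \<kappa> \<inter> f -` cdom \<mu>)) (cmap \<mu> \<circ> f \<circ> cinv \<kappa>)"
    using assms by (simp add: smooth_map_on_def)
  ultimately have "(cmap \<mu> \<circ> f \<circ> cinv \<kappa>) differentiable (at (cmap \<kappa> p))"
    using smooth_on_differentiable by blast
  moreover have "isCont f p" using cont assms(2,3) continuous_on_eq_continuous_at by blast
  ultimately show ?thesis
    using assms unfolding md_def differentiable_def by (auto simp: o_def)
qed

section \<open>Change of coordinates in the tangent spaces\<close>

locale atlas =
  fixes A :: "('m::t2_space, 'e::euclidean_space) chart set"
  assumes smooth_atlas: "smooth_atlas A"
begin

lemma chart: "\<kappa> \<in> A \<Longrightarrow> is_chart \<kappa>"
  using smooth_atlas by (simp add: smooth_atlas_def)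

lemma chart_at: "chart_at A p \<in> A" "p \<in> cdom (chart_at A p)"
proof -
  have "p \<in> (\<Union>\<kappa>\<in>A. cdom \<kappa>)" using smooth_atlas by (simp add: smooth_atlas_def)
  then have "\<exists>\<kappa>. \<kappa> \<in> A \<and> p \<in> cdom \<kappa>" by blast
  from someI_ex[OF this] show "chart_at A p \<in> A" "p \<in> cdom (chart_at A p)"
    unfolding chart_at_def by auto
qed

lemma chart_chart_at: "is_chart (chart_at A p)"
  using chart chart_at by blast

text \<open>Converts components of a tangent vector in the chart \<open>\<kappa>\<close> to the
  chart that represents the tangent space at \<open>p\<close>.\<close>

definition tconv :: "('m, 'e) chart \<Rightarrow> 'm \<Rightarrow> 'e \<Rightarrow> 'e" where
  "tconv \<kappa> p = frechet_derivative (cmap (chart_at A p) \<circ> cinv \<kappa>) (at (cmap \<kappa> p))"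

lemma md_transition:
  assumes "\<kappa> \<in> A" "\<mu> \<in> A" "p \<in> cdom \<kappa>" "p \<in> cdom \<mu>"
  shows "\<exists>L. md \<kappa> \<mu> (\<lambda>q. q) p L"
proof -
  have "smooth_on (cmap \<kappa> ` (cdom \<kappa> \<inter> cdom \<mu>)) (cmap \<mu> \<circ> cinv \<kappa>)"
    using smooth_atlas assms by (simp add: smooth_atlas_def)
  moreover have "cmap \<kappa> p \<in> cmap \<kappa> ` (cdom \<kappa> \<inter> cdom \<mu>)" using assms by auto
  ultimately have "(cmap \<mu> \<circ> cinv \<kappa>) differentiable (at (cmap \<kappa> p))"
    using smooth_on_differentiable by blast
  then show ?thesis
    using assms chart unfolding md_def differentiable_def by (auto simp: o_def)
qed

lemma md_tconv:
  assumes "\<kappa> \<in> A" "p \<in> cdom \<kappa>"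
  shows "md \<kappa> (chart_at A p) (\<lambda>q. q) p (tconv \<kappa> p)"
proof -
  obtain L where L: "md \<kappa> (chart_at A p) (\<lambda>q. q) p L"
    using md_transition[OF assms(1) chart_at(1) assms(2) chart_at(2)] by blast
  moreover have "tconv \<kappa> p = L"
    using L frechet_derivative_at unfolding md_def tconv_def o_def by metis
  ultimately show ?thesis by simp
qed

lemma tconv_chart_at: "tconv (chart_at A p) p = (\<lambda>v. v)"
  using md_unique[OF md_tconv[OF chart_at] md_ident[OF chart_chart_at chart_at(2)]] .

lemma tconv_inverse:
  assumes "\<kappa> \<in> A" "p \<in> cdom \<kappa>"
  obtains L where "md (chart_at A p) \<kappa> (\<lambda>q. q) p L" "\<And>v. L (tconv \<kappa> p v) = v" "\<And>v. tconv \<kappa> p (L v) = v"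
proof -
  obtain L where L: "md (chart_at A p) \<kappa> (\<lambda>q. q) p L"
    using md_transition[OF chart_at(1) assms(1) chart_at(2) assms(2)] by blast
  have "(\<lambda>v. L (tconv \<kappa> p v)) = (\<lambda>v. v)"
    using md_unique[OF md_chain[OF md_tconv[OF assms] L] md_ident[OF chart[OF assms(1)] assms(2)]] .
  moreover have "(\<lambda>v. tconv \<kappa> p (L v)) = (\<lambda>v. v)"
    using md_unique[OF md_chain[OF L md_tconv[OF assms]] md_ident[OF chart_chart_at chart_at(2)]] .
  ultimately show ?thesis using that L by metis
qed

lemma tconv_linear: "\<kappa> \<in> A \<Longrightarrow> p \<in> cdom \<kappa> \<Longrightarrow> linear (tconv \<kappa> p)"
  using md_tconv md_linear by blast

end

text \<open>Inserting transition maps on both sides lets \<open>mfderiv\<close> be computed in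
  whichever charts are convenient.\<close>

lemma mfderiv_tconv:
  fixes A :: "('m::t2_space, 'e::euclidean_space) chart set" and B :: "('n::t2_space, 'f::euclidean_space) chart set"
  assumes "smooth_atlas A" "smooth_atlas B" and m: "md \<kappa> \<mu> f p L" and "\<kappa> \<in> A" "\<mu> \<in> B"
  shows "mfderiv A B f p (atlas.tconv A \<kappa> p u) = atlas.tconv B \<mu> (f p) (L u)"
    and "md (chart_at A p) (chart_at B (f p)) f p (mfderiv A B f p)"
proof -
  interpret A: atlas A by unfold_locales fact
  interpret B: atlas B by unfold_locales fact
  have p: "p \<in> cdom \<kappa>" "f p \<in> cdom \<mu>" using m by (auto simp: md_def)
  obtain M where M: "md (chart_at A p) \<kappa> (\<lambda>q. q) p M" "\<And>v. M (A.tconv \<kappa> p v) = v"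
    using A.tconv_inverse[OF assms(4) p(1)] by metis
  have 1: "md (chart_at A p) (chart_at B (f p)) f p (\<lambda>v. B.tconv \<mu> (f p) (L (M v)))"
    using md_chain[OF M(1) md_chain[OF m B.md_tconv[OF assms(5) p(2)]]] .
  then show "md (chart_at A p) (chart_at B (f p)) f p (mfderiv A B f p)"
    and "mfderiv A B f p (A.tconv \<kappa> p u) = B.tconv \<mu> (f p) (L u)"
    using md_mfderiv[OF 1] M(2) by simp_all
qed

text \<open>The local expression of a map on a product. The two chart inverses are kept apart, since
  \<open>cinv\<close> of a product chart is a separate choice of inverse on the product
  domain.\<close>

definition pF :: "('m, 'e::euclidean_space) chart \<Rightarrow> ('n, 'f::euclidean_space) chart \<Rightarrow> ('k, 'h::euclidean_space) chart
    \<Rightarrow> ('m \<times> 'n \<Rightarrow> 'k) \<Rightarrow> 'e \<times> 'f \<Rightarrow> 'h" where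
  "pF \<kappa> \<mu> \<nu> F z = cmap \<nu> (F (cinv \<kappa> (fst z), cinv \<mu> (snd z)))"

definition pdom :: "('m, 'e::euclidean_space) chart \<Rightarrow> ('n, 'f::euclidean_space) chart \<Rightarrow> ('k, 'h::euclidean_space) chart
    \<Rightarrow> ('m \<times> 'n \<Rightarrow> 'k) \<Rightarrow> ('e \<times> 'f) set" where
  "pdom \<kappa> \<mu> \<nu> F = {z. fst z \<in> cmap \<kappa> ` cdom \<kappa> \<and> snd z \<in> cmap \<mu> ` cdom \<mu> \<and>
     F (cinv \<kappa> (fst z), cinv \<mu> (snd z)) \<in> cdom \<nu>}"

locale smooth_binary =
  A: atlas A + B: atlas B + C: atlas C
  for A :: "('m::t2_space, 'e::euclidean_space) chart set"
    and B :: "('n::t2_space, 'f::euclidean_space) chart set"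
    and C :: "('k::t2_space, 'h::euclidean_space) chart set" +
  fixes F :: "'m \<times> 'n \<Rightarrow> 'k"
  assumes smooth: "smooth_map (prod_atlas A B) C F"
begin

lemma F_cont: "continuous_on UNIV F"
  using smooth by (simp add: smooth_map_on_def)

lemma pdom_smooth:
  assumes "\<kappa> \<in> A" "\<mu> \<in> B" "\<nu> \<in> C"
  shows "open (pdom \<kappa> \<mu> \<nu> F)" "smooth_on (pdom \<kappa> \<mu> \<nu> F) (pF \<kappa> \<mu> \<nu> F)"
proof -
  have ch: "is_chart \<kappa>" "is_chart \<mu>" "is_chart \<nu>" using assms A.chart B.chart C.chart by auto
  let ?K = "cmap \<kappa> ` cdom \<kappa>" and ?M = "cmap \<mu> ` cdom \<mu>"
  have c1: "continuous_on ?K (cinv \<kappa>)" "continuous_on ?M (cinv \<mu>)"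
    using ch unfolding is_chart_def homeomorphism_def by auto
  have "continuous_on (?K \<times> ?M) (\<lambda>z. F (cinv \<kappa> (fst z), cinv \<mu> (snd z)))"
    by (rule continuous_on_compose2[OF F_cont])
      (auto intro!: continuous_on_Pair continuous_on_compose2[OF c1(1)] continuous_on_compose2[OF c1(2)]
        continuous_on_fst continuous_on_snd continuous_on_id)
  then have "open ((\<lambda>z. F (cinv \<kappa> (fst z), cinv \<mu> (snd z))) -` cdom \<nu> \<inter> (?K \<times> ?M))"
    using continuous_on_open_vimage[OF open_Times[OF chart_open(2)[OF ch(1)] chart_open(2)[OF ch(2)]]]
      chart_open(1)[OF ch(3)] by blast
  moreover have "pdom \<kappa> \<mu> \<nu> F = (\<lambda>z. F (cinv \<kappa> (fst z), cinv \<mu> (snd z))) -` cdom \<nu> \<inter> (?K \<times> ?M)"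
    by (auto simp: pdom_def)
  ultimately show op: "open (pdom \<kappa> \<mu> \<nu> F)" by simp
  let ?\<pi> = "(cdom \<kappa> \<times> cdom \<mu>, map_prod (cmap \<kappa>) (cmap \<mu>))"
  have inj: "inj_on (map_prod (cmap \<kappa>) (cmap \<mu>)) (cdom \<kappa> \<times> cdom \<mu>)"
    by (rule inj_on_inverseI[of _ "map_prod (cinv \<kappa>) (cinv \<mu>)"]) (auto simp: chart_inv ch)
  have img: "cmap ?\<pi> ` (UNIV \<inter> cdom ?\<pi> \<inter> F -` cdom \<nu>) = pdom \<kappa> \<mu> \<nu> F"
  proof (intro equalityI subsetI)
    fix z assume "z \<in> cmap ?\<pi> ` (UNIV \<inter> cdom ?\<pi> \<inter> F -` cdom \<nu>)"
    then obtain p q where "z = (cmap \<kappa> p, cmap \<mu> q)" "p \<in> cdom \<kappa>" "q \<in> cdom \<mu>" "F (p, q) \<in> cdom \<nu>" by auto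
    then show "z \<in> pdom \<kappa> \<mu> \<nu> F" by (simp add: pdom_def chart_inv ch)
  next
    fix z assume "z \<in> pdom \<kappa> \<mu> \<nu> F"
    then have "z = map_prod (cmap \<kappa>) (cmap \<mu>) (cinv \<kappa> (fst z), cinv \<mu> (snd z))"
        "(cinv \<kappa> (fst z), cinv \<mu> (snd z)) \<in> UNIV \<inter> cdom ?\<pi> \<inter> F -` cdom \<nu>"
      using chart_inv[OF ch(1)] chart_inv[OF ch(2)] by (auto simp: pdom_def prod_eq_iff)
    then show "z \<in> cmap ?\<pi> ` (UNIV \<inter> cdom ?\<pi> \<inter> F -` cdom \<nu>)" by (metis image_eqI snd_conv)
  qed
  have "?\<pi> \<in> prod_atlas A B" unfolding prod_atlas_def using assms(1,2) by blast
  then have "smooth_on (pdom \<kappa> \<mu> \<nu> F) (cmap \<nu> \<circ> F \<circ> cinv ?\<pi>)"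
    using smooth assms(3) unfolding smooth_map_on_def img[symmetric] by blast
  moreover have "(cmap \<nu> \<circ> F \<circ> cinv ?\<pi>) z = pF \<kappa> \<mu> \<nu> F z" if "z \<in> pdom \<kappa> \<mu> \<nu> F" for z
  proof -
    \<comment> \<open>Injectivity on the product domain forces the chosen inverse to be the pair of
      inverses.\<close>
    have "cinv ?\<pi> z = (cinv \<kappa> (fst z), cinv \<mu> (snd z))"
      unfolding cinv_def[of ?\<pi>] fst_conv snd_conv
      by (rule inv_into_f_eq[OF inj]) (use that chart_inv[OF ch(1)] chart_inv[OF ch(2)] in \<open>auto simp: pdom_def prod_eq_iff\<close>)
    then show ?thesis by (simp add: pF_def)
  qed
  ultimately show "smooth_on (pdom \<kappa> \<mu> \<nu> F) (pF \<kappa> \<mu> \<nu> F)"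
    using smooth_on_cong[OF op] by blast
qed

lemma pdom_iff:
  assumes "\<kappa> \<in> A" "\<mu> \<in> B" "a \<in> cdom \<kappa>" "b \<in> cdom \<mu>"
  shows "(cmap \<kappa> a, cmap \<mu> b) \<in> pdom \<kappa> \<mu> \<nu> F \<longleftrightarrow> F (a, b) \<in> cdom \<nu>"
  using assms by (auto simp: pdom_def chart_inv[OF A.chart] chart_inv[OF B.chart])

lemma pF_derivative:
  assumes "\<kappa> \<in> A" "\<mu> \<in> B" "\<nu> \<in> C" "z \<in> pdom \<kappa> \<mu> \<nu> F"
  shows "((pF \<kappa> \<mu> \<nu> F) has_derivative (\<lambda>w. Dv (pF \<kappa> \<mu> \<nu> F) z w)) (at z)"
  using smooth_on_differentiable[OF pdom_smooth(2)[OF assms(1-3)] assms(4)] frechet_derivative_works by blast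

lemma md_fst:
  assumes "\<kappa> \<in> A" "\<mu> \<in> B" "\<nu> \<in> C" "a \<in> cdom \<kappa>" "b \<in> cdom \<mu>" "F (a, b) \<in> cdom \<nu>"
  shows "md \<kappa> \<nu> (\<lambda>a. F (a, b)) a (\<lambda>u. Dv (pF \<kappa> \<mu> \<nu> F) (cmap \<kappa> a, cmap \<mu> b) (u, 0))"
proof -
  have "continuous_on UNIV (\<lambda>a. F (a, b))"
    by (rule continuous_on_compose2[OF F_cont]) (auto intro!: continuous_intros)
  then have "isCont (\<lambda>a. F (a, b)) a" by (simp add: continuous_on_eq_continuous_at)
  moreover have "((\<lambda>x. pF \<kappa> \<mu> \<nu> F (x, cmap \<mu> b)) has_derivative
      (\<lambda>u. Dv (pF \<kappa> \<mu> \<nu> F) (cmap \<kappa> a, cmap \<mu> b) (u, 0))) (at (cmap \<kappa> a))"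
    using diff_chain_at[OF has_derivative_Pair[OF has_derivative_ident has_derivative_const]
        pF_derivative[OF assms(1-3) pdom_iff[OF assms(1,2,4,5), THEN iffD2, OF assms(6)]]] by (simp add: o_def)
  ultimately show ?thesis
    using assms A.chart B.chart C.chart by (simp add: md_def pF_def chart_inv)
qed

lemma md_snd:
  assumes "\<kappa> \<in> A" "\<mu> \<in> B" "\<nu> \<in> C" "a \<in> cdom \<kappa>" "b \<in> cdom \<mu>" "F (a, b) \<in> cdom \<nu>"
  shows "md \<mu> \<nu> (\<lambda>b. F (a, b)) b (\<lambda>u. Dv (pF \<kappa> \<mu> \<nu> F) (cmap \<kappa> a, cmap \<mu> b) (0, u))"
proof -
  have "continuous_on UNIV (\<lambda>b. F (a, b))"
    by (rule continuous_on_compose2[OF F_cont]) (auto intro!: continuous_intros)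
  then have "isCont (\<lambda>b. F (a, b)) b" by (simp add: continuous_on_eq_continuous_at)
  moreover have "((\<lambda>x. pF \<kappa> \<mu> \<nu> F (cmap \<kappa> a, x)) has_derivative
      (\<lambda>u. Dv (pF \<kappa> \<mu> \<nu> F) (cmap \<kappa> a, cmap \<mu> b) (0, u))) (at (cmap \<mu> b))"
    using diff_chain_at[OF has_derivative_Pair[OF has_derivative_const has_derivative_ident]
        pF_derivative[OF assms(1-3) pdom_iff[OF assms(1,2,4,5), THEN iffD2, OF assms(6)]]] by (simp add: o_def)
  ultimately show ?thesis
    using assms A.chart B.chart C.chart by (simp add: md_def pF_def chart_inv)
qed

end

text \<open>Positivity survives the passage to chart coordinates because the conversion of tangent
  vectors is invertible.\<close>

lemma coord_metric_local:
  fixes B :: "('m::t2_space, 'e::euclidean_space) chart set"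
  assumes "smooth_atlas B" "riemannian_metric B g" "\<kappa> \<in> B"
  shows "local_metric (coord_metric B g \<kappa>) (cmap \<kappa> ` cdom \<kappa>)"
    and "x \<in> cmap \<kappa> ` cdom \<kappa> \<Longrightarrow> coord_metric B g \<kappa> x u v
      = g (cinv \<kappa> x) (atlas.tconv B \<kappa> (cinv \<kappa> x) u) (atlas.tconv B \<kappa> (cinv \<kappa> x) v)"
proof -
  interpret B: atlas B by unfold_locales fact
  have ch: "is_chart \<kappa>" using B.chart assms(3) .
  show eq: "coord_metric B g \<kappa> x u v = g (cinv \<kappa> x) (B.tconv \<kappa> (cinv \<kappa> x) u) (B.tconv \<kappa> (cinv \<kappa> x) v)"
    if "x \<in> cmap \<kappa> ` cdom \<kappa>" for x u v
    using chart_inv(2)[OF ch that] by (simp add: coord_metric_def B.tconv_def Let_def)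
  show "local_metric (coord_metric B g \<kappa>) (cmap \<kappa> ` cdom \<kappa>)"
  proof
    show "open (cmap \<kappa> ` cdom \<kappa>)" using chart_open(2)[OF ch] .
    show "Ck_on 2 (cmap \<kappa> ` cdom \<kappa>) (\<lambda>x. coord_metric B g \<kappa> x u v)" for u v
      using assms(2,3) by (auto simp: riemannian_metric_def intro!: smooth_on_Ck)
    fix x assume x: "x \<in> cmap \<kappa> ` cdom \<kappa>"
    let ?p = "cinv \<kappa> x"
    have p: "?p \<in> cdom \<kappa>" using chart_inv(3)[OF ch x] .
    have ip: "inner_product_form (g ?p)" using assms(2) by (simp add: riemannian_metric_def)
    have l: "linear (B.tconv \<kappa> ?p)" using B.tconv_linear[OF assms(3) p] .
    obtain L where L: "\<And>v. L (B.tconv \<kappa> ?p v) = v" "md (chart_at B ?p) \<kappa> (\<lambda>q. q) ?p L"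
      using B.tconv_inverse[OF assms(3) p] by metis
    have nz: "B.tconv \<kappa> ?p u \<noteq> 0" if "u \<noteq> 0" for u
      using L(1)[of u] linear_0[OF md_linear[OF L(2)]] that by metis
    have bil: "bilinear (g ?p)" using ip by (simp add: inner_product_form_def)
    have "bilinear (\<lambda>u v. g ?p (B.tconv \<kappa> ?p u) (B.tconv \<kappa> ?p v))"
      using bil unfolding bilinear_def by (auto intro!: linear_compose[OF l, unfolded o_def])
    then show "inner_product_form (coord_metric B g \<kappa> x)"
      using ip nz eq[OF x] unfolding inner_product_form_def by presburger
  qed
qed

section \<open>Isometric actions of Lie groups\<close>

locale isometric_action =
  fixes A :: "('g::t2_space, 'l::euclidean_space) chart set" and G :: "'g monoid"
    and B :: "('m::t2_space, 'e::euclidean_space) chart set" and g :: "'m \<Rightarrow> 'e \<Rightarrow> 'e \<Rightarrow> real"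
    and \<phi> :: "'g \<Rightarrow> 'm \<Rightarrow> 'm"
  assumes lie: "lie_group A G" and atlas_B: "smooth_atlas B" and riem: "riemannian_metric B g"
    and act: "smooth_isometric_action A G B g \<phi>"
begin

sublocale A: atlas A using lie by unfold_locales (simp add: lie_group_def)
sublocale B: atlas B using atlas_B by unfold_locales
sublocale G: group G using lie by (simp add: lie_group_def)
sublocale mul: smooth_binary A A A "\<lambda>(a, b). a \<otimes>\<^bsub>G\<^esub> b"
  using lie by unfold_locales (simp add: lie_group_def)
sublocale actn: smooth_binary A B B "\<lambda>(a, p). \<phi> a p"
  using act by unfold_locales (simp add: smooth_isometric_action_def)
sublocale ga: group_action G UNIV \<phi>
  using act by (simp add: smooth_isometric_action_def)

lemma carrier: "a \<in> carrier G"
  using lie by (simp add: lie_group_def)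

lemma inv_smooth: "smooth_map A A (\<lambda>a. inv\<^bsub>G\<^esub> a)"
  using lie by (simp add: lie_group_def)

lemma act_one: "\<phi> \<one>\<^bsub>G\<^esub> p = p"
  using ga.id_eq_one by (metis UNIV_I restrict_apply)

lemma act_mult: "\<phi> (a \<otimes>\<^bsub>G\<^esub> b) p = \<phi> a (\<phi> b p)"
  using ga.composition_rule carrier by simp

lemma isometry: "g (\<phi> a p) (mfderiv B B (\<phi> a) p u) (mfderiv B B (\<phi> a) p v) = g p u v"
  using act carrier by (simp add: smooth_isometric_action_def)

definition "\<kappa>G = chart_at A \<one>\<^bsub>G\<^esub>"
definition "e = cmap \<kappa>G \<one>\<^bsub>G\<^esub>"

lemma kG: "\<kappa>G \<in> A" "\<one>\<^bsub>G\<^esub> \<in> cdom \<kappa>G" "is_chart \<kappa>G" "chart_at A \<one>\<^bsub>G\<^esub> = \<kappa>G" "cmap \<kappa>G \<one>\<^bsub>G\<^esub> = e"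
  "cinv \<kappa>G e = \<one>\<^bsub>G\<^esub>" "e \<in> cmap \<kappa>G ` cdom \<kappa>G"
  using A.chart_at[of "\<one>\<^bsub>G\<^esub>"] A.chart_chart_at chart_inv(1)[OF A.chart_chart_at A.chart_at(2)]
  by (auto simp: \<kappa>G_def e_def)

text \<open>Conjugation is a left translation followed by a right translation, each of them a
  partial map of the multiplication.\<close>

lemma md_conj: "md \<kappa>G \<kappa>G (\<lambda>b. a \<otimes>\<^bsub>G\<^esub> b \<otimes>\<^bsub>G\<^esub> inv\<^bsub>G\<^esub> a) \<one>\<^bsub>G\<^esub> (Ad A G a)"
proof -
  let ?L1 = "\<lambda>u. Dv (pF (chart_at A a) \<kappa>G (chart_at A a) (\<lambda>(a, b). a \<otimes>\<^bsub>G\<^esub> b)) (cmap (chart_at A a) a, cmap \<kappa>G \<one>\<^bsub>G\<^esub>) (0, u)"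
  have 1: "md \<kappa>G (chart_at A a) (\<lambda>b. a \<otimes>\<^bsub>G\<^esub> b) \<one>\<^bsub>G\<^esub> ?L1"
    using mul.md_snd[OF A.chart_at(1) kG(1) A.chart_at(1) A.chart_at(2) kG(2), of a a] A.chart_at(2)[of a] carrier by simp
  obtain L2 where 2: "md (chart_at A a) \<kappa>G (\<lambda>b. b \<otimes>\<^bsub>G\<^esub> inv\<^bsub>G\<^esub> a) a L2"
    using mul.md_fst[OF A.chart_at(1) A.chart_at(1) kG(1) A.chart_at(2) A.chart_at(2), of a "inv\<^bsub>G\<^esub> a"] kG(2) carrier by auto
  have "md \<kappa>G \<kappa>G (\<lambda>b. a \<otimes>\<^bsub>G\<^esub> b \<otimes>\<^bsub>G\<^esub> inv\<^bsub>G\<^esub> a) \<one>\<^bsub>G\<^esub> (\<lambda>v. L2 (?L1 v))"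
    using md_chain[OF 1, of \<kappa>G "\<lambda>b. b \<otimes>\<^bsub>G\<^esub> inv\<^bsub>G\<^esub> a" L2] 2 carrier by simp
  moreover from this have "Ad A G a = (\<lambda>v. L2 (?L1 v))"
    unfolding Ad_def using carrier by (intro md_mfderiv) (simp add: kG(4))
  ultimately show ?thesis by simp
qed

lemma Ad_linear: "linear (Ad A G a)"
  using md_conj md_linear by blast

lemma Ad_one: "Ad A G \<one>\<^bsub>G\<^esub> = (\<lambda>v. v)"
proof -
  have "md \<kappa>G \<kappa>G (\<lambda>b. b) \<one>\<^bsub>G\<^esub> (Ad A G \<one>\<^bsub>G\<^esub>)" using md_conj[of "\<one>\<^bsub>G\<^esub>"] carrier by simp
  then show ?thesis using md_unique md_ident[OF kG(3,2)] by blast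
qed

subsection \<open>The action in a chart\<close>

abbreviation "dm \<kappa> \<equiv> cmap \<kappa> ` cdom \<kappa>"
abbreviation "\<Phi> \<kappa> \<equiv> pF \<kappa>G \<kappa> \<kappa> (\<lambda>(a, p). \<phi> a p)"
abbreviation "\<Omega> \<kappa> \<equiv> pdom \<kappa>G \<kappa> \<kappa> (\<lambda>(a, p). \<phi> a p)"

text \<open>The action field of \<open>X\<close> in the coordinates of \<open>\<kappa>\<close>. In
  contrast to \<open>action_field\<close>, whose values live in charts depending on the point, it is
  a map on one open set that can be differentiated.\<close>

definition V :: "('m, 'e) chart \<Rightarrow> 'l \<Rightarrow> 'e \<Rightarrow> 'e" where
  "V \<kappa> X x = Dv (\<Phi> \<kappa>) (e, x) (X, 0)"

lemma e_in: "\<kappa> \<in> B \<Longrightarrow> x \<in> dm \<kappa> \<Longrightarrow> (e, x) \<in> \<Omega> \<kappa>"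
  "\<kappa> \<in> B \<Longrightarrow> x \<in> dm \<kappa> \<Longrightarrow> \<Phi> \<kappa> (e, x) = x"
  using B.chart by (auto simp: pdom_def pF_def kG act_one chart_inv)

lemma md_orbit:
  assumes "\<kappa> \<in> B" "p \<in> cdom \<kappa>"
  shows "md \<kappa>G \<kappa> (\<lambda>b. \<phi> b p) \<one>\<^bsub>G\<^esub> (\<lambda>X. V \<kappa> X (cmap \<kappa> p))"
  using actn.md_fst[OF kG(1) assms(1) assms(1) kG(2) assms(2)] assms(2) by (simp add: act_one V_def kG)

lemma action_field_chart:
  assumes "\<kappa> \<in> B" "p \<in> cdom \<kappa>"
  shows "action_field A G B \<phi> p X = B.tconv \<kappa> p (V \<kappa> X (cmap \<kappa> p))"
  using mfderiv_tconv(1)[OF A.smooth_atlas B.smooth_atlas md_orbit[OF assms] kG(1) assms(1), of X]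
    A.tconv_chart_at[of "\<one>\<^bsub>G\<^esub>"]
  by (simp add: action_field_def act_one kG(4))

lemma md_action_field: "md \<kappa>G (chart_at B p) (\<lambda>b. \<phi> b p) \<one>\<^bsub>G\<^esub> (action_field A G B \<phi> p)"
  using mfderiv_tconv(2)[OF A.smooth_atlas B.smooth_atlas md_orbit[OF B.chart_at] kG(1) B.chart_at(1), of p]
  by (simp add: action_field_def[abs_def] act_one kG(4))

lemma action_field_linear: "linear (action_field A G B \<phi> p)"
  using md_action_field md_linear by blast

lemma md_act:
  assumes "\<kappa> \<in> B" "\<mu> \<in> B" "p \<in> cdom \<kappa>" "\<phi> a p \<in> cdom \<mu>"
  shows "\<exists>L. md \<kappa> \<mu> (\<phi> a) p L"
  using actn.md_snd[OF A.chart_at(1) assms(1,2) A.chart_at(2)[of a] assms(3)] assms(4) by auto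

lemma orbit_conj: "\<phi> a (\<phi> b p) = \<phi> (a \<otimes>\<^bsub>G\<^esub> b \<otimes>\<^bsub>G\<^esub> inv\<^bsub>G\<^esub> a) (\<phi> a p)"
  by (simp add: act_mult[symmetric] G.m_assoc carrier)

text \<open>Both sides are the derivative at the identity of \<open>b\<close> mapped to
  \<open>\<phi> a (\<phi> b p)\<close>, once as it stands and once rewritten by
  \<open>orbit_conj\<close> with the conjugate of \<open>b\<close> by \<open>a\<close>.\<close>

lemma act_equivariant:
  "mfderiv B B (\<phi> a) p (action_field A G B \<phi> p X) = action_field A G B \<phi> (\<phi> a p) (Ad A G a X)"
proof -
  have 1: "md (chart_at B p) (chart_at B (\<phi> a p)) (\<phi> a) p (mfderiv B B (\<phi> a) p)"
    using md_act[OF B.chart_at(1) B.chart_at(1) B.chart_at(2)[of p] B.chart_at(2)[of "\<phi> a p"]] md_mfderiv[of B p B "\<phi> a"] by auto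
  have "md \<kappa>G (chart_at B (\<phi> a p)) (\<lambda>b. \<phi> a (\<phi> b p)) \<one>\<^bsub>G\<^esub> (\<lambda>X. mfderiv B B (\<phi> a) p (action_field A G B \<phi> p X))"
    using md_chain[OF md_action_field[of p], of "chart_at B (\<phi> a p)" "\<phi> a"] 1 by (simp add: act_one)
  moreover have "md \<kappa>G (chart_at B (\<phi> a p)) (\<lambda>b. \<phi> a (\<phi> b p)) \<one>\<^bsub>G\<^esub> (\<lambda>X. action_field A G B \<phi> (\<phi> a p) (Ad A G a X))"
    unfolding orbit_conj[of a _ p]
    using md_chain[OF md_conj, of "chart_at B (\<phi> a p)" "\<lambda>b. \<phi> b (\<phi> a p)"] md_action_field[of "\<phi> a p"]
    by (simp add: carrier)
  ultimately show ?thesis using md_unique by (metis (no_types, lifting))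
qed

lemma action_field_isometry:
  "g (\<phi> a p) (action_field A G B \<phi> (\<phi> a p) (Ad A G a X)) (action_field A G B \<phi> (\<phi> a p) (Ad A G a Y))
    = g p (action_field A G B \<phi> p X) (action_field A G B \<phi> p Y)"
  unfolding act_equivariant[symmetric] by (rule isometry)

lemma Omega_D:
  assumes "\<kappa> \<in> B" "(a, x) \<in> \<Omega> \<kappa>"
  shows "cinv \<kappa>G a \<in> cdom \<kappa>G" "cinv \<kappa> x \<in> cdom \<kappa>" "\<phi> (cinv \<kappa>G a) (cinv \<kappa> x) \<in> cdom \<kappa>"
    "cmap \<kappa>G (cinv \<kappa>G a) = a" "cmap \<kappa> (cinv \<kappa> x) = x" "x \<in> dm \<kappa>"
    "\<Phi> \<kappa> (a, x) = cmap \<kappa> (\<phi> (cinv \<kappa>G a) (cinv \<kappa> x))" "\<Phi> \<kappa> (a, x) \<in> dm \<kappa>"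
    "cinv \<kappa> (\<Phi> \<kappa> (a, x)) = \<phi> (cinv \<kappa>G a) (cinv \<kappa> x)"
  using assms chart_inv[OF kG(3)] chart_inv[OF B.chart[OF assms(1)]] by (auto simp: pdom_def pF_def)

lemma md_act_chart:
  assumes "\<kappa> \<in> B" "(a, x) \<in> \<Omega> \<kappa>"
  shows "md \<kappa> \<kappa> (\<phi> (cinv \<kappa>G a)) (cinv \<kappa> x) (\<lambda>u. Dv (\<Phi> \<kappa>) (a, x) (0, u))"
  using actn.md_snd[OF kG(1) assms(1,1) Omega_D(1,2)[OF assms]] Omega_D[OF assms] by simp

lemma Phi_isometry:
  assumes k: "\<kappa> \<in> B" and ax: "(a, x) \<in> \<Omega> \<kappa>"
  shows "coord_metric B g \<kappa> (\<Phi> \<kappa> (a, x)) (Dv (\<Phi> \<kappa>) (a, x) (0, u)) (Dv (\<Phi> \<kappa>) (a, x) (0, v))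
    = coord_metric B g \<kappa> x u v"
  using mfderiv_tconv(1)[OF B.smooth_atlas B.smooth_atlas md_act_chart[OF assms] k k]
    isometry[of "cinv \<kappa>G a" "cinv \<kappa> x" "B.tconv \<kappa> (cinv \<kappa> x) u" "B.tconv \<kappa> (cinv \<kappa> x) v"] Omega_D[OF assms]
  by (simp add: coord_metric_local(2)[OF atlas_B riem k])

text \<open>Equivariance in one chart, in a form that can be differentiated in \<open>a\<close>;
  this later yields the bracket of action fields.\<close>

lemma Phi_equivariant:
  assumes k: "\<kappa> \<in> B" and ax: "(a, x) \<in> \<Omega> \<kappa>"
  shows "Dv (\<Phi> \<kappa>) (a, x) (0, V \<kappa> X x) = V \<kappa> (Ad A G (cinv \<kappa>G a) X) (\<Phi> \<kappa> (a, x))"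
proof -
  let ?a = "cinv \<kappa>G a" and ?p = "cinv \<kappa> x"
  note D = Omega_D[OF assms]
  have "md \<kappa>G \<kappa> (\<lambda>b. \<phi> ?a (\<phi> b ?p)) \<one>\<^bsub>G\<^esub> (\<lambda>X. Dv (\<Phi> \<kappa>) (a, x) (0, V \<kappa> X x))"
    using md_chain[OF md_orbit[OF k D(2)], of \<kappa> "\<phi> ?a"] md_act_chart[OF assms] by (simp add: act_one D)
  moreover have "md \<kappa>G \<kappa> (\<lambda>b. \<phi> ?a (\<phi> b ?p)) \<one>\<^bsub>G\<^esub> (\<lambda>X. V \<kappa> (Ad A G ?a X) (\<Phi> \<kappa> (a, x)))"
    unfolding orbit_conj[of ?a _ ?p]
    using md_chain[OF md_conj, of \<kappa> "\<lambda>b. \<phi> b (\<phi> ?a ?p)"] md_orbit[OF k D(3)]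
    by (simp add: carrier D)
  ultimately show ?thesis using md_unique by (metis (no_types, lifting))
qed

lemma Phi_smooth:
  assumes "\<kappa> \<in> B" shows "open (\<Omega> \<kappa>)" "smooth_on (\<Omega> \<kappa>) (\<Phi> \<kappa>)"
  using actn.pdom_smooth[OF kG(1) assms assms] .

lemma V_smooth: assumes k: "\<kappa> \<in> B" shows "smooth_on (dm \<kappa>) (V \<kappa> X)"
  unfolding V_def
proof (rule smooth_on_compose[where g="\<lambda>x. (e, x)" and T="\<Omega> \<kappa>"])
  show "open (dm \<kappa>)" using chart_open(2) B.chart k by blast
  then show "smooth_on (dm \<kappa>) (\<lambda>x. (e, x))"
    by (intro smooth_on_Pair smooth_on_const smooth_on_bounded_linear) (auto simp: bounded_linear_ident)
  show "smooth_on (\<Omega> \<kappa>) (\<lambda>z. Dv (\<Phi> \<kappa>) z (X, 0))" by (rule smooth_on_Dv[OF Phi_smooth(2)[OF k]])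
qed (use Phi_smooth[OF k] e_in[OF k] in auto)

lemma V_linear: "\<kappa> \<in> B \<Longrightarrow> x \<in> dm \<kappa> \<Longrightarrow> linear (\<lambda>X. V \<kappa> X x)"
proof -
  assume "\<kappa> \<in> B" "x \<in> dm \<kappa>"
  then have "linear (Dv (\<Phi> \<kappa>) (e, x))"
    using Phi_smooth e_in by (intro linear_frechet_derivative' smooth_on_differentiable) blast+
  note l = this
  have "linear (\<lambda>X. Dv (\<Phi> \<kappa>) (e, x) (X, 0))"
  proof (rule linearI)
    show "Dv (\<Phi> \<kappa>) (e, x) (X + Y, 0) = Dv (\<Phi> \<kappa>) (e, x) (X, 0) + Dv (\<Phi> \<kappa>) (e, x) (Y, 0)" for X Y
      using linear_add[OF l, of "(X, 0)" "(Y, 0)"] by simp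
    show "Dv (\<Phi> \<kappa>) (e, x) (k *\<^sub>R X, 0) = k *\<^sub>R Dv (\<Phi> \<kappa>) (e, x) (X, 0)" for k X
      using linear_cmul[OF l, of k "(X, 0)"] by simp
  qed
  then show ?thesis by (simp add: V_def)
qed

lemma Phi_dfst:
  assumes k: "\<kappa> \<in> B" and x: "x \<in> dm \<kappa>"
  shows "((\<lambda>a. \<Phi> \<kappa> (a, x)) has_derivative (\<lambda>Z. V \<kappa> Z x)) (at e)"
  using diff_chain_at[OF has_derivative_Pair[OF has_derivative_ident has_derivative_const]
    actn.pF_derivative[OF kG(1) k k e_in(1)[OF k x]]] by (simp add: o_def V_def)

text \<open>This is the symmetry of the mixed second derivatives of the action.\<close>

lemma Phi_mixed:
  assumes k: "\<kappa> \<in> B" and x: "x \<in> dm \<kappa>"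
  shows "((\<lambda>a. Dv (\<Phi> \<kappa>) (a, x) (0, u)) has_derivative (\<lambda>Z. Dv (V \<kappa> Z) x u)) (at e)"
proof -
  have d: "((\<lambda>z. Dv (\<Phi> \<kappa>) z w) has_derivative (\<lambda>z. Dv (\<lambda>z. Dv (\<Phi> \<kappa>) z w) (e, x) z)) (at (e, x))" for w
    using smooth_on_differentiable[OF smooth_on_Dv[OF Phi_smooth(2)[OF k]] e_in(1)[OF k x]] frechet_derivative_works by blast
  have 1: "((\<lambda>a. Dv (\<Phi> \<kappa>) (a, x) (0, u)) has_derivative (\<lambda>Z. Dv (\<lambda>z. Dv (\<Phi> \<kappa>) z (0, u)) (e, x) (Z, 0))) (at e)"
    using diff_chain_at[OF has_derivative_Pair[OF has_derivative_ident has_derivative_const] d] by (simp add: o_def)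
  have "((V \<kappa> Z) has_derivative (\<lambda>u. Dv (\<lambda>z. Dv (\<Phi> \<kappa>) z (Z, 0)) (e, x) (0, u))) (at x)" for Z
    unfolding V_def
    using diff_chain_at[OF has_derivative_Pair[OF has_derivative_const has_derivative_ident] d] by (simp add: o_def)
  then have "Dv (V \<kappa> Z) x u = Dv (\<lambda>z. Dv (\<Phi> \<kappa>) z (Z, 0)) (e, x) (0, u)" for Z
    using frechet_derivative_at by metis
  also have "Dv (\<lambda>z. Dv (\<Phi> \<kappa>) z (Z, 0)) (e, x) (0, u) = Dv (\<lambda>z. Dv (\<Phi> \<kappa>) z (0, u)) (e, x) (Z, 0)" for Z
    by (rule second_derivative_symmetric[OF Phi_smooth(1)[OF k] e_in(1)[OF k x]]) (rule smooth_on_Ck[OF Phi_smooth(2)[OF k]])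
  finally show ?thesis using 1 by simp
qed

lemma Phi_dsnd:
  assumes k: "\<kappa> \<in> B" and x: "x \<in> dm \<kappa>"
  shows "Dv (\<Phi> \<kappa>) (e, x) (0, u) = u"
proof -
  have "((\<lambda>y. \<Phi> \<kappa> (e, y)) has_derivative (\<lambda>u. Dv (\<Phi> \<kappa>) (e, x) (0, u))) (at x)"
    using diff_chain_at[OF has_derivative_Pair[OF has_derivative_const has_derivative_ident]
      actn.pF_derivative[OF kG(1) k k e_in(1)[OF k x]]] by (simp add: o_def)
  moreover have "((\<lambda>y. \<Phi> \<kappa> (e, y)) has_derivative (\<lambda>u. u)) (at x)"
    by (rule has_derivative_transform_within_open[OF has_derivative_ident chart_open(2)[OF B.chart[OF k]] x])
      (simp add: e_in[OF k])
  ultimately show ?thesis using has_derivative_unique by metis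
qed

lemma Omega_slice:
  assumes k: "\<kappa> \<in> B" and x: "x \<in> dm \<kappa>"
  shows "open {a. (a, x) \<in> \<Omega> \<kappa>}" "e \<in> {a. (a, x) \<in> \<Omega> \<kappa>}"
proof -
  have "open ((\<lambda>a. (a, x)) -` \<Omega> \<kappa>)"
    using Phi_smooth(1)[OF k] by (intro open_vimage) (auto intro!: continuous_intros)
  then show "open {a. (a, x) \<in> \<Omega> \<kappa>}" by (simp add: vimage_def)
  show "e \<in> {a. (a, x) \<in> \<Omega> \<kappa>}" using e_in[OF k x] by simp
qed

text \<open>The Killing equation is the derivative at the identity, in the group variable, of the
  isometry relation \<open>Phi_isometry\<close>.\<close>

lemma V_killing:
  assumes k: "\<kappa> \<in> B"
  shows "local_metric.killing (coord_metric B g \<kappa>) (dm \<kappa>) (V \<kappa> Z)"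
proof -
  let ?\<gamma> = "coord_metric B g \<kappa>"
  interpret L: local_metric ?\<gamma> "dm \<kappa>" using coord_metric_local(1)[OF atlas_B riem k] .
  have "L.dg x (V \<kappa> Z x) v w + ?\<gamma> x (Dv (V \<kappa> Z) x v) w + ?\<gamma> x v (Dv (V \<kappa> Z) x w) = 0" if x: "x \<in> dm \<kappa>" for x v w
  proof -
    have "((\<lambda>a. ?\<gamma> (\<Phi> \<kappa> (a, x)) (Dv (\<Phi> \<kappa>) (a, x) (0, v)) (Dv (\<Phi> \<kappa>) (a, x) (0, w))) has_derivative
      (\<lambda>Z. ?\<gamma> x (Dv (V \<kappa> Z) x v + L.\<Gamma> x (V \<kappa> Z x) v) w + ?\<gamma> x v (Dv (V \<kappa> Z) x w + L.\<Gamma> x (V \<kappa> Z x) w))) (at e)"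
      using L.has_derivative_metric[OF Phi_dfst[OF k x] _ Phi_mixed[OF k x] Phi_mixed[OF k x], of v w] x
      by (simp add: e_in[OF k x] Phi_dsnd[OF k x])
    moreover have "((\<lambda>a. ?\<gamma> (\<Phi> \<kappa> (a, x)) (Dv (\<Phi> \<kappa>) (a, x) (0, v)) (Dv (\<Phi> \<kappa>) (a, x) (0, w))) has_derivative (\<lambda>Z. 0)) (at e)"
      by (rule has_derivative_transform_within_open[OF has_derivative_const[of "?\<gamma> x v w"] Omega_slice[OF k x]])
        (simp add: Phi_isometry[OF k])
    ultimately have "?\<gamma> x (Dv (V \<kappa> Z) x v + L.\<Gamma> x (V \<kappa> Z x) v) w + ?\<gamma> x v (Dv (V \<kappa> Z) x w + L.\<Gamma> x (V \<kappa> Z x) w) = 0"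
      using has_derivative_unique by (metis (no_types, lifting))
    then show ?thesis using L.metric_compatible[OF x, where u="V \<kappa> Z x" and v=v and w=w] by (simp add: L.g_simps[OF x])
  qed
  then show ?thesis using smooth_on_Ck[OF V_smooth[OF k]] by (auto simp: L.killing_def)
qed

subsection \<open>Differentiability of the adjoint representation\<close>

text \<open>Near \<open>(e, e)\<close> conjugation is a smooth map of two variables in the chart at
  the identity. \<open>Ad\<close> is its partial derivative in the second variable, hence depends
  differentiably on the first.\<close>

lemma Ad_differentiable: "(\<lambda>x. Ad A G (cinv \<kappa>G x) Y) differentiable (at e)"
proof -
  let ?M = "\<lambda>(a, b). a \<otimes>\<^bsub>G\<^esub> b"
  let ?m = "pF \<kappa>G \<kappa>G \<kappa>G ?M" and ?P = "pdom \<kappa>G \<kappa>G \<kappa>G ?M"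
  define Di where "Di = cmap \<kappa>G ` (UNIV \<inter> cdom \<kappa>G \<inter> (\<lambda>a. inv\<^bsub>G\<^esub> a) -` cdom \<kappa>G)"
  define \<iota> where "\<iota> = (\<lambda>x. cmap \<kappa>G (inv\<^bsub>G\<^esub> (cinv \<kappa>G x)))"
  have P: "open ?P" "smooth_on ?P ?m" using mul.pdom_smooth[OF kG(1,1,1)] .
  have cinvs: "continuous_on UNIV (\<lambda>a. inv\<^bsub>G\<^esub> a)" using inv_smooth by (simp add: smooth_map_on_def)
  have Di: "open Di"
  proof -
    have "open ((\<lambda>a. inv\<^bsub>G\<^esub> a) -` cdom \<kappa>G)"
      using cinvs chart_open(1)[OF kG(3)] by (metis continuous_on_open_vimage open_UNIV Int_UNIV_right)
    from chart_open_image[OF kG(3) this] show ?thesis by (simp add: Di_def Int_commute)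
  qed
  have \<iota>: "smooth_on Di \<iota>"
    using inv_smooth kG(1) unfolding smooth_map_on_def Di_def \<iota>_def o_def by blast
  \<comment> \<open>On \<open>W1\<close> the product and the inverse can be formed within the chart;
    on \<open>W\<close> their product can be formed as well.\<close>
  define W1 where "W1 = ?P \<inter> fst -` Di"
  define k where "k z = (?m z, \<iota> (fst z))" for z
  define W where "W = W1 \<inter> k -` ?P"
  have W1: "open W1" unfolding W1_def using P Di by (intro open_Int open_vimage) (auto intro: continuous_intros)
  have ks: "smooth_on W1 k" unfolding k_def
    by (intro smooth_on_Pair[OF W1] smooth_on_subset[OF P(2)] smooth_on_compose[OF W1 Di _ \<iota>] smooth_on_bounded_linear bounded_linear_fst)
      (auto simp: W1_def)
  have W: "open W" unfolding W_def
    using continuous_open_preimage[OF _ W1 P(1)] Ck_on.simps(1) smooth_on_Ck[OF ks, of 0] by metis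
  have Cs: "smooth_on W (\<lambda>z. ?m (k z))"
    by (rule smooth_on_compose[OF W P(1) _ P(2) smooth_on_subset[OF ks]]) (auto simp: W_def)
  have me: "(e, e) \<in> ?P" "?m (e, e) = e" and ie: "\<iota> e = e"
    using kG carrier by (simp_all add: pdom_def pF_def \<iota>_def)
  have "e \<in> Di" using kG(2,5) unfolding Di_def by (intro image_eqI[of _ _ "\<one>\<^bsub>G\<^esub>"]) auto
  then have ee: "(e, e) \<in> W" using me ie by (simp add: W_def W1_def k_def)
  have C: "?m (k (a, b)) = cmap \<kappa>G (cinv \<kappa>G a \<otimes>\<^bsub>G\<^esub> cinv \<kappa>G b \<otimes>\<^bsub>G\<^esub> inv\<^bsub>G\<^esub> (cinv \<kappa>G a))" if "(a, b) \<in> W" for a b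
  proof -
    have "cinv \<kappa>G (?m (a, b)) = cinv \<kappa>G a \<otimes>\<^bsub>G\<^esub> cinv \<kappa>G b"
      using that chart_inv(1)[OF kG(3)] by (auto simp: W_def W1_def pdom_def pF_def)
    moreover have "cinv \<kappa>G (\<iota> a) = inv\<^bsub>G\<^esub> (cinv \<kappa>G a)"
      using that chart_inv(1)[OF kG(3)] by (auto simp: W_def W1_def Di_def \<iota>_def)
    ultimately show ?thesis by (simp add: k_def pF_def)
  qed
  define N where "N = (\<lambda>a. (a, e)) -` W"
  have N: "open N" "e \<in> N" unfolding N_def using W ee by (auto intro!: open_vimage continuous_intros)
  have AdN: "Ad A G (cinv \<kappa>G a) Y = Dv (\<lambda>z. ?m (k z)) (a, e) (0, Y)" if "a \<in> N" for a
  proof -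
    have aW: "(a, e) \<in> W" using that by (simp add: N_def)
    have a: "((\<lambda>z. ?m (k z)) has_derivative (\<lambda>w. Dv (\<lambda>z. ?m (k z)) (a, e) w)) (at (a, e))"
      using smooth_on_differentiable[OF Cs aW] frechet_derivative_works by blast
    have "((\<lambda>b. ?m (k (a, b))) has_derivative (\<lambda>u. Dv (\<lambda>z. ?m (k z)) (a, e) (0, u))) (at e)"
      using diff_chain_at[OF has_derivative_Pair[OF has_derivative_const has_derivative_ident] a] by (simp add: o_def)
    moreover have "open ((\<lambda>b. (a, b)) -` W)" using W by (intro open_vimage) (auto intro!: continuous_intros)
    ultimately have "((\<lambda>b. cmap \<kappa>G (cinv \<kappa>G a \<otimes>\<^bsub>G\<^esub> cinv \<kappa>G b \<otimes>\<^bsub>G\<^esub> inv\<^bsub>G\<^esub> (cinv \<kappa>G a))) has_derivative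
        (\<lambda>u. Dv (\<lambda>z. ?m (k z)) (a, e) (0, u))) (at e)"
      by (rule has_derivative_transform_within_open) (use aW C in auto)
    moreover have "((\<lambda>b. cmap \<kappa>G (cinv \<kappa>G a \<otimes>\<^bsub>G\<^esub> cinv \<kappa>G b \<otimes>\<^bsub>G\<^esub> inv\<^bsub>G\<^esub> (cinv \<kappa>G a))) has_derivative Ad A G (cinv \<kappa>G a)) (at e)"
      using md_conj[of "cinv \<kappa>G a"] by (simp add: md_def kG(5))
    ultimately show ?thesis using has_derivative_unique by metis
  qed
  have "(\<lambda>a. Dv (\<lambda>z. ?m (k z)) (a, e) (0, Y)) differentiable (at e)"
    using differentiable_chain_at[of "\<lambda>a. (a, e)" e "\<lambda>z. Dv (\<lambda>z. ?m (k z)) z (0, Y)"]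
      smooth_on_differentiable[OF smooth_on_Dv[OF Cs] ee]
    by (simp add: o_def)
  then show ?thesis using differentiable_cong_open[OF N, of "\<lambda>a. Ad A G (cinv \<kappa>G a) Y"] AdN by auto
qed

section \<open>The Lie bracket and the commutator of action fields\<close>

abbreviation "br \<equiv> lie_bracket A G"

lemma Ad_derivative: "((\<lambda>x. Ad A G (cinv \<kappa>G x) Y) has_derivative (\<lambda>X. br X Y)) (at e)"
  using Ad_differentiable[THEN frechet_derivative_works[THEN iffD1], of Y]
  by (simp add: lie_bracket_def Let_def kG)

lemma br_bilinear: "bilinear br"
proof -
  have "linear (\<lambda>X. br X Y)" for Y using Ad_derivative has_derivative_linear by blast
  moreover have "linear (\<lambda>Y. br X Y)" for X
  proof (rule linearI)
    fix Y1 Y2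
    have "((\<lambda>x. Ad A G (cinv \<kappa>G x) (Y1 + Y2)) has_derivative (\<lambda>X. br X Y1 + br X Y2)) (at e)"
      using has_derivative_add[OF Ad_derivative Ad_derivative] by (simp add: linear_add[OF Ad_linear])
    then show "br X (Y1 + Y2) = br X Y1 + br X Y2" using has_derivative_unique[OF Ad_derivative] by metis
  next
    fix k Y
    have "((\<lambda>x. Ad A G (cinv \<kappa>G x) (k *\<^sub>R Y)) has_derivative (\<lambda>X. k *\<^sub>R br X Y)) (at e)"
      using has_derivative_scaleR_right[OF Ad_derivative] by (simp add: linear_cmul[OF Ad_linear])
    then show "br X (k *\<^sub>R Y) = k *\<^sub>R br X Y" using has_derivative_unique[OF Ad_derivative] by metis
  qed
  ultimately show ?thesis by (simp add: bilinear_def)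
qed

lemma bi_invariant_br:
  assumes "bi_invariant A G Q"
  shows "Q (br Z X) Y + Q X (br Z Y) = 0"
proof -
  have bil: "bilinear Q" and inv: "\<And>a X Y. Q (Ad A G a X) (Ad A G a Y) = Q X Y"
    using assms carrier by (auto simp: bi_invariant_def inner_product_form_def)
  have "((\<lambda>x. Q (Ad A G (cinv \<kappa>G x) X) (Ad A G (cinv \<kappa>G x) Y)) has_derivative
      (\<lambda>Z. 0 + Q (br Z X) (Ad A G (cinv \<kappa>G e) Y) + Q (Ad A G (cinv \<kappa>G e) X) (br Z Y))) (at e)"
    by (rule has_derivative_bilinear_field[OF open_UNIV UNIV_I bil has_derivative_const Ad_derivative Ad_derivative])
  then have "((\<lambda>x. Q X Y) has_derivative (\<lambda>Z. Q (br Z X) Y + Q X (br Z Y))) (at e)"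
    by (simp add: inv kG Ad_one)
  then show ?thesis using has_derivative_unique[OF has_derivative_const] by metis
qed

text \<open>Differentiate equivariance at the identity: one side gives the mixed derivative
  \<open>Phi_mixed\<close>, the other the product rule for \<open>Ad\<close> and the moved point.
  The minus sign is that of a left action, whose fields form an antihomomorphism.\<close>

lemma V_bracket:
  assumes k: "\<kappa> \<in> B" and x: "x \<in> dm \<kappa>"
  shows "Dv (V \<kappa> X) x (V \<kappa> Z x) - Dv (V \<kappa> Z) x (V \<kappa> X x) = - V \<kappa> (br Z X) x"
proof -
  note S = Omega_slice[OF k x]
  have dV: "((V \<kappa> Y) has_derivative (\<lambda>v. Dv (V \<kappa> Y) (\<Phi> \<kappa> (e, x)) v)) (at (\<Phi> \<kappa> (e, x)))" for Y
    using smooth_on_differentiable[OF V_smooth[OF k] x, THEN frechet_derivative_works[THEN iffD1]] by (simp add: e_in[OF k x])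
  have "((\<lambda>a. V \<kappa> Y (\<Phi> \<kappa> (a, x))) has_derivative (\<lambda>Z. Dv (V \<kappa> Y) x (V \<kappa> Z x))) (at e)" for Y
    using diff_chain_at[OF Phi_dfst[OF k x] dV[of Y]] by (simp add: o_def e_in[OF k x])
  then have "((\<lambda>a. V \<kappa> (Ad A G (cinv \<kappa>G a) X) (\<Phi> \<kappa> (a, x))) has_derivative
     (\<lambda>Z. Dv (V \<kappa> (Ad A G (cinv \<kappa>G e) X)) x (V \<kappa> Z x) + V \<kappa> (br Z X) (\<Phi> \<kappa> (e, x)))) (at e)"
    by (intro has_derivative_linear_field[OF S, where F="\<lambda>a Y. V \<kappa> Y (\<Phi> \<kappa> (a, x))"] Ad_derivative)
      (auto intro!: V_linear[OF k] Omega_D(8)[OF k])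
  then have "((\<lambda>a. V \<kappa> (Ad A G (cinv \<kappa>G a) X) (\<Phi> \<kappa> (a, x))) has_derivative
     (\<lambda>Z. Dv (V \<kappa> X) x (V \<kappa> Z x) + V \<kappa> (br Z X) x)) (at e)"
    by (simp add: kG Ad_one e_in[OF k x])
  then have "((\<lambda>a. Dv (\<Phi> \<kappa>) (a, x) (0, V \<kappa> X x)) has_derivative
     (\<lambda>Z. Dv (V \<kappa> X) x (V \<kappa> Z x) + V \<kappa> (br Z X) x)) (at e)"
    by (rule has_derivative_transform_within_open[OF _ S]) (simp add: Phi_equivariant[OF k])
  from has_derivative_unique[OF Phi_mixed[OF k x] this, THEN fun_cong, of Z]
  have "Dv (V \<kappa> X) x (V \<kappa> Z x) + V \<kappa> (br Z X) x = Dv (V \<kappa> Z) x (V \<kappa> X x)" by simp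
  then show ?thesis by (simp add: algebra_simps)
qed

end

section \<open>The Einstein equations along a normal curve\<close>

text \<open>For an invariant metric \<open>h\<close> on the orbit, \<open>kosf\<close> is Koszul's formula for the Levi-Civita
  connection on action fields; \<open>Dhf\<close> and \<open>Dkosf\<close> are the derivatives of \<open>h\<close> and \<open>kosf\<close> along the
  action field of \<open>W\<close>.\<close>

definition Dhf :: "('l \<Rightarrow> 'l \<Rightarrow> 'l) \<Rightarrow> ('l \<Rightarrow> 'l \<Rightarrow> real) \<Rightarrow> 'l \<Rightarrow> 'l \<Rightarrow> 'l \<Rightarrow> real" where
  "Dhf br h W X Y = - h (br W X) Y - h X (br W Y)"
definition kosf :: "('l \<Rightarrow> 'l \<Rightarrow> 'l) \<Rightarrow> ('l \<Rightarrow> 'l \<Rightarrow> real) \<Rightarrow> 'l \<Rightarrow> 'l \<Rightarrow> 'l \<Rightarrow> real" where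
  "kosf br h Y X Z = (- h (br Y X) Z + h (br Z Y) X - h (br X Z) Y) / 2"
definition Dkosf :: "('l \<Rightarrow> 'l \<Rightarrow> 'l) \<Rightarrow> ('l \<Rightarrow> 'l \<Rightarrow> real) \<Rightarrow> 'l \<Rightarrow> 'l \<Rightarrow> 'l \<Rightarrow> 'l \<Rightarrow> real" where
  "Dkosf br h W Y X Z = (- Dhf br h W (br Y X) Z + Dhf br h W (br Z Y) X - Dhf br h W (br X Z) Y) / 2"

locale cohomogeneity_one_action = isometric_action A G B g \<phi>
  for A :: "('g::t2_space, 'l::euclidean_space) chart set" and G :: "'g monoid"
    and B :: "('m::t2_space, 'e::euclidean_space) chart set" and g \<phi> +
  fixes K :: "'g set" and I :: "real set" and c :: "real \<Rightarrow> 'm" and \<Lambda> :: real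
  assumes cohom: "cohomogeneity_one A G B g \<phi>"
    and normal: "normal_curve A G B g \<phi> K I c"
    and ricci: "\<And>p v w. ricci B g p v w = \<Lambda> * g p v w"
begin

abbreviation "\<alpha> t \<equiv> action_field A G B \<phi> (c t)"
abbreviation "vel \<equiv> velocity B c"

definition "H X Y t = orbit_metric A G B g \<phi> c t X Y"
definition "dH X Y t = deriv (H X Y) t"

text \<open>An orthonormal frame of the tangent space, stated through its expansion property because
  traces use it in this form. The vectors tangent to the orbit are given by Lie algebra
  elements.\<close>

definition frame_at :: "real \<Rightarrow> ('i \<Rightarrow> 'l) \<Rightarrow> 'i set \<Rightarrow> bool" where
  "frame_at t E S \<longleftrightarrow> finite S \<and>
     (\<forall>v. v = g (c t) v (vel t) *\<^sub>R vel t + (\<Sum>i\<in>S. g (c t) v (\<alpha> t (E i)) *\<^sub>R \<alpha> t (E i)))"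

lemma I: "open I" "is_interval I" "I \<noteq> {}"
  using normal by (auto simp: normal_curve_def)

lemma curve: "t \<in> I \<Longrightarrow> g (c t) (vel t) (vel t) = 1" "t \<in> I \<Longrightarrow> g (c t) (vel t) (\<alpha> t X) = 0"
  "t \<in> I \<Longrightarrow> stabilizer G \<phi> (c t) = K"
  using normal by (auto simp: normal_curve_def)

lemma H_eq: "H X Y t = g (c t) (\<alpha> t X) (\<alpha> t Y)"
  by (simp add: H_def orbit_metric_def)

context
  fixes t0 assumes t0: "t0 \<in> I"
begin

abbreviation "\<kappa>0 \<equiv> chart_at B (c t0)"
text \<open>Tangent vectors at \<open>c t\<close> are represented in a chart that may jump with
  \<open>t\<close>. Keeping the chart at \<open>c t0\<close> on a neighbourhood \<open>J\<close>
  makes it possible to differentiate along the curve; at \<open>t0\<close> both representations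
  agree.\<close>

definition "J = {t \<in> I. c t \<in> cdom \<kappa>0}"
definition "cc t = cmap \<kappa>0 (c t)"
definition "cc' t = vector_derivative cc (at t)"
definition "cc'' t = vector_derivative cc' (at t)"

lemma cc_smooth: "open J" "smooth_on J cc" "t0 \<in> J" "\<And>t. t \<in> J \<Longrightarrow> isCont c t"
proof -
  have sm: "smooth_map_on real_atlas I B c" using normal by (simp add: normal_curve_def)
  then have cont: "continuous_on I c" by (simp add: smooth_map_on_def)
  have Jeq: "J = c -` cdom \<kappa>0 \<inter> I" by (auto simp: J_def)
  show "open J" unfolding Jeq
    using cont I(1) chart_open(1)[OF B.chart_chart_at] continuous_on_open_vimage by blast
  have cinv_id: "cinv ((UNIV, id) :: (real, real) chart) = id"
    by (simp add: cinv_def)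
  have "(UNIV, id) \<in> real_atlas" by (simp add: real_atlas_def)
  with sm B.chart_at(1)[of "c t0"]
  have "smooth_on (cmap ((UNIV, id) :: (real, real) chart) ` (I \<inter> cdom ((UNIV, id) :: (real, real) chart) \<inter> c -` cdom \<kappa>0))
     (cmap \<kappa>0 \<circ> c \<circ> cinv ((UNIV, id) :: (real, real) chart))"
    unfolding smooth_map_on_def by blast
  then show "smooth_on J cc" unfolding cinv_id by (simp add: Jeq cc_def[abs_def] o_def Int_commute)
  show "t0 \<in> J" using t0 B.chart_at(2) by (simp add: J_def)
  show "isCont c t" if "t \<in> J" for t
    using that cont I(1) by (auto simp: J_def continuous_on_eq_continuous_at)
qed

lemma smooth_curve_derivative:
  fixes q :: "real \<Rightarrow> 'x::euclidean_space"
  assumes "open S" "smooth_on S q" "t \<in> S"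
  shows "(q has_vector_derivative vector_derivative q (at t)) (at t)"
    and "smooth_on S (\<lambda>t. vector_derivative q (at t))"
proof -
  have d: "q differentiable (at t)" if "t \<in> S" for t using smooth_on_differentiable assms(2) that by blast
  show "(q has_vector_derivative vector_derivative q (at t)) (at t)"
    using d[OF assms(3)] vector_derivative_works by blast
  have "Dv q t 1 = vector_derivative q (at t)" if "t \<in> S" for t
    using frechet_derivative_eq_vector_derivative[OF d[OF that]] by simp
  then have "smooth_on S (\<lambda>t. Dv q t 1) \<longleftrightarrow> smooth_on S (\<lambda>t. vector_derivative q (at t))"
    by (rule smooth_on_cong[OF assms(1)])
  then show "smooth_on S (\<lambda>t. vector_derivative q (at t))"
    using smooth_on_Dv[OF assms(2), of 1] by simp
qed

lemma vel_chart: assumes t: "t \<in> J" shows "vel t = B.tconv \<kappa>0 (c t) (cc' t)"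
proof -
  have ct: "c t \<in> cdom \<kappa>0" using t by (simp add: J_def)
  have d: "(cc has_derivative (\<lambda>s. s *\<^sub>R cc' t)) (at t)"
    using smooth_curve_derivative(1)[OF cc_smooth(1,2) t] by (simp add: has_vector_derivative_def cc'_def)
  obtain W where W: "open W" "t \<in> W" "\<And>s. s \<in> W \<Longrightarrow> c s \<in> cdom \<kappa>0"
    using isCont_nbhd[OF cc_smooth(4)[OF t] chart_open(1)[OF B.chart_chart_at] ct] by blast
  have m: "md \<kappa>0 (chart_at B (c t)) (\<lambda>q. q) (c t) (B.tconv \<kappa>0 (c t))"
    using B.md_tconv[OF B.chart_at(1) ct] .
  then have D: "((\<lambda>x. cmap (chart_at B (c t)) (cinv \<kappa>0 x)) has_derivative B.tconv \<kappa>0 (c t)) (at (cc t))"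
    by (simp add: md_def cc_def)
  have "((\<lambda>s. cmap (chart_at B (c t)) (cinv \<kappa>0 (cc s))) has_derivative (\<lambda>s. B.tconv \<kappa>0 (c t) (s *\<^sub>R cc' t))) (at t)"
    using diff_chain_at[OF d D] by (simp add: o_def)
  then have "((\<lambda>s. cmap (chart_at B (c t)) (c s)) has_derivative (\<lambda>s. B.tconv \<kappa>0 (c t) (s *\<^sub>R cc' t))) (at t)"
    by (rule has_derivative_transform_within_open[OF _ W(1,2)])
      (simp add: cc_def chart_inv(1)[OF B.chart_chart_at W(3)])
  then have "((\<lambda>s. cmap (chart_at B (c t)) (c s)) has_vector_derivative B.tconv \<kappa>0 (c t) (cc' t)) (at t)"
    by (simp add: has_vector_derivative_def linear_cmul[OF md_linear[OF m]])
  then show ?thesis by (simp add: velocity_def o_def vector_derivative_at)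
qed

abbreviation "\<gamma>0 \<equiv> coord_metric B g \<kappa>0"

lemma gamma_cc:
  assumes "t \<in> J"
  shows "cc t \<in> dm \<kappa>0" "\<gamma>0 (cc t) u v = g (c t) (B.tconv \<kappa>0 (c t) u) (B.tconv \<kappa>0 (c t) v)"
    "\<alpha> t X = B.tconv \<kappa>0 (c t) (V \<kappa>0 X (cc t))"
proof -
  have ct: "c t \<in> cdom \<kappa>0" using assms by (simp add: J_def)
  then show c: "cc t \<in> dm \<kappa>0" by (simp add: cc_def)
  show "\<gamma>0 (cc t) u v = g (c t) (B.tconv \<kappa>0 (c t) u) (B.tconv \<kappa>0 (c t) v)"
    unfolding coord_metric_local(2)[OF atlas_B riem B.chart_at(1) c]
    by (simp add: cc_def chart_inv(1)[OF B.chart_chart_at ct])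
  show "\<alpha> t X = B.tconv \<kappa>0 (c t) (V \<kappa>0 X (cc t))"
    using action_field_chart[OF B.chart_at(1) ct] by (simp add: cc_def)
qed

lemma gamma_t0: "\<gamma>0 (cc t0) u v = g (c t0) u v" "V \<kappa>0 X (cc t0) = \<alpha> t0 X" "cc' t0 = vel t0"
  using gamma_cc[OF cc_smooth(3)] vel_chart[OF cc_smooth(3)] by (simp_all add: B.tconv_chart_at)

context
  fixes E :: "'i \<Rightarrow> 'l" and S :: "'i set" assumes frame: "frame_at t0 E S"
begin

lemma local_model: "cohom_local \<gamma>0 (dm \<kappa>0) (V \<kappa>0) br cc cc' cc'' t0 J E S"
proof -
  interpret L: local_metric \<gamma>0 "dm \<kappa>0" using coord_metric_local(1)[OF atlas_B riem B.chart_at(1)] .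
  have sm: "smooth_on J cc'" unfolding cc'_def[abs_def]
    using smooth_curve_derivative(2)[OF cc_smooth(1,2)] cc_smooth(3) by blast
  show ?thesis
  proof (intro cohom_local.intro cohom_local_axioms.intro)
    show "local_metric \<gamma>0 (dm \<kappa>0)" by (rule L.local_metric_axioms)
    show "L.killing (V \<kappa>0 X)" for X using V_killing[OF B.chart_at(1)] .
    show "linear (\<lambda>X. V \<kappa>0 X x)" if "x \<in> dm \<kappa>0" for x using V_linear[OF B.chart_at(1) that] .
    show "Dv (V \<kappa>0 X) x (V \<kappa>0 Z x) - Dv (V \<kappa>0 Z) x (V \<kappa>0 X x) = - V \<kappa>0 (br Z X) x" if "x \<in> dm \<kappa>0" for x X Z
      using V_bracket[OF B.chart_at(1) that] .
    show "open J" "t0 \<in> J" using cc_smooth by auto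
    show "cc t \<in> dm \<kappa>0" if "t \<in> J" for t using gamma_cc(1)[OF that] .
    show "(cc has_vector_derivative cc' t) (at t)" if "t \<in> J" for t
      unfolding cc'_def using smooth_curve_derivative(1)[OF cc_smooth(1,2) that] .
    show "(cc' has_vector_derivative cc'' t) (at t)" if "t \<in> J" for t
      unfolding cc''_def using smooth_curve_derivative(1)[OF cc_smooth(1) sm that] .
    show "\<gamma>0 (cc t) (cc' t) (cc' t) = 1" if "t \<in> J" for t
      using gamma_cc(2)[OF that] vel_chart[OF that] curve(1)[of t] that by (simp add: J_def)
    show "\<gamma>0 (cc t) (cc' t) (V \<kappa>0 X (cc t)) = 0" if "t \<in> J" for t X
      using gamma_cc(2,3)[OF that] vel_chart[OF that] curve(2)[of t X] that by (simp add: J_def)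
    show "finite S" using frame by (simp add: frame_at_def)
    show "v = \<gamma>0 (cc t0) v (cc' t0) *\<^sub>R cc' t0 + (\<Sum>i\<in>S. \<gamma>0 (cc t0) v (V \<kappa>0 (E i) (cc t0)) *\<^sub>R V \<kappa>0 (E i) (cc t0))" for v
      using frame unfolding frame_at_def gamma_t0 by blast
  qed
qed

interpretation L: cohom_local \<gamma>0 "dm \<kappa>0" "V \<kappa>0" br cc cc' cc'' t0 J E S
  by (rule local_model)

lemma h_H: "t \<in> J \<Longrightarrow> L.h X Y t = H X Y t"
  by (simp add: L.h_def L.f_def H_eq gamma_cc(2,3))

lemma H_deriv_J: assumes t: "t \<in> J" shows "(H X Y has_real_derivative L.dh X Y t) (at t)"
  by (rule has_field_derivative_transform_within_open[OF L.h_deriv[OF t] cc_smooth(1) t]) (rule h_H)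

lemma dh_dH: "t \<in> J \<Longrightarrow> L.dh X Y t = dH X Y t"
  using H_deriv_J DERIV_imp_deriv unfolding dH_def by metis

lemma H_deriv: "(H X Y has_real_derivative dH X Y t0) (at t0)"
  using H_deriv_J[OF cc_smooth(3)] dh_dH[OF cc_smooth(3)] by simp

lemma ricci_t0: "coord_ricci \<gamma>0 (cc t0) v w = \<Lambda> * g (c t0) v w"
  using ricci[of "c t0" v w] by (simp add: ricci_def cc_def)

text \<open>An action field is orthogonal to the velocity, so the Einstein equation sets the
  component in \<open>ricci_normal\<close> to zero.\<close>

lemma einstein_mixed:
  "(\<Sum>i\<in>S. dH (br Z (E i)) (E i) t0) = (\<Sum>j\<in>S. dH Z (E j) t0 * (\<Sum>i\<in>S. H (br (E j) (E i)) (E i) t0))"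
  using L.ricci_normal[of Z] curve(2)[OF t0]
  by (simp add: ricci_t0 gamma_t0 h_H[OF cc_smooth(3)] dh_dH[OF cc_smooth(3)])

lemma einstein_tangential:
  "(dH X Y has_real_derivative
     2 * (\<Sum>i\<in>S. Dkosf br (\<lambda>X Y. H X Y t0) (E i) Y X (E i)
         - (\<Sum>j\<in>S. kosf br (\<lambda>X Y. H X Y t0) Y X (E j) * kosf br (\<lambda>X Y. H X Y t0) (E i) (E i) (E j))
         - dH X Y t0 * dH (E i) (E i) t0 / 4
         - (\<Sum>j\<in>S. kosf br (\<lambda>X Y. H X Y t0) (E i) Y (E j) * kosf br (\<lambda>X Y. H X Y t0) (E j) X (E i))
         + dH Y (E i) t0 * dH X (E i) t0 / 4)
     + (\<Sum>i\<in>S. dH Y (E i) t0 * dH X (E i) t0) / 2 - 2 * \<Lambda> * H X Y t0) (at t0)"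
proof -
  have k: "L.kos = kosf br (\<lambda>X Y. H X Y t0)" "L.Dkos = Dkosf br (\<lambda>X Y. H X Y t0)"
    by (simp_all add: fun_eq_iff L.kos_def kosf_def L.Dkos_def Dkosf_def L.Dh_def Dhf_def h_H[OF cc_smooth(3)])
  have "(dH X Y has_real_derivative
     2 * (\<Sum>i\<in>S. L.Dkos (E i) Y X (E i) - (\<Sum>j\<in>S. L.kos Y X (E j) * L.kos (E i) (E i) (E j))
         - L.dh X Y t0 * L.dh (E i) (E i) t0 / 4
         - (\<Sum>j\<in>S. L.kos (E i) Y (E j) * L.kos (E j) X (E i)) + L.dh Y (E i) t0 * L.dh X (E i) t0 / 4)
     + (\<Sum>i\<in>S. L.dh Y (E i) t0 * L.dh X (E i) t0) / 2
     - 2 * coord_ricci \<gamma>0 (cc t0) (V \<kappa>0 X (cc t0)) (V \<kappa>0 Y (cc t0))) (at t0)"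
    by (rule has_field_derivative_transform_within_open[OF L.dh_deriv cc_smooth(1,3)]) (rule dh_dH)
  then show ?thesis
    by (simp add: k ricci_t0 gamma_t0 dh_dH[OF cc_smooth(3)] H_eq mult.assoc)
qed

end

end

end

section \<open>Local solutions of autonomous differential equations\<close>

text \<open>Banach's fixed point theorem for the integral operator, which
  \<open>\<epsilon> * L < 1\<close> makes a contraction.\<close>

lemma picard_lipschitz:
  fixes W :: "'a::euclidean_space \<Rightarrow> 'a"
  assumes L: "0 \<le> L" "\<And>x y. dist (W x) (W y) \<le> L * dist x y" and eps: "0 < \<epsilon>" "\<epsilon> * L < 1"
  shows "\<exists>y. y 0 = e \<and> (\<forall>t\<in>{-\<epsilon><..<\<epsilon>}. (y has_vector_derivative W (y t)) (at t))"
proof -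
  have Wc: "continuous_on UNIV W"
    using L by (intro lipschitz_on_continuous_on[of L]) (auto simp: lipschitz_on_def)
  define F :: "(real \<Rightarrow>\<^sub>C 'a) \<Rightarrow> real \<Rightarrow> 'a" where "F y t = integral {-\<epsilon>..t} (\<lambda>s. W (y s))" for y t
  have cW: "continuous_on T (\<lambda>s. W (y s))" for T and y :: "real \<Rightarrow>\<^sub>C 'a"
    by (rule continuous_on_compose2[OF Wc]) auto
  have dF: "((F y) has_vector_derivative W (y t)) (at t within {-\<epsilon>..\<epsilon>})" if "t \<in> {-\<epsilon>..\<epsilon>}" for y t
    unfolding F_def by (rule integral_has_vector_derivative[OF cW that])
  have cF: "continuous_on {-\<epsilon>..\<epsilon>} (F y)" for y
    using dF has_vector_derivative_continuous unfolding continuous_on_eq_continuous_within by blast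
  \<comment> \<open>Clamping the time to the interval turns the integral operator into a self map of
    the bounded continuous functions on the whole line.\<close>
  define cl where "cl t = max (-\<epsilon>) (min \<epsilon> t)" for t
  have cl: "cl t \<in> {-\<epsilon>..\<epsilon>}" "\<bar>cl t\<bar> \<le> \<epsilon>" for t using eps(1) by (auto simp: cl_def)
  have clc: "continuous_on UNIV cl" unfolding cl_def by (intro continuous_intros)
  \<comment> \<open>The integral starts at \<open>-\<epsilon>\<close>; subtracting its value at 0
    gives the integral from 0 for times of either sign.\<close>
  define q where "q y t = e + (F y (cl t) - F y 0)" for y t
  have q: "q y \<in> bcontfun" for y
  proof -
    have "continuous_on UNIV (q y)"
      unfolding q_def by (intro continuous_intros continuous_on_compose2[OF cF clc]) (use cl in auto)
    moreover have "bounded (range (q y))"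
    proof -
      have "compact ((\<lambda>t. e + (F y t - F y 0)) ` {-\<epsilon>..\<epsilon>})"
        by (intro compact_continuous_image continuous_intros cF) auto
      moreover have "range (q y) \<subseteq> (\<lambda>t. e + (F y t - F y 0)) ` {-\<epsilon>..\<epsilon>}"
        unfolding q_def using cl(1) by blast
      ultimately show ?thesis using bounded_subset compact_imp_bounded by blast
    qed
    ultimately show ?thesis by (simp add: bcontfun_def)
  qed
  define P where "P y = Bcontfun (q y)" for y
  have P: "apply_bcontfun (P y) = q y" for y unfolding P_def using q by (simp add: Bcontfun_inverse)
  have contr: "dist (P y) (P z) \<le> (\<epsilon> * L) * dist y z" for y z
  proof (rule dist_bound)
    fix t
    let ?D = "\<lambda>t. F y t - F z t"
    have dD: "(?D has_derivative (\<lambda>h. h *\<^sub>R (W (y u) - W (z u)))) (at u within {-\<epsilon>..\<epsilon>})" if "u \<in> {-\<epsilon>..\<epsilon>}" for u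
      using has_vector_derivative_diff[OF dF[OF that, of y] dF[OF that, of z]] by (simp add: has_vector_derivative_def)
    have "norm (?D (cl t) - ?D 0) \<le> (L * dist y z) * norm (cl t - 0)"
    proof (rule differentiable_bound[OF _ dD])
      fix u assume "u \<in> {-\<epsilon>..\<epsilon>}"
      have "norm (W (y u) - W (z u)) \<le> L * dist (y u) (z u)" using L(2) by (simp add: dist_norm)
      also have "\<dots> \<le> L * dist y z" by (intro mult_left_mono dist_bounded L(1))
      finally show "onorm (\<lambda>h. h *\<^sub>R (W (y u) - W (z u))) \<le> L * dist y z"
        by (intro onorm_bound) (auto simp: L(1) mult.commute[of "L * dist y z"] intro: mult_left_mono)
    qed (use cl eps in auto)
    also have "\<dots> \<le> (L * dist y z) * \<epsilon>" using cl(2)[of t] L(1) by (intro mult_left_mono) auto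
    finally show "dist (P y t) (P z t) \<le> (\<epsilon> * L) * dist y z"
      by (simp add: P q_def dist_norm algebra_simps)
  qed
  obtain y where y: "P y = y"
    using banach_fix_type[of "\<epsilon> * L" P] contr eps L(1) by (auto simp: mult_less_cancel_right)
  have "apply_bcontfun y 0 = e"
    using arg_cong[OF y, of "\<lambda>y. apply_bcontfun y 0"] eps by (simp add: P q_def cl_def)
  moreover have "(apply_bcontfun y has_vector_derivative W (y t)) (at t)" if t: "t \<in> {-\<epsilon><..<\<epsilon>}" for t
  proof -
    have "(F y has_vector_derivative W (y t)) (at t)"
      using dF[of t y] t by (simp add: at_within_Icc_at)
    then have "((\<lambda>t. e + (F y t - F y 0)) has_vector_derivative W (y t)) (at t)"
      by (auto intro!: derivative_eq_intros)
    moreover have "e + (F y s - F y 0) = apply_bcontfun y s" if "s \<in> {-\<epsilon><..<\<epsilon>}" for s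
    proof -
      have "apply_bcontfun y s = q y s" using y P by metis
      moreover have "cl s = s" using that by (auto simp: cl_def)
      ultimately show ?thesis by (simp add: q_def)
    qed
    ultimately show ?thesis
      using has_vector_derivative_transform_within_open[OF _ open_greaterThanLessThan t] by blast
  qed
  ultimately show ?thesis by blast
qed

text \<open>Composition with the nearest point projection onto a closed ball, which does not
  increase distances, makes \<open>W\<close> globally Lipschitz. For a short time the solution stays
  in the ball, where the projection is the identity.\<close>

lemma picard_local:
  fixes W :: "'a::euclidean_space \<Rightarrow> 'a"
  assumes D: "open D" "e \<in> D" and W: "Ck_on 1 D W"
  shows "\<exists>\<epsilon>>0. \<exists>y. y 0 = e \<and> (\<forall>t\<in>{-\<epsilon><..<\<epsilon>}. y t \<in> D \<and> (y has_vector_derivative W (y t)) (at t))"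
proof -
  obtain \<rho> where \<rho>: "\<rho> > 0" "cball e \<rho> \<subseteq> D" using D open_contains_cball by blast
  let ?C = "cball e \<rho>"
  have dW: "(W has_derivative (\<lambda>v. Dv W x v)) (at x)" if "x \<in> D" for x
    using W that by (auto simp: frechet_derivative_works[symmetric])
  have cD: "continuous_on ?C (\<lambda>x. Dv W x b)" for b
    using W \<rho> by (auto intro: continuous_on_subset)
  have "\<exists>M. \<forall>x\<in>?C. norm (Dv W x b) \<le> M" for b
    using compact_imp_bounded[OF compact_continuous_image[OF cD compact_cball]] unfolding bounded_iff by blast
  then obtain M where M: "\<And>b x. x \<in> ?C \<Longrightarrow> norm (Dv W x b) \<le> M b" by metis
  define L where "L = (\<Sum>b\<in>Basis. \<bar>M b\<bar>)"
  have L0: "L \<ge> 0" by (simp add: L_def sum_nonneg)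
  have lip: "norm (W x - W y) \<le> L * norm (x - y)" if "x \<in> ?C" "y \<in> ?C" for x y
  proof (rule differentiable_bound[OF convex_cball[of e \<rho>] _ _ that])
    fix z assume z: "z \<in> ?C"
    then show "(W has_derivative (\<lambda>v. Dv W z v)) (at z within ?C)"
      using dW \<rho> has_derivative_at_withinI by blast
    show "onorm (\<lambda>v. Dv W z v) \<le> L"
    proof (rule onorm_bound[OF L0])
      fix v
      have "norm (Dv W z v) \<le> (\<Sum>b\<in>Basis. norm v * \<bar>M b\<bar>)"
        unfolding linear_expand[OF has_derivative_linear[OF dW[OF subsetD[OF \<rho>(2) z]]], of v]
      proof (rule sum_norm_le)
        fix b :: 'a assume b: "b \<in> Basis"
        show "norm ((v \<bullet> b) *\<^sub>R Dv W z b) \<le> norm v * \<bar>M b\<bar>"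
          using Basis_le_norm[OF b, of v] M[OF z, of b] by (simp, intro mult_mono) auto
      qed
      then show "norm (Dv W z v) \<le> L * norm v" by (simp add: L_def sum_distrib_left mult.commute)
    qed
  qed
  define pr where "pr = closest_point ?C"
  have C: "convex ?C" "closed ?C" "?C \<noteq> {}" using \<rho> by auto
  have pr: "pr x \<in> ?C" "dist (pr x) (pr y) \<le> dist x y" "z \<in> ?C \<Longrightarrow> pr z = z" for x y z
    unfolding pr_def using closest_point_in_set[OF C(2,3)] closest_point_lipschitz[OF C] closest_point_self by blast+
  define B where "B = norm (W e) + L * \<rho>"
  have B0: "B \<ge> 0" using L0 \<rho> by (simp add: B_def)
  have bound: "norm (W (pr x)) \<le> B" for x
  proof -
    have "norm (W (pr x)) \<le> norm (W e) + norm (W (pr x) - W e)" using norm_triangle_sub by blast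
    also have "norm (W (pr x) - W e) \<le> L * norm (pr x - e)" using lip pr(1) \<rho> by auto
    also have "\<dots> \<le> L * \<rho>" using pr(1)[of x] L0 by (intro mult_left_mono) (auto simp: dist_norm norm_minus_commute)
    finally show ?thesis by (simp add: B_def)
  qed
  \<comment> \<open>The first bound makes the integral operator contract, and the second prevents a
    solution of speed at most \<open>B\<close> from leaving the ball of radius
    \<open>\<rho>\<close>.\<close>
  define \<epsilon> where "\<epsilon> = min (1 / (2 * (L + 1))) (\<rho> / (B + 1))"
  have \<epsilon>: "\<epsilon> > 0" "\<epsilon> * L < 1" "\<epsilon> * B \<le> \<rho>"
  proof -
    show "\<epsilon> > 0" using L0 B0 \<rho> by (simp add: \<epsilon>_def)
    have "\<epsilon> * L \<le> 1 / (2 * (L + 1)) * L" unfolding \<epsilon>_def using L0 by (intro mult_right_mono) auto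
    also have "\<dots> < 1" using L0 by (simp add: field_simps)
    finally show "\<epsilon> * L < 1" .
    have "\<epsilon> * B \<le> \<rho> / (B + 1) * B" unfolding \<epsilon>_def using B0 by (intro mult_right_mono) auto
    also have "\<dots> \<le> \<rho>" using B0 \<rho> by (simp add: field_simps)
    finally show "\<epsilon> * B \<le> \<rho>" .
  qed
  have "dist (W (pr x)) (W (pr y)) \<le> L * dist x y" for x y
    using lip[OF pr(1) pr(1), of x y] mult_left_mono[OF pr(2)[of x y] L0] by (simp add: dist_norm)
  from picard_lipschitz[OF L0 this \<epsilon>(1,2), of e]
  obtain y where y: "y 0 = e" "\<And>t. t \<in> {-\<epsilon><..<\<epsilon>} \<Longrightarrow> (y has_vector_derivative W (pr (y t))) (at t)"
    by blast
  have inC: "y t \<in> ?C" if t: "t \<in> {-\<epsilon><..<\<epsilon>}" for t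
  proof -
    have "norm (y t - y 0) \<le> B * norm (t - 0)"
    proof (rule differentiable_bound[OF convex_real_interval(8)[of "-\<epsilon>" \<epsilon>]])
      fix s assume "s \<in> {-\<epsilon><..<\<epsilon>}"
      then show "(y has_derivative (\<lambda>h. h *\<^sub>R W (pr (y s)))) (at s within {-\<epsilon><..<\<epsilon>})"
        using y(2) has_derivative_at_withinI unfolding has_vector_derivative_def by blast
      show "onorm (\<lambda>h. h *\<^sub>R W (pr (y s))) \<le> B"
        by (intro onorm_bound) (auto simp: B0 bound mult.commute[of B] intro: mult_left_mono)
    qed (use t \<epsilon> in auto)
    also have "\<dots> \<le> B * \<epsilon>" using t B0 by (intro mult_left_mono) auto
    finally show ?thesis using \<epsilon>(3) y(1) by (simp add: dist_norm norm_minus_commute mult.commute)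
  qed
  show ?thesis
  proof (intro exI conjI ballI)
    fix t assume "t \<in> {-\<epsilon><..<\<epsilon>}"
    then show "y t \<in> D" "(y has_vector_derivative W (y t)) (at t)" using inC \<rho> y(2) pr(3) by (blast, metis)
  qed (use \<epsilon> y in auto)
qed

text \<open>Bootstrapping: each order of differentiability of \<open>y\<close> is inherited by
  \<open>W (y t)\<close>, which is the derivative of \<open>y\<close>.\<close>

lemma ode_solution_smooth:
  fixes W :: "'a::euclidean_space \<Rightarrow> 'a"
  assumes "open S" "open D" "smooth_on D W"
    and y: "\<And>t. t \<in> S \<Longrightarrow> y t \<in> D" "\<And>t. t \<in> S \<Longrightarrow> (y has_vector_derivative W (y t)) (at t)"
  shows "smooth_on S y"
  unfolding smooth_on_def
proof
  fix k show "Ck_on k S y"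
  proof (induction k)
    case 0
    have "isCont y t" if "t \<in> S" for t using y(2)[OF that] has_vector_derivative_continuous by blast
    then show ?case by (simp add: continuous_at_imp_continuous_on)
  next
    case (Suc k)
    have d: "(y has_derivative (\<lambda>h. h *\<^sub>R W (y t))) (at t)" if "t \<in> S" for t
      using y(2)[OF that] by (simp add: has_vector_derivative_def)
    have WC: "Ck_on k S (\<lambda>t. W (y t))"
      by (rule Ck_on_compose[OF assms(1,2) _ smooth_on_Ck[OF assms(3)] Suc]) (use y in auto)
    have "Ck_on k S (\<lambda>t. Dv y t v)" for v
    proof (subst Ck_on_cong[OF assms(1), of _ "\<lambda>t. v *\<^sub>R W (y t)"])
      show "Dv y t v = v *\<^sub>R W (y t)" if "t \<in> S" for t
        using frechet_derivative_at[OF d[OF that]] by metis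
      show "Ck_on k S (\<lambda>t. v *\<^sub>R W (y t))"
        by (rule Ck_on_linear_comp[OF assms(1) WC bounded_linear_scaleR_right])
    qed
    then show ?case using d by (auto simp: differentiable_def)
  qed
qed

section \<open>One-parameter subgroups\<close>

abbreviation (input) "\<kappa>R \<equiv> ((UNIV, id) :: (real, real) chart)"

lemma is_chart_R: "is_chart \<kappa>R" "cinv \<kappa>R = id"
  by (simp_all add: is_chart_def homeomorphism_def cinv_def continuous_on_id')

lemma md_curve: "md \<kappa>R \<mu> q t L \<longleftrightarrow> is_chart \<mu> \<and> q t \<in> cdom \<mu> \<and> isCont q t \<and> ((\<lambda>s. cmap \<mu> (q s)) has_derivative L) (at t)"
  by (auto simp: md_def is_chart_R)

text \<open>This serves as a uniqueness principle for curves in a manifold. The charts may vary from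
  time to time; a transition map sends a zero derivative to a zero derivative, so the curve is
  locally constant in one fixed chart.\<close>

lemma (in atlas) md_zero_const:
  fixes q :: "real \<Rightarrow> 'm"
  assumes T: "open T" "connected T" and q: "\<And>t. t \<in> T \<Longrightarrow> \<exists>\<mu>\<in>A. md \<kappa>R \<mu> q t (\<lambda>h. 0)"
    and st: "s \<in> T" "t \<in> T"
  shows "q s = q t"
proof -
  have "q constant_on T"
  proof (rule locally_constant_imp_constant[OF T(2)])
    fix a assume a: "a \<in> T"
    let ?\<kappa> = "chart_at A (q a)"
    have cont: "isCont q a" using q[OF a] by (auto simp: md_curve)
    obtain V where V: "open V" "a \<in> V" "\<And>s. s \<in> V \<Longrightarrow> q s \<in> cdom ?\<kappa>"
      using isCont_nbhd[OF cont chart_open(1)[OF chart_chart_at] chart_at(2)] by blast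
    obtain d where d: "d > 0" "ball a d \<subseteq> V \<inter> T" using V T a by (metis IntI open_Int open_contains_ball)
    have z: "((\<lambda>s. cmap ?\<kappa> (q s)) has_derivative (\<lambda>h. 0)) (at s within ball a d)" if "s \<in> ball a d" for s
    proof -
      have s: "s \<in> V" "s \<in> T" using that d by auto
      obtain \<mu> where \<mu>: "\<mu> \<in> A" "md \<kappa>R \<mu> q s (\<lambda>h. 0)" using q[OF s(2)] by blast
      have qs: "q s \<in> cdom \<mu>" using \<mu>(2) by (auto simp: md_curve)
      obtain L where L: "md \<mu> ?\<kappa> (\<lambda>q. q) (q s) L"
        using md_transition[OF \<mu>(1) chart_at(1) qs V(3)[OF s(1)]] by blast
      have "md \<kappa>R ?\<kappa> q s (\<lambda>h. L 0)" using md_chain[OF \<mu>(2) L] .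
      then show ?thesis
        using linear_0[OF md_linear[OF L]] by (auto simp: md_curve intro: has_derivative_at_withinI)
    qed
    have "q s = q a" if s: "s \<in> ball a d" for s
    proof -
      have "cmap ?\<kappa> (q s) = cmap ?\<kappa> (q a)"
        using has_derivative_zero_constant[OF convex_ball z] s d(1) by (metis centre_in_ball)
      moreover have "q s \<in> cdom ?\<kappa>" using s d V by auto
      ultimately show ?thesis using chart_inv(1)[OF chart_chart_at] chart_at(2) by metis
    qed
    moreover have "openin (top_of_set T) (ball a d)" "a \<in> ball a d"
      using d by (auto simp: openin_open_eq[OF T(1)])
    ultimately show "\<exists>W. openin (top_of_set T) W \<and> a \<in> W \<and> (\<forall>s\<in>W. q s = q a)" by blast
  qed
  then show ?thesis using st by (auto simp: constant_on_def)
qed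

section \<open>From an integral curve through the identity to a one-parameter group\<close>

context isometric_action begin

abbreviation "mlt \<equiv> (\<lambda>(a, b). a \<otimes>\<^bsub>G\<^esub> b)"
abbreviation "mh \<equiv> pF \<kappa>G \<kappa>G \<kappa>G mlt"

lemma md_left:
  assumes "\<kappa> \<in> A" "\<mu> \<in> A" "p \<in> cdom \<kappa>" "a \<otimes>\<^bsub>G\<^esub> p \<in> cdom \<mu>"
  shows "\<exists>L. md \<kappa> \<mu> (\<lambda>b. a \<otimes>\<^bsub>G\<^esub> b) p L"
  using mul.md_snd[OF A.chart_at(1) assms(1,2) A.chart_at(2)[of a] assms(3)] assms(4) by auto

lemma md_right:
  assumes "\<kappa> \<in> A" "\<mu> \<in> A" "p \<in> cdom \<kappa>" "p \<otimes>\<^bsub>G\<^esub> a \<in> cdom \<mu>"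
  shows "\<exists>L. md \<kappa> \<mu> (\<lambda>b. b \<otimes>\<^bsub>G\<^esub> a) p L"
  using mul.md_fst[OF assms(1) A.chart_at(1) assms(2) assms(3) A.chart_at(2)[of a]] assms(4) by auto

lemma md_two_sided:
  assumes "\<mu> \<in> A" "u \<otimes>\<^bsub>G\<^esub> w \<in> cdom \<mu>"
  shows "\<exists>L. md \<kappa>G \<mu> (\<lambda>b. u \<otimes>\<^bsub>G\<^esub> b \<otimes>\<^bsub>G\<^esub> w) \<one>\<^bsub>G\<^esub> L"
proof -
  obtain L1 where 1: "md \<kappa>G (chart_at A u) (\<lambda>b. u \<otimes>\<^bsub>G\<^esub> b) \<one>\<^bsub>G\<^esub> L1"
    using md_left[OF kG(1) A.chart_at(1) kG(2), of u u] A.chart_at(2)[of u] carrier by auto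
  obtain L2 where 2: "md (chart_at A u) \<mu> (\<lambda>b. b \<otimes>\<^bsub>G\<^esub> w) u L2"
    using md_right[OF A.chart_at(1) assms(1) A.chart_at(2)] assms(2) by blast
  show ?thesis using md_chain[OF 1, of \<mu> "\<lambda>b. b \<otimes>\<^bsub>G\<^esub> w" L2] 2 carrier by auto
qed

lemma mh_unit: "(e, e) \<in> pdom \<kappa>G \<kappa>G \<kappa>G mlt" "Dv mh (e, e) (0, u) = u" "Dv mh (e, e) (u, 0) = u"
  "linear (Dv mh (e, e))"
proof -
  show ee: "(e, e) \<in> pdom \<kappa>G \<kappa>G \<kappa>G mlt"
    using kG carrier by (simp add: pdom_def)
  have "md \<kappa>G \<kappa>G (\<lambda>b. b) \<one>\<^bsub>G\<^esub> (\<lambda>u. Dv mh (e, e) (0, u))"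
    using mul.md_snd[OF kG(1,1,1,2,2)] kG carrier by simp
  then show "Dv mh (e, e) (0, u) = u" using md_unique[OF _ md_ident[OF kG(3,2)]] by metis
  have "md \<kappa>G \<kappa>G (\<lambda>b. b) \<one>\<^bsub>G\<^esub> (\<lambda>u. Dv mh (e, e) (u, 0))"
    using mul.md_fst[OF kG(1,1,1,2,2)] kG carrier by simp
  then show "Dv mh (e, e) (u, 0) = u" using md_unique[OF _ md_ident[OF kG(3,2)]] by metis
  show "linear (Dv mh (e, e))"
    using mul.pF_derivative[OF kG(1,1,1) ee] has_derivative_linear by blast
qed

text \<open>The derivative of the multiplication at the identity is addition.\<close>

lemma md_mult:
  assumes k: "md \<kappa> \<kappa>G k p k'" and h: "md \<kappa> \<kappa>G h p h'" and "k p = \<one>\<^bsub>G\<^esub>" "h p = \<one>\<^bsub>G\<^esub>"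
  shows "md \<kappa> \<kappa>G (\<lambda>q. k q \<otimes>\<^bsub>G\<^esub> h q) p (\<lambda>r. k' r + h' r)"
proof -
  have p: "p \<in> cdom \<kappa>" "is_chart \<kappa>" using k by (auto simp: md_def)
  have inv: "cinv \<kappa> (cmap \<kappa> p) = p" by (rule chart_inv(1)[OF p(2,1)])
  have dk: "((\<lambda>x. cmap \<kappa>G (k (cinv \<kappa> x))) has_derivative k') (at (cmap \<kappa> p))"
    and dh: "((\<lambda>x. cmap \<kappa>G (h (cinv \<kappa> x))) has_derivative h') (at (cmap \<kappa> p))"
    and ck: "isCont k p" and ch: "isCont h p"
    using k h by (auto simp: md_def)
  have cx: "isCont (\<lambda>x. k (cinv \<kappa> x)) (cmap \<kappa> p)" "isCont (\<lambda>x. h (cinv \<kappa> x)) (cmap \<kappa> p)"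
    using ck ch inv chart_isCont(3)[OF p(2,1)] by (auto intro!: isCont_o2[where f="cinv \<kappa>"])
  obtain V1 where V1: "open V1" "cmap \<kappa> p \<in> V1" "\<And>x. x \<in> V1 \<Longrightarrow> k (cinv \<kappa> x) \<in> cdom \<kappa>G"
    by (rule isCont_nbhd[OF cx(1) chart_open(1)[OF kG(3)]]) (use inv kG assms in auto)
  obtain V2 where V2: "open V2" "cmap \<kappa> p \<in> V2" "\<And>x. x \<in> V2 \<Longrightarrow> h (cinv \<kappa> x) \<in> cdom \<kappa>G"
    by (rule isCont_nbhd[OF cx(2) chart_open(1)[OF kG(3)]]) (use inv kG assms in auto)
  have dm: "(mh has_derivative Dv mh (e, e)) (at (cmap \<kappa>G (k (cinv \<kappa> (cmap \<kappa> p))), cmap \<kappa>G (h (cinv \<kappa> (cmap \<kappa> p)))))"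
    using mul.pF_derivative[OF kG(1,1,1) mh_unit(1)] inv assms(3,4) by (simp add: kG)
  have "((\<lambda>x. mh (cmap \<kappa>G (k (cinv \<kappa> x)), cmap \<kappa>G (h (cinv \<kappa> x)))) has_derivative (\<lambda>r. Dv mh (e, e) (k' r, h' r))) (at (cmap \<kappa> p))"
    using diff_chain_at[OF has_derivative_Pair[OF dk dh] dm] by (simp add: o_def)
  moreover have "Dv mh (e, e) (a, b) = a + b" for a b
    using linear_add[OF mh_unit(4), of "(a, 0)" "(0, b)"] by (simp add: mh_unit)
  ultimately have "((\<lambda>x. mh (cmap \<kappa>G (k (cinv \<kappa> x)), cmap \<kappa>G (h (cinv \<kappa> x)))) has_derivative (\<lambda>r. k' r + h' r)) (at (cmap \<kappa> p))"
    by simp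
  then have "((\<lambda>x. cmap \<kappa>G (k (cinv \<kappa> x) \<otimes>\<^bsub>G\<^esub> h (cinv \<kappa> x))) has_derivative (\<lambda>r. k' r + h' r)) (at (cmap \<kappa> p))"
    by (rule has_derivative_transform_within_open[OF _ open_Int[OF V1(1) V2(1)]])
      (use V1 V2 in \<open>auto simp: pF_def chart_inv[OF kG(3)]\<close>)
  moreover have "isCont (\<lambda>q. k q \<otimes>\<^bsub>G\<^esub> h q) p"
  proof -
    have "isCont mlt z" for z using mul.F_cont unfolding continuous_on_eq_continuous_at[OF open_UNIV] by (rule bspec) simp
    from isCont_o2[OF continuous_Pair[OF ck ch] this] show ?thesis by simp
  qed
  ultimately show ?thesis using p kG assms carrier by (simp add: md_def)
qed

lemma md_const: "is_chart \<kappa> \<Longrightarrow> is_chart \<mu> \<Longrightarrow> p \<in> cdom \<kappa> \<Longrightarrow> a \<in> cdom \<mu> \<Longrightarrow> md \<kappa> \<mu> (\<lambda>q. a) p (\<lambda>r. 0)"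
  by (simp add: md_def)

text \<open>Differentiate the constant product of an element with its inverse.\<close>

lemma md_inverse: "md \<kappa>G \<kappa>G (\<lambda>b. inv\<^bsub>G\<^esub> b) \<one>\<^bsub>G\<^esub> (\<lambda>u. - u)"
proof -
  obtain L where L: "md \<kappa>G \<kappa>G (\<lambda>b. inv\<^bsub>G\<^esub> b) \<one>\<^bsub>G\<^esub> L"
    using md_smooth[OF inv_smooth open_UNIV UNIV_I kG(1,1,3,3,2)] kG(2) carrier by auto
  have "md \<kappa>G \<kappa>G (\<lambda>b. \<one>\<^bsub>G\<^esub>) \<one>\<^bsub>G\<^esub> (\<lambda>u. u + L u)"
    using md_mult[OF md_ident[OF kG(3,2)] L] carrier by simp
  from md_unique[OF this md_const[OF kG(3,3,2,2)]] have "L u = - u" for u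
    by (metis add_eq_0_iff)
  then show ?thesis using L by (metis (no_types, lifting) ext)
qed

text \<open>The left logarithmic derivative. The curve is translated back so that it passes through
  the identity at time \<open>t\<close>, and only the chart at the identity is involved.\<close>

definition log_deriv :: "(real \<Rightarrow> 'g) \<Rightarrow> real \<Rightarrow> 'l \<Rightarrow> bool" where
  "log_deriv a t X \<longleftrightarrow> md \<kappa>R \<kappa>G (\<lambda>s. inv\<^bsub>G\<^esub> (a t) \<otimes>\<^bsub>G\<^esub> a s) t (\<lambda>r. r *\<^sub>R X)"

text \<open>In the chart at the identity, \<open>W\<close> is the left invariant vector field with
  value \<open>X\<close>.\<close>

lemma integral_curve:
  obtains \<epsilon> y where "\<epsilon> > 0" "y 0 = e" "smooth_on {-\<epsilon><..<\<epsilon>} y"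
    "\<And>t. t \<in> {-\<epsilon><..<\<epsilon>} \<Longrightarrow> y t \<in> dm \<kappa>G"
    "\<And>t. t \<in> {-\<epsilon><..<\<epsilon>} \<Longrightarrow> log_deriv (\<lambda>t. cinv \<kappa>G (y t)) t X"
    "(y has_vector_derivative X) (at 0)"
proof -
  let ?P = "pdom \<kappa>G \<kappa>G \<kappa>G mlt"
  define D where "D = (\<lambda>x. (x, e)) -` ?P"
  define W where "W x = Dv mh (x, e) (0, X)" for x
  have P: "open ?P" "smooth_on ?P mh" using mul.pdom_smooth[OF kG(1,1,1)] .
  have D: "open D" "e \<in> D" unfolding D_def using P mh_unit(1) by (auto intro!: open_vimage continuous_intros)
  have W: "smooth_on D W" unfolding W_def
  proof (rule smooth_on_compose[OF D(1) P(1) _ smooth_on_Dv[OF P(2)]])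
    show "smooth_on D (\<lambda>x. (x, e))"
      by (rule smooth_on_Pair[OF D(1) smooth_on_bounded_linear[OF bounded_linear_ident] smooth_on_const])
  qed (auto simp: D_def)
  obtain \<epsilon> y where y: "\<epsilon> > 0" "y 0 = e" "\<And>t. t \<in> {-\<epsilon><..<\<epsilon>} \<Longrightarrow> y t \<in> D"
      "\<And>t. t \<in> {-\<epsilon><..<\<epsilon>} \<Longrightarrow> (y has_vector_derivative W (y t)) (at t)"
    using picard_local[OF D smooth_on_Ck[OF W]] by blast
  have ydm: "y t \<in> dm \<kappa>G" if "t \<in> {-\<epsilon><..<\<epsilon>}" for t
    using y(3)[OF that] by (auto simp: D_def pdom_def)
  have ld: "log_deriv (\<lambda>t. cinv \<kappa>G (y t)) t X" if t: "t \<in> {-\<epsilon><..<\<epsilon>}" for t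
  proof -
    let ?a = "cinv \<kappa>G (y t)"
    have a: "?a \<in> cdom \<kappa>G" "cmap \<kappa>G ?a = y t" using chart_inv[OF kG(3)] ydm[OF t] by auto
    have yc: "isCont y t" using y(4)[OF t] has_vector_derivative_continuous by blast
    have 1: "md \<kappa>R \<kappa>G (\<lambda>t. cinv \<kappa>G (y t)) t (\<lambda>r. r *\<^sub>R W (y t))"
      unfolding md_curve
    proof (intro conjI)
      show "isCont (\<lambda>t. cinv \<kappa>G (y t)) t" using yc chart_isCont(2)[OF kG(3) ydm[OF t]] isCont_o2 by blast
      have "(y has_derivative (\<lambda>r. r *\<^sub>R W (y t))) (at t)" using y(4)[OF t] by (simp add: has_vector_derivative_def)
      then show "((\<lambda>s. cmap \<kappa>G (cinv \<kappa>G (y s))) has_derivative (\<lambda>r. r *\<^sub>R W (y t))) (at t)"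
        by (rule has_derivative_transform_within_open[OF _ open_greaterThanLessThan t])
          (use ydm chart_inv(2)[OF kG(3)] in auto)
    qed (use a kG in auto)
    have 2: "md \<kappa>G \<kappa>G (\<lambda>b. ?a \<otimes>\<^bsub>G\<^esub> b) \<one>\<^bsub>G\<^esub> (\<lambda>u. Dv mh (y t, e) (0, u))"
      using mul.md_snd[OF kG(1,1,1) a(1) kG(2)] a kG(5) carrier by simp
    obtain M where M: "md \<kappa>G \<kappa>G (\<lambda>b. inv\<^bsub>G\<^esub> ?a \<otimes>\<^bsub>G\<^esub> b) ?a M"
      using md_left[OF kG(1,1) a(1), of "inv\<^bsub>G\<^esub> ?a"] kG(2) carrier by auto
    \<comment> \<open>Translation by the inverse undoes translation by \<open>?a\<close>, so its
      derivative \<open>M\<close> carries \<open>W (y t)\<close> back to \<open>X\<close>.\<close>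
    have "md \<kappa>G \<kappa>G (\<lambda>b. b) \<one>\<^bsub>G\<^esub> (\<lambda>u. M (Dv mh (y t, e) (0, u)))"
      using md_chain[OF 2, of \<kappa>G "\<lambda>b. inv\<^bsub>G\<^esub> ?a \<otimes>\<^bsub>G\<^esub> b" M] M carrier by (simp add: G.m_assoc[symmetric])
    from md_unique[OF this md_ident[OF kG(3,2)]] have "M (W (y t)) = X"
      unfolding W_def by (rule fun_cong)
    then show ?thesis
      unfolding log_deriv_def using md_chain[OF 1 M] linear_cmul[OF md_linear[OF M]] by simp
  qed
  have "W e = X" by (simp add: W_def mh_unit)
  then have "(y has_vector_derivative X) (at 0)" using y(4)[of 0] y(1,2) by simp
  then show ?thesis
    using that[OF y(1,2) ode_solution_smooth[OF open_greaterThanLessThan D(1) W y(3,4)] ydm ld] by blast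
qed

lemma md_shift: "md \<kappa>R \<kappa>R (\<lambda>\<tau>. s + \<tau>) t (\<lambda>r. r)"
  by (auto simp: md_curve is_chart_R intro!: derivative_eq_intros continuous_intros)

text \<open>The product of \<open>a (s + t)\<close> with the inverse of \<open>a t\<close> does not
  change with \<open>t\<close>: both factors have the same logarithmic derivative, and the
  contributions cancel at the identity. At \<open>t = 0\<close> the product is
  \<open>a s\<close>.\<close>

lemma local_homomorphism:
  assumes ld: "\<And>t. t \<in> {-\<epsilon><..<\<epsilon>} \<Longrightarrow> log_deriv a t X" and a0: "a 0 = \<one>\<^bsub>G\<^esub>" and "\<epsilon> > 0"
    and st: "\<bar>s\<bar> < \<epsilon>" "\<bar>t\<bar> < \<epsilon>" "\<bar>s + t\<bar> < \<epsilon>"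
  shows "a (s + t) = a s \<otimes>\<^bsub>G\<^esub> a t"
proof -
  \<comment> \<open>The interval of all times \<open>t\<close> for which both \<open>t\<close> and
    \<open>s + t\<close> remain admissible.\<close>
  define T where "T = {max (-\<epsilon>) (-\<epsilon> - s)<..<min \<epsilon> (\<epsilon> - s)}"
  have T: "open T" "connected T" "0 \<in> T" "t \<in> T" using st by (auto simp: T_def)
  have "a (s + t) \<otimes>\<^bsub>G\<^esub> inv\<^bsub>G\<^esub> (a t) = a (s + 0) \<otimes>\<^bsub>G\<^esub> inv\<^bsub>G\<^esub> (a 0)"
  proof (rule A.md_zero_const[OF T(1,2) _ T(4,3), where q="\<lambda>t. a (s + t) \<otimes>\<^bsub>G\<^esub> inv\<^bsub>G\<^esub> (a t)"])
    fix t assume "t \<in> T"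
    then have t: "t \<in> {-\<epsilon><..<\<epsilon>}" "s + t \<in> {-\<epsilon><..<\<epsilon>}" by (auto simp: T_def)
    let ?u = "a (s + t)" and ?w = "inv\<^bsub>G\<^esub> (a t)"
    let ?k = "\<lambda>\<tau>. inv\<^bsub>G\<^esub> ?u \<otimes>\<^bsub>G\<^esub> a (s + \<tau>)" and ?h = "\<lambda>\<tau>. ?w \<otimes>\<^bsub>G\<^esub> a \<tau>"
    have k: "md \<kappa>R \<kappa>G ?k t (\<lambda>r. r *\<^sub>R X)"
      using md_chain[OF md_shift[of s t] ld[OF t(2), unfolded log_deriv_def]] .
    have h: "md \<kappa>R \<kappa>G ?h t (\<lambda>r. r *\<^sub>R X)" using ld[OF t(1)] by (simp add: log_deriv_def)
    have hi: "md \<kappa>R \<kappa>G (\<lambda>\<tau>. inv\<^bsub>G\<^esub> (?h \<tau>)) t (\<lambda>r. - (r *\<^sub>R X))"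
      using md_chain[OF h, of \<kappa>G "\<lambda>b. inv\<^bsub>G\<^esub> b"] md_inverse carrier by simp
    have z: "md \<kappa>R \<kappa>G (\<lambda>\<tau>. ?k \<tau> \<otimes>\<^bsub>G\<^esub> inv\<^bsub>G\<^esub> (?h \<tau>)) t (\<lambda>r. 0)"
      using md_mult[OF k hi] carrier by simp
    obtain L where L: "md \<kappa>G (chart_at A (?u \<otimes>\<^bsub>G\<^esub> ?w)) (\<lambda>b. ?u \<otimes>\<^bsub>G\<^esub> b \<otimes>\<^bsub>G\<^esub> ?w) \<one>\<^bsub>G\<^esub> L"
      using md_two_sided[OF A.chart_at] by blast
    have "md \<kappa>R (chart_at A (?u \<otimes>\<^bsub>G\<^esub> ?w)) (\<lambda>\<tau>. ?u \<otimes>\<^bsub>G\<^esub> (?k \<tau> \<otimes>\<^bsub>G\<^esub> inv\<^bsub>G\<^esub> (?h \<tau>)) \<otimes>\<^bsub>G\<^esub> ?w) t (\<lambda>r. L 0)"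
      using md_chain[OF z, of _ "\<lambda>b. ?u \<otimes>\<^bsub>G\<^esub> b \<otimes>\<^bsub>G\<^esub> ?w" L] L carrier by simp
    moreover have "?u \<otimes>\<^bsub>G\<^esub> (?k \<tau> \<otimes>\<^bsub>G\<^esub> inv\<^bsub>G\<^esub> (?h \<tau>)) \<otimes>\<^bsub>G\<^esub> ?w = a (s + \<tau>) \<otimes>\<^bsub>G\<^esub> inv\<^bsub>G\<^esub> (a \<tau>)" for \<tau>
    proof -
      have "inv\<^bsub>G\<^esub> (?h \<tau>) = inv\<^bsub>G\<^esub> (a \<tau>) \<otimes>\<^bsub>G\<^esub> a t"
        by (simp add: G.inv_mult_group carrier)
      then have "?u \<otimes>\<^bsub>G\<^esub> (?k \<tau> \<otimes>\<^bsub>G\<^esub> inv\<^bsub>G\<^esub> (?h \<tau>)) \<otimes>\<^bsub>G\<^esub> ?w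
        = (?u \<otimes>\<^bsub>G\<^esub> inv\<^bsub>G\<^esub> ?u) \<otimes>\<^bsub>G\<^esub> (a (s + \<tau>) \<otimes>\<^bsub>G\<^esub> inv\<^bsub>G\<^esub> (a \<tau>)) \<otimes>\<^bsub>G\<^esub> (a t \<otimes>\<^bsub>G\<^esub> ?w)"
        by (simp only: G.m_assoc carrier G.m_closed)
      then show ?thesis by (simp add: carrier)
    qed
    ultimately show "\<exists>\<mu>\<in>A. md \<kappa>R \<mu> (\<lambda>t. a (s + t) \<otimes>\<^bsub>G\<^esub> inv\<^bsub>G\<^esub> (a t)) t (\<lambda>h. 0)"
      using linear_0[OF md_linear[OF L]] A.chart_at(1) by auto
  qed
  then have "a (s + t) \<otimes>\<^bsub>G\<^esub> inv\<^bsub>G\<^esub> (a t) \<otimes>\<^bsub>G\<^esub> a t = a s \<otimes>\<^bsub>G\<^esub> a t" by (simp add: a0 carrier)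
  then show ?thesis by (simp add: G.m_assoc carrier)
qed

text \<open>The velocity of \<open>\<phi> (a t) p\<close> is the image under the derivative of
  \<open>\<phi> (a t)\<close> of the action field of \<open>X\<close> at \<open>p\<close>, which
  vanishes.\<close>

lemma local_stabilizer:
  assumes ld: "\<And>t. t \<in> {-\<epsilon><..<\<epsilon>} \<Longrightarrow> log_deriv a t X" and a0: "a 0 = \<one>\<^bsub>G\<^esub>"
    and X: "action_field A G B \<phi> p X = 0" and t: "\<bar>t\<bar> < \<epsilon>"
  shows "\<phi> (a t) p = p"
proof -
  have "\<phi> (a t) p = \<phi> (a 0) p"
  proof (rule B.md_zero_const[of "{-\<epsilon><..<\<epsilon>}" "\<lambda>t. \<phi> (a t) p"])
    fix t assume t: "t \<in> {-\<epsilon><..<\<epsilon>}"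
    let ?k = "\<lambda>\<tau>. inv\<^bsub>G\<^esub> (a t) \<otimes>\<^bsub>G\<^esub> a \<tau>"
    have k: "md \<kappa>R \<kappa>G ?k t (\<lambda>r. r *\<^sub>R X)" using ld[OF t] by (simp add: log_deriv_def)
    have "md \<kappa>R (chart_at B p) (\<lambda>\<tau>. \<phi> (?k \<tau>) p) t (\<lambda>r. action_field A G B \<phi> p (r *\<^sub>R X))"
      using md_chain[OF k, of _ "\<lambda>b. \<phi> b p"] md_action_field[of p] carrier by simp
    then have z: "md \<kappa>R (chart_at B p) (\<lambda>\<tau>. \<phi> (?k \<tau>) p) t (\<lambda>r. 0)"
      by (simp add: X linear_cmul[OF action_field_linear])
    obtain L where L: "md (chart_at B p) (chart_at B (\<phi> (a t) p)) (\<phi> (a t)) p L"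
      using md_act[OF B.chart_at(1) B.chart_at(1) B.chart_at(2) B.chart_at(2)] by blast
    have "md \<kappa>R (chart_at B (\<phi> (a t) p)) (\<lambda>\<tau>. \<phi> (a t) (\<phi> (?k \<tau>) p)) t (\<lambda>r. L 0)"
      using md_chain[OF z, of _ "\<phi> (a t)" L] L carrier by (simp add: act_one)
    moreover have "\<phi> (a t) (\<phi> (?k \<tau>) p) = \<phi> (a \<tau>) p" for \<tau>
      by (simp add: act_mult[symmetric] G.m_assoc[symmetric] carrier)
    ultimately show "\<exists>\<mu>\<in>B. md \<kappa>R \<mu> (\<lambda>t. \<phi> (a t) p) t (\<lambda>h. 0)"
      using linear_0[OF md_linear[OF L]] B.chart_at(1) by auto
  qed (use t in auto)
  then show ?thesis by (simp add: a0 act_one)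
qed

text \<open>The local homomorphism is extended by taking the \<open>n\<close>-th power of its value
  at \<open>t / n\<close>. Translation by \<open>\<gamma> t1\<close> carries smoothness from time 0
  to time \<open>t1\<close>, and a point fixed by the local curve is fixed by all its
  powers.\<close>

lemma one_parameter_subgroup:
  "\<exists>\<gamma>. smooth_map real_atlas A \<gamma> \<and> (\<forall>s t. \<gamma> (s + t) = \<gamma> s \<otimes>\<^bsub>G\<^esub> \<gamma> t) \<and> velocity A \<gamma> 0 = X \<and>
     (\<forall>p t. action_field A G B \<phi> p X = 0 \<longrightarrow> \<phi> (\<gamma> t) p = p)"
proof -
  obtain \<epsilon> y where \<epsilon>: "\<epsilon> > 0" and y0: "y 0 = e" and ys: "smooth_on {-\<epsilon><..<\<epsilon>} y"
    and ydm: "\<And>t. t \<in> {-\<epsilon><..<\<epsilon>} \<Longrightarrow> y t \<in> dm \<kappa>G"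
    and ld: "\<And>t. t \<in> {-\<epsilon><..<\<epsilon>} \<Longrightarrow> log_deriv (\<lambda>t. cinv \<kappa>G (y t)) t X"
    and y': "(y has_vector_derivative X) (at 0)"
    using integral_curve by blast
  define a where "a t = cinv \<kappa>G (y t)" for t
  have a0: "a 0 = \<one>\<^bsub>G\<^esub>" by (simp add: a_def y0 kG)
  have lda: "log_deriv a t X" if "t \<in> {-\<epsilon><..<\<epsilon>}" for t using ld[OF that] by (simp add: a_def[abs_def])
  have hom: "a (s + t) = a s \<otimes>\<^bsub>G\<^esub> a t" if "\<bar>s\<bar> < \<epsilon>" "\<bar>t\<bar> < \<epsilon>" "\<bar>s + t\<bar> < \<epsilon>" for s t
    using local_homomorphism[OF lda a0 \<epsilon> that] .
  have pw: "a (real j * s) = a s [^]\<^bsub>G\<^esub> j" if "\<bar>real j * s\<bar> < \<epsilon>" for j s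
    using that
  proof (induction j)
    case (Suc j)
    have "\<bar>real j * s\<bar> \<le> \<bar>real (Suc j) * s\<bar>" "\<bar>s\<bar> \<le> \<bar>real (Suc j) * s\<bar>"
      by (auto simp: abs_mult intro!: mult_right_mono mult_right_le_one_le mult_left_le_one_le)
        (metis abs_ge_zero le_add_same_cancel1 mult.commute mult_left_mono mult.right_neutral of_nat_0_le_iff)
    then have "\<bar>real j * s\<bar> < \<epsilon>" "\<bar>s\<bar> < \<epsilon>" using Suc.prems by linarith+
    moreover have "real (Suc j) * s = real j * s + s" by (simp add: algebra_simps)
    ultimately show ?case using hom[of "real j * s" s] Suc by simp
  qed (simp add: a0)
  \<comment> \<open>The summand 1 makes the number of parts positive and the bound by
    \<open>\<epsilon>\<close> strict.\<close>
  define \<gamma> where "\<gamma> t = a (t / real (nat \<lceil>\<bar>t\<bar> / \<epsilon>\<rceil> + 1)) [^]\<^bsub>G\<^esub> (nat \<lceil>\<bar>t\<bar> / \<epsilon>\<rceil> + 1)" for t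
  \<comment> \<open>Two subdivisions of \<open>t\<close> are compared through their common
    refinement into \<open>n * m\<close> parts.\<close>
  have indep: "a (t / real n) [^]\<^bsub>G\<^esub> n = a (t / real m) [^]\<^bsub>G\<^esub> m"
    if "n \<ge> 1" "m \<ge> 1" "\<bar>t / real n\<bar> < \<epsilon>" "\<bar>t / real m\<bar> < \<epsilon>" for n m t
  proof -
    have "a (t / real n) = a (t / real (n * m)) [^]\<^bsub>G\<^esub> m" "a (t / real m) = a (t / real (n * m)) [^]\<^bsub>G\<^esub> n"
      using pw[of m "t / real (n * m)"] pw[of n "t / real (n * m)"] that by simp_all
    then show ?thesis by (simp add: G.nat_pow_pow carrier mult.commute)
  qed
  have \<gamma>: "\<gamma> t = a (t / real n) [^]\<^bsub>G\<^esub> n" if "n \<ge> 1" "\<bar>t / real n\<bar> < \<epsilon>" for n t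
    unfolding \<gamma>_def
  proof (rule indep)
    define N where "N = real (nat \<lceil>\<bar>t\<bar> / \<epsilon>\<rceil> + 1)"
    have "\<bar>t\<bar> / \<epsilon> < N" "N > 0" unfolding N_def by linarith+
    then have "\<bar>t / N\<bar> < \<epsilon>" using \<epsilon> by (simp add: field_simps)
    then show "\<bar>t / real (nat \<lceil>\<bar>t\<bar> / \<epsilon>\<rceil> + 1)\<bar> < \<epsilon>" by (simp add: N_def)
  qed (use that in auto)
  have big: "\<exists>n\<ge>1. \<bar>t\<bar> / real n < \<epsilon>" for t
  proof -
    obtain n where "\<bar>t\<bar> / \<epsilon> < real n" using reals_Archimedean2 by blast
    moreover have "0 \<le> \<bar>t\<bar> / \<epsilon>" using \<epsilon> by simp
    ultimately have n: "0 < real n" by linarith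
    then have "\<bar>t\<bar> / real n < \<epsilon>" using \<open>\<bar>t\<bar> / \<epsilon> < real n\<close> \<epsilon> by (simp add: pos_divide_less_eq mult.commute)
    moreover have "n \<ge> 1" using n by simp
    ultimately have "n \<ge> 1" "\<bar>t\<bar> / real n < \<epsilon>" by auto
    then show ?thesis by blast
  qed
  have \<gamma>hom: "\<gamma> (s + t) = \<gamma> s \<otimes>\<^bsub>G\<^esub> \<gamma> t" for s t
  proof -
    obtain n where n: "n \<ge> 1" "\<bar>\<bar>s\<bar> + \<bar>t\<bar>\<bar> / real n < \<epsilon>" using big by blast
    have m: "\<bar>x / real n\<bar> < \<epsilon>" if "\<bar>x\<bar> \<le> \<bar>s\<bar> + \<bar>t\<bar>" for x
      using n that divide_right_mono[of "\<bar>x\<bar>" "\<bar>s\<bar> + \<bar>t\<bar>" "real n"] by simp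
    have l: "\<bar>s / real n\<bar> < \<epsilon>" "\<bar>t / real n\<bar> < \<epsilon>" "\<bar>(s + t) / real n\<bar> < \<epsilon>" by (rule m; linarith)+
    have h1: "a ((s + t) / real n) = a (s / real n) \<otimes>\<^bsub>G\<^esub> a (t / real n)"
      using hom[of "s / real n" "t / real n"] l by (simp add: add_divide_distrib)
    have h2: "a ((s + t) / real n) = a (t / real n) \<otimes>\<^bsub>G\<^esub> a (s / real n)"
      using hom[of "t / real n" "s / real n"] l by (simp add: add_divide_distrib add.commute)
    have "(a (s / real n) \<otimes>\<^bsub>G\<^esub> a (t / real n)) [^]\<^bsub>G\<^esub> n = a (s / real n) [^]\<^bsub>G\<^esub> n \<otimes>\<^bsub>G\<^esub> a (t / real n) [^]\<^bsub>G\<^esub> n"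
      by (rule G.pow_mult_distrib) (use h1 h2 carrier in auto)
    then show ?thesis using \<gamma>[OF n(1)] l h1 by simp
  qed
  have \<gamma>a: "\<gamma> t = a t" if "\<bar>t\<bar> < \<epsilon>" for t using \<gamma>[of 1 t] that by (simp add: carrier)
  have \<gamma>loc: "\<gamma> t = \<gamma> t1 \<otimes>\<^bsub>G\<^esub> cinv \<kappa>G (y (t - t1))" if "\<bar>t - t1\<bar> < \<epsilon>" for t t1
    using \<gamma>hom[of t1 "t - t1"] \<gamma>a[OF that] by (simp add: a_def)
  have yct: "isCont y t" if "\<bar>t\<bar> < \<epsilon>" for t
    using Ck_on_continuous[OF smooth_on_Ck[OF ys, of 0]] that
    by (subst (asm) continuous_on_eq_continuous_at) (auto simp: abs_less_iff)
  have cont: "isCont \<gamma> t1" for t1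
  proof -
    have "isCont (\<lambda>t. y (t - t1)) t1"
      using yct[of 0] \<epsilon> by (intro isCont_o2[where f="\<lambda>t. t - t1" and g=y] continuous_intros) auto
    then have "isCont (\<lambda>t. cinv \<kappa>G (y (t - t1))) t1"
      using chart_isCont(2)[OF kG(3) ydm[of 0]] \<epsilon> by (intro isCont_o2[where f="\<lambda>t. y (t - t1)" and g="cinv \<kappa>G"]) auto
    then have "isCont (\<lambda>t. mlt (\<gamma> t1, cinv \<kappa>G (y (t - t1)))) t1"
      using mul.F_cont[unfolded continuous_on_eq_continuous_at[OF open_UNIV], THEN bspec]
      by (intro isCont_o2[where f="\<lambda>t. (\<gamma> t1, cinv \<kappa>G (y (t - t1)))" and g=mlt] continuous_Pair continuous_const) simp_all
    then show ?thesis
    proof (rule iffD1[OF isCont_cong, rotated])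
      show "\<forall>\<^sub>F t in nhds t1. mlt (\<gamma> t1, cinv \<kappa>G (y (t - t1))) = \<gamma> t"
        unfolding eventually_nhds_metric
        by (intro exI[of _ \<epsilon>]) (use \<epsilon> \<gamma>loc in \<open>auto simp: dist_real_def\<close>)
    qed
  qed
  have sm: "smooth_map real_atlas A \<gamma>"
    unfolding smooth_map_on_def
  proof (intro conjI ballI)
    show "continuous_on UNIV \<gamma>" using cont by (simp add: continuous_at_imp_continuous_on)
    fix \<kappa> :: "(real, real) chart" and \<mu> assume \<kappa>: "\<kappa> \<in> real_atlas" and \<mu>: "\<mu> \<in> A"
    have ch: "is_chart \<mu>" using \<mu> A.chart by blast
    have "\<kappa> = \<kappa>R" using \<kappa> by (simp add: real_atlas_def)
    moreover have "smooth_on {t. \<gamma> t \<in> cdom \<mu>} (\<lambda>t. cmap \<mu> (\<gamma> t))"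
      unfolding smooth_on_def
    proof (intro allI Ck_on_local)
      fix k t1 assume "t1 \<in> {t. \<gamma> t \<in> cdom \<mu>}"
      then have t1: "\<gamma> t1 \<in> cdom \<mu>" by simp
      let ?k1 = "chart_at A (\<gamma> t1)"
      let ?b = "cmap ?k1 (\<gamma> t1)"
      let ?P = "pdom ?k1 \<kappa>G \<mu> mlt" and ?F = "pF ?k1 \<kappa>G \<mu> mlt"
      have P: "open ?P" "smooth_on ?P ?F" using mul.pdom_smooth[OF A.chart_at(1) kG(1) \<mu>] .
      define S where "S = {t1 - \<epsilon><..<t1 + \<epsilon>}"
      have Sy: "smooth_on S (\<lambda>t. (?b, y (t - t1)))"
      proof (intro smooth_on_Pair smooth_on_const smooth_on_compose[OF _ open_greaterThanLessThan _ ys])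
        show "smooth_on S (\<lambda>t. t - t1)"
          unfolding smooth_on_def using Ck_on_add[OF _ Ck_on_ident Ck_on_const, of S _ "- t1"] by (simp add: S_def)
      qed (auto simp: S_def)
      have oT: "open ((\<lambda>t. (?b, y (t - t1))) -` ?P \<inter> S)"
        using Ck_on_continuous[OF smooth_on_Ck[OF Sy, of 0]] P(1)
        by (intro continuous_on_open_vimage[THEN iffD1, rule_format]) (auto simp: S_def)
      define T where "T = (\<lambda>t. (?b, y (t - t1))) -` ?P \<inter> S"
      have "Ck_on k T (\<lambda>t. ?F (?b, y (t - t1)))"
        by (rule Ck_on_compose[OF _ P(1) _ smooth_on_Ck[OF P(2)] Ck_on_subset[OF smooth_on_Ck[OF Sy]]])
          (use oT in \<open>auto simp: T_def\<close>)
      moreover have "?F (?b, y (t - t1)) = cmap \<mu> (\<gamma> t)" if "t \<in> T" for t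
      proof -
        have "\<bar>t - t1\<bar> < \<epsilon>" using that by (auto simp: T_def S_def)
        then show ?thesis
          using \<gamma>loc[of t t1] by (simp add: pF_def chart_inv(1)[OF A.chart_chart_at A.chart_at(2)])
      qed
      moreover have "t1 \<in> T"
        using \<epsilon> t1 kG carrier A.chart_at(2)[of "\<gamma> t1"]
        by (auto simp: T_def S_def pdom_def y0 chart_inv(1)[OF A.chart_chart_at A.chart_at(2)])
      ultimately show "\<exists>T. open T \<and> t1 \<in> T \<and> Ck_on k T (\<lambda>t. cmap \<mu> (\<gamma> t))"
        using oT Ck_on_cong[of T "\<lambda>t. ?F (?b, y (t - t1))" "\<lambda>t. cmap \<mu> (\<gamma> t)" k] unfolding T_def[symmetric] by blast
    qed
    ultimately show "smooth_on (cmap \<kappa> ` (UNIV \<inter> cdom \<kappa> \<inter> \<gamma> -` cdom \<mu>)) (cmap \<mu> \<circ> \<gamma> \<circ> cinv \<kappa>)"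
      by (simp add: is_chart_R vimage_def o_def)
  qed
  have "((\<lambda>t. cmap \<kappa>G (\<gamma> t)) has_vector_derivative X) (at 0)"
    by (rule has_vector_derivative_transform_within_open[OF y' open_greaterThanLessThan[of "-\<epsilon>" \<epsilon>]])
      (use \<epsilon> ydm \<gamma>a in \<open>auto simp: a_def chart_inv[OF kG(3)]\<close>)
  then have vel: "velocity A \<gamma> 0 = X"
    using \<gamma>a[of 0] \<epsilon> by (simp add: velocity_def a0 kG(4) o_def vector_derivative_at)
  have stab: "\<phi> (\<gamma> t) p = p" if X: "action_field A G B \<phi> p X = 0" for p t
  proof -
    obtain n where n: "n \<ge> 1" "\<bar>t\<bar> / real n < \<epsilon>" using big by blast
    let ?s = "t / real n"
    have fx: "\<phi> (a ?s) p = p" using local_stabilizer[OF lda a0 X] n by simp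
    have "\<phi> (a ?s [^]\<^bsub>G\<^esub> j) p = p" for j :: nat
      by (induction j) (simp_all add: act_one act_mult fx)
    then show ?thesis using \<gamma>[OF n(1), of t] n(2) by simp
  qed
  show ?thesis using sm \<gamma>hom vel stab by blast
qed

text \<open>An element whose action field vanishes at \<open>p\<close> generates a one-parameter
  group that fixes \<open>p\<close>, hence lies in the isotropy group. Conversely, the orbit map is
  constant along a one-parameter group in \<open>K\<close>.\<close>

lemma isotropy_algebra:
  assumes K: "stabilizer G \<phi> p = K"
  shows "lie_algebra_of A G K = {X. action_field A G B \<phi> p X = 0}"
proof (intro equalityI subsetI)
  fix X assume "X \<in> {X. action_field A G B \<phi> p X = 0}"
  then obtain \<gamma> where \<gamma>: "smooth_map real_atlas A \<gamma>" "\<forall>s t. \<gamma> (s + t) = \<gamma> s \<otimes>\<^bsub>G\<^esub> \<gamma> t" "velocity A \<gamma> 0 = X"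
      "\<forall>t. \<phi> (\<gamma> t) p = p"
    using one_parameter_subgroup[of X] by auto
  have "range \<gamma> \<subseteq> K" using \<gamma>(4) carrier K by (auto simp: stabilizer_def)
  then show "X \<in> lie_algebra_of A G K" using \<gamma> unfolding lie_algebra_of_def by blast
next
  fix X assume "X \<in> lie_algebra_of A G K"
  then obtain \<gamma> where \<gamma>: "smooth_map real_atlas A \<gamma>" "\<And>s t. \<gamma> (s + t) = \<gamma> s \<otimes>\<^bsub>G\<^esub> \<gamma> t" "X = velocity A \<gamma> 0"
      "range \<gamma> \<subseteq> K" unfolding lie_algebra_of_def by blast
  have g0: "\<gamma> 0 = \<one>\<^bsub>G\<^esub>" using \<gamma>(2)[of 0 0] G.l_cancel_one'[of "\<gamma> 0" "\<gamma> 0"] carrier by simp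
  have fx: "\<phi> (\<gamma> t) p = p" for t using \<gamma>(4) K by (auto simp: stabilizer_def)
  obtain L where L: "md \<kappa>R \<kappa>G \<gamma> 0 L"
    using md_smooth[OF \<gamma>(1) open_UNIV UNIV_I _ kG(1) is_chart_R(1) kG(3), of 0] g0 kG(2)
    unfolding real_atlas_def by auto
  have "((\<lambda>s. cmap \<kappa>G (\<gamma> s)) has_derivative L) (at 0)" using L by (simp add: md_curve)
  moreover have "L = (\<lambda>r. r *\<^sub>R L 1)"
  proof
    show "L r = r *\<^sub>R L 1" for r using linear_cmul[OF md_linear[OF L], of r 1] by simp
  qed
  ultimately have "((\<lambda>s. cmap \<kappa>G (\<gamma> s)) has_vector_derivative L 1) (at 0)"
    by (simp add: has_vector_derivative_def)
  then have X: "X = L 1" by (simp add: \<gamma>(3) velocity_def g0 kG(4) o_def vector_derivative_at)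
  have "md \<kappa>R (chart_at B p) (\<lambda>t. \<phi> (\<gamma> t) p) 0 (\<lambda>r. action_field A G B \<phi> p (L r))"
    using md_chain[OF L, of _ "\<lambda>b. \<phi> b p"] md_action_field[of p] g0 by simp
  then have "md \<kappa>R (chart_at B p) (\<lambda>t. p) 0 (\<lambda>r. action_field A G B \<phi> p (L r))" by (simp add: fx)
  moreover have "md \<kappa>R (chart_at B p) (\<lambda>t. p) 0 (\<lambda>r. 0)"
    by (rule md_const) (simp_all add: is_chart_R B.chart_chart_at B.chart_at)
  ultimately have "(\<lambda>r. action_field A G B \<phi> p (L r)) = (\<lambda>r. 0)" by (rule md_unique)
  then have "action_field A G B \<phi> p (L 1) = 0" by (rule fun_cong)
  then show "X \<in> {X. action_field A G B \<phi> p X = 0}" by (simp add: X)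
qed

end

section \<open>Functions generated by a polynomial differential system\<close>

text \<open>The algebra of real polynomials in the functions of \<open>U\<close>.\<close>

inductive_set poly_alg :: "(real \<Rightarrow> real) set \<Rightarrow> (real \<Rightarrow> real) set" for U where
  const: "(\<lambda>t. a) \<in> poly_alg U"
| gen: "u \<in> U \<Longrightarrow> u \<in> poly_alg U"
| add: "f \<in> poly_alg U \<Longrightarrow> g \<in> poly_alg U \<Longrightarrow> (\<lambda>t. f t + g t) \<in> poly_alg U"
| mult: "f \<in> poly_alg U \<Longrightarrow> g \<in> poly_alg U \<Longrightarrow> (\<lambda>t. f t * g t) \<in> poly_alg U"

lemma poly_alg_cmult: "f \<in> poly_alg U \<Longrightarrow> (\<lambda>t. a * f t) \<in> poly_alg U"
  by (rule poly_alg.mult[OF poly_alg.const])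

lemma poly_alg_minus: "f \<in> poly_alg U \<Longrightarrow> (\<lambda>t. - f t) \<in> poly_alg U"
  using poly_alg_cmult[of f U "-1"] by simp

lemma poly_alg_diff: "f \<in> poly_alg U \<Longrightarrow> g \<in> poly_alg U \<Longrightarrow> (\<lambda>t. f t - g t) \<in> poly_alg U"
  using poly_alg.add[OF _ poly_alg_minus, of f U g] by simp

lemma poly_alg_divide: "f \<in> poly_alg U \<Longrightarrow> (\<lambda>t. f t / a) \<in> poly_alg U"
  using poly_alg_cmult[of f U "inverse a"] by (simp add: field_simps)

lemma poly_alg_sum: "(\<And>j. j \<in> S \<Longrightarrow> f j \<in> poly_alg U) \<Longrightarrow> (\<lambda>t. \<Sum>j\<in>S. f j t) \<in> poly_alg U"
  by (induction S rule: infinite_finite_induct) (auto intro: poly_alg.intros)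

text \<open>Linear combinations of monomials of degree at most \<open>k\<close> whose coefficients have absolute sum at
  most \<open>w\<close>.\<close>

inductive monomial :: "(real \<Rightarrow> real) set \<Rightarrow> nat \<Rightarrow> (real \<Rightarrow> real) \<Rightarrow> bool" for U where
  one: "monomial U 0 (\<lambda>t. 1)"
| Suc: "u \<in> U \<Longrightarrow> monomial U n f \<Longrightarrow> monomial U (Suc n) (\<lambda>t. u t * f t)"

inductive wt :: "(real \<Rightarrow> real) set \<Rightarrow> nat \<Rightarrow> real \<Rightarrow> (real \<Rightarrow> real) \<Rightarrow> bool" for U k where
  zero: "0 \<le> w \<Longrightarrow> wt U k w (\<lambda>t. 0)"
| step: "monomial U j m \<Longrightarrow> j \<le> k \<Longrightarrow> wt U k w f \<Longrightarrow> wt U k (w + \<bar>a\<bar>) (\<lambda>t. a * m t + f t)"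

lemma wt_nonneg: "wt U k w f \<Longrightarrow> 0 \<le> w"
  by (induction rule: wt.induct) auto

lemma wt_weaken: "wt U k w f \<Longrightarrow> k \<le> k' \<Longrightarrow> w \<le> w' \<Longrightarrow> wt U k' w' f"
proof (induction arbitrary: w' rule: wt.induct)
  case (step j m w f a)
  have "wt U k' (w' - \<bar>a\<bar>) f" using step by auto
  from wt.step[OF step.hyps(1) _ this, of a] show ?case using step by auto
qed (auto intro: wt.zero)

lemma wt_add: "wt U k w f \<Longrightarrow> wt U k w' g \<Longrightarrow> wt U k (w + w') (\<lambda>t. f t + g t)"
proof (induction rule: wt.induct)
  case (zero w)
  then show ?case using wt_weaken by auto
next
  case (step j m w f a)
  from wt.step[OF step.hyps(1,2) step.IH[OF step.prems], of a] show ?case by (simp add: algebra_simps)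
qed

lemma wt_scale: "wt U k w f \<Longrightarrow> wt U k (\<bar>b\<bar> * w) (\<lambda>t. b * f t)"
proof (induction rule: wt.induct)
  case (zero w)
  then show ?case by (auto intro: wt.zero)
next
  case (step j m w f a)
  from wt.step[OF step.hyps(1,2) step.IH, of "b * a"] show ?case by (simp add: algebra_simps abs_mult)
qed

lemma mono_wt: "monomial U j m \<Longrightarrow> wt U j 1 m"
  using wt.step[of U j m j 0 "\<lambda>t. 0" 1] wt.zero[of 0] by simp

lemma mono_mult: "monomial U j m \<Longrightarrow> monomial U j' m' \<Longrightarrow> monomial U (j + j') (\<lambda>t. m t * m' t)"
  by (induction rule: monomial.induct) (auto simp: mult.assoc dest: monomial.Suc)

lemma wt_mono_mult: "wt U k w f \<Longrightarrow> monomial U j m \<Longrightarrow> wt U (j + k) w (\<lambda>t. m t * f t)"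
proof (induction rule: wt.induct)
  case (zero w)
  then show ?case by (auto intro: wt.zero)
next
  case (step j' m' w f a)
  from wt.step[OF mono_mult[OF step.prems step.hyps(1)] _ step.IH[OF step.prems], of a] step.hyps(2)
  show ?case by (simp add: algebra_simps)
qed

lemma wt_mult:
  assumes "wt U k w f" and g: "wt U k' w' g"
  shows "wt U (k + k') (w * w') (\<lambda>t. f t * g t)"
  using assms(1)
proof (induction rule: wt.induct)
  case (zero w)
  then show ?case using wt_nonneg[OF g] by (auto intro: wt.zero)
next
  case (step j m w f a)
  have "wt U (k + k') w' (\<lambda>t. m t * g t)"
    using wt_mono_mult[OF g step.hyps(1)] wt_weaken step.hyps(2) by auto
  from wt_add[OF wt_scale[OF this, of a] step.IH] show ?case by (simp add: algebra_simps)
qed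

lemma poly_alg_wt: "f \<in> poly_alg U \<Longrightarrow> \<exists>k w. wt U k w f"
proof (induction rule: poly_alg.induct)
  case (const a)
  show ?case using wt_scale[OF mono_wt[OF monomial.one], of U a] by auto
next
  case (gen u)
  show ?case using mono_wt[OF monomial.Suc[OF gen monomial.one]] by auto
next
  case (add f g)
  then obtain k w k' w' where "wt U k w f" "wt U k' w' g" by blast
  then have "wt U (max k k') (w + w') (\<lambda>t. f t + g t)" by (intro wt_add) (auto intro: wt_weaken)
  then show ?case by blast
next
  case (mult f g)
  then show ?case using wt_mult by blast
qed

lemma wt_poly_alg: "wt U k w f \<Longrightarrow> f \<in> poly_alg U"
proof (induction rule: wt.induct)
  case (step j m w f a)
  have "m \<in> poly_alg U" using step.hyps(1) by (induction rule: monomial.induct) (auto intro: poly_alg.intros)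
  then show ?case using step by (auto intro!: poly_alg.add poly_alg_cmult)
qed (rule poly_alg.const)

section \<open>Growth of iterated derivatives and the identity theorem\<close>

definition derivs :: "real set \<Rightarrow> (nat \<Rightarrow> real \<Rightarrow> real) \<Rightarrow> bool" where
  "derivs I F \<longleftrightarrow> (\<forall>n. \<forall>t\<in>I. (F n has_real_derivative F (Suc n) t) (at t))"

locale poly_system =
  fixes U :: "(real \<Rightarrow> real) set" and I :: "real set"
  assumes finite_U: "finite U" and open_I: "open I" and conn_I: "connected I"
    and closed_U: "\<And>u. u \<in> U \<Longrightarrow> \<exists>u'\<in>poly_alg U. \<forall>t\<in>I. (u has_real_derivative u' t) (at t)"
begin

text \<open>Finiteness of \<open>U\<close> gives common bounds. The degree of the derivative of a
  generator is written \<open>q + 1\<close> so that differentiation raises the degree of a monomial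
  by \<open>q\<close>.\<close>

lemma degree_bound: "\<exists>q L. 0 \<le> L \<and> (\<forall>u\<in>U. \<exists>u'. wt U (q + 1) L u' \<and> (\<forall>t\<in>I. (u has_real_derivative u' t) (at t)))"
proof -
  have "\<exists>u' k w. wt U k w u' \<and> (\<forall>t\<in>I. (u has_real_derivative u' t) (at t))" if "u \<in> U" for u
    using closed_U[OF that] poly_alg_wt by blast
  then obtain d k w where d: "\<And>u. u \<in> U \<Longrightarrow> wt U (k u) (w u) (d u) \<and> (\<forall>t\<in>I. (u has_real_derivative d u t) (at t))"
    by metis
  define q where "q = (\<Sum>u\<in>U. k u)"
  define L where "L = (\<Sum>u\<in>U. w u)"
  have w0: "0 \<le> w u" if "u \<in> U" for u using d[OF that] wt_nonneg by blast
  have "wt U (q + 1) L (d u)" if "u \<in> U" for u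
  proof (rule wt_weaken)
    show "wt U (k u) (w u) (d u)" using d that by blast
    show "k u \<le> q + 1" unfolding q_def using member_le_sum[OF that, of k] finite_U by simp
    show "w u \<le> L" unfolding L_def using member_le_sum[OF that, of w] finite_U w0 by auto
  qed
  moreover have "0 \<le> L" unfolding L_def using w0 by (rule sum_nonneg)
  ultimately show ?thesis using d by blast
qed

definition "qL = (SOME qL. 0 \<le> snd qL \<and> (\<forall>u\<in>U. \<exists>u'. wt U (fst qL + 1) (snd qL) u' \<and> (\<forall>t\<in>I. (u has_real_derivative u' t) (at t))))"
abbreviation "q \<equiv> fst qL"
abbreviation "L \<equiv> snd qL"

lemma qL: "0 \<le> L" "u \<in> U \<Longrightarrow> \<exists>u'. wt U (q + 1) L u' \<and> (\<forall>t\<in>I. (u has_real_derivative u' t) (at t))"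
proof -
  have "\<exists>qL. 0 \<le> snd qL \<and> (\<forall>u\<in>U. \<exists>u'. wt U (fst qL + 1) (snd qL) u' \<and> (\<forall>t\<in>I. (u has_real_derivative u' t) (at t)))"
    using degree_bound by auto
  from someI_ex[OF this] show "0 \<le> L" "u \<in> U \<Longrightarrow> \<exists>u'. wt U (q + 1) L u' \<and> (\<forall>t\<in>I. (u has_real_derivative u' t) (at t))"
    unfolding qL_def[symmetric] by auto
qed

text \<open>In the Leibniz rule each of the \<open>j\<close> factors is replaced in turn by a
  polynomial of degree at most \<open>q + 1\<close> and weight at most \<open>L\<close>.\<close>

lemma mono_deriv: "monomial U j m \<Longrightarrow> \<exists>m'. wt U (j + q) (real j * L) m' \<and> (\<forall>t\<in>I. (m has_real_derivative m' t) (at t))"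
proof (induction rule: monomial.induct)
  case one
  then show ?case by (intro exI[of _ "\<lambda>t. 0"]) (auto intro: wt.zero)
next
  case (Suc u n f)
  obtain u' where u': "wt U (q + 1) L u'" "\<forall>t\<in>I. (u has_real_derivative u' t) (at t)" using qL(2)[OF Suc.hyps(1)] by blast
  obtain f' where f': "wt U (n + q) (real n * L) f'" "\<forall>t\<in>I. (f has_real_derivative f' t) (at t)" using Suc.IH by blast
  have 1: "wt U (Suc n + q) L (\<lambda>t. u' t * f t)"
    using wt_mult[OF u'(1) mono_wt[OF Suc.hyps(2)]] by (simp add: add.commute add.left_commute)
  have 2: "wt U (Suc n + q) (real n * L) (\<lambda>t. u t * f' t)"
    using wt_mult[OF mono_wt[OF monomial.Suc[OF Suc.hyps(1) monomial.one]] f'(1)] by simp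
  show ?case
  proof (intro exI conjI ballI)
    show "wt U (Suc n + q) (real (Suc n) * L) (\<lambda>t. u' t * f t + u t * f' t)"
      using wt_add[OF 1 2] by (simp add: algebra_simps)
    show "((\<lambda>t. u t * f t) has_real_derivative u' t * f t + u t * f' t) (at t)" if "t \<in> I" for t
      using DERIV_mult[of u "u' t" t UNIV f "f' t"] u'(2) f'(2) that by (simp add: algebra_simps)
  qed
qed

lemma wt_deriv: "wt U k w f \<Longrightarrow> \<exists>f'. wt U (k + q) (w * (real k * L)) f' \<and> (\<forall>t\<in>I. (f has_real_derivative f' t) (at t))"
proof (induction rule: wt.induct)
  case (zero w)
  then show ?case using qL(1) by (intro exI[of _ "\<lambda>t. 0"]) (auto intro: wt.zero)
next
  case (step j m w f a)
  obtain m' where m': "wt U (j + q) (real j * L) m'" "\<forall>t\<in>I. (m has_real_derivative m' t) (at t)"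
    using mono_deriv[OF step.hyps(1)] by blast
  obtain f' where f': "wt U (k + q) (w * (real k * L)) f'" "\<forall>t\<in>I. (f has_real_derivative f' t) (at t)"
    using step.IH by blast
  have "wt U (k + q) (real k * L) m'"
    by (rule wt_weaken[OF m'(1)]) (use step.hyps(2) qL(1) in \<open>auto intro: mult_right_mono\<close>)
  from wt_add[OF wt_scale[OF this, of a] f'(1)]
  have "wt U (k + q) ((w + \<bar>a\<bar>) * (real k * L)) (\<lambda>t. a * m' t + f' t)" by (simp add: algebra_simps)
  moreover have "((\<lambda>t. a * m t + f t) has_real_derivative a * m' t + f' t) (at t)" if "t \<in> I" for t
    using m'(2) f'(2) that by (auto intro!: derivative_eq_intros)
  ultimately show ?case by blast
qed

text \<open>Each differentiation multiplies the weight by \<open>L\<close> times the current degree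
  bound, which grows by \<open>q\<close>. A derivative is determined on \<open>I\<close> only, so
  its polynomial representatives are chosen successively.\<close>

lemma derivative_sequence:
  assumes "wt U k w f"
  shows "\<exists>F. F 0 = f \<and> derivs I F \<and> (\<forall>n. wt U (k + n * q) (w * (\<Prod>j<n. real (k + j * q) * L)) (F n))"
proof -
  let ?P = "\<lambda>n g. wt U (k + n * q) (w * (\<Prod>j<n. real (k + j * q) * L)) g \<and> (n = 0 \<longrightarrow> g = f)"
  let ?Q = "\<lambda>n g g'. \<forall>t\<in>I. (g has_real_derivative g' t) (at t)"
  have "\<exists>F. \<forall>n. ?P n (F n) \<and> ?Q n (F n) (F (Suc n))"
  proof (rule dependent_nat_choice)
    show "\<exists>g. ?P 0 g" using assms by auto
    fix g n assume "?P n g"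
    then obtain g' where g': "wt U (k + n * q + q) (w * (\<Prod>j<n. real (k + j * q) * L) * (real (k + n * q) * L)) g'" "?Q n g g'"
      using wt_deriv by blast
    then have "?P (Suc n) g'" by (simp add: algebra_simps)
    then show "\<exists>g'. ?P (Suc n) g' \<and> ?Q n g g'" using g'(2) by blast
  qed
  then obtain F where "\<forall>n. ?P n (F n) \<and> ?Q n (F n) (F (Suc n))" by blast
  then show ?thesis unfolding derivs_def by (intro exI[of _ F]) auto
qed

lemma poly_alg_derivs: "f \<in> poly_alg U \<Longrightarrow> \<exists>F. F 0 = f \<and> derivs I F \<and> (\<forall>n. F n \<in> poly_alg U)"
  using poly_alg_wt[of f U] derivative_sequence wt_poly_alg by metis

text \<open>As \<open>k + n * q\<close> is at most \<open>(k + q) * (1 + n)\<close>, the product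
  grows like a factorial times a geometric sequence, the growth of the derivatives of an analytic
  function.\<close>

lemma prod_bound: "(\<Prod>j<n. real (k + j * q) * L) \<le> (real (k + q) * L) ^ n * fact n"
proof (induction n)
  case (Suc n)
  have "real (k + n * q) \<le> real (k + q) * (1 + real n)"
    using mult_left_mono[of 1 "1 + real n" "real k"] by (simp add: algebra_simps)
  then have "real (k + n * q) * L \<le> (real (k + q) * L) * (1 + real n)"
    using qL(1) mult_right_mono by (metis (no_types, lifting) mult.assoc mult.commute)
  then have "(\<Prod>j<n. real (k + j * q) * L) * (real (k + n * q) * L)
      \<le> ((real (k + q) * L) ^ n * fact n) * ((real (k + q) * L) * (1 + real n))"
    by (rule mult_mono[OF Suc]) (use qL(1) in auto)
  then show ?case by (simp add: algebra_simps)
qed simp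

lemma mono_bound: "monomial U j m \<Longrightarrow> (\<And>u. u \<in> U \<Longrightarrow> \<bar>u t\<bar> \<le> M) \<Longrightarrow> \<bar>m t\<bar> \<le> M ^ j"
  by (induction rule: monomial.induct) (auto simp: abs_mult intro!: mult_mono intro: order_trans[OF abs_ge_zero])

lemma wt_bound: "wt U k w f \<Longrightarrow> (\<And>u. u \<in> U \<Longrightarrow> \<bar>u t\<bar> \<le> M) \<Longrightarrow> 1 \<le> M \<Longrightarrow> \<bar>f t\<bar> \<le> w * M ^ k"
proof (induction rule: wt.induct)
  case (step j m w f a)
  have "\<bar>m t\<bar> \<le> M ^ j" by (rule mono_bound[OF step.hyps(1) step.prems(1)])
  also have "\<dots> \<le> M ^ k" by (rule power_increasing[OF step.hyps(2) step.prems(2)])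
  finally have "\<bar>a * m t\<bar> \<le> \<bar>a\<bar> * M ^ k" by (simp add: abs_mult mult_left_mono)
  moreover have "\<bar>f t\<bar> \<le> w * M ^ k" using step by blast
  ultimately show ?case by (simp add: algebra_simps)
qed auto

text \<open>The bound \<open>C * M ^ n * fact n\<close> for the \<open>n\<close>-th derivative, which comes from counting monomials,
  gives real analyticity.\<close>

lemma local_vanishing:
  assumes f: "f \<in> poly_alg U" and t0: "t0 \<in> I" and F: "F 0 = f" "derivs I F" "\<And>n. F n t0 = 0"
  shows "\<exists>d>0. \<forall>t\<in>ball t0 d. t \<in> I \<and> f t = 0"
proof -
  obtain k w where wt: "wt U k w f" using poly_alg_wt[OF f] by blast
  obtain F' where F': "F' 0 = f" "derivs I F'" "\<And>n. wt U (k + n * q) (w * (\<Prod>j<n. real (k + j * q) * L)) (F' n)"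
    using derivative_sequence[OF wt] by blast
  \<comment> \<open>Two sequences of derivatives of \<open>f\<close> agree on \<open>I\<close>, so
    the bounds obtained for \<open>F'\<close> hold for the given \<open>F\<close>.\<close>
  have FF: "\<forall>t\<in>I. F n t = F' n t" for n
  proof (induction n)
    case (Suc n)
    show ?case
    proof
      fix t assume t: "t \<in> I"
      have "(F n has_real_derivative F' (Suc n) t) (at t)"
        using has_field_derivative_transform_within_open[OF _ open_I t, of "F' n" _ "F n"] F'(2) t Suc
        by (simp add: derivs_def)
      then show "F (Suc n) t = F' (Suc n) t" using F(2) t DERIV_unique unfolding derivs_def by blast
    qed
  qed (simp add: F F')
  obtain r where r: "r > 0" "cball t0 r \<subseteq> I" using open_I t0 open_contains_cball by blast
  have "\<exists>M. \<forall>t\<in>cball t0 r. \<bar>u t\<bar> \<le> M" if u: "u \<in> U" for u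
  proof -
    obtain u' where "\<forall>t\<in>I. (u has_real_derivative u' t) (at t)" using closed_U[OF u] by blast
    then have "continuous_on (cball t0 r) u"
      using r DERIV_isCont by (intro continuous_at_imp_continuous_on) blast
    then show ?thesis
      using compact_imp_bounded[OF compact_continuous_image[OF _ compact_cball]] by (fastforce simp: bounded_iff)
  qed
  then obtain b where b: "\<And>u t. u \<in> U \<Longrightarrow> t \<in> cball t0 r \<Longrightarrow> \<bar>u t\<bar> \<le> b u" by metis
  define M where "M = 1 + (\<Sum>u\<in>U. \<bar>b u\<bar>)"
  have M1: "1 \<le> M" by (simp add: M_def sum_nonneg)
  have M: "\<bar>u t\<bar> \<le> M" if "u \<in> U" "t \<in> cball t0 r" for u t
  proof -
    have "\<bar>b u\<bar> \<le> (\<Sum>u\<in>U. \<bar>b u\<bar>)" using member_le_sum[OF that(1), of "\<lambda>u. \<bar>b u\<bar>"] finite_U by simp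
    then show ?thesis using b[OF that] by (simp add: M_def)
  qed
  define R where "R = real (k + q) * L * M ^ q"
  define C where "C = w * M ^ k"
  have R0: "R \<ge> 0" using qL(1) M1 by (simp add: R_def)
  have C0: "C \<ge> 0" using wt_nonneg[OF wt] M1 by (simp add: C_def)
  have bound: "\<bar>F n t\<bar> \<le> C * (R ^ n * fact n)" if "t \<in> cball t0 r" for n t
  proof -
    have "\<bar>F' n t\<bar> \<le> (w * (\<Prod>j<n. real (k + j * q) * L)) * M ^ (k + n * q)"
      by (rule wt_bound[OF F'(3)]) (use M that M1 in auto)
    also have "\<dots> \<le> (w * ((real (k + q) * L) ^ n * fact n)) * M ^ (k + n * q)"
      using prod_bound wt_nonneg[OF wt] M1 by (intro mult_right_mono mult_left_mono) auto
    also have "M ^ (k + n * q) = M ^ k * (M ^ q) ^ n"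
      by (simp add: power_add power_mult[symmetric] mult.commute)
    also have "(w * ((real (k + q) * L) ^ n * fact n)) * (M ^ k * (M ^ q) ^ n) = C * (R ^ n * fact n)"
      by (simp add: C_def R_def power_mult_distrib)
    finally show ?thesis using FF that r by (metis subsetD)
  qed
  \<comment> \<open>Within this radius the bound on the Taylor remainder is a geometric sequence
    with ratio below 1.\<close>
  define d where "d = min r (1 / (2 * (R + 1)))"
  have d: "d > 0" "d \<le> r" "d * R < 1"
  proof -
    show "d > 0" "d \<le> r" using r R0 by (auto simp: d_def)
    have "d * R \<le> 1 / (2 * (R + 1)) * R" unfolding d_def using R0 by (intro mult_right_mono) auto
    also have "\<dots> < 1" using R0 by (simp add: field_simps)
    finally show "d * R < 1" .
  qed
  have "f t = 0" if t: "t \<in> ball t0 d" for t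
  proof (cases "t = t0")
    case True
    then show ?thesis using F by metis
  next
    case False
    have est: "\<bar>f t\<bar> \<le> C * (R * \<bar>t - t0\<bar>) ^ n" if "n > 0" for n
    proof -
      have "\<exists>s. (if t < t0 then t < s \<and> s < t0 else t0 < s \<and> s < t) \<and>
         f t = (\<Sum>m<n. (F m t0 / fact m) * (t - t0) ^ m) + (F n s / fact n) * (t - t0) ^ n"
      proof (rule Taylor[where a="t0 - r" and b="t0 + r"])
        show "\<forall>m s. m < n \<and> t0 - r \<le> s \<and> s \<le> t0 + r \<longrightarrow> (F m has_real_derivative F (Suc m) s) (at s)"
        proof (intro allI impI)
          fix m s assume "m < n \<and> t0 - r \<le> s \<and> s \<le> t0 + r"
          then have "s \<in> cball t0 r" by (auto simp: dist_real_def)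
          then show "(F m has_real_derivative F (Suc m) s) (at s)" using F(2) r by (auto simp: derivs_def)
        qed
      qed (use that F False t d r in \<open>auto simp: dist_real_def\<close>)
      then obtain s where s: "if t < t0 then t < s \<and> s < t0 else t0 < s \<and> s < t" "f t = (F n s / fact n) * (t - t0) ^ n"
        by (auto simp: F(3))
      have "s \<in> cball t0 r" using s(1) t d(2) by (auto simp: dist_real_def split: if_splits)
      from bound[OF this, of n] have "\<bar>F n s\<bar> / fact n \<le> C * R ^ n" by (simp add: field_simps)
      then have "(\<bar>F n s\<bar> / fact n) * \<bar>t - t0\<bar> ^ n \<le> (C * R ^ n) * \<bar>t - t0\<bar> ^ n" by (intro mult_right_mono) auto
      then show ?thesis by (simp add: s(2) abs_mult power_abs power_mult_distrib mult.assoc)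
    qed
    have "R * \<bar>t - t0\<bar> < 1"
    proof -
      have "R * \<bar>t - t0\<bar> \<le> R * d" using t R0 by (intro mult_left_mono) (auto simp: dist_real_def)
      then show ?thesis using d(3) by (simp add: mult.commute)
    qed
    then have "(\<lambda>n. C * (R * \<bar>t - t0\<bar>) ^ n) \<longlonglongrightarrow> C * 0"
      using R0 by (intro tendsto_mult_left LIMSEQ_power_zero) auto
    then have "\<bar>f t\<bar> \<le> C * 0"
      by (rule LIMSEQ_le_const) (use est in \<open>auto intro!: exI[of _ 1]\<close>)
    then show ?thesis by simp
  qed
  moreover have "t \<in> I" if "t \<in> ball t0 d" for t using that d(2) r by auto
  ultimately show ?thesis using d(1) by blast
qed

text \<open>The set where all derivatives vanish is open by \<open>local_vanishing\<close> and
  relatively closed by continuity, and \<open>I\<close> is connected.\<close>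

lemma identity_theorem:
  assumes f: "f \<in> poly_alg U" and t0: "t0 \<in> I" and F: "F 0 = f" "derivs I F" "\<And>n. F n t0 = 0"
    and t: "t \<in> I"
  shows "f t = 0"
proof -
  define Z where "Z = {t \<in> I. \<forall>n. F n t = 0}"
  have cont: "isCont (F n) t" if "t \<in> I" for n t using F(2) that DERIV_isCont unfolding derivs_def by blast
  have oZ: "open Z"
  proof (subst open_contains_ball, intro ballI)
    fix s assume s: "s \<in> Z"
    then obtain d where d: "d > 0" "\<And>t. t \<in> ball s d \<Longrightarrow> t \<in> I \<and> f t = 0"
      using local_vanishing[OF f _ F(1,2), of s] by (auto simp: Z_def)
    have "\<forall>t\<in>ball s d. F n t = 0" for n
    proof (induction n)
      case (Suc n)
      show ?case
      proof
        fix t assume t: "t \<in> ball s d"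
        have "(F n has_real_derivative 0) (at t)"
          by (rule has_field_derivative_transform_within_open[OF DERIV_const[of 0] open_ball t]) (use Suc in auto)
        then show "F (Suc n) t = 0" using F(2) d(2)[OF t] DERIV_unique unfolding derivs_def by blast
      qed
    qed (use d F in auto)
    then show "\<exists>e>0. ball s e \<subseteq> Z" using d by (intro exI[of _ d]) (auto simp: Z_def)
  qed
  have "open (I - Z)"
  proof -
    have "I - Z = (\<Union>n. {t \<in> I. F n t \<noteq> 0})" by (auto simp: Z_def)
    moreover have "open {t \<in> I. F n t \<noteq> 0}" for n
    proof -
      have "continuous_on I (F n)" using cont by (simp add: continuous_at_imp_continuous_on)
      then have "open (I \<inter> F n -` (- {0}))" by (rule continuous_open_preimage[OF _ open_I]) auto
      moreover have "I \<inter> F n -` (- {0}) = {t \<in> I. F n t \<noteq> 0}" by auto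
      ultimately show ?thesis by simp
    qed
    ultimately show ?thesis by auto
  qed
  then have "Z \<inter> I = {} \<or> (I - Z) \<inter> I = {}"
    using connectedD[OF conn_I oZ, of "I - Z"] by (auto simp: Z_def)
  moreover have "t0 \<in> Z \<inter> I" using t0 F(3) by (simp add: Z_def)
  ultimately have "t \<in> Z" using t by blast
  then show ?thesis using F(1) by (auto simp: Z_def)
qed

end

section \<open>Curves of symmetric matrices commuting with their derivative\<close>

lemma bilinear_matrix_mult: "bilinear ((**) :: real^'n^'n \<Rightarrow> real^'n^'n \<Rightarrow> real^'n^'n)"
  unfolding bilinear_def
  by (auto intro!: linearI simp: vec_eq_iff matrix_matrix_mult_def sum.distrib algebra_simps sum_distrib_left)

lemmas bounded_bilinear_matrix_mult = bilinear_matrix_mult[unfolded bilinear_conv_bounded_bilinear]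

text \<open>On \<open>W\<close> the limit map is bounded below by \<open>c\<close> times the norm,
  and convergence on a basis is uniform on bounded sets, so the bound survives nearby. This is the
  lower semicontinuity of rank.\<close>

lemma tendsto_linear_family_injective:
  fixes \<Psi> :: "real \<Rightarrow> 'a::euclidean_space \<Rightarrow> 'b::euclidean_space"
  assumes lin: "\<And>s. linear (\<Psi> s)" and lin0: "linear \<Psi>0"
    and lim: "\<And>v. ((\<lambda>s. \<Psi> s v) \<longlongrightarrow> \<Psi>0 v) (at t)"
    and W: "subspace W" and inj: "\<And>v. v \<in> W \<Longrightarrow> \<Psi>0 v = 0 \<Longrightarrow> v = 0"
  shows "\<forall>\<^sub>F s in at t. \<forall>v\<in>W. \<Psi> s v = 0 \<longrightarrow> v = 0"
proof -
  obtain c where c: "c > 0" "\<And>v. v \<in> W \<Longrightarrow> norm (\<Psi>0 v) \<ge> c * norm v"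
    using injective_imp_isometric[OF closed_subspace[OF W] W _ , of \<Psi>0] lin0 inj linear_conv_bounded_linear by blast
  define \<epsilon> where "\<epsilon> s = (\<Sum>b\<in>Basis. norm (\<Psi> s b - \<Psi>0 b))" for s
  have diff: "norm (\<Psi> s v - \<Psi>0 v) \<le> \<epsilon> s * norm v" for s v
  proof -
    have "\<Psi> s v - \<Psi>0 v = (\<Sum>b\<in>Basis. (v \<bullet> b) *\<^sub>R (\<Psi> s b - \<Psi>0 b))"
      by (subst linear_expand[OF lin], subst linear_expand[OF lin0])
        (simp add: sum_subtractf scaleR_diff_right)
    also have "norm \<dots> \<le> (\<Sum>b\<in>Basis. norm v * norm (\<Psi> s b - \<Psi>0 b))"
      by (rule sum_norm_le) (simp add: Basis_le_norm mult_right_mono)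
    finally show ?thesis by (simp add: \<epsilon>_def sum_distrib_left mult.commute)
  qed
  have "(\<epsilon> \<longlongrightarrow> (\<Sum>b\<in>Basis. norm (\<Psi>0 b - \<Psi>0 b))) (at t)"
    unfolding \<epsilon>_def by (intro tendsto_intros lim)
  then have "\<forall>\<^sub>F s in at t. \<epsilon> s < c" using order_tendstoD(2)[of \<epsilon> 0 "at t" c] c(1) by simp
  then show ?thesis
  proof eventually_elim
    case (elim s)
    show ?case
    proof (intro ballI impI)
      fix v assume v: "v \<in> W" "\<Psi> s v = 0"
      have "c * norm v \<le> \<epsilon> s * norm v" using c(2)[OF v(1)] diff[of s v] v(2) by simp
      then show "v = 0" using elim by (metis mult_le_cancel_right norm_eq_zero norm_ge_zero not_less order_le_less)
    qed
  qed
qed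

lemma dim_le_of_injective:
  fixes f :: "'a::euclidean_space \<Rightarrow> 'b::euclidean_space"
  assumes "linear f" "subspace W" "\<And>v. v \<in> W \<Longrightarrow> f v = 0 \<Longrightarrow> v = 0" "f ` W \<subseteq> R"
  shows "dim W \<le> dim R"
proof -
  have "inj_on f W"
  proof (rule inj_onI)
    fix x y assume "x \<in> W" "y \<in> W" "f x = f y"
    then have "f (x - y) = 0" "x - y \<in> W" using linear_diff[OF assms(1)] assms(2) subspace_diff by auto
    then show "x = y" using assms(3) by fastforce
  qed
  then have "dim (f ` W) = dim W"
    using dim_image_eq[OF assms(1), of W] assms(2) by (simp add: span_eq_iff[THEN iffD2])
  then show ?thesis using dim_subset[OF assms(4)] by simp
qed

section \<open>The commutator map of a symmetric matrix\<close>

definition adm :: "real^'n^'n \<Rightarrow> real^'n^'n \<Rightarrow> real^'n^'n" where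
  "adm S X = S ** X - X ** S"

lemma adm_linear: "linear (adm S)"
  unfolding adm_def
  by (intro linearI) (auto simp: vec_eq_iff matrix_matrix_mult_def sum.distrib algebra_simps sum_distrib_left)

lemma adm_bilinear: "bilinear adm"
  unfolding bilinear_def adm_def
  by (auto intro!: linearI simp: vec_eq_iff matrix_matrix_mult_def sum.distrib algebra_simps sum_distrib_left)

lemma inner_matrix: "(X :: real^'n^'n) \<bullet> Y = (\<Sum>i\<in>UNIV. \<Sum>j\<in>UNIV. X $ i $ j * Y $ i $ j)"
  by (simp add: inner_vec_def)

text \<open>Self-adjointness makes the kernel and the range of \<open>adm S\<close> orthogonal to
  each other, so \<open>adm S\<close> is injective on its range.\<close>

lemma adm_self_adjoint:
  assumes "transpose S = S"
  shows "adm S X \<bullet> Y = X \<bullet> adm S Y"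
proof -
  have s: "S $ i $ j = S $ j $ i" for i j using assms by (simp add: transpose_def vec_eq_iff)
  have 1: "(S ** X) \<bullet> Y = X \<bullet> (S ** Y)"
  proof -
    have "(S ** X) \<bullet> Y = (\<Sum>i\<in>UNIV. \<Sum>j\<in>UNIV. \<Sum>k\<in>UNIV. S $ i $ k * X $ k $ j * Y $ i $ j)"
      by (simp add: inner_matrix matrix_matrix_mult_def sum_distrib_right)
    also have "\<dots> = (\<Sum>k\<in>UNIV. \<Sum>j\<in>UNIV. \<Sum>i\<in>UNIV. S $ i $ k * X $ k $ j * Y $ i $ j)"
      by (subst sum.swap[of _ UNIV UNIV], subst (2) sum.swap, subst (1) sum.swap) (rule refl)
    also have "\<dots> = X \<bullet> (S ** Y)"
      by (simp add: inner_matrix matrix_matrix_mult_def sum_distrib_left s[of _ k for k] ac_simps)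
    finally show ?thesis .
  qed
  have 2: "(X ** S) \<bullet> Y = X \<bullet> (Y ** S)"
  proof -
    have "(X ** S) \<bullet> Y = (\<Sum>i\<in>UNIV. \<Sum>j\<in>UNIV. \<Sum>k\<in>UNIV. X $ i $ k * S $ k $ j * Y $ i $ j)"
      by (simp add: inner_matrix matrix_matrix_mult_def sum_distrib_right)
    also have "\<dots> = (\<Sum>i\<in>UNIV. \<Sum>k\<in>UNIV. \<Sum>j\<in>UNIV. X $ i $ k * S $ k $ j * Y $ i $ j)"
      by (intro sum.cong refl sum.swap)
    also have "\<dots> = (\<Sum>i\<in>UNIV. \<Sum>k\<in>UNIV. \<Sum>j\<in>UNIV. X $ i $ k * (Y $ i $ j * S $ j $ k))"
      by (intro sum.cong refl) (metis s mult.assoc mult.commute)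
    also have "\<dots> = X \<bullet> (Y ** S)"
      by (simp add: inner_matrix matrix_matrix_mult_def sum_distrib_left)
    finally show ?thesis .
  qed
  show ?thesis by (simp add: adm_def inner_diff_left inner_diff_right 1 2)
qed

text \<open>Where the rank of \<open>adm (S 0 t)\<close> is maximal, an element \<open>X\<close> of its kernel satisfies
  \<open>adm (S 1 t) X = 0\<close>, as otherwise the rank would increase nearby. Hence the derivative of a curve
  of matrices commuting with \<open>S 0\<close> commutes with \<open>S 0\<close> as well.\<close>

lemma commuting_derivatives:
  fixes S :: "nat \<Rightarrow> real \<Rightarrow> real^'n^'n"
  assumes I: "open I" "I \<noteq> {}"
    and S: "\<And>n t. t \<in> I \<Longrightarrow> (S n has_vector_derivative S (Suc n) t) (at t)"
    and sym: "\<And>t. t \<in> I \<Longrightarrow> transpose (S 0 t) = S 0 t"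
    and comm: "\<And>t. t \<in> I \<Longrightarrow> adm (S 0 t) (S 1 t) = 0"
  shows "\<exists>J. open J \<and> J \<subseteq> I \<and> J \<noteq> {} \<and> (\<forall>t\<in>J. \<forall>n. adm (S 0 t) (S n t) = 0)"
proof -
  define rk where "rk t = dim (range (adm (S 0 t)))" for t
  have fin: "finite (rk ` I)"
  proof (rule finite_subset)
    show "rk ` I \<subseteq> {..DIM(real^'n^'n)}" unfolding rk_def using dim_subset_UNIV by blast
  qed simp
  define \<rho> where "\<rho> = Max (rk ` I)"
  obtain t1 where t1: "t1 \<in> I" "rk t1 = \<rho>" using Max_in[OF fin] I(2) unfolding \<rho>_def by (metis empty_is_image imageE)
  have le: "rk t \<le> \<rho>" if "t \<in> I" for t unfolding \<rho>_def using fin that by simp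
  define J where "J = {t \<in> I. rk t = \<rho>}"
  have nearI: "\<forall>\<^sub>F s in at t. s \<in> I" if "t \<in> I" for t
    using I(1) that eventually_at_topological by blast
  have Sc: "(S n \<longlongrightarrow> S n t) (at t)" if "t \<in> I" for n t
    using S[OF that, of n] has_vector_derivative_continuous isCont_def by blast
  have bb: "bounded_bilinear (adm :: real^'n^'n \<Rightarrow> _)"
    using adm_bilinear bilinear_conv_bounded_bilinear by blast
  have rng: "subspace (range (adm (S 0 t)))" for t
    using linear_subspace_image[OF adm_linear subspace_UNIV] .
  have perp: "Y \<bullet> Z = 0" if t: "t \<in> I" and Y: "adm (S 0 t) Y = 0" and Z: "Z \<in> range (adm (S 0 t))" for t Y Z
  proof -
    obtain Z' where "Z = adm (S 0 t) Z'" using Z by blast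
    then show ?thesis using adm_self_adjoint[OF sym[OF t], of Y Z'] Y by simp
  qed
  have injW: "w = 0" if "t \<in> I" "w \<in> range (adm (S 0 t))" "adm (S 0 t) w = 0" for t w
    using perp[OF that(1,3,2)] by simp
  have oJ: "open J"
  proof (subst open_dist, intro ballI)
    fix t assume t: "t \<in> J"
    then have tI: "t \<in> I" by (simp add: J_def)
    have "\<forall>\<^sub>F s in at t. \<forall>v\<in>range (adm (S 0 t)). adm (S 0 s) v = 0 \<longrightarrow> v = 0"
      by (rule tendsto_linear_family_injective[OF adm_linear adm_linear _ rng])
        (use bounded_bilinear.tendsto[OF bb Sc[OF tI] tendsto_const] injW[OF tI] in auto)
    then have "\<forall>\<^sub>F s in at t. s \<in> J" using nearI[OF tI]
    proof eventually_elim
      case (elim s)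
      have "dim (range (adm (S 0 t))) \<le> dim (range (adm (S 0 s)))"
        by (rule dim_le_of_injective[OF adm_linear rng]) (use elim in auto)
      then have "\<rho> \<le> rk s" using t by (simp add: J_def rk_def)
      then show ?case using le[OF elim(2)] elim(2) by (simp add: J_def)
    qed
    then obtain d where "d > 0" "\<forall>s. s \<noteq> t \<and> dist s t < d \<longrightarrow> s \<in> J" unfolding eventually_at by blast
    then show "\<exists>e>0. \<forall>y. dist y t < e \<longrightarrow> y \<in> J" using t by metis
  qed
  have key: "adm (S 1 t) X = 0" if t: "t \<in> J" and X: "adm (S 0 t) X = 0" for t X
  proof (rule ccontr)
    let ?Y = "adm (S 1 t) X"
    assume Y: "?Y \<noteq> 0"
    have tI: "t \<in> I" and rt: "rk t = \<rho>" using t by (auto simp: J_def)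
    let ?R = "range (adm (S 0 t))"
    have X0: "X \<noteq> 0" using Y linear_0[OF adm_linear] by metis
    then have XX: "X \<bullet> X \<noteq> 0" by simp
    \<comment> \<open>Both \<open>S 1 t\<close> and \<open>X\<close> commute with
      \<open>S 0 t\<close>, hence so does their commutator, which is therefore orthogonal to the
      range.\<close>
    have "adm (S 0 t) ?Y = 0"
    proof -
      have 1: "S 0 t ** S 1 t = S 1 t ** S 0 t" "S 0 t ** X = X ** S 0 t"
        using comm[OF tI] X by (simp_all add: adm_def)
      have "S 0 t ** (S 1 t ** X) = (S 1 t ** X) ** S 0 t" "S 0 t ** (X ** S 1 t) = (X ** S 1 t) ** S 0 t"
        using 1 matrix_mul_assoc by metis+
      then show ?thesis
        by (simp add: adm_def bounded_bilinear.diff_left[OF bounded_bilinear_matrix_mult]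
          bounded_bilinear.diff_right[OF bounded_bilinear_matrix_mult])
    qed
    from perp[OF tI this] have Yperp: "?Y \<bullet> Z = 0" if "Z \<in> ?R" for Z using that .
    have Xperp: "X \<bullet> Z = 0" if "Z \<in> ?R" for Z using perp[OF tI X that] .
    let ?p = "\<lambda>v. (v \<bullet> X) / (X \<bullet> X)"
    \<comment> \<open>\<open>\<Psi> s\<close> takes its values in the range of
      \<open>adm (S 0 s)\<close>. On the range of \<open>adm (S 0 t)\<close> it is
      \<open>adm (S 0 s)\<close>, and on \<open>X\<close> it is a difference quotient with limit
      \<open>?Y\<close>. The limit is injective on \<open>X\<close> together with that range, so the
      rank would exceed its maximum near \<open>t\<close>.\<close>
    define \<Psi> where "\<Psi> s v = adm (S 0 s) (v - ?p v *\<^sub>R X) + (?p v / (s - t)) *\<^sub>R adm (S 0 s) X" for s v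
    define \<Psi>0 where "\<Psi>0 v = adm (S 0 t) (v - ?p v *\<^sub>R X) + ?p v *\<^sub>R ?Y" for v
    have lin: "linear (\<Psi> s)" for s
      unfolding \<Psi>_def by (rule linearI)
        (simp_all add: linear_diff[OF adm_linear] linear_add[OF adm_linear] linear_cmul[OF adm_linear]
          inner_add_left add_divide_distrib scaleR_add_left algebra_simps)
    have lin0: "linear \<Psi>0"
      unfolding \<Psi>0_def by (rule linearI)
        (simp_all add: linear_diff[OF adm_linear] linear_add[OF adm_linear] linear_cmul[OF adm_linear]
          inner_add_left add_divide_distrib scaleR_add_left algebra_simps)
    have quot: "((\<lambda>s. (1 / (s - t)) *\<^sub>R adm (S 0 s) X) \<longlongrightarrow> ?Y) (at t)"
    proof -
      have "((\<lambda>s. adm (S 0 s) X) has_vector_derivative ?Y) (at t)"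
        using bounded_linear.has_vector_derivative[OF bounded_bilinear.bounded_linear_left[OF bb] S[OF tI, of 0], of X] by simp
      then have "((\<lambda>s. norm (adm (S 0 s) X - (s - t) *\<^sub>R ?Y) / norm (s - t)) \<longlongrightarrow> 0) (at t)"
        by (simp add: has_vector_derivative_def has_derivative_iff_norm X)
      moreover have "\<forall>\<^sub>F s in at t. norm (adm (S 0 s) X - (s - t) *\<^sub>R ?Y) / norm (s - t)
          = norm ((1 / (s - t)) *\<^sub>R adm (S 0 s) X - ?Y)"
      proof (rule eventually_at_topological[THEN iffD2], intro exI[of _ UNIV] conjI ballI impI)
        fix s assume "s \<noteq> t"
        then have "(1 / (s - t)) *\<^sub>R adm (S 0 s) X - ?Y = (1 / (s - t)) *\<^sub>R (adm (S 0 s) X - (s - t) *\<^sub>R ?Y)"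
          by (simp add: scaleR_diff_right)
        then show "norm (adm (S 0 s) X - (s - t) *\<^sub>R ?Y) / norm (s - t) = norm ((1 / (s - t)) *\<^sub>R adm (S 0 s) X - ?Y)"
          by simp
      qed auto
      ultimately have "((\<lambda>s. norm ((1 / (s - t)) *\<^sub>R adm (S 0 s) X - ?Y)) \<longlongrightarrow> 0) (at t)"
        by (rule Lim_transform_eventually)
      then have "((\<lambda>s. (1 / (s - t)) *\<^sub>R adm (S 0 s) X - ?Y) \<longlongrightarrow> 0) (at t)"
        by (rule tendsto_norm_zero_cancel)
      then show ?thesis by (rule Lim_null[THEN iffD2])
    qed
    have lim: "((\<lambda>s. \<Psi> s v) \<longlongrightarrow> \<Psi>0 v) (at t)" for v
    proof -
      have "((\<lambda>s. ?p v *\<^sub>R ((1 / (s - t)) *\<^sub>R adm (S 0 s) X)) \<longlongrightarrow> ?p v *\<^sub>R ?Y) (at t)"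
        by (intro tendsto_scaleR tendsto_const quot)
      then have "((\<lambda>s. (?p v / (s - t)) *\<^sub>R adm (S 0 s) X) \<longlongrightarrow> ?p v *\<^sub>R ?Y) (at t)" by simp
      then show ?thesis unfolding \<Psi>_def \<Psi>0_def
        by (intro tendsto_add bounded_bilinear.tendsto[OF bb] Sc[OF tI] tendsto_const)
    qed
    define W where "W = span (insert X ?R)"
    have Wform: "\<exists>w\<in>?R. \<exists>a. v = w + a *\<^sub>R X" if "v \<in> W" for v
      using that unfolding W_def span_insert span_eq_iff[THEN iffD2, OF rng]
      by (auto simp: algebra_simps) (metis add.commute diff_add_cancel rangeI)
    have "v = 0" if v: "v \<in> W" "\<Psi>0 v = 0" for v
    proof -
      obtain w a where w: "w \<in> ?R" "v = w + a *\<^sub>R X" using Wform[OF v(1)] by blast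
      have "?p v = a" using Xperp[OF w(1)] X0 by (simp add: w(2) inner_add_left inner_commute[of w])
      then have z: "adm (S 0 t) w + a *\<^sub>R ?Y = 0" using v(2) by (simp add: \<Psi>0_def w(2))
      have "a * (?Y \<bullet> ?Y) = 0"
        using arg_cong[OF z, of "\<lambda>z. ?Y \<bullet> z"] Yperp[of "adm (S 0 t) w"] by (simp add: inner_add_right)
      then have a: "a = 0" using Y by simp
      then have "w = 0" using z injW[OF tI w(1)] by simp
      then show "v = 0" using w a by simp
    qed
    then have "\<forall>\<^sub>F s in at t. \<forall>v\<in>W. \<Psi> s v = 0 \<longrightarrow> v = 0"
      by (intro tendsto_linear_family_injective[OF lin lin0 lim]) (auto simp: W_def)
    then have "\<forall>\<^sub>F s in at t. False" using nearI[OF tI]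
    proof eventually_elim
      case (elim s)
      have "\<Psi> s v \<in> range (adm (S 0 s))" for v
        unfolding \<Psi>_def using rng by (intro subspace_add subspace_scale) auto
      then have "dim W \<le> rk s" unfolding rk_def
        by (intro dim_le_of_injective[OF lin[of s]]) (use elim in \<open>auto simp: W_def\<close>)
      moreover have "X \<notin> span ?R"
        using Xperp[of X] X0 by (auto simp: span_eq_iff[THEN iffD2, OF rng])
      then have "dim W = Suc (rk t)" by (simp add: W_def dim_insert rk_def)
      ultimately show False using le[OF elim(2)] rt by simp
    qed
    then show False by simp
  qed
  have all: "\<forall>t\<in>J. adm (S 0 t) (S n t) = 0" for n
  proof (induction n)
    case 0
    then show ?case by (simp add: adm_def)
  next
    case (Suc n)
    show ?case
    proof
      fix t assume t: "t \<in> J"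
      then have tI: "t \<in> I" by (simp add: J_def)
      \<comment> \<open>Differentiating the induction hypothesis produces the next order and a
        second term, which \<open>key\<close> removes.\<close>
      have "((\<lambda>t. adm (S 0 t) (S n t)) has_vector_derivative adm (S 0 t) (S (Suc n) t) + adm (S 1 t) (S n t)) (at t)"
        using bounded_bilinear.has_vector_derivative[OF bb S[OF tI, of 0] S[OF tI, of n]] by simp
      moreover have "((\<lambda>t. adm (S 0 t) (S n t)) has_vector_derivative 0) (at t)"
        by (rule has_vector_derivative_transform_within_open[OF has_vector_derivative_const[of 0] oJ t]) (use Suc in auto)
      ultimately have "adm (S 0 t) (S (Suc n) t) + adm (S 1 t) (S n t) = 0"
        using vector_derivative_unique_at by blast
      then show "adm (S 0 t) (S (Suc n) t) = 0" using key[OF t] Suc t by simp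
    qed
  qed
  have "t1 \<in> J" using t1 by (simp add: J_def)
  then show ?thesis using oJ all by (intro exI[of _ J]) (auto simp: J_def)
qed

lemma matrix_axis_expand: "(M :: real^'n^'n) = (\<Sum>i\<in>UNIV. \<Sum>j\<in>UNIV. M $ i $ j *\<^sub>R axis i (axis j 1))"
proof -
  have "(\<Sum>i\<in>UNIV. \<Sum>j\<in>UNIV. M $ i $ j *\<^sub>R (axis i (axis j 1) :: real^'n^'n)) $ p $ q = M $ p $ q" for p q
  proof -
    have "(\<Sum>i\<in>UNIV. \<Sum>j\<in>UNIV. M $ i $ j *\<^sub>R (axis i (axis j 1) :: real^'n^'n)) $ p $ q
      = (\<Sum>i\<in>UNIV. if p = i then (\<Sum>j\<in>UNIV. if q = j then M $ i $ j else 0) else 0)"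
      unfolding sum_component vector_scaleR_component
    proof (intro sum.cong refl)
      fix i
      show "(\<Sum>j\<in>UNIV. M $ i $ j *\<^sub>R (axis i (axis j 1) :: real^'n^'n) $ p $ q)
        = (if p = i then (\<Sum>j\<in>UNIV. if q = j then M $ i $ j else 0) else 0)"
        by (cases "p = i") (auto simp: axis_def if_distrib cong: if_cong)
    qed
    also have "\<dots> = M $ p $ q" by simp
    finally show ?thesis .
  qed
  then show ?thesis by (simp add: vec_eq_iff del: sum_component)
qed

lemma matrix_has_vector_derivative:
  fixes M :: "real \<Rightarrow> real^'n^'n"
  assumes "\<And>i j. ((\<lambda>t. M t $ i $ j) has_real_derivative M' $ i $ j) (at t)"
  shows "(M has_vector_derivative M') (at t)"
proof -
  have "((\<lambda>t. \<Sum>i\<in>UNIV. \<Sum>j\<in>UNIV. M t $ i $ j *\<^sub>R (axis i (axis j 1) :: real^'n^'n)) has_vector_derivative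
      (\<Sum>i\<in>UNIV. \<Sum>j\<in>UNIV. M' $ i $ j *\<^sub>R axis i (axis j 1))) (at t)"
  proof (intro has_vector_derivative_sum)
    fix i j :: 'n
    show "((\<lambda>t. M t $ i $ j *\<^sub>R (axis i (axis j 1) :: real^'n^'n)) has_vector_derivative M' $ i $ j *\<^sub>R (axis i (axis j 1) :: real^'n^'n)) (at t)"
      using has_vector_derivative_scaleR[OF assms[of i j] has_vector_derivative_const[of "axis i (axis j 1)"]] by simp
  qed
  moreover have "(\<lambda>t. \<Sum>i\<in>UNIV. \<Sum>j\<in>UNIV. M t $ i $ j *\<^sub>R axis i (axis j 1)) = M"
    by (rule ext) (rule matrix_axis_expand[symmetric])
  ultimately show ?thesis using matrix_axis_expand[of M'] by simp
qed

lemma adm_entry: "adm S X $ i $ j = (\<Sum>k\<in>UNIV. S $ i $ k * X $ k $ j) - (\<Sum>k\<in>UNIV. X $ i $ k * S $ k $ j)"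
  by (simp add: adm_def matrix_matrix_mult_def)

lemma adm_swap: "adm X S = - adm S X"
  by (simp add: adm_def)

text \<open>For \<open>t\<close> in the open set of \<open>commuting_derivatives\<close>, all
  derivatives in \<open>s\<close> of the commutator vanish at \<open>s = t\<close>, and the identity
  theorem covers all \<open>s\<close>. For fixed \<open>s\<close> the commutator then vanishes on an
  open set of \<open>t\<close>, and a second application covers all \<open>t\<close>.\<close>

lemma (in poly_system) commuting_curve:
  fixes S :: "real \<Rightarrow> real^'n^'n"
  assumes ne: "I \<noteq> {}" and alg: "\<And>i j. (\<lambda>t. S t $ i $ j) \<in> poly_alg U"
    and sym: "\<And>t. t \<in> I \<Longrightarrow> transpose (S t) = S t"
    and comm: "\<And>t D. t \<in> I \<Longrightarrow> (S has_vector_derivative D) (at t) \<Longrightarrow> adm (S t) D = 0"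
    and s: "s \<in> I" and t: "t \<in> I"
  shows "adm (S s) (S t) = 0"
proof -
  have "\<exists>F. F 0 = (\<lambda>t. S t $ i $ j) \<and> derivs I F \<and> (\<forall>n. F n \<in> poly_alg U)" for i j
    using poly_alg_derivs[OF alg] .
  then obtain F where F: "\<And>i j. F i j 0 = (\<lambda>t. S t $ i $ j)" "\<And>i j. derivs I (F i j)" "\<And>i j n. F i j n \<in> poly_alg U"
    by metis
  define Sn where "Sn n t = (\<chi> i j. F i j n t)" for n t
  have Sn0: "Sn 0 t = S t" for t by (simp add: Sn_def F(1) vec_eq_iff)
  have dS: "(Sn n has_vector_derivative Sn (Suc n) t) (at t)" if "t \<in> I" for n t
    by (rule matrix_has_vector_derivative) (use F(2) that in \<open>auto simp: Sn_def derivs_def\<close>)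
  have dS0: "(S has_vector_derivative Sn 1 t) (at t)" if "t \<in> I" for t
  proof -
    have "Sn 0 = S" by (rule ext) (rule Sn0)
    then show ?thesis using dS[OF that, of 0] by simp
  qed
  have "\<exists>J. open J \<and> J \<subseteq> I \<and> J \<noteq> {} \<and> (\<forall>t\<in>J. \<forall>n. adm (Sn 0 t) (Sn n t) = 0)"
    by (rule commuting_derivatives[of I Sn]) (use open_I ne dS sym comm dS0 in \<open>auto simp: Sn0\<close>)
  then obtain J where J: "open J" "J \<subseteq> I" "J \<noteq> {}" "\<And>t n. t \<in> J \<Longrightarrow> adm (S t) (Sn n t) = 0"
    unfolding Sn0 by blast
  have dSij: "((\<lambda>t. Sn n t $ i $ j) has_real_derivative Sn (Suc n) t $ i $ j) (at t)" if "t \<in> I" for n t i j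
    using F(2) that by (simp add: Sn_def derivs_def)
  have algn: "(\<lambda>t. Sn n t $ i $ j) \<in> poly_alg U" for n i j
    using F(3) by (simp add: Sn_def)
  have 1: "adm (S s) (S t) = 0" if s: "s \<in> I" and t: "t \<in> J" for s t
  proof -
    have "(\<lambda>s. adm (S s) (S t) $ p $ q) s = 0" for p q
    proof (rule identity_theorem[of "\<lambda>s. adm (S s) (S t) $ p $ q" t "\<lambda>n s. adm (Sn n s) (S t) $ p $ q" s])
      show "(\<lambda>s. adm (S s) (S t) $ p $ q) \<in> poly_alg U"
        unfolding adm_entry by (intro poly_alg_diff poly_alg_sum poly_alg.mult alg poly_alg.const)
      show "derivs I (\<lambda>n s. adm (Sn n s) (S t) $ p $ q)"
        unfolding derivs_def adm_entry
        by (intro allI ballI DERIV_diff DERIV_sum DERIV_cmult DERIV_cmult_right dSij) auto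
      show "adm (Sn n t) (S t) $ p $ q = 0" for n
        using J(4)[OF t, of n] adm_swap[of "Sn n t" "S t"] by simp
    qed (use J(2) t s in \<open>auto simp: Sn0\<close>)
    then show ?thesis by (simp add: vec_eq_iff)
  qed
  obtain t1 where t1: "t1 \<in> J" using J(3) by blast
  have "(\<lambda>t. adm (S s) (S t) $ p $ q) t = 0" for p q
  proof (rule identity_theorem[of "\<lambda>t. adm (S s) (S t) $ p $ q" t1 "\<lambda>n t. adm (S s) (Sn n t) $ p $ q" t])
    show "(\<lambda>t. adm (S s) (S t) $ p $ q) \<in> poly_alg U"
      unfolding adm_entry by (intro poly_alg_diff poly_alg_sum poly_alg.mult alg poly_alg.const)
    show d: "derivs I (\<lambda>n t. adm (S s) (Sn n t) $ p $ q)"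
      unfolding derivs_def adm_entry
      by (intro allI ballI DERIV_diff DERIV_sum DERIV_cmult DERIV_cmult_right dSij) auto
    have "\<forall>t\<in>J. adm (S s) (Sn n t) $ p $ q = 0" for n
    proof (induction n)
      case (Suc n)
      show ?case
      proof
        fix t assume tJ: "t \<in> J"
        have "((\<lambda>t. adm (S s) (Sn n t) $ p $ q) has_real_derivative 0) (at t)"
          by (rule has_field_derivative_transform_within_open[OF DERIV_const[of 0] J(1) tJ]) (use Suc in auto)
        then show "adm (S s) (Sn (Suc n) t) $ p $ q = 0"
          using d tJ J(2) DERIV_unique unfolding derivs_def by blast
      qed
    qed (use 1[OF s] in \<open>simp add: Sn0\<close>)
    then show "adm (S s) (Sn n t1) $ p $ q = 0" for n using t1 by blast
  qed (use J(2) t1 t in \<open>auto simp: Sn0\<close>)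
  then show ?thesis by (simp add: vec_eq_iff)
qed

section \<open>Simultaneous diagonalization\<close>

text \<open>At a maximum of the quotient of \<open>h\<close> by \<open>Q\<close>, the form
  \<open>\<mu> * Q - h\<close> is nonnegative on \<open>V\<close> and vanishes at \<open>x\<close>;
  a nonnegative symmetric form pairs such a vector to zero with all others.\<close>

lemma form_extremum:
  fixes Q h :: "'v::euclidean_space \<Rightarrow> 'v \<Rightarrow> real"
  assumes Q: "inner_product_form Q" and h: "bilinear h" and hs: "\<And>x y. x \<in> V \<Longrightarrow> y \<in> V \<Longrightarrow> h x y = h y x"
    and V: "subspace V" "V \<noteq> {0}"
  shows "\<exists>\<mu>. \<exists>x\<in>V. x \<noteq> 0 \<and> (\<forall>y\<in>V. h x y = \<mu> * Q x y)"
proof -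
  have Qb: "bilinear Q" and Qs: "\<And>x y. Q x y = Q y x" and Qp: "\<And>x. x \<noteq> 0 \<Longrightarrow> Q x x > 0"
    using Q by (auto simp: inner_product_form_def)
  let ?K = "V \<inter> sphere 0 1"
  obtain v where v: "v \<in> V" "v \<noteq> 0" using V subspace_0 by blast
  then have "v /\<^sub>R norm v \<in> ?K" using V(1) by (simp add: subspace_scale)
  then have ne: "?K \<noteq> {}" by blast
  have comp: "compact ?K" using closed_subspace[OF V(1)] by (intro closed_Int_compact) auto
  have c: "continuous_on ?K (\<lambda>x. B x x)" if "bilinear B" for B :: "'v \<Rightarrow> 'v \<Rightarrow> real"
    using bounded_bilinear.continuous_on[OF that[unfolded bilinear_conv_bounded_bilinear] continuous_on_id continuous_on_id] by simp
  have "continuous_on ?K (\<lambda>x. h x x / Q x x)"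
  proof (rule continuous_on_divide[OF c[OF h] c[OF Qb]])
    show "\<forall>x\<in>?K. Q x x \<noteq> 0" using Qp by (metis IntD2 less_irrefl mem_sphere_0 norm_zero zero_neq_one)
  qed
  from continuous_attains_sup[OF comp ne this]
  obtain x where x: "x \<in> ?K" "\<And>y. y \<in> ?K \<Longrightarrow> h y y / Q y y \<le> h x x / Q x x" by blast
  define \<mu> where "\<mu> = h x x / Q x x"
  have xV: "x \<in> V" "x \<noteq> 0" using x(1) by auto
  define B where "B a b = \<mu> * Q a b - h a b" for a b
  have Bb: "bilinear B"
    unfolding B_def bilinear_def
    by (auto intro!: linearI simp: bilinear_ladd[OF Qb] bilinear_radd[OF Qb] bilinear_lmul[OF Qb] bilinear_rmul[OF Qb]
        bilinear_ladd[OF h] bilinear_radd[OF h] bilinear_lmul[OF h] bilinear_rmul[OF h] algebra_simps)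
  have Bx: "B x x = 0" using Qp[OF xV(2)] by (simp add: B_def \<mu>_def)
  have Bpos: "B y y \<ge> 0" if y: "y \<in> V" for y
  proof (cases "y = 0")
    case True
    then show ?thesis by (simp add: bilinear_lzero[OF Bb])
  next
    case False
    let ?u = "y /\<^sub>R norm y"
    have "?u \<in> ?K" using y V(1) False by (simp add: subspace_scale)
    then have "h ?u ?u \<le> \<mu> * Q ?u ?u"
      using x(2)[of ?u] Qp[of ?u] False by (simp add: \<mu>_def pos_divide_le_eq)
    then have "B ?u ?u \<ge> 0" by (simp add: B_def)
    moreover have "B ?u ?u = (inverse (norm y))\<^sup>2 * B y y"
      by (simp add: bilinear_lmul[OF Bb] bilinear_rmul[OF Bb] power2_eq_square)
    ultimately show ?thesis using False by (simp add: zero_le_mult_iff)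
  qed
  have "B x y = 0" if y: "y \<in> V" for y
  proof (rule ccontr)
    assume nz: "B x y \<noteq> 0"
    have exp: "0 \<le> 2 * s * B x y + s\<^sup>2 * B y y" for s
    proof -
      have "B (x + s *\<^sub>R y) (x + s *\<^sub>R y) = 2 * s * B x y + s\<^sup>2 * B y y"
      proof -
        have "B y x = B x y" using hs[OF xV(1) y] Qs[of x y] by (simp add: B_def)
        then show ?thesis using Bx
          by (simp add: bilinear_ladd[OF Bb] bilinear_radd[OF Bb] bilinear_lmul[OF Bb] bilinear_rmul[OF Bb] power2_eq_square algebra_simps)
      qed
      then show ?thesis using Bpos[of "x + s *\<^sub>R y"] xV(1) y V(1) by (simp add: subspace_add subspace_scale)
    qed
    \<comment> \<open>At \<open>s = - B x y / b\<close> the quadratic polynomial in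
      \<open>exp\<close> is negative; the summand 1 keeps \<open>b\<close> positive when
      \<open>B y y\<close> vanishes.\<close>
    define b where "b = B y y + 1"
    have b: "b > 0" using Bpos[OF y] by (simp add: b_def)
    have "2 * (- B x y / b) * B x y + (- B x y / b)\<^sup>2 * B y y < 0"
    proof -
      have "2 * (- B x y / b) * B x y + (- B x y / b)\<^sup>2 * B y y = (B x y)\<^sup>2 / b\<^sup>2 * (B y y - 2 * b)"
        using b by (simp add: field_simps power2_eq_square)
      moreover have "B y y - 2 * b < 0" using Bpos[OF y] by (simp add: b_def)
      moreover have "(B x y)\<^sup>2 / b\<^sup>2 > 0" using nz b by simp
      ultimately show ?thesis using mult_pos_neg by metis
    qed
    then show False using exp[of "- B x y / b"] by linarith
  qed
  then show ?thesis using xV by (intro exI[of _ \<mu>] bexI[of _ x]) (auto simp: B_def)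
qed

text \<open>Induction on the dimension. If some \<open>f\<close> is not scalar on \<open>V\<close>,
  one of its eigenspaces and the orthogonal complement are proper subspaces, invariant under the
  family by commutation and self-adjointness.\<close>

lemma common_eigenbasis:
  fixes F :: "('v::euclidean_space \<Rightarrow> 'v) set"
  assumes "subspace V" and lin: "\<And>f. f \<in> F \<Longrightarrow> linear f" and "\<And>f x. f \<in> F \<Longrightarrow> x \<in> V \<Longrightarrow> f x \<in> V"
    and "\<And>f x y. f \<in> F \<Longrightarrow> x \<in> V \<Longrightarrow> y \<in> V \<Longrightarrow> f x \<bullet> y = x \<bullet> f y"
    and "\<And>f g x. f \<in> F \<Longrightarrow> g \<in> F \<Longrightarrow> x \<in> V \<Longrightarrow> f (g x) = g (f x)"
  shows "\<exists>B. B \<subseteq> V \<and> pairwise orthogonal B \<and> (\<forall>b\<in>B. norm b = 1) \<and> span B = V \<and>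
     (\<forall>b\<in>B. \<forall>f\<in>F. \<exists>\<mu>. f b = \<mu> *\<^sub>R b)"
  using assms(1,3-5)
proof (induction "dim V" arbitrary: V rule: less_induct)
  case less
  note V = less.prems
  show ?case
  proof (cases "\<forall>f\<in>F. \<exists>\<mu>. \<forall>x\<in>V. f x = \<mu> *\<^sub>R x")
    case True
    obtain B where "B \<subseteq> V" "pairwise orthogonal B" "\<And>x. x \<in> B \<Longrightarrow> norm x = 1" "span B = V"
      using orthonormal_basis_subspace[OF V(1)] by metis
    then show ?thesis using True by (intro exI[of _ B]) blast
  next
    case False
    then obtain f where f: "f \<in> F" "\<And>\<mu>. \<exists>x\<in>V. f x \<noteq> \<mu> *\<^sub>R x" by blast
    have V0: "V \<noteq> {0}" using f(2)[of 0] linear_0[OF lin[OF f(1)]] by auto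
    have "bilinear (\<lambda>x y. f x \<bullet> y)"
      unfolding bilinear_def by (auto intro!: linearI simp: inner_add_left inner_add_right linear_add[OF lin[OF f(1)]] linear_cmul[OF lin[OF f(1)]])
    moreover have "inner_product_form ((\<bullet>) :: 'v \<Rightarrow> 'v \<Rightarrow> real)"
      by (auto simp: inner_product_form_def inner_commute bilinear_conv_bounded_bilinear bounded_bilinear_inner)
    ultimately obtain \<mu> x where x: "x \<in> V" "x \<noteq> 0" "\<And>y. y \<in> V \<Longrightarrow> f x \<bullet> y = \<mu> * (x \<bullet> y)"
      using form_extremum[of "(\<bullet>)" "\<lambda>x y. f x \<bullet> y" V] V(1,3) V0 f(1) by (metis inner_commute)
    have fx: "f x = \<mu> *\<^sub>R x"
    proof -
      have "f x - \<mu> *\<^sub>R x \<in> V" using V(1,2) f(1) x(1) by (intro subspace_diff subspace_scale) auto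
      from x(3)[OF this] have "(f x - \<mu> *\<^sub>R x) \<bullet> (f x - \<mu> *\<^sub>R x) = 0" by (simp add: inner_diff_left)
      then show ?thesis by simp
    qed
    define W where "W = {x \<in> V. f x = \<mu> *\<^sub>R x}"
    define W' where "W' = {x \<in> V. \<forall>w\<in>W. orthogonal w x}"
    have W: "subspace W" unfolding W_def
      using V(1) by (auto simp: subspace_def linear_0[OF lin[OF f(1)]] linear_add[OF lin[OF f(1)]] linear_cmul[OF lin[OF f(1)]] algebra_simps)
    have W': "subspace W'" unfolding W'_def
      using V(1) by (auto simp: subspace_def orthogonal_clauses)
    have sub: "W \<subseteq> V" "W' \<subseteq> V" by (auto simp: W_def W'_def)
    have xW: "x \<in> W" using x(1) fx by (simp add: W_def)
    have WV: "W \<noteq> V" using f(2)[of \<mu>] by (auto simp: W_def)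
    have W'V: "W' \<noteq> V"
    proof
      assume "W' = V"
      then have "orthogonal x x" using xW x(1) by (auto simp: W'_def)
      then show False using x(2) by (simp add: orthogonal_def)
    qed
    have dl: "dim W < dim V" "dim W' < dim V"
      using dim_psubset[of W V] dim_psubset[of W' V] sub WV W'V W W' V(1) by (metis psubsetI span_eq_iff)+
    have invW: "g w \<in> W" if "g \<in> F" "w \<in> W" for g w
    proof -
      have w: "w \<in> V" "f w = \<mu> *\<^sub>R w" using that(2) by (auto simp: W_def)
      have "f (g w) = g (f w)" using V(4) f(1) that(1) w(1) by blast
      also have "\<dots> = \<mu> *\<^sub>R g w" using w(2) linear_cmul[OF lin[OF that(1)]] by simp
      finally show ?thesis using V(2) that(1) w(1) by (simp add: W_def)
    qed
    have invW': "g w \<in> W'" if g: "g \<in> F" and w: "w \<in> W'" for g w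
      unfolding W'_def
    proof (intro CollectI conjI ballI)
      show "g w \<in> V" using V(2) g w sub by blast
      fix u assume u: "u \<in> W"
      have "u \<in> V" "w \<in> V" using u w sub by auto
      then have "u \<bullet> g w = g u \<bullet> w" using V(3)[OF g, of u w] by simp
      also have "\<dots> = 0" using invW[OF g u] w by (auto simp: W'_def orthogonal_def)
      finally show "orthogonal u (g w)" by (simp add: orthogonal_def)
    qed
    obtain B1 where B1: "B1 \<subseteq> W" "pairwise orthogonal B1" "\<forall>b\<in>B1. norm b = 1" "span B1 = W" "\<forall>b\<in>B1. \<forall>f\<in>F. \<exists>\<mu>. f b = \<mu> *\<^sub>R b"
    proof -
      have "\<exists>B. B \<subseteq> W \<and> pairwise orthogonal B \<and> (\<forall>b\<in>B. norm b = 1) \<and> span B = W \<and> (\<forall>b\<in>B. \<forall>f\<in>F. \<exists>\<mu>. f b = \<mu> *\<^sub>R b)"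
        by (rule less.hyps[OF dl(1) W]) (use invW V(3,4) sub(1) in \<open>blast+\<close>)
      then show thesis using that by blast
    qed
    obtain B2 where B2: "B2 \<subseteq> W'" "pairwise orthogonal B2" "\<forall>b\<in>B2. norm b = 1" "span B2 = W'" "\<forall>b\<in>B2. \<forall>f\<in>F. \<exists>\<mu>. f b = \<mu> *\<^sub>R b"
    proof -
      have "\<exists>B. B \<subseteq> W' \<and> pairwise orthogonal B \<and> (\<forall>b\<in>B. norm b = 1) \<and> span B = W' \<and> (\<forall>b\<in>B. \<forall>f\<in>F. \<exists>\<mu>. f b = \<mu> *\<^sub>R b)"
        by (rule less.hyps[OF dl(2) W']) (use invW' V(3,4) sub(2) in \<open>blast+\<close>)
      then show thesis using that by blast
    qed
    show ?thesis
    proof (intro exI[of _ "B1 \<union> B2"] conjI)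
      show "B1 \<union> B2 \<subseteq> V" using B1 B2 sub by blast
      show "pairwise orthogonal (B1 \<union> B2)"
      proof -
        have 1: "orthogonal x y" if "x \<in> B1" "y \<in> B2" for x y
          using B1(1) B2(1) that unfolding W'_def by blast
        then have "orthogonal y x" if "x \<in> B1" "y \<in> B2" for x y
          using that orthogonal_commute by blast
        with 1 show ?thesis using B1(2) B2(2) unfolding pairwise_def by blast
      qed
      show "span (B1 \<union> B2) = V"
      proof
        show "span (B1 \<union> B2) \<subseteq> V" using B1 B2 sub V(1) by (intro span_minimal) auto
        show "V \<subseteq> span (B1 \<union> B2)"
        proof
          fix v assume v: "v \<in> V"
          obtain y z where yz: "y \<in> span W" "\<And>w. w \<in> span W \<Longrightarrow> orthogonal z w" "v = y + z"
            using orthogonal_subspace_decomp_exists[of W v] by blast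
          have sW: "span W = W" using W span_eq_iff by blast
          have "z \<in> V" using yz(1,3) v V(1) sub sW subspace_diff[of V v y] by auto
          then have "z \<in> W'" using yz(2) sW by (auto simp: W'_def orthogonal_commute)
          then show "v \<in> span (B1 \<union> B2)"
            using yz(1,3) sW B1(4) B2(4) span_mono[of B1 "B1 \<union> B2"] span_mono[of B2 "B1 \<union> B2"]
            by (metis Un_upper1 Un_upper2 span_add subsetD)
        qed
      qed
    qed (use B1 B2 in auto)
  qed
qed

text \<open>The number \<open>r\<close> is not a type, so \<open>r \<times> r\<close> matrices are put as blocks into matrices over a finite
  index type.\<close>

definition emb :: "(nat \<Rightarrow> 'n) \<Rightarrow> nat \<Rightarrow> (nat \<Rightarrow> nat \<Rightarrow> real) \<Rightarrow> real^'n^'n" where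
  "emb \<iota> r h = (\<chi> p q. if p \<in> \<iota> ` {1..r} \<and> q \<in> \<iota> ` {1..r} then h (inv_into {1..r} \<iota> p) (inv_into {1..r} \<iota> q) else 0)"

lemma emb_nth:
  assumes "inj_on \<iota> {1..r}"
  shows "i \<in> {1..r} \<Longrightarrow> j \<in> {1..r} \<Longrightarrow> emb \<iota> r h $ \<iota> i $ \<iota> j = h i j"
    "p \<notin> \<iota> ` {1..r} \<Longrightarrow> emb \<iota> r h $ p $ q = 0" "q \<notin> \<iota> ` {1..r} \<Longrightarrow> emb \<iota> r h $ p $ q = 0"
  using assms by (auto simp: emb_def)

lemma emb_sum:
  fixes f :: "'n::finite \<Rightarrow> real"
  assumes "inj_on \<iota> {1..r}" "\<And>p. p \<notin> \<iota> ` {1..r} \<Longrightarrow> f p = 0"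
  shows "(\<Sum>p\<in>UNIV. f p) = (\<Sum>i\<in>{1..r}. f (\<iota> i))"
proof -
  have "(\<Sum>p\<in>UNIV. f p) = (\<Sum>p\<in>\<iota> ` {1..r}. f p)"
    by (rule sum.mono_neutral_right) (use assms(2) in auto)
  then show ?thesis by (simp add: sum.reindex[OF assms(1)])
qed

lemma emb_mult:
  fixes \<iota> :: "nat \<Rightarrow> 'n::finite"
  assumes i: "inj_on \<iota> {1..r}"
  shows "emb \<iota> r h ** emb \<iota> r k = emb \<iota> r (\<lambda>i j. \<Sum>l\<in>{1..r}. h i l * k l j)"
proof -
  have "(\<Sum>l\<in>UNIV. emb \<iota> r h $ p $ l * emb \<iota> r k $ l $ q) = emb \<iota> r (\<lambda>i j. \<Sum>l\<in>{1..r}. h i l * k l j) $ p $ q" for p q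
  proof (cases "p \<in> \<iota> ` {1..r} \<and> q \<in> \<iota> ` {1..r}")
    case True
    then obtain a b where ab: "p = \<iota> a" "q = \<iota> b" "a \<in> {1..r}" "b \<in> {1..r}" by blast
    have "(\<Sum>l\<in>UNIV. emb \<iota> r h $ p $ l * emb \<iota> r k $ l $ q)
        = (\<Sum>l\<in>{1..r}. emb \<iota> r h $ p $ \<iota> l * emb \<iota> r k $ \<iota> l $ q)"
      by (rule emb_sum[OF i]) (simp add: emb_nth(2)[OF i])
    also have "\<dots> = (\<Sum>l\<in>{1..r}. h a l * k l b)"
      unfolding ab by (intro sum.cong refl) (simp only: emb_nth(1)[OF i] ab(3,4))
    finally show ?thesis unfolding ab by (simp only: emb_nth(1)[OF i ab(3,4)])
  next
    case False
    then show ?thesis by (auto simp: emb_nth[OF i])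
  qed
  then show ?thesis by (simp add: vec_eq_iff matrix_matrix_mult_def)
qed

lemma emb_cong: "(\<And>i j. i \<in> {1..r} \<Longrightarrow> j \<in> {1..r} \<Longrightarrow> h i j = k i j) \<Longrightarrow> emb \<iota> r h = emb \<iota> r k"
proof -
  assume "\<And>i j. i \<in> {1..r} \<Longrightarrow> j \<in> {1..r} \<Longrightarrow> h i j = k i j"
  moreover have "inv_into {1..r} \<iota> p \<in> {1..r}" if "p \<in> \<iota> ` {1..r}" for p
    using that by (rule inv_into_into)
  ultimately show ?thesis unfolding emb_def vec_eq_iff by (simp del: atLeastAtMost_iff)
qed

text \<open>Common eigenvectors are sought in the coordinate subspace of the embedded block, away
  from the zero rows. Their coordinates are the rows of the orthogonal matrix; the column relations
  express completeness of the eigenbasis.\<close>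

lemma simultaneous_diagonalization:
  fixes \<iota> :: "nat \<Rightarrow> 'n::finite" and h :: "'t \<Rightarrow> nat \<Rightarrow> nat \<Rightarrow> real"
  assumes i: "inj_on \<iota> {1..r}"
    and sym: "\<And>t i j. t \<in> T \<Longrightarrow> i \<in> {1..r} \<Longrightarrow> j \<in> {1..r} \<Longrightarrow> h t i j = h t j i"
    and comm: "\<And>s t. s \<in> T \<Longrightarrow> t \<in> T \<Longrightarrow> adm (emb \<iota> r (h s)) (emb \<iota> r (h t)) = 0"
  shows "\<exists>P. (\<forall>i\<in>{1..r}. \<forall>j\<in>{1..r}. (\<Sum>k\<in>{1..r}. P i k * P j k) = (if i = j then 1 else 0)) \<and>
     (\<forall>i\<in>{1..r}. \<forall>j\<in>{1..r}. (\<Sum>k\<in>{1..r}. P k i * P k j) = (if i = j then 1 else 0)) \<and>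
     (\<forall>t\<in>T. \<forall>i\<in>{1..r}. \<forall>j\<in>{1..r}. i \<noteq> j \<longrightarrow> (\<Sum>k\<in>{1..r}. \<Sum>l\<in>{1..r}. P i k * h t k l * P j l) = (0::real))"
proof -
  let ?R = "\<iota> ` {1..r}"
  define V where "V = span ((\<lambda>p. axis p (1::real)) ` ?R)"
  define F where "F = (\<lambda>t x. emb \<iota> r (h t) *v x) ` T"
  have V0: "x $ p = 0" if "x \<in> V" "p \<notin> ?R" for x p
  proof -
    have "V \<subseteq> {x. \<forall>p. p \<notin> ?R \<longrightarrow> x $ p = 0}" unfolding V_def
    proof (rule span_minimal)
      show "subspace {x :: real^'n. \<forall>p. p \<notin> ?R \<longrightarrow> x $ p = 0}" by (auto simp: subspace_def)
    qed (auto simp: axis_def)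
    then show ?thesis using that by blast
  qed
  have V1: "x \<in> V" if "\<And>p. p \<notin> ?R \<Longrightarrow> x $ p = 0" for x
  proof -
    have "x = (\<Sum>p\<in>?R. x $ p *\<^sub>R axis p 1)"
      using that by (auto simp: vec_eq_iff axis_def if_distrib if_distribR sum.delta cong: if_cong)
    also have "\<dots> \<in> V" unfolding V_def by (intro span_sum span_scale span_base) auto
    finally show ?thesis .
  qed
  have embv: "emb \<iota> r (h t) *v x \<in> V" for t x
    by (rule V1) (auto simp: matrix_vector_mult_def emb_nth[OF i])
  have Mt: "transpose (emb \<iota> r (h t)) = emb \<iota> r (h t)" if "t \<in> T" for t
  proof -
    have "inv_into {1..r} \<iota> p \<in> {1..r}" if "p \<in> ?R" for p using that by (rule inv_into_into)
    then show ?thesis using sym[OF that] unfolding transpose_def emb_def vec_eq_iff by (simp del: atLeastAtMost_iff)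
  qed
  have "\<exists>B. B \<subseteq> V \<and> pairwise orthogonal B \<and> (\<forall>b\<in>B. norm b = 1) \<and> span B = V \<and>
     (\<forall>b\<in>B. \<forall>f\<in>F. \<exists>\<mu>. f b = \<mu> *\<^sub>R b)"
  proof (rule common_eigenbasis)
    show "subspace V" by (simp add: V_def)
    show "linear f" if "f \<in> F" for f using that by (auto simp: F_def)
    show "f x \<in> V" if "f \<in> F" for f x using that embv by (auto simp: F_def)
    show "f x \<bullet> y = x \<bullet> f y" if "f \<in> F" for f x y
      using that Mt by (auto simp: F_def) (metis dot_lmul_matrix inner_commute transpose_matrix_vector)
    show "f (g x) = g (f x)" if "f \<in> F" "g \<in> F" for f g x
      using that comm by (auto simp: F_def adm_def matrix_vector_mul_assoc)
  qed
  then obtain B where B: "B \<subseteq> V" "pairwise orthogonal B" "\<And>b. b \<in> B \<Longrightarrow> norm b = 1" "span B = V"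
     "\<And>b f. b \<in> B \<Longrightarrow> f \<in> F \<Longrightarrow> \<exists>\<mu>. f b = \<mu> *\<^sub>R b" by blast
  have ind: "independent B" by (rule pairwise_orthogonal_independent[OF B(2)]) (use B(3) in force)
  have "card B = dim V" using ind B(4) dim_span_eq_card_independent by metis
  also have "\<dots> = card ((\<lambda>p. axis p (1::real)) ` ?R)"
    unfolding V_def
    by (rule dim_span_eq_card_independent) (rule independent_mono[OF independent_Basis], auto simp: Basis_vec_def)
  also have "\<dots> = r"
  proof -
    have "inj (\<lambda>p::'n. axis p (1::real))" by (auto simp: inj_def axis_eq_axis)
    then show ?thesis using i by (simp add: card_image inj_on_subset)
  qed
  finally have "card B = card {1..r}" by simp
  moreover have "finite B" using ind independent_imp_finite by blast
  ultimately obtain b where b: "bij_betw b {1..r} B" using finite_same_card_bij[of "{1..r}" B] by auto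
  have bB: "b i \<in> B" if "i \<in> {1..r}" for i using b that bij_betwE by blast
  have bb: "b i \<bullet> b j = (if i = j then 1 else 0)" if "i \<in> {1..r}" "j \<in> {1..r}" for i j
  proof (cases "i = j")
    case True
    then show ?thesis using B(3)[OF bB[OF that(1)]] by (simp add: norm_eq_1)
  next
    case False
    then have "b i \<noteq> b j" using b that by (meson bij_betw_imp_inj_on inj_onD)
    then show ?thesis using False B(2) bB that by (auto simp: pairwise_def orthogonal_def)
  qed
  have ip: "x \<bullet> y = (\<Sum>k\<in>{1..r}. x $ \<iota> k * y $ \<iota> k)" if "x \<in> V" for x y
    using emb_sum[OF i, of "\<lambda>p. x $ p * y $ p"] V0[OF that] by (simp add: inner_vec_def)
  show ?thesis
  proof (intro exI[of _ "\<lambda>i k. b i $ \<iota> k"] conjI ballI impI)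
    fix i j assume ij: "i \<in> {1..r}" "j \<in> {1..r}"
    show "(\<Sum>k\<in>{1..r}. b i $ \<iota> k * b j $ \<iota> k) = (if i = j then 1 else 0)"
      using ip[of "b i" "b j"] bb[OF ij] B(1) bB[OF ij(1)] by auto
  next
    fix k l assume kl: "k \<in> {1..r}" "l \<in> {1..r}"
    have "axis (\<iota> k) 1 \<in> span B" unfolding B(4) V_def using kl by (intro span_base) auto
    then have "(\<Sum>b\<in>B. (axis (\<iota> k) 1 \<bullet> b) *\<^sub>R b) = axis (\<iota> k) 1"
      using orthonormal_basis_expand[OF B(2,3) _ \<open>finite B\<close>] by blast
    then have "(\<Sum>i\<in>{1..r}. (axis (\<iota> k) 1 \<bullet> b i) *\<^sub>R b i) = axis (\<iota> k) 1"
      using sum.reindex_bij_betw[OF b, of "\<lambda>b. (axis (\<iota> k) 1 \<bullet> b) *\<^sub>R b"] by simp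
    then have "(\<Sum>i\<in>{1..r}. (axis (\<iota> k) 1 \<bullet> b i) *\<^sub>R b i) $ \<iota> l = axis (\<iota> k) 1 $ \<iota> l" by simp
    moreover have "axis (\<iota> k) 1 $ \<iota> l = (if k = l then 1 else (0::real))"
      using inj_onD[OF i _ kl] by (auto simp: axis_def)
    ultimately show "(\<Sum>i\<in>{1..r}. b i $ \<iota> k * b i $ \<iota> l) = (if k = l then 1 else 0)"
      by (simp add: sum_component inner_axis' )
  next
    fix t i' j assume t: "t \<in> T" and ij: "i' \<in> {1..r}" "j \<in> {1..r}" "i' \<noteq> j"
    let ?M = "emb \<iota> r (h t)"
    obtain \<mu> where \<mu>: "?M *v b j = \<mu> *\<^sub>R b j" using B(5)[OF bB[OF ij(2)]] t by (auto simp: F_def)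
    have "0 = b i' \<bullet> (?M *v b j)" using bb[OF ij(1,2)] ij(3) \<mu> by simp
    also have "\<dots> = (\<Sum>k\<in>{1..r}. b i' $ \<iota> k * (\<Sum>l\<in>{1..r}. ?M $ \<iota> k $ \<iota> l * b j $ \<iota> l))"
    proof -
      have "(?M *v b j) $ p = (\<Sum>l\<in>{1..r}. ?M $ p $ \<iota> l * b j $ \<iota> l)" for p
        unfolding matrix_vector_mult_def using emb_sum[OF i, of "\<lambda>q. ?M $ p $ q * b j $ q"] by (simp add: emb_nth[OF i])
      then show ?thesis using ip[of "b i'"] B(1) bB[OF ij(1)] by auto
    qed
    also have "\<dots> = (\<Sum>k\<in>{1..r}. \<Sum>l\<in>{1..r}. b i' $ \<iota> k * h t k l * b j $ \<iota> l)"
      by (simp add: emb_nth[OF i] sum_distrib_left mult.assoc)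
    finally show "(\<Sum>k\<in>{1..r}. \<Sum>l\<in>{1..r}. b i' $ \<iota> k * h t k l * b j $ \<iota> l) = 0" by simp
  qed
qed

section \<open>Invariant forms on a representation\<close>

definition onb :: "('l::euclidean_space \<Rightarrow> 'l \<Rightarrow> real) \<Rightarrow> 'l set \<Rightarrow> 'l set \<Rightarrow> bool" where
  "onb Q B W \<longleftrightarrow> finite B \<and> (\<forall>b\<in>B. \<forall>c\<in>B. Q b c = (if b = c then 1 else 0)) \<and> span B = W"

lemma inner_product_formD:
  assumes "inner_product_form Q"
  shows "bilinear Q" "Q x y = Q y x" "x \<noteq> 0 \<Longrightarrow> Q x x > 0" "Q x x = 0 \<longleftrightarrow> x = 0"
  using assms by (force simp: inner_product_form_def bilinear_lzero)+

lemma onb_mem: "onb Q B W \<Longrightarrow> b \<in> B \<Longrightarrow> b \<in> W"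
  by (auto simp: onb_def span_base)

lemma onb_expand:
  assumes Q: "inner_product_form Q" and B: "onb Q B W" and w: "w \<in> W"
  shows "w = (\<Sum>b\<in>B. Q w b *\<^sub>R b)"
proof -
  note bil = inner_product_formD(1)[OF Q]
  have fin: "finite B" and orth: "\<And>b c. b \<in> B \<Longrightarrow> c \<in> B \<Longrightarrow> Q b c = (if b = c then 1 else 0)"
    and "w \<in> span B" using B w by (auto simp: onb_def)
  from \<open>w \<in> span B\<close> show ?thesis
  proof (induction rule: span_induct)
    case base
    have "(\<Sum>b\<in>B. Q (c *\<^sub>R x) b *\<^sub>R b) = c *\<^sub>R (\<Sum>b\<in>B. Q x b *\<^sub>R b)" for c x
      by (simp add: bilinear_lmul[OF bil] scaleR_sum_right)
    then show "subspace {x. x = (\<Sum>b\<in>B. Q x b *\<^sub>R b)}"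
      by (auto simp: subspace_def bilinear_lzero[OF bil] bilinear_ladd[OF bil] scaleR_add_left sum.distrib)
  next
    case (step x)
    have "(\<Sum>b\<in>B. Q x b *\<^sub>R b) = (\<Sum>b\<in>B. if x = b then b else 0)"
      by (intro sum.cong refl) (simp add: orth step)
    then show ?case using fin step by simp
  qed
qed

lemma form_eqI:
  assumes Q: "inner_product_form Q" and W: "subspace W" and "x \<in> W" "y \<in> W" "\<And>w. w \<in> W \<Longrightarrow> Q x w = Q y w"
  shows "x = y"
proof -
  have "x - y \<in> W" using assms by (simp add: subspace_diff)
  then have "Q (x - y) (x - y) = 0" using assms(5) by (simp add: bilinear_lsub[OF inner_product_formD(1)[OF Q]])
  then show ?thesis using inner_product_formD(4)[OF Q] by simp
qed

text \<open>Gram-Schmidt with respect to \<open>Q\<close>; a vector dependent on its predecessors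
  leaves \<open>y = 0\<close> and is skipped.\<close>

lemma onb_exists:
  fixes Q :: "'l::euclidean_space \<Rightarrow> 'l \<Rightarrow> real"
  assumes Q: "inner_product_form Q" and W: "subspace W"
  shows "\<exists>B. onb Q B W"
proof -
  note bil = inner_product_formD(1)[OF Q] and sym = inner_product_formD(2)[OF Q]
  have "\<exists>B. onb Q B (span S)" if "finite S" for S
    using that
  proof (induction S)
    case empty
    have "onb Q {} (span {})" by (simp add: onb_def)
    then show ?case by blast
  next
    case (insert x S)
    then obtain B where B: "onb Q B (span S)" by blast
    define y where "y = x - (\<Sum>b\<in>B. Q x b *\<^sub>R b)"
    have fin: "finite B" and orth: "\<And>b c. b \<in> B \<Longrightarrow> c \<in> B \<Longrightarrow> Q b c = (if b = c then 1 else 0)"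
      and sp: "span B = span S" using B by (auto simp: onb_def)
    have proj: "(\<Sum>b\<in>B. Q x b *\<^sub>R b) \<in> span B" by (intro span_sum span_scale span_base)
    have Qy: "Q y c = 0" if "c \<in> B" for c
    proof -
      have "Q (\<Sum>b\<in>B. Q x b *\<^sub>R b) c = (\<Sum>b\<in>B. Q (Q x b *\<^sub>R b) c)"
        using linear_sum[of "\<lambda>v. Q v c"] bil by (simp add: bilinear_def)
      also have "\<dots> = (\<Sum>b\<in>B. if b = c then Q x b else 0)"
        by (intro sum.cong refl) (simp add: bilinear_lmul[OF bil] orth that)
      also have "\<dots> = Q x c" using fin that by simp
      finally show ?thesis by (simp add: y_def bilinear_lsub[OF bil])
    qed
    have ins: "span (insert x S) = span (insert y B)"
    proof -
      have "span (insert x S) = span (insert x B)" by (metis sp span_insert)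
      also have "\<dots> = span (insert y B)"
        using eq_span_insert_eq[of x y B] proj by (simp add: y_def)
      finally show ?thesis .
    qed
    show ?case
    proof (cases "y = 0")
      case True
      then have "span (insert x S) = span B" using ins span_insert_0 by metis
      then show ?thesis using B sp by auto
    next
      case False
      define u where "u = y /\<^sub>R sqrt (Q y y)"
      have pos: "Q y y > 0" using inner_product_formD(3)[OF Q False] .
      have uu: "Q u u = 1" using pos
        by (simp add: u_def bilinear_lmul[OF bil] bilinear_rmul[OF bil] field_simps)
      have ub: "Q u b = 0" "Q b u = 0" if "b \<in> B" for b
        using Qy[OF that] sym[of b u] by (auto simp: u_def bilinear_lmul[OF bil])
      have "span (insert y B) = span (insert u B)"
      proof -
        have "sqrt (Q y y) *\<^sub>R u = y" using pos by (simp add: u_def)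
        then have "y \<in> span (insert u B)" by (metis insertI1 span_base span_scale)
        moreover have "u \<in> span (insert y B)" unfolding u_def by (intro span_scale span_base) simp
        ultimately show ?thesis
          by (intro equalityI span_minimal subspace_span) (auto intro: span_base)
      qed
      then have "onb Q (insert u B) (span (insert x S))"
        using fin uu ub orth ins ub[of u] by (auto simp: onb_def)
      then show ?thesis by blast
    qed
  qed
  moreover obtain S where "S \<subseteq> W" "independent S" "W \<subseteq> span S" using basis_exists by metis
  then have "finite S" "span S = W" using independent_imp_finite W span_minimal by blast+
  ultimately show ?thesis by metis
qed

lemma bilinear_sum_left: "bilinear f \<Longrightarrow> f (\<Sum>i\<in>S. x i) y = (\<Sum>i\<in>S. f (x i) y)"
  and bilinear_sum_right: "bilinear f \<Longrightarrow> f y (\<Sum>i\<in>S. x i) = (\<Sum>i\<in>S. f y (x i))"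
  by (simp_all add: bilinear_def linear_sum[of "\<lambda>v. f v y"] linear_sum)

text \<open>Invariance is restricted to \<open>V\<close> and \<open>W\<close>, because forms
  obtained by composition with an equivalence of summands are known to be invariant there
  only.\<close>

definition invar :: "('g \<Rightarrow> 'l \<Rightarrow> 'l) \<Rightarrow> 'g set \<Rightarrow> ('l::euclidean_space \<Rightarrow> 'l \<Rightarrow> real) \<Rightarrow> 'l set \<Rightarrow> 'l set \<Rightarrow> bool" where
  "invar \<rho> K h V W \<longleftrightarrow> bilinear h \<and> (\<forall>a\<in>K. \<forall>x\<in>V. \<forall>y\<in>W. h (\<rho> a x) (\<rho> a y) = h x y)"

section \<open>Schur's lemma for invariant bilinear forms\<close>

locale orthogonal_action =
  fixes \<rho> :: "'g \<Rightarrow> 'l::euclidean_space \<Rightarrow> 'l" and K :: "'g set" and Q :: "'l \<Rightarrow> 'l \<Rightarrow> real"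
  assumes Q: "inner_product_form Q" and rho_linear: "\<And>a. linear (\<rho> a)"
    and rho_Q: "\<And>a x y. a \<in> K \<Longrightarrow> Q (\<rho> a x) (\<rho> a y) = Q x y"
begin

lemmas Q_bil = inner_product_formD(1)[OF Q] and Q_sym = inner_product_formD(2)[OF Q]
  and Q_zero = inner_product_formD(4)[OF Q] and Q_pos = inner_product_formD(3)[OF Q]

lemma rho_image:
  assumes V: "invariant_subspace \<rho> K V" and a: "a \<in> K"
  shows "\<rho> a ` V = V"
proof -
  have inj: "inj (\<rho> a)" unfolding linear_injective_0[OF rho_linear]
    using rho_Q[OF a] Q_zero by (metis bilinear_lzero[OF Q_bil])
  have sub: "subspace V" "\<rho> a ` V \<subseteq> V" using V a by (auto simp: invariant_subspace_def)
  have "dim (\<rho> a ` V) = dim V" using inj by (intro dim_image_eq[OF rho_linear] inj_on_subset[OF inj]) simp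
  moreover have "subspace (\<rho> a ` V)" using sub(1) rho_linear linear_subspace_image by blast
  ultimately show ?thesis using subspace_dim_equal[of "\<rho> a ` V" V] sub by simp
qed

lemma irreducible_eqI:
  assumes "irreducible_rep \<rho> K V" "invariant_subspace \<rho> K W" "W \<subseteq> V" "x \<in> W" "x \<noteq> 0"
  shows "W = V"
  using assms by (auto simp: irreducible_rep_def)

text \<open>An extremum of \<open>h\<close> relative to \<open>Q\<close> is an eigenvector. Its
  eigenspace is a nonzero invariant subspace, hence everything.\<close>

lemma schur_symmetric:
  assumes V: "irreducible_rep \<rho> K V" and h: "invar \<rho> K h V V"
    and sym: "\<And>x y. x \<in> V \<Longrightarrow> y \<in> V \<Longrightarrow> h x y = h y x"
  shows "\<exists>\<mu>. \<forall>x\<in>V. \<forall>y\<in>V. h x y = \<mu> * Q x y"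
proof -
  have bil: "bilinear h" using h by (simp add: invar_def)
  have inv: "invariant_subspace \<rho> K V" and ne: "V \<noteq> {0}" and sub: "subspace V"
    using V by (auto simp: irreducible_rep_def invariant_subspace_def)
  obtain \<mu> x where x: "x \<in> V" "x \<noteq> 0" "\<And>y. y \<in> V \<Longrightarrow> h x y = \<mu> * Q x y"
    using form_extremum[OF Q bil sym sub ne] by blast
  define W where "W = {x \<in> V. \<forall>y\<in>V. h x y = \<mu> * Q x y}"
  have "subspace W" using sub unfolding W_def
    by (auto simp: subspace_def bilinear_lzero[OF bil] bilinear_lzero[OF Q_bil] bilinear_ladd[OF bil]
        bilinear_ladd[OF Q_bil] bilinear_lmul[OF bil] bilinear_lmul[OF Q_bil] algebra_simps)
  moreover have "\<rho> a x \<in> W" if a: "a \<in> K" and x: "x \<in> W" for a x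
  proof -
    have "h (\<rho> a x) y = \<mu> * Q (\<rho> a x) y" if "y \<in> V" for y
    proof -
      have "y \<in> \<rho> a ` V" using that rho_image[OF inv a] by simp
      then obtain z where "z \<in> V" "y = \<rho> a z" by (rule imageE)
      then show ?thesis using h x a rho_Q by (simp add: W_def invar_def)
    qed
    then show ?thesis using rho_image[OF inv a] x by (auto simp: W_def)
  qed
  ultimately have "invariant_subspace \<rho> K W" by (auto simp: invariant_subspace_def)
  moreover have "W \<subseteq> V" "x \<in> W" using x by (auto simp: W_def)
  ultimately have "W = V" using irreducible_eqI[OF V _ _ _ x(2)] by blast
  then show ?thesis by (auto simp: W_def)
qed

text \<open>Kernel and image are invariant subspaces, and one nonzero value leaves a single
  possibility for each.\<close>

lemma intertwiner_equivalence:
  assumes V: "irreducible_rep \<rho> K V" and W: "irreducible_rep \<rho> K W" and T: "linear T" "T ` V \<subseteq> W"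
    and eq: "\<And>a x. a \<in> K \<Longrightarrow> x \<in> V \<Longrightarrow> T (\<rho> a x) = \<rho> a (T x)" and x: "x \<in> V" "T x \<noteq> 0"
  shows "equivalence_map \<rho> K V W T"
proof -
  have sub: "subspace V" and inv: "\<And>a. a \<in> K \<Longrightarrow> \<rho> a ` V \<subseteq> V"
    using V by (auto simp: irreducible_rep_def invariant_subspace_def)
  let ?N = "{x \<in> V. T x = 0}"
  have N: "invariant_subspace \<rho> K ?N"
    using sub inv linear_0[OF rho_linear] by (auto simp: invariant_subspace_def subspace_def linear_0[OF T(1)] linear_add[OF T(1)]
        linear_cmul[OF T(1)] eq)
  have "?N \<noteq> V" using x by auto
  then have N0: "?N = {0}" using V N unfolding irreducible_rep_def by blast
  have "inj_on T V"
  proof (rule inj_onI)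
    fix x y assume "x \<in> V" "y \<in> V" "T x = T y"
    then have "x - y \<in> ?N" using sub by (simp add: subspace_diff linear_diff[OF T(1)])
    then show "x = y" using N0 by simp
  qed
  moreover have "invariant_subspace \<rho> K (T ` V)"
    unfolding invariant_subspace_def
  proof (intro conjI ballI subsetI)
    show "subspace (T ` V)" using sub T(1) linear_subspace_image by blast
    fix a y assume "a \<in> K" "y \<in> \<rho> a ` T ` V"
    then obtain x where "a \<in> K" "x \<in> V" "y = T (\<rho> a x)" using eq by force
    then show "y \<in> T ` V" using inv by blast
  qed
  then have "T ` V = W" using irreducible_eqI[OF W _ T(2)] x by blast
  ultimately show ?thesis using T(1) eq by (simp add: equivalence_map_def bij_betw_def)
qed

text \<open>The operator represents \<open>h\<close> through \<open>Q\<close>. Building it from an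
  orthonormal basis of \<open>W\<close> places its values in \<open>W\<close>, and nondegeneracy
  turns invariance of \<open>h\<close> into commutation with the action.\<close>

lemma invar_operator:
  assumes W: "invariant_subspace \<rho> K W" and h: "invar \<rho> K h V W" and V: "invariant_subspace \<rho> K V"
  shows "\<exists>T. linear T \<and> (\<forall>x. T x \<in> W) \<and> (\<forall>x. \<forall>y\<in>W. Q (T x) y = h x y) \<and> (\<forall>a\<in>K. \<forall>x\<in>V. T (\<rho> a x) = \<rho> a (T x))"
proof -
  have bil: "bilinear h" and inv: "\<And>a x y. a \<in> K \<Longrightarrow> x \<in> V \<Longrightarrow> y \<in> W \<Longrightarrow> h (\<rho> a x) (\<rho> a y) = h x y"
    using h by (auto simp: invar_def)
  have sub: "subspace W" using W by (simp add: invariant_subspace_def)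
  obtain F where F: "onb Q F W" using onb_exists[OF Q sub] by blast
  define T where "T x = (\<Sum>f\<in>F. h x f *\<^sub>R f)" for x
  have lin: "linear T" unfolding T_def
    by (intro linearI) (simp_all add: bilinear_ladd[OF bil] bilinear_lmul[OF bil] scaleR_add_left sum.distrib scaleR_sum_right)
  have TW: "T x \<in> W" for x unfolding T_def using F sub by (intro subspace_sum subspace_scale) (auto dest: onb_mem)
  have TQ: "Q (T x) y = h x y" if "y \<in> W" for x y
  proof -
    have "Q (T x) y = (\<Sum>f\<in>F. h x f * Q y f)"
      by (simp add: T_def bilinear_sum_left[OF Q_bil] bilinear_lmul[OF Q_bil] Q_sym[of y])
    also have "\<dots> = h x (\<Sum>f\<in>F. Q y f *\<^sub>R f)"
      by (simp add: bilinear_sum_right[OF bil] bilinear_rmul[OF bil] mult.commute)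
    also have "\<dots> = h x y" by (simp only: onb_expand[OF Q F that, symmetric])
    finally show ?thesis .
  qed
  have "T (\<rho> a x) = \<rho> a (T x)" if a: "a \<in> K" and x: "x \<in> V" for a x
  proof (rule form_eqI[OF Q sub TW])
    show "\<rho> a (T x) \<in> W" using TW rho_image[OF W a] imageI[of "T x" W "\<rho> a"] by simp
    fix w assume "w \<in> W"
    then have "w \<in> \<rho> a ` W" using rho_image[OF W a] by simp
    then obtain z where z: "z \<in> W" "w = \<rho> a z" by (rule imageE) 
    then show "Q (T (\<rho> a x)) w = Q (\<rho> a (T x)) w"
      using \<open>w \<in> W\<close> inv[OF a x] rho_Q[OF a] TQ by metis
  qed
  with lin TW TQ show ?thesis by blast
qed

lemma schur_inequivalent:
  assumes V: "irreducible_rep \<rho> K V" and W: "irreducible_rep \<rho> K W" and ne: "\<not> equivalent_reps \<rho> K V W"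
    and h: "invar \<rho> K h V W" and xy: "x \<in> V" "y \<in> W"
  shows "h x y = 0"
proof -
  have "invariant_subspace \<rho> K V" "invariant_subspace \<rho> K W" using V W by (auto simp: irreducible_rep_def)
  then obtain T where T: "linear T" "\<And>x. T x \<in> W" "\<And>x y. y \<in> W \<Longrightarrow> Q (T x) y = h x y"
    "\<And>a x. a \<in> K \<Longrightarrow> x \<in> V \<Longrightarrow> T (\<rho> a x) = \<rho> a (T x)"
    using invar_operator[OF _ h] by blast
  have "T x = 0"
    using intertwiner_equivalence[OF V W T(1) _ T(4) xy(1)] T(2) ne by (auto simp: equivalent_reps_def)
  then show ?thesis using T(3)[OF xy(2), of x] by (simp add: bilinear_lzero[OF Q_bil])
qed

text \<open>The form \<open>Q (J x) (J y)\<close> is symmetric and invariant, so it is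
  \<open>\<nu> * Q x y\<close>. If \<open>\<nu>\<close> were positive, \<open>J\<close> divided by
  its square root would be an invariant complex structure, and its graph a proper complex invariant
  subspace of the complexification.\<close>

lemma schur_skew:
  assumes V: "orthogonal_rep \<rho> K V" and h: "invar \<rho> K h V V"
    and skew: "\<And>x y. x \<in> V \<Longrightarrow> y \<in> V \<Longrightarrow> h x y = - h y x" and xy: "x \<in> V" "y \<in> V"
  shows "h x y = 0"
proof -
  have irr: "irreducible_rep \<rho> K V" using V by (simp add: orthogonal_rep_def)
  then have inv: "invariant_subspace \<rho> K V" and sub: "subspace V" and ne: "V \<noteq> {0}"
    by (auto simp: irreducible_rep_def invariant_subspace_def)
  obtain J where J: "linear J" "\<And>x. J x \<in> V" "\<And>x y. y \<in> V \<Longrightarrow> Q (J x) y = h x y"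
    "\<And>a x. a \<in> K \<Longrightarrow> x \<in> V \<Longrightarrow> J (\<rho> a x) = \<rho> a (J x)"
    using invar_operator[OF inv h inv] by blast
  note Jlin = linear_0[OF J(1)] linear_add[OF J(1)] linear_cmul[OF J(1)]
  have "bilinear (\<lambda>x y. Q (J x) (J y))"
    by (simp add: bilinear_def linear_iff bilinear_ladd[OF Q_bil] bilinear_radd[OF Q_bil]
        bilinear_lmul[OF Q_bil] bilinear_rmul[OF Q_bil] Jlin)
  then have "invar \<rho> K (\<lambda>x y. Q (J x) (J y)) V V"
    by (simp add: invar_def J(4) rho_Q)
  then obtain \<nu> where \<nu>: "\<And>x y. x \<in> V \<Longrightarrow> y \<in> V \<Longrightarrow> Q (J x) (J y) = \<nu> * Q x y"
    using schur_symmetric[OF irr, of "\<lambda>x y. Q (J x) (J y)"] Q_sym by blast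
  obtain v where v: "v \<in> V" "v \<noteq> 0" using ne sub subspace_0 by blast
  have "\<nu> \<ge> 0"
  proof -
    have "\<nu> * Q v v \<ge> 0" using \<nu>[OF v(1) v(1)] Q_pos[of "J v"] by (cases "J v = 0") (auto simp: bilinear_lzero[OF Q_bil])
    then show ?thesis using Q_pos[OF v(2)] by (simp add: zero_le_mult_iff)
  qed
  moreover have "\<not> \<nu> > 0"
  proof
    assume pos: "\<nu> > 0"
    define s where "s = sqrt \<nu>"
    have s: "s * s = \<nu>" "s \<noteq> 0" using pos by (auto simp: s_def)
    have JJ: "J (J x) = (- \<nu>) *\<^sub>R x" if x: "x \<in> V" for x
    proof (rule form_eqI[OF Q sub])
      fix w assume w: "w \<in> V"
      have "Q (J (J x)) w = - Q (J w) (J x)" using J(3)[OF w, of "J x"] J(3)[OF J(2), of w x] skew[OF J(2) w] by simp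
      then show "Q (J (J x)) w = Q ((- \<nu>) *\<^sub>R x) w"
        using \<nu>[OF w x] Q_sym[of w x] bilinear_lmul[OF Q_bil, of "- \<nu>" x w] by simp
    qed (use x sub J(2) in \<open>auto intro: subspace_scale subspace_neg\<close>)
    define W where "W = (\<lambda>x. (x, (1/s) *\<^sub>R J x)) ` V"
    have "linear (\<lambda>x. (x, (1/s) *\<^sub>R J x))"
      by (intro linearI) (simp_all add: Jlin scaleR_add_right)
    then have "subspace W" unfolding W_def using sub linear_subspace_image by blast
    moreover have "map_prod (\<rho> a) (\<rho> a) ` W \<subseteq> W" if a: "a \<in> K" for a
    proof -
      have "(\<rho> a x, \<rho> a ((1/s) *\<^sub>R J x)) = (\<lambda>x. (x, (1/s) *\<^sub>R J x)) (\<rho> a x)" if "x \<in> V" for x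
        using J(4)[OF a that] linear_cmul[OF rho_linear] by simp
      moreover have "\<rho> a x \<in> V" if "x \<in> V" for x using rho_image[OF inv a] that by blast
      ultimately show ?thesis by (auto simp: W_def simp del: scaleR_eq_0_iff)
    qed
    ultimately have "invariant_subspace (\<lambda>a. map_prod (\<rho> a) (\<rho> a)) K W" by (simp add: invariant_subspace_def)
    moreover have "W \<subseteq> V \<times> V" using J(2) sub by (auto simp: W_def subspace_scale)
    moreover have "(- y, x) \<in> W" if "(x, y) \<in> W" for x y
    proof -
      have x: "x \<in> V" and y: "y = (1/s) *\<^sub>R J x" using that by (auto simp: W_def)
      have "(1/s) *\<^sub>R J (- y) = x"
        using s by (simp add: y linear_neg[OF J(1)] Jlin JJ[OF x] flip: s(1))
      moreover have "- y \<in> V" using J(2) sub y by (simp add: subspace_scale subspace_neg)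
      ultimately show ?thesis by (auto simp: W_def image_iff intro!: bexI[of _ "- y"])
    qed
    ultimately have "W = {0} \<or> W = V \<times> V" using V unfolding orthogonal_rep_def by blast
    then show False
    proof
      assume "W = {0}"
      moreover have "(v, (1/s) *\<^sub>R J v) \<in> W" using v by (auto simp: W_def)
      ultimately show False using v by (auto simp: zero_prod_def)
    next
      assume "W = V \<times> V"
      then have "(0, v) \<in> W" using v sub subspace_0 by auto
      then show False using v Jlin by (auto simp: W_def)
    qed
  qed
  ultimately have "\<nu> = 0" by simp
  then have "J x = 0" using \<nu>[OF xy(1) xy(1)] Q_zero by simp
  then show ?thesis using J(3)[OF xy(2), of x] by (simp add: bilinear_lzero[OF Q_bil])
qed

text \<open>The symmetric part is a multiple of \<open>Q\<close>, and the skew part vanishes by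
  orthogonal type.\<close>

lemma schur_orthogonal:
  assumes V: "orthogonal_rep \<rho> K V" and h: "invar \<rho> K h V V"
  shows "\<exists>\<mu>. \<forall>x\<in>V. \<forall>y\<in>V. h x y = \<mu> * Q x y"
proof -
  have bil: "bilinear h" and inv: "\<And>a x y. a \<in> K \<Longrightarrow> x \<in> V \<Longrightarrow> y \<in> V \<Longrightarrow> h (\<rho> a x) (\<rho> a y) = h x y"
    using h by (auto simp: invar_def)
  have b: "bilinear (\<lambda>x y. h x y + \<epsilon> * h y x)" for \<epsilon>
    by (simp add: bilinear_def linear_iff bilinear_ladd[OF bil] bilinear_radd[OF bil]
        bilinear_lmul[OF bil] bilinear_rmul[OF bil] algebra_simps)
  have irr: "irreducible_rep \<rho> K V" using V by (simp add: orthogonal_rep_def)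
  have i: "invar \<rho> K (\<lambda>x y. h x y + \<epsilon> * h y x) V V" for \<epsilon> using b inv by (simp add: invar_def)
  obtain \<mu> where "\<And>x y. x \<in> V \<Longrightarrow> y \<in> V \<Longrightarrow> h x y + 1 * h y x = \<mu> * Q x y"
    using schur_symmetric[OF irr i[of 1]] by (auto simp: add.commute)
  moreover have "h x y + (-1) * h y x = 0" if "x \<in> V" "y \<in> V" for x y
    by (rule schur_skew[OF V i[of "-1"] _ that]) simp
  ultimately have "h x y = (\<mu> / 2) * Q x y" if "x \<in> V" "y \<in> V" for x y using that by (simp add: field_simps)
  then show ?thesis by blast
qed

end

section \<open>The isotropy representation\<close>

lemma equivalence_map_compose:
  assumes "equivalence_map \<rho> K U V S" "equivalence_map \<rho> K V W T"
  shows "equivalence_map \<rho> K U W (\<lambda>x. T (S x))"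
  using assms linear_compose[of S T] bij_betw_trans[of S U V T W]
  by (auto simp: equivalence_map_def o_def dest: bij_betwE)

locale isotropy_rep = orthogonal_action "Ad A G" K Q
  for A :: "('g::topological_space, 'l::euclidean_space) chart set" and G :: "'g monoid"
    and K :: "'g set" and Q :: "'l \<Rightarrow> 'l \<Rightarrow> real" +
  fixes m r d :: nat and P :: "nat \<Rightarrow> 'l set" and Y :: "nat \<Rightarrow> nat \<Rightarrow> 'l"
  assumes kk: "subspace (lie_algebra_of A G K)"
    and dec: "isotropy_decomposition A G K Q m r d P Y"
begin

abbreviation "\<rho> \<equiv> Ad A G"
abbreviation "kk \<equiv> lie_algebra_of A G K"
abbreviation "pp \<equiv> span (\<Union>i\<in>{1..m}. P i)"

lemma decD:
  "1 \<le> r" "r \<le> m" "\<And>i. i \<in> {1..m} \<Longrightarrow> irreducible_rep \<rho> K (P i)"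
  "\<And>i X Z. i \<in> {1..m} \<Longrightarrow> X \<in> kk \<Longrightarrow> Z \<in> P i \<Longrightarrow> Q X Z = 0"
  "\<And>i j X Z. i \<in> {1..m} \<Longrightarrow> j \<in> {1..m} \<Longrightarrow> i \<noteq> j \<Longrightarrow> X \<in> P i \<Longrightarrow> Z \<in> P j \<Longrightarrow> Q X Z = 0"
  "span (kk \<union> (\<Union>i\<in>{1..m}. P i)) = UNIV"
  "\<And>i j. i \<in> {1..r} \<Longrightarrow> j \<in> {1..r} \<Longrightarrow> equivalent_reps \<rho> K (P i) (P j)"
  "\<And>l. l \<in> {r<..m} \<Longrightarrow> \<not> equivalent_reps \<rho> K (P 1) (P l)"
  "\<And>l l'. l \<in> {r<..m} \<Longrightarrow> l' \<in> {r<..m} \<Longrightarrow> l \<noteq> l' \<Longrightarrow> \<not> equivalent_reps \<rho> K (P l) (P l')"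
  "\<And>i. i \<in> {1..r} \<Longrightarrow> orthogonal_rep \<rho> K (P i)" "\<And>i. i \<in> {1..r} \<Longrightarrow> dim (P i) = d"
  "\<And>i k l. i \<in> {1..r} \<Longrightarrow> k \<in> {1..d} \<Longrightarrow> l \<in> {1..d} \<Longrightarrow> Q (Y i k) (Y i l) = (if k = l then 1 else 0)"
  "\<And>i. i \<in> {1..r} \<Longrightarrow> span (Y i ` {1..d}) = P i"
  "\<And>i j. i \<in> {1..r} \<Longrightarrow> j \<in> {1..r} \<Longrightarrow> \<exists>T. equivalence_map \<rho> K (P i) (P j) T \<and> (\<forall>k\<in>{1..d}. T (Y i k) = Y j k)"
  using dec unfolding isotropy_decomposition_def
  by (simp_all del: One_nat_def atLeastAtMost_iff greaterThanAtMost_iff)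

lemma r_sub: "i \<in> {1..r} \<Longrightarrow> i \<in> {1..m}" "l \<in> {r<..m} \<Longrightarrow> l \<in> {1..m}" "1 \<in> {1..r}"
  using decD(1,2) by auto

lemma P_inv: "i \<in> {1..m} \<Longrightarrow> invariant_subspace \<rho> K (P i)" "i \<in> {1..m} \<Longrightarrow> subspace (P i)"
  using decD(3) by (auto simp: irreducible_rep_def invariant_subspace_def)

lemma d_pos: "1 \<in> {1..d}"
proof -
  have "P 1 \<noteq> {0}" "dim (P 1) = d" "subspace (P 1)"
    using decD(3)[OF r_sub(1)[OF r_sub(3)]] decD(11)[OF r_sub(3)] P_inv(2)[OF r_sub(1)[OF r_sub(3)]] by (auto simp: irreducible_rep_def)
  then have "d \<noteq> 0" using subspace_0 by (auto simp: dim_eq_0)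
  then show ?thesis by simp
qed

lemma Y_in: "i \<in> {1..r} \<Longrightarrow> k \<in> {1..d} \<Longrightarrow> Y i k \<in> P i"
  using decD(13)[of i] span_base[of "Y i k" "Y i ` {1..d}"] by (metis imageI)

lemma Q_YY:
  assumes "i \<in> {1..r}" "j \<in> {1..r}" "k \<in> {1..d}" "l \<in> {1..d}"
  shows "Q (Y i k) (Y j l) = (if i = j \<and> k = l then 1 else 0)"
  using decD(12)[OF assms(1,3,4)] decD(5)[OF r_sub(1)[OF assms(1)] r_sub(1)[OF assms(2)] _ Y_in[OF assms(1,3)] Y_in[OF assms(2,4)]]
  by (cases "i = j") auto

lemma Y_inj: "i \<in> {1..r} \<Longrightarrow> inj_on (Y i) {1..d}"
  using decD(12) by (metis inj_onI zero_neq_one)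

text \<open>Bases adapted to the decomposition. The given \<open>Y\<close> are kept on the
  equivalent summands; on every other summand an invariant form is a multiple of \<open>Q\<close>,
  so an arbitrary orthonormal basis diagonalizes it.\<close>

definition "Bi i = (if i \<le> r then Y i ` {1..d} else SOME B. onb Q B (P i))"
definition "BB = (\<Union>i\<in>{1..m}. Bi i)"

lemma Bi: assumes i: "i \<in> {1..m}" shows "onb Q (Bi i) (P i)"
proof (cases "i \<le> r")
  case True
  then have ir: "i \<in> {1..r}" using i by simp
  then show ?thesis using True Y_inj[OF ir] decD(13)[OF ir] decD(12)[OF ir]
    by (auto simp: onb_def Bi_def inj_on_eq_iff simp del: atLeastAtMost_iff)
next
  case False
  then show ?thesis using someI_ex[OF onb_exists[OF Q P_inv(2)[OF i]]] by (simp add: Bi_def)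
qed

lemma Bi_disjoint: assumes "i \<in> {1..m}" "j \<in> {1..m}" "i \<noteq> j" shows "Bi i \<inter> Bi j = {}"
proof -
  have False if "b \<in> Bi i" "b \<in> Bi j" for b
  proof -
    have "Q b b = 1" using Bi[OF assms(1)] that(1) by (simp add: onb_def)
    moreover have "Q b b = 0"
      using decD(5)[OF assms] onb_mem[OF Bi[OF assms(1)] that(1)] onb_mem[OF Bi[OF assms(2)] that(2)] by blast
    ultimately show False by simp
  qed
  then show ?thesis by blast
qed

lemma BB: "onb Q BB pp"
proof -
  have fin: "finite (Bi i)" if "i \<in> {1..m}" for i using Bi[OF that] by (simp add: onb_def)
  have "Q b c = (if b = c then 1 else 0)" if "b \<in> BB" "c \<in> BB" for b c
  proof -
    obtain i j where ij: "i \<in> {1..m}" "j \<in> {1..m}" "b \<in> Bi i" "c \<in> Bi j" using \<open>b \<in> BB\<close> \<open>c \<in> BB\<close> unfolding BB_def by blast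
    show ?thesis
    proof (cases "i = j")
      case True
      then show ?thesis using Bi[OF ij(1)] ij by (auto simp: onb_def)
    next
      case False
      then have "b \<noteq> c" using Bi_disjoint[OF ij(1,2)] ij by blast
      then show ?thesis using decD(5)[OF ij(1,2) False onb_mem[OF Bi[OF ij(1)] ij(3)] onb_mem[OF Bi[OF ij(2)] ij(4)]] by simp
    qed
  qed
  moreover have "span BB = pp"
  proof (intro equalityI span_minimal subspace_span)
    show "BB \<subseteq> pp" unfolding BB_def using onb_mem[OF Bi] by (blast intro: span_base)
    have "P i \<subseteq> span BB" if "i \<in> {1..m}" for i
    proof -
      have "span (Bi i) \<subseteq> span BB" using that unfolding BB_def by (intro span_mono) blast
      then show ?thesis using Bi[OF that] by (simp add: onb_def)
    qed
    then show "(\<Union>i\<in>{1..m}. P i) \<subseteq> span BB" by blast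
  qed
  ultimately show ?thesis using fin by (simp add: onb_def BB_def)
qed

lemma BB_fin: "finite BB" and BB_pp: "b \<in> BB \<Longrightarrow> b \<in> pp"
  using BB onb_mem[OF BB] by (auto simp: onb_def)

lemma pp_expand: "X \<in> pp \<Longrightarrow> X = (\<Sum>b\<in>BB. Q X b *\<^sub>R b)"
  by (rule onb_expand[OF Q BB])

lemma sum_BB:
  "(\<Sum>b\<in>BB. f b) = (\<Sum>i\<in>{1..r}. \<Sum>k\<in>{1..d}. f (Y i k)) + (\<Sum>l\<in>{r<..m}. \<Sum>b\<in>Bi l. f b)"
proof -
  have "(\<Sum>b\<in>BB. f b) = (\<Sum>i\<in>{1..m}. \<Sum>b\<in>Bi i. f b)" unfolding BB_def
    by (rule sum.UNION_disjoint) (use Bi Bi_disjoint in \<open>auto simp: onb_def simp del: atLeastAtMost_iff\<close>)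
  also have "{1..m} = {1..r} \<union> {r<..m}" using decD(1,2) by auto
  also have "(\<Sum>i\<in>{1..r} \<union> {r<..m}. \<Sum>b\<in>Bi i. f b) = (\<Sum>i\<in>{1..r}. \<Sum>b\<in>Bi i. f b) + (\<Sum>l\<in>{r<..m}. \<Sum>b\<in>Bi l. f b)"
    by (rule sum.union_disjoint) auto
  also have "(\<Sum>i\<in>{1..r}. \<Sum>b\<in>Bi i. f b) = (\<Sum>i\<in>{1..r}. \<Sum>k\<in>{1..d}. f (Y i k))"
    by (intro sum.cong refl) (use sum.reindex[OF Y_inj] in \<open>simp add: Bi_def\<close>)
  finally show ?thesis .
qed

subsection \<open>The projection onto the complement\<close>

text \<open>The orthogonal projection along \<open>kk\<close>, written as a sum so that linearity is
  visible; \<open>p_part_pr\<close> identifies it with the definite description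
  \<open>p_part\<close>.\<close>

definition "pr X = (\<Sum>b\<in>BB. Q X b *\<^sub>R b)"

lemma pr_linear: "linear pr"
  unfolding pr_def by (intro linearI) (simp_all add: bilinear_ladd[OF Q_bil] bilinear_lmul[OF Q_bil] scaleR_add_left sum.distrib scaleR_sum_right)

lemma pr_pp: "pr X \<in> pp"
  unfolding pr_def by (intro span_sum span_scale BB_pp)

lemma pr_id: "X \<in> pp \<Longrightarrow> pr X = X"
  using pp_expand by (simp add: pr_def)

lemma kk_pp: assumes "X \<in> kk" "Z \<in> pp" shows "Q X Z = 0"
proof -
  have "pp \<subseteq> {Z. Q X Z = 0}"
    by (rule span_minimal) (use decD(4)[OF _ assms(1)] in \<open>auto simp: subspace_def bilinear_rzero[OF Q_bil] bilinear_radd[OF Q_bil] bilinear_rmul[OF Q_bil]\<close>)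
  then show ?thesis using assms by blast
qed

lemma pr_kk: "X \<in> kk \<Longrightarrow> pr X = 0"
  unfolding pr_def by (rule sum.neutral) (use kk_pp BB_pp in auto)

lemma pr_diff: "X - pr X \<in> kk"
proof -
  have "X \<in> span (kk \<union> (\<Union>i\<in>{1..m}. P i))" using decD(6) by blast
  then obtain x y where "x \<in> span kk" "y \<in> pp" "X = x + y" unfolding span_Un by blast
  moreover have "x \<in> kk" using \<open>x \<in> span kk\<close> kk span_eq_iff by blast
  ultimately show ?thesis by (simp add: linear_add[OF pr_linear] pr_kk pr_id)
qed

lemma Q_pr: "Z \<in> pp \<Longrightarrow> Q (pr X) Z = Q X Z"
  using kk_pp[OF pr_diff, of Z X] by (simp add: bilinear_lsub[OF Q_bil])

lemma p_part_pr: "p_part A G K m P X = pr X"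
  unfolding p_part_def
proof (rule the_equality)
  show "pr X \<in> pp \<and> X - pr X \<in> kk" using pr_pp pr_diff by blast
  fix Z assume "Z \<in> pp \<and> X - Z \<in> kk"
  then show "Z = pr X" using linear_diff[OF pr_linear, of X Z] pr_kk[of "X - Z"] pr_id[of Z] by simp
qed

lemma pp_inv: "invariant_subspace \<rho> K pp"
  unfolding invariant_subspace_def
proof (intro conjI ballI)
  fix a assume a: "a \<in> K"
  have "\<rho> a ` pp = span (\<rho> a ` (\<Union>i\<in>{1..m}. P i))" by (rule linear_span_image[OF rho_linear, symmetric])
  also have "\<dots> \<subseteq> pp" using P_inv(1) a unfolding invariant_subspace_def by (intro span_mono) blast
  finally show "\<rho> a ` pp \<subseteq> pp" .
qed (rule subspace_span)

lemma pr_rho: assumes a: "a \<in> K" shows "pr (\<rho> a X) = \<rho> a (pr X)"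
proof (rule form_eqI[OF Q subspace_span pr_pp])
  show "\<rho> a (pr X) \<in> pp" using imageI[OF pr_pp, of "\<rho> a" X] unfolding rho_image[OF pp_inv a] .
  fix w assume w: "w \<in> pp"
  then have "w \<in> \<rho> a ` pp" unfolding rho_image[OF pp_inv a] .
  then obtain z where "z \<in> pp" "w = \<rho> a z" by (rule imageE)
  then show "Q (pr (\<rho> a X)) w = Q (\<rho> a (pr X)) w" using Q_pr w rho_Q[OF a] by metis
qed

subsection \<open>Invariant symmetric forms\<close>

definition iform :: "('l \<Rightarrow> 'l \<Rightarrow> real) \<Rightarrow> bool" where
  "iform f \<longleftrightarrow> bilinear f \<and> (\<forall>a\<in>K. \<forall>x y. f (\<rho> a x) (\<rho> a y) = f x y) \<and> (\<forall>x y. f x y = f y x)"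

lemma iform_invar: "iform f \<Longrightarrow> invar \<rho> K f V W"
  by (simp add: iform_def invar_def)

lemma iform_bil: "iform f \<Longrightarrow> bilinear f" and iform_sym: "iform f \<Longrightarrow> f x y = f y x"
  unfolding iform_def by blast+

text \<open>Composition with the equivalence from \<open>P i\<close> to \<open>P j\<close> gives an
  invariant form on \<open>P i\<close>, which orthogonal type makes a multiple of \<open>Q\<close>.
  The entry with index 1 names the multiple.\<close>

lemma iform_Y:
  assumes f: "iform f" and ij: "i \<in> {1..r}" "j \<in> {1..r}" and kl: "k \<in> {1..d}" "l \<in> {1..d}"
  shows "f (Y i k) (Y j l) = (if k = l then f (Y i 1) (Y j 1) else 0)"
proof -
  note bil = iform_bil[OF f]
  obtain T where T: "equivalence_map \<rho> K (P i) (P j) T" "\<And>k. k \<in> {1..d} \<Longrightarrow> T (Y i k) = Y j k"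
    using decD(14)[OF ij] by blast
  have lin: "linear T" and eq: "\<And>a x. a \<in> K \<Longrightarrow> x \<in> P i \<Longrightarrow> T (\<rho> a x) = \<rho> a (T x)"
    using T(1) by (auto simp: equivalence_map_def)
  have "bilinear (\<lambda>x y. f x (T y))"
    by (simp add: bilinear_def linear_iff bilinear_ladd[OF bil] bilinear_lmul[OF bil] bilinear_radd[OF bil] bilinear_rmul[OF bil]
        linear_add[OF lin] linear_cmul[OF lin])
  then have "invar \<rho> K (\<lambda>x y. f x (T y)) (P i) (P i)"
    using f eq by (simp add: invar_def iform_def)
  then obtain \<mu> where "\<And>x y. x \<in> P i \<Longrightarrow> y \<in> P i \<Longrightarrow> f x (T y) = \<mu> * Q x y"
    using schur_orthogonal[OF decD(10)[OF ij(1)]] by blast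
  then have *: "f (Y i k) (Y j l) = \<mu> * Q (Y i k) (Y i l)" if "k \<in> {1..d}" "l \<in> {1..d}" for k l
    using T(2)[OF that(2)] Y_in[OF ij(1)] that by metis
  show ?thesis using *[OF kl] *[OF d_pos d_pos] decD(12)[OF ij(1)] kl d_pos by simp
qed

lemma iform_zero:
  assumes f: "iform f" and i: "i \<in> {1..m}" and l: "l \<in> {r<..m}" and "i \<noteq> l" and xy: "x \<in> P i" "y \<in> P l"
  shows "f x y = 0" "f y x = 0"
proof -
  have "\<not> equivalent_reps \<rho> K (P i) (P l)"
  proof (cases "i \<le> r")
    case True
    then have ir: "i \<in> {1..r}" using i by simp
    then show ?thesis using decD(7)[OF r_sub(3) ir] decD(8)[OF l] equivalence_map_compose
      unfolding equivalent_reps_def by blast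
  next
    case False
    then show ?thesis using decD(9)[OF _ l] i \<open>i \<noteq> l\<close> by simp
  qed
  then show "f x y = 0" using schur_inequivalent[OF decD(3)[OF i] decD(3)[OF r_sub(2)[OF l]] _ iform_invar[OF f] xy] by blast
  then show "f y x = 0" using iform_sym[OF f, of x y] by simp
qed

lemma iform_P:
  assumes f: "iform f" and l: "l \<in> {r<..m}"
  shows "\<exists>\<mu>. \<forall>x\<in>P l. \<forall>y\<in>P l. f x y = \<mu> * Q x y"
  by (rule schur_symmetric[OF decD(3)[OF r_sub(2)[OF l]] iform_invar[OF f] iform_sym[OF f]])

text \<open>The operator on the complement that represents \<open>f\<close> with respect to
  \<open>Q\<close>.\<close>

definition "contr f x = (\<Sum>b\<in>BB. f x b *\<^sub>R b)"

lemma contr_Y: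
  assumes f: "iform f" and i: "i \<in> {1..r}" and k: "k \<in> {1..d}"
  shows "contr f (Y i k) = (\<Sum>l\<in>{1..r}. f (Y i 1) (Y l 1) *\<^sub>R Y l k)"
proof -
  have "f (Y i k) b = 0" if "l \<in> {r<..m}" "b \<in> Bi l" for l b
    using iform_zero(1)[OF f r_sub(1)[OF i] that(1) _ Y_in[OF i k] onb_mem[OF Bi[OF r_sub(2)[OF that(1)]] that(2)]] that i by auto
  then have "contr f (Y i k) = (\<Sum>j\<in>{1..r}. \<Sum>l\<in>{1..d}. f (Y i k) (Y j l) *\<^sub>R Y j l)"
    by (simp add: contr_def sum_BB)
  also have "\<dots> = (\<Sum>j\<in>{1..r}. \<Sum>l\<in>{1..d}. if k = l then f (Y i 1) (Y j 1) *\<^sub>R Y j l else 0)"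
    by (intro sum.cong refl) (simp only: iform_Y[OF f i _ k] split: if_splits, simp)
  also have "\<dots> = (\<Sum>j\<in>{1..r}. f (Y i 1) (Y j 1) *\<^sub>R Y j k)" using k by simp
  finally show ?thesis .
qed

lemma contr_P:
  assumes f: "iform f" and l: "l \<in> {r<..m}"
  shows "\<exists>\<mu>. \<forall>x\<in>P l. contr f x = \<mu> *\<^sub>R x"
proof -
  obtain \<mu> where \<mu>: "\<And>x y. x \<in> P l \<Longrightarrow> y \<in> P l \<Longrightarrow> f x y = \<mu> * Q x y" using iform_P[OF f l] by blast
  have "contr f x = \<mu> *\<^sub>R x" if x: "x \<in> P l" for x
  proof -
    have lm: "l \<in> {1..m}" using r_sub(2)[OF l] .
    have "contr f x = (\<Sum>b\<in>BB. (\<mu> * Q x b) *\<^sub>R b)"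
      unfolding contr_def
    proof (rule sum.cong[OF refl])
      fix b assume "b \<in> BB"
      then obtain i where i: "i \<in> {1..m}" "b \<in> P i" unfolding BB_def using onb_mem[OF Bi] by blast
      have "f x b = \<mu> * Q x b"
      proof (cases "i = l")
        case True then show ?thesis using \<mu> x i by simp
      next
        case False
        then show ?thesis using iform_zero(2)[OF f i(1) l False i(2) x] decD(5)[OF lm i(1) _ x i(2)] by simp
      qed
      then show "f x b *\<^sub>R b = (\<mu> * Q x b) *\<^sub>R b" by simp
    qed
    also have "\<dots> = \<mu> *\<^sub>R pr x" by (simp add: pr_def scaleR_sum_right)
    also have "pr x = x" using x lm by (intro pr_id span_base) blast
    finally show ?thesis .
  qed
  then show ?thesis by blast
qed

lemma contr_right:
  fixes g :: "'l \<Rightarrow> 'l \<Rightarrow> real"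
  assumes "bilinear g" shows "(\<Sum>c\<in>BB. f b c * g X c) = g X (contr f b)"
  by (simp add: contr_def bilinear_sum_right[OF assms] bilinear_rmul[OF assms])

lemma kills_pr:
  assumes f: "bilinear f" and k: "\<And>X Z. X \<in> kk \<Longrightarrow> f X Z = 0"
  shows "f X Z = f (pr X) Z"
  using k[OF pr_diff, of X Z] by (simp add: bilinear_lsub[OF f])

lemma Q_contr:
  assumes f: "iform f" and k: "\<And>X Z. X \<in> kk \<Longrightarrow> f X Z = 0"
  shows "f X Z = Q X (contr f Z)"
proof -
  have "f X Z = f (\<Sum>b\<in>BB. Q X b *\<^sub>R b) Z" using kills_pr[OF iform_bil[OF f] k] by (simp add: pr_def)
  also have "\<dots> = (\<Sum>b\<in>BB. Q X b * f b Z)"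
    by (simp add: bilinear_sum_left[OF iform_bil[OF f]] bilinear_lmul[OF iform_bil[OF f]])
  also have "\<dots> = (\<Sum>b\<in>BB. f Z b * Q X b)"
    by (intro sum.cong refl) (subst iform_sym[OF f], rule mult.commute)
  also have "\<dots> = Q X (contr f Z)" by (rule contr_right[OF Q_bil])
  finally show ?thesis .
qed

text \<open>The left side is a trace of \<open>D\<close> against the product of the operators of
  \<open>\<kappa>\<close> and \<open>\<eta>\<close>. On an inequivalent summand both operators are
  scalar and skewness of \<open>D\<close> gives zero; on the equivalent ones they act on the summand
  index only.\<close>

lemma trace_commutator:
  assumes \<kappa>: "iform \<kappa>" and \<eta>: "iform \<eta>" and k: "\<And>X Z. X \<in> kk \<Longrightarrow> \<eta> X Z = 0"
    and skew: "\<And>X. Q (D X) X = 0"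
  shows "(\<Sum>b\<in>BB. \<Sum>c\<in>BB. \<kappa> b c * \<eta> (D b) c) =
    (\<Sum>i\<in>{1..r}. \<Sum>j\<in>{1..r}. (\<Sum>l\<in>{1..r}. \<kappa> (Y i 1) (Y l 1) * \<eta> (Y l 1) (Y j 1)) * (\<Sum>k\<in>{1..d}. Q (D (Y i k)) (Y j k)))"
proof -
  have 1: "(\<Sum>c\<in>BB. \<kappa> b c * \<eta> (D b) c) = Q (D b) (contr \<eta> (contr \<kappa> b))" for b
    unfolding contr_right[OF iform_bil[OF \<eta>]] by (rule Q_contr[OF \<eta> k])
  have lin: "linear (contr \<eta>)" unfolding contr_def
    by (intro linearI) (simp_all add: bilinear_ladd[OF iform_bil[OF \<eta>]] bilinear_lmul[OF iform_bil[OF \<eta>]] scaleR_add_left sum.distrib scaleR_sum_right)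
  have z: "Q (D b) (contr \<eta> (contr \<kappa> b)) = 0" if l: "l \<in> {r<..m}" and b: "b \<in> Bi l" for l b
  proof -
    have "b \<in> P l" using onb_mem[OF Bi[OF r_sub(2)[OF l]] b] .
    then show ?thesis using contr_P[OF \<kappa> l] contr_P[OF \<eta> l] skew[of b]
      by (auto simp: linear_cmul[OF lin] bilinear_rmul[OF Q_bil])
  qed
  have y: "Q (D (Y i k)) (contr \<eta> (contr \<kappa> (Y i k))) =
      (\<Sum>j\<in>{1..r}. (\<Sum>l\<in>{1..r}. \<kappa> (Y i 1) (Y l 1) * \<eta> (Y l 1) (Y j 1)) * Q (D (Y i k)) (Y j k))"
    if i: "i \<in> {1..r}" and k: "k \<in> {1..d}" for i k
  proof -
    have "contr \<eta> (contr \<kappa> (Y i k)) = (\<Sum>l\<in>{1..r}. \<kappa> (Y i 1) (Y l 1) *\<^sub>R contr \<eta> (Y l k))"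
      by (simp only: contr_Y[OF \<kappa> i k] linear_sum[OF lin] linear_cmul[OF lin])
    also have "\<dots> = (\<Sum>l\<in>{1..r}. \<kappa> (Y i 1) (Y l 1) *\<^sub>R (\<Sum>j\<in>{1..r}. \<eta> (Y l 1) (Y j 1) *\<^sub>R Y j k))"
      by (intro sum.cong refl) (simp only: contr_Y[OF \<eta> _ k])
    also have "\<dots> = (\<Sum>l\<in>{1..r}. \<Sum>j\<in>{1..r}. (\<kappa> (Y i 1) (Y l 1) * \<eta> (Y l 1) (Y j 1)) *\<^sub>R Y j k)"
      by (simp add: scaleR_sum_right)
    also have "\<dots> = (\<Sum>j\<in>{1..r}. (\<Sum>l\<in>{1..r}. \<kappa> (Y i 1) (Y l 1) * \<eta> (Y l 1) (Y j 1)) *\<^sub>R Y j k)"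
      by (subst sum.swap) (simp add: scaleR_sum_left)
    finally show ?thesis by (simp add: bilinear_sum_right[OF Q_bil] bilinear_rmul[OF Q_bil])
  qed
  have "(\<Sum>b\<in>BB. \<Sum>c\<in>BB. \<kappa> b c * \<eta> (D b) c) =
      (\<Sum>i\<in>{1..r}. \<Sum>k\<in>{1..d}. Q (D (Y i k)) (contr \<eta> (contr \<kappa> (Y i k))))"
    unfolding 1 sum_BB by (simp add: z)
  also have "\<dots> = (\<Sum>i\<in>{1..r}. \<Sum>k\<in>{1..d}. \<Sum>j\<in>{1..r}. (\<Sum>l\<in>{1..r}. \<kappa> (Y i 1) (Y l 1) * \<eta> (Y l 1) (Y j 1)) * Q (D (Y i k)) (Y j k))"
    by (intro sum.cong refl) (rule y)
  also have "\<dots> = (\<Sum>i\<in>{1..r}. \<Sum>j\<in>{1..r}. \<Sum>k\<in>{1..d}. (\<Sum>l\<in>{1..r}. \<kappa> (Y i 1) (Y l 1) * \<eta> (Y l 1) (Y j 1)) * Q (D (Y i k)) (Y j k))"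
    by (rule sum.cong[OF refl], rule sum.swap)
  finally show ?thesis by (simp add: sum_distrib_left)
qed

end

subsection \<open>The inverse of an invariant metric\<close>

lemma independent_family:
  fixes f :: "'i \<Rightarrow> 'v::euclidean_space"
  assumes I: "finite I" and dim: "dim (span (f ` I)) = card I" and s: "(\<Sum>i\<in>I. u i *\<^sub>R f i) = 0" and i: "i \<in> I"
  shows "u i = 0"
proof -
  have "dim (f ` I) \<le> card (f ` I)" by (rule dim_le_card') (use I in simp)
  moreover have "card (f ` I) \<le> card I" using card_image_le[OF I] .
  \<comment> \<open>The dimension reaches the number of indices only if \<open>f\<close> is
    injective and its image is independent.\<close>
  ultimately have c: "card (f ` I) = card I" "dim (f ` I) = card (f ` I)" using dim by (simp_all add: dim_span)
  have inj: "inj_on f I" using c(1) eq_card_imp_inj_on[OF I] by blast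
  have "independent (f ` I)" using c(2) I by (intro card_le_dim_spanning[of _ "f ` I"]) (auto intro: span_base)
  moreover have "(\<Sum>v\<in>f ` I. u (inv_into I f v) *\<^sub>R v) = 0"
    using s by (simp add: sum.reindex[OF inj] inv_into_f_f[OF inj])
  ultimately have "u (inv_into I f (f i)) = 0"
    using I i by (intro independentD[of "f ` I" "f ` I" "\<lambda>v. u (inv_into I f v)"]) auto
  then show ?thesis using i by (simp add: inv_into_f_f[OF inj])
qed

lemma card_increasing_pairs: "card {(i, j). 1 \<le> i \<and> i < j \<and> j \<le> r} = r * (r - 1) div (2::nat)"
proof -
  have "{(i, j). 1 \<le> i \<and> i < j \<and> j \<le> r} = prod.swap ` (SIGMA j:{1..r}. {1..<j})"
    by (auto simp: image_iff)
  then have "card {(i, j). 1 \<le> i \<and> i < j \<and> j \<le> r} = card (SIGMA j:{1..r}. {1..<j})"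
    by (simp add: card_image)
  also have "\<dots> = (\<Sum>j\<in>{1..r}. j - 1)" by simp
  also have "\<dots> = r * (r - 1) div 2"
  proof (induction r)
    case (Suc r)
    then show ?case by (cases r) auto
  qed simp
  finally show ?thesis .
qed

text \<open>Skewness kills the diagonal and folds the full sum onto the pairs \<open>i < j\<close>,
  with coefficients \<open>N i j - N j i\<close>. The dimension makes these vectors
  independent.\<close>

lemma skew_family_symmetric:
  fixes Z :: "nat \<Rightarrow> nat \<Rightarrow> 'v::euclidean_space"
  assumes dim: "dim (span {Z i j | i j. 1 \<le> i \<and> i < j \<and> j \<le> r}) = r * (r - 1) div 2"
    and skew: "\<And>i j. i \<in> {1..r} \<Longrightarrow> j \<in> {1..r} \<Longrightarrow> Z i j = - Z j i"
    and s: "(\<Sum>i\<in>{1..r}. \<Sum>j\<in>{1..r}. N i j *\<^sub>R Z i j) = 0"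
    and ij: "i \<in> {1..r}" "j \<in> {1..r}"
  shows "N i j = N j i"
proof -
  define I where "I = {(i, j). 1 \<le> i \<and> i < j \<and> j \<le> r}"
  have "I \<subseteq> {1..r} \<times> {1..r}" by (auto simp: I_def)
  then have fin: "finite I" by (rule finite_subset) simp
  have im: "{Z i j | i j. 1 \<le> i \<and> i < j \<and> j \<le> r} = (\<lambda>(i, j). Z i j) ` I" by (auto simp: I_def)
  have "(\<Sum>i\<in>{1..r}. \<Sum>j\<in>{1..r}. N i j *\<^sub>R Z i j) = (\<Sum>(i,j)\<in>{1..r}\<times>{1..r}. N i j *\<^sub>R Z i j)"
    by (rule sum.cartesian_product)
  also have "\<dots> = (\<Sum>(i,j)\<in>I \<union> prod.swap ` I. N i j *\<^sub>R Z i j)"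
  proof (rule sum.mono_neutral_right)
    show "I \<union> prod.swap ` I \<subseteq> {1..r} \<times> {1..r}" by (auto simp: I_def)
    show "\<forall>p\<in>{1..r} \<times> {1..r} - (I \<union> prod.swap ` I). (case p of (i, j) \<Rightarrow> N i j *\<^sub>R Z i j) = 0"
    proof (rule ballI)
      fix p assume p: "p \<in> {1..r} \<times> {1..r} - (I \<union> prod.swap ` I)"
      obtain i j where ij: "p = (i, j)" by (cases p)
      have *: "i \<in> {1..r}" "j \<in> {1..r}" "(i, j) \<notin> I \<union> prod.swap ` I" using p unfolding ij by auto
      then have "i = j" by (force simp: I_def image_iff)
      then have "Z i j + Z i j = 0" using skew[OF *(1,2)] by (metis add.right_inverse)
      then have "Z i j = 0" by (simp flip: scaleR_2)
      then show "(case p of (i, j) \<Rightarrow> N i j *\<^sub>R Z i j) = 0" by (simp add: ij)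
    qed
  qed simp
  also have "\<dots> = (\<Sum>(i,j)\<in>I. N i j *\<^sub>R Z i j) + (\<Sum>(i,j)\<in>prod.swap ` I. N i j *\<^sub>R Z i j)"
    by (rule sum.union_disjoint) (use fin in \<open>auto simp: I_def\<close>)
  also have "(\<Sum>(i,j)\<in>prod.swap ` I. N i j *\<^sub>R Z i j) = (\<Sum>(i,j)\<in>I. N j i *\<^sub>R Z j i)"
    by (simp add: sum.reindex prod.case_eq_if)
  also have "(\<Sum>(i,j)\<in>I. N j i *\<^sub>R Z j i) = (\<Sum>(i,j)\<in>I. - (N j i *\<^sub>R Z i j))"
  proof (rule sum.cong[OF refl], clarify)
    fix i j assume "(i, j) \<in> I"
    then have "j \<in> {1..r}" "i \<in> {1..r}" by (auto simp: I_def)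
    then show "N j i *\<^sub>R Z j i = - (N j i *\<^sub>R Z i j)" using skew[of j i] by simp
  qed
  finally have "(\<Sum>p\<in>I. (case p of (i, j) \<Rightarrow> N i j - N j i) *\<^sub>R (case p of (i, j) \<Rightarrow> Z i j)) = 0"
    using s by (simp add: prod.case_eq_if scaleR_diff_left sum_subtractf sum_negf)
  moreover have "dim (span ((\<lambda>(i, j). Z i j) ` I)) = card I"
    using dim card_increasing_pairs[of r, folded I_def] unfolding im by simp
  ultimately have "N i j - N j i = 0" if "(i, j) \<in> I" for i j
    using independent_family[OF fin _ _ that, of "\<lambda>(i, j). Z i j" "\<lambda>(i, j). N i j - N j i"] by simp
  moreover have "i = j \<or> (i, j) \<in> I \<or> (j, i) \<in> I" using ij by (auto simp: I_def)
  ultimately show ?thesis by force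
qed

context isotropy_rep
begin

definition pform :: "('l \<Rightarrow> 'l \<Rightarrow> real) \<Rightarrow> bool" where
  "pform h \<longleftrightarrow> iform h \<and> (\<forall>X\<in>kk. \<forall>Z. h X Z = 0) \<and> (\<forall>X\<in>pp. X \<noteq> 0 \<longrightarrow> h X X > 0)"

text \<open>The form \<open>full h\<close> extends the metric \<open>h\<close> from the complement to an inner product on the Lie
  algebra, and \<open>dual h\<close> has the inverse matrix of \<open>h\<close>.\<close>

definition "full h X Z = h X Z + Q (X - pr X) (Z - pr Z)"
definition "sharp h X = (THE z. \<forall>w. full h z w = Q X w)"
definition "dual h X Z = Q (sharp h X) Z"

lemma pformD:
  assumes "pform h"
  shows "iform h" "bilinear h" "h x y = h y x" "X \<in> kk \<Longrightarrow> h X Z = 0" "X \<in> kk \<Longrightarrow> h Z X = 0"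
    "X \<in> pp \<Longrightarrow> X \<noteq> 0 \<Longrightarrow> h X X > 0"
  using assms iform_bil iform_sym unfolding pform_def by metis+

lemma full_bilinear: assumes h: "pform h" shows "bilinear (full h)"
proof -
  note b = pformD(2)[OF h]
  have l: "(x + y) - pr (x + y) = (x - pr x) + (y - pr y)" "c *\<^sub>R x - pr (c *\<^sub>R x) = c *\<^sub>R (x - pr x)" for x y c
    by (simp_all add: linear_add[OF pr_linear] linear_cmul[OF pr_linear] scaleR_diff_right)
  show ?thesis unfolding bilinear_def linear_iff full_def l
    by (simp add: bilinear_ladd[OF b] bilinear_radd[OF b] bilinear_lmul[OF b] bilinear_rmul[OF b]
      bilinear_ladd[OF Q_bil] bilinear_radd[OF Q_bil] bilinear_lmul[OF Q_bil] bilinear_rmul[OF Q_bil] distrib_left)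
qed

lemma full_ip: assumes h: "pform h" shows "inner_product_form (full h)"
  unfolding inner_product_form_def
proof (intro conjI allI impI)
  show "bilinear (full h)" using full_bilinear[OF h] .
  show "full h u v = full h v u" for u v
    using pformD(3)[OF h, of u v] Q_sym[of "u - pr u" "v - pr v"] by (simp add: full_def)
  show "full h u u > 0" if "u \<noteq> 0" for u
  proof -
    have 1: "h u u = h (pr u) (pr u)"
      using kills_pr[OF pformD(2)[OF h] pformD(4)[OF h], of u u] kills_pr[OF pformD(2)[OF h] pformD(4)[OF h], of u "pr u"]
        pformD(3)[OF h, of u "pr u"] by simp
    show ?thesis
    proof (cases "pr u = 0")
      case True
      then show ?thesis using Q_pos[OF that] by (simp add: full_def 1 bilinear_lzero[OF pformD(2)[OF h]])
    next
      case False
      moreover have "Q x x \<ge> 0" for x using Q_pos[of x] by (cases "x = 0") (auto simp: bilinear_lzero[OF Q_bil])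
      ultimately show ?thesis using pformD(6)[OF h pr_pp False] by (simp add: full_def 1 add_pos_nonneg)
    qed
  qed
qed

lemma sharp: assumes h: "pform h" shows "full h (sharp h X) w = Q X w"
    and "(\<And>w. full h z w = Q X w) \<Longrightarrow> sharp h X = z"
proof -
  have "linear (Q X)" using Q_bil by (simp add: bilinear_def)
  note r = inner_product_form_riesz[OF full_ip[OF h] this]
  show "full h (sharp h X) w = Q X w" using theI'[OF r] by (simp add: sharp_def)
  show "(\<And>w. full h z w = Q X w) \<Longrightarrow> sharp h X = z"
    unfolding sharp_def using r by (intro the1_equality) auto
qed

lemma full_rho: "pform h \<Longrightarrow> a \<in> K \<Longrightarrow> full h (\<rho> a X) (\<rho> a Z) = full h X Z"
  using pformD(1)[of h] rho_Q[of a "X - pr X" "Z - pr Z"]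
  by (simp add: full_def iform_def pr_rho linear_diff[OF rho_linear])

lemma iform_dual: assumes h: "pform h" shows "iform (dual h)"
  unfolding iform_def
proof (intro conjI allI ballI)
  note bil = full_bilinear[OF h]
  have "linear (sharp h)"
    by (intro linearI sharp(2)[OF h])
      (simp_all add: bilinear_ladd[OF bil] bilinear_lmul[OF bil] bilinear_ladd[OF Q_bil] bilinear_lmul[OF Q_bil] sharp(1)[OF h])
  then show "bilinear (dual h)" unfolding dual_def
    by (simp add: bilinear_def linear_iff bilinear_ladd[OF Q_bil] bilinear_radd[OF Q_bil] bilinear_lmul[OF Q_bil] bilinear_rmul[OF Q_bil])
  show "dual h x y = dual h y x" for x y
    using sharp(1)[OF h, of x "sharp h y"] sharp(1)[OF h, of y "sharp h x"] full_ip[OF h]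
      Q_sym[of x "sharp h y"] Q_sym[of y "sharp h x"]
    by (simp add: dual_def inner_product_formD(2)[of "full h" "sharp h x"])
  fix a x y assume a: "a \<in> K"
  have "sharp h (\<rho> a x) = \<rho> a (sharp h x)"
  proof (rule sharp(2)[OF h])
    fix w
    have "invariant_subspace \<rho> K UNIV" by (simp add: invariant_subspace_def)
    from rho_image[OF this a] obtain v where "w = \<rho> a v" by blast
    then show "full h (\<rho> a (sharp h x)) w = Q (\<rho> a x) w"
      using full_rho[OF h a] rho_Q[OF a] sharp(1)[OF h] by simp
  qed
  then show "dual h (\<rho> a x) (\<rho> a y) = dual h x y" by (simp add: dual_def rho_Q[OF a])
qed

lemma sharp_pp: assumes h: "pform h" and X: "X \<in> pp" shows "sharp h X \<in> pp"
proof -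
  let ?n = "sharp h X - pr (sharp h X)"
  have n: "?n \<in> kk" by (rule pr_diff)
  have "full h (sharp h X) ?n = 0" using sharp(1)[OF h] kk_pp[OF n X] Q_sym[of X ?n] by simp
  then have "Q ?n ?n = 0" using pformD(5)[OF h n] pr_kk[OF n] by (simp add: full_def)
  then have "sharp h X = pr (sharp h X)" using Q_zero by simp
  then show ?thesis using pr_pp by metis
qed

lemma h_sharp: assumes h: "pform h" and X: "X \<in> pp" shows "h Z (sharp h X) = Q Z X"
proof -
  have "full h (sharp h X) Z = h (sharp h X) Z"
    using pr_id[OF sharp_pp[OF h X]] by (simp add: full_def bilinear_lzero[OF Q_bil])
  then show ?thesis using sharp(1)[OF h, of X Z] pformD(3)[OF h, of Z] Q_sym[of Z X] by simp
qed

lemma sharp_contr: assumes h: "pform h" and X: "X \<in> pp" shows "sharp h X = contr (dual h) X"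
  using pp_expand[OF sharp_pp[OF h X]] by (simp add: contr_def dual_def)

text \<open>By \<open>contr_Y\<close> the inverse sends \<open>Y i 1\<close> into the span of the
  vectors \<open>Y l 1\<close>, so the block of the inverse is the inverse of the block.\<close>

lemma dual_inverse:
  assumes h: "pform h" and i: "i \<in> {1..r}" and j: "j \<in> {1..r}"
  shows "(\<Sum>l\<in>{1..r}. dual h (Y i 1) (Y l 1) * h (Y l 1) (Y j 1)) = (if i = j then 1 else 0)"
proof -
  have Yi: "Y i 1 \<in> pp" using Y_in[OF i d_pos] r_sub(1)[OF i] by (blast intro: span_base)
  have "(\<Sum>l\<in>{1..r}. dual h (Y i 1) (Y l 1) * h (Y l 1) (Y j 1)) = h (\<Sum>l\<in>{1..r}. dual h (Y i 1) (Y l 1) *\<^sub>R Y l 1) (Y j 1)"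
    by (simp add: bilinear_sum_left[OF pformD(2)[OF h]] bilinear_lmul[OF pformD(2)[OF h]])
  also have "\<dots> = h (sharp h (Y i 1)) (Y j 1)"
    by (simp only: contr_Y[OF iform_dual[OF h] i d_pos, symmetric] sharp_contr[OF h Yi])
  also have "\<dots> = Q (Y i 1) (Y j 1)" using h_sharp[OF h Yi, of "Y j 1"] pformD(3)[OF h, of "Y j 1"] Q_sym[of "Y j 1" "Y i 1"] by simp
  finally show ?thesis using Q_YY[OF i j d_pos d_pos] by simp
qed

text \<open>The sum of the tensor squares of an \<open>h\<close>-orthonormal frame is the inverse of
  \<open>h\<close>. Traces over frames that vary with time thereby become expressions in the fixed
  basis \<open>BB\<close>.\<close>

lemma frame_sum:
  fixes F :: "'l \<Rightarrow> 'l \<Rightarrow> real" and E :: "'i \<Rightarrow> 'l"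
  assumes h: "pform h" and F: "bilinear F" and S: "finite S" "\<And>z. z \<in> S \<Longrightarrow> E z \<in> pp"
    and E: "\<And>X. X \<in> pp \<Longrightarrow> X = (\<Sum>z\<in>S. h X (E z) *\<^sub>R E z)"
  shows "(\<Sum>z\<in>S. F (E z) (E z)) = (\<Sum>b\<in>BB. \<Sum>c\<in>BB. dual h b c * F b c)"
proof -
  have d: "dual h b c = (\<Sum>z\<in>S. Q (E z) b * Q (E z) c)" if "b \<in> BB" for b c
  proof -
    have b: "b \<in> pp" using BB_pp[OF that] .
    have "sharp h b = (\<Sum>z\<in>S. Q (E z) b *\<^sub>R E z)"
      using E[OF sharp_pp[OF h b]] h_sharp[OF h b] pformD(3)[OF h, of "sharp h b"] by simp
    then show ?thesis by (simp add: dual_def bilinear_sum_left[OF Q_bil] bilinear_lmul[OF Q_bil])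
  qed
  have "F (E z) (E z) = (\<Sum>b\<in>BB. \<Sum>c\<in>BB. Q (E z) b * Q (E z) c * F b c)" if "z \<in> S" for z
  proof -
    note e = pp_expand[OF S(2)[OF that]]
    have "F (E z) (E z) = F (\<Sum>b\<in>BB. Q (E z) b *\<^sub>R b) (\<Sum>c\<in>BB. Q (E z) c *\<^sub>R c)" by (simp only: e[symmetric])
    then show ?thesis
      by (simp add: bilinear_sum_left[OF F] bilinear_sum_right[OF F] bilinear_lmul[OF F] bilinear_rmul[OF F] sum_distrib_left mult.assoc)
        (subst sum.swap, simp add: mult.left_commute)
  qed
  then have "(\<Sum>z\<in>S. F (E z) (E z)) = (\<Sum>z\<in>S. \<Sum>b\<in>BB. \<Sum>c\<in>BB. Q (E z) b * Q (E z) c * F b c)" by simp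
  also have "\<dots> = (\<Sum>b\<in>BB. \<Sum>z\<in>S. \<Sum>c\<in>BB. Q (E z) b * Q (E z) c * F b c)" by (rule sum.swap)
  also have "\<dots> = (\<Sum>b\<in>BB. \<Sum>c\<in>BB. \<Sum>z\<in>S. Q (E z) b * Q (E z) c * F b c)"
    by (rule sum.cong[OF refl], rule sum.swap)
  also have "\<dots> = (\<Sum>b\<in>BB. \<Sum>c\<in>BB. dual h b c * F b c)"
    by (intro sum.cong refl) (simp add: d sum_distrib_right)
  finally show ?thesis .
qed

lemma trace_dual:
  assumes h: "pform h"
  shows "(\<Sum>b\<in>BB. \<Sum>c\<in>BB. dual h b c * h (D b) c) = (\<Sum>b\<in>BB. Q (D b) b)"
proof (rule sum.cong[OF refl])
  fix b assume "b \<in> BB"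
  then have b: "b \<in> pp" by (rule BB_pp)
  show "(\<Sum>c\<in>BB. dual h b c * h (D b) c) = Q (D b) b"
    unfolding contr_right[OF pformD(2)[OF h]] sharp_contr[OF h b, symmetric] by (rule h_sharp[OF h b])
qed

text \<open>The hypothesis says that the product of the inverse block \<open>D\<close> and
  \<open>E\<close> is symmetric. Both factors are symmetric, so they commute, and then
  \<open>E\<close> commutes with the inverse \<open>S\<close> of \<open>D\<close>. The unit
  \<open>U\<close> is that of the block, zero outside it.\<close>

lemma commute_dual:
  fixes \<iota> :: "nat \<Rightarrow> 'n::finite"
  assumes h: "pform h" and \<eta>: "iform \<eta>" and \<iota>: "inj_on \<iota> {1..r}"
    and N: "\<And>i j. i \<in> {1..r} \<Longrightarrow> j \<in> {1..r} \<Longrightarrow>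
      (\<Sum>l\<in>{1..r}. dual h (Y i 1) (Y l 1) * \<eta> (Y l 1) (Y j 1)) = (\<Sum>l\<in>{1..r}. dual h (Y j 1) (Y l 1) * \<eta> (Y l 1) (Y i 1))"
  shows "adm (emb \<iota> r (\<lambda>i j. h (Y i 1) (Y j 1))) (emb \<iota> r (\<lambda>i j. \<eta> (Y i 1) (Y j 1))) = 0"
proof -
  define S where "S = emb \<iota> r (\<lambda>i j. h (Y i 1) (Y j 1))"
  define E where "E = emb \<iota> r (\<lambda>i j. \<eta> (Y i 1) (Y j 1))"
  define D where "D = emb \<iota> r (\<lambda>i j. dual h (Y i 1) (Y j 1))"
  define U where "U = emb \<iota> r (\<lambda>i j. if i = j then 1 else 0)"
  have U1: "emb \<iota> r f ** U = emb \<iota> r f" for f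
    unfolding U_def emb_mult[OF \<iota>] by (rule emb_cong) (simp add: if_distrib cong: if_cong)
  have U2: "U ** emb \<iota> r f = emb \<iota> r f" for f
    unfolding U_def emb_mult[OF \<iota>] by (rule emb_cong) (simp add: if_distrib if_distribR cong: if_cong)
  have DS: "D ** S = U" unfolding D_def S_def U_def emb_mult[OF \<iota>]
    by (rule emb_cong) (rule dual_inverse[OF h])
  have SD: "S ** D = U" unfolding D_def S_def U_def emb_mult[OF \<iota>]
  proof (rule emb_cong)
    fix i j assume ij: "i \<in> {1..r}" "j \<in> {1..r}"
    have "(\<Sum>l\<in>{1..r}. h (Y i 1) (Y l 1) * dual h (Y l 1) (Y j 1)) = (\<Sum>l\<in>{1..r}. dual h (Y j 1) (Y l 1) * h (Y l 1) (Y i 1))"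
      by (rule sum.cong[OF refl]) (metis mult.commute pformD(3)[OF h] iform_sym[OF iform_dual[OF h]])
    then show "(\<Sum>l\<in>{1..r}. h (Y i 1) (Y l 1) * dual h (Y l 1) (Y j 1)) = (if i = j then 1 else 0)"
      using dual_inverse[OF h ij(2,1)] by simp
  qed
  have DE: "D ** E = E ** D" unfolding D_def E_def emb_mult[OF \<iota>]
  proof (rule emb_cong)
    fix i j assume ij: "i \<in> {1..r}" "j \<in> {1..r}"
    have "(\<Sum>l\<in>{1..r}. \<eta> (Y i 1) (Y l 1) * dual h (Y l 1) (Y j 1)) = (\<Sum>l\<in>{1..r}. dual h (Y j 1) (Y l 1) * \<eta> (Y l 1) (Y i 1))"
      by (rule sum.cong[OF refl]) (metis mult.commute iform_sym[OF \<eta>] iform_sym[OF iform_dual[OF h]])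
    then show "(\<Sum>l\<in>{1..r}. dual h (Y i 1) (Y l 1) * \<eta> (Y l 1) (Y j 1)) = (\<Sum>l\<in>{1..r}. \<eta> (Y i 1) (Y l 1) * dual h (Y l 1) (Y j 1))"
      using N[OF ij] by simp
  qed
  have "E ** S = U ** E ** S" by (simp add: E_def U2)
  also have "\<dots> = S ** (D ** E) ** S" by (simp add: SD[symmetric] matrix_mul_assoc)
  also have "\<dots> = S ** E ** (D ** S)" unfolding DE by (simp only: matrix_mul_assoc)
  also have "\<dots> = S ** (E ** U)" unfolding DS by (simp only: matrix_mul_assoc)
  also have "\<dots> = S ** E" by (simp add: E_def U1)
  finally show ?thesis by (simp add: adm_def S_def E_def)
qed

end

subsection \<open>Rotating the equivalent summands\<close>

context orthogonal_action
begin

lemma transport_irreducible: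
  assumes V: "irreducible_rep \<rho> K V" and R: "linear R" "inj_on R V"
    and eq: "\<And>a x. a \<in> K \<Longrightarrow> x \<in> V \<Longrightarrow> R (\<rho> a x) = \<rho> a (R x)"
  shows "irreducible_rep \<rho> K (R ` V)"
proof -
  have sub: "subspace V" and inv: "\<And>a x. a \<in> K \<Longrightarrow> x \<in> V \<Longrightarrow> \<rho> a x \<in> V" and ne: "V \<noteq> {0}"
    using V by (auto simp: irreducible_rep_def invariant_subspace_def)
  have "subspace (R ` V)" using sub R(1) linear_subspace_image by blast
  moreover have "\<rho> a ` R ` V \<subseteq> R ` V" if "a \<in> K" for a
    using that eq inv by (auto simp: image_iff) metis
  ultimately have 1: "invariant_subspace \<rho> K (R ` V)" by (simp add: invariant_subspace_def)
  have 2: "R ` V \<noteq> {0}"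
  proof -
    obtain v where "v \<in> V" "v \<noteq> 0" using ne sub subspace_0 by blast
    then have "R v \<noteq> R 0" using inj_onD[OF R(2), of v 0] subspace_0[OF sub] by blast
    then show ?thesis using \<open>v \<in> V\<close> linear_0[OF R(1)] by auto
  qed
  have 3: "W = {0} \<or> W = R ` V" if W: "invariant_subspace \<rho> K W" "W \<subseteq> R ` V" for W
  proof -
    have subW: "subspace W" and invW: "\<And>a x. a \<in> K \<Longrightarrow> x \<in> W \<Longrightarrow> \<rho> a x \<in> W"
      using W(1) by (auto simp: invariant_subspace_def)
    let ?W = "{x \<in> V. R x \<in> W}"
    have "subspace ?W" using sub subW by (auto simp: subspace_def linear_0[OF R(1)] linear_add[OF R(1)] linear_cmul[OF R(1)])
    then have "invariant_subspace \<rho> K ?W" using inv eq invW by (auto simp: invariant_subspace_def)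
    moreover have "?W \<subseteq> V" by blast
    ultimately have "?W = {0} \<or> ?W = V" using V unfolding irreducible_rep_def by blast
    moreover have "W = R ` ?W" using W(2) by auto
    ultimately show ?thesis using linear_0[OF R(1)] by auto
  qed
  show ?thesis unfolding irreducible_rep_def using 1 2 3 by blast
qed

lemma transport_orthogonal:
  assumes V: "orthogonal_rep \<rho> K V" and R: "linear R" "inj_on R V"
    and eq: "\<And>a x. a \<in> K \<Longrightarrow> x \<in> V \<Longrightarrow> R (\<rho> a x) = \<rho> a (R x)"
  shows "orthogonal_rep \<rho> K (R ` V)"
proof -
  have irr: "irreducible_rep \<rho> K V" using V by (simp add: orthogonal_rep_def)
  then have sub: "subspace V" and inv: "\<And>a x. a \<in> K \<Longrightarrow> x \<in> V \<Longrightarrow> \<rho> a x \<in> V"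
    by (auto simp: irreducible_rep_def invariant_subspace_def)
  have "W = {0} \<or> W = R ` V \<times> R ` V"
    if W: "invariant_subspace (\<lambda>a. map_prod (\<rho> a) (\<rho> a)) K W" "W \<subseteq> R ` V \<times> R ` V" "\<forall>(x, y)\<in>W. (- y, x) \<in> W" for W
  proof -
    have subW: "subspace W" and invW: "\<And>a x y. a \<in> K \<Longrightarrow> (x, y) \<in> W \<Longrightarrow> (\<rho> a x, \<rho> a y) \<in> W"
      using W(1) by (auto simp: invariant_subspace_def)
    have W0: "(0, 0) \<in> W" using subspace_0[OF subW] by (simp add: zero_prod_def)
    have Wa: "(x + x', y + y') \<in> W" if "(x, y) \<in> W" "(x', y') \<in> W" for x y x' y'
      using subspace_add[OF subW that] by simp
    have Wm: "(s *\<^sub>R x, s *\<^sub>R y) \<in> W" if "(x, y) \<in> W" for x y s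
      using subspace_scale[OF subW that] by simp
    let ?W = "{(x, y). x \<in> V \<and> y \<in> V \<and> (R x, R y) \<in> W}"
    have "subspace ?W" using sub Wa Wm W0
      by (auto simp: subspace_def linear_0[OF R(1)] linear_add[OF R(1)] linear_cmul[OF R(1)] zero_prod_def)
    then have "invariant_subspace (\<lambda>a. map_prod (\<rho> a) (\<rho> a)) K ?W"
      using inv eq invW by (auto simp: invariant_subspace_def)
    moreover have "?W \<subseteq> V \<times> V" by blast
    moreover have "\<forall>(x, y)\<in>?W. (- y, x) \<in> ?W" using W(3) sub by (auto simp: linear_neg[OF R(1)] subspace_neg)
    ultimately have "?W = {0} \<or> ?W = V \<times> V" using V unfolding orthogonal_rep_def by blast
    moreover have "W = map_prod R R ` ?W" using W(2) by (auto simp: image_iff)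
    ultimately show ?thesis using linear_0[OF R(1)] by (auto simp: zero_prod_def map_prod_surj_on)
  qed
  then show ?thesis unfolding orthogonal_rep_def using transport_irreducible[OF irr R eq] by blast
qed

text \<open>The equivalence is \<open>S\<close> after the inverse of \<open>R\<close>. That inverse
  is written as an expansion in the orthonormal vectors \<open>u\<close>, which defines it linearly
  on the whole space, as \<open>equivalence_map\<close> demands.\<close>

lemma transport_equivalence:
  fixes u v w :: "nat \<Rightarrow> 'l"
  assumes V: "irreducible_rep \<rho> K V" and w: "span (w ` {1..d}) = V"
    and R: "linear R" "\<And>k. k \<in> {1..d} \<Longrightarrow> R (w k) = u k" and S: "linear S" "inj_on S V" "\<And>k. k \<in> {1..d} \<Longrightarrow> S (w k) = v k"
    and eqR: "\<And>a x. a \<in> K \<Longrightarrow> x \<in> V \<Longrightarrow> R (\<rho> a x) = \<rho> a (R x)"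
    and eqS: "\<And>a x. a \<in> K \<Longrightarrow> x \<in> V \<Longrightarrow> S (\<rho> a x) = \<rho> a (S x)"
    and u: "\<And>k l. k \<in> {1..d} \<Longrightarrow> l \<in> {1..d} \<Longrightarrow> Q (u k) (u l) = (if k = l then 1 else 0)"
  shows "\<exists>T. equivalence_map \<rho> K (R ` V) (S ` V) T \<and> (\<forall>k\<in>{1..d}. T (u k) = v k)"
proof -
  define p where "p x = (\<Sum>k\<in>{1..d}. Q x (u k) *\<^sub>R w k)" for x
  have p: "linear p" unfolding p_def
    by (intro linearI) (simp_all add: bilinear_ladd[OF Q_bil] bilinear_lmul[OF Q_bil] scaleR_add_left sum.distrib scaleR_sum_right)
  have pR: "p (R x) = x" if "x \<in> V" for x
  proof -
    have "x \<in> span (w ` {1..d})" using that w by simp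
    then show ?thesis
    proof (induction rule: span_induct)
      case base
      show "subspace {x. p (R x) = x}"
        by (auto simp: subspace_def linear_0[OF p] linear_0[OF R(1)] linear_add[OF p] linear_add[OF R(1)]
            linear_cmul[OF p] linear_cmul[OF R(1)])
    next
      case (step x)
      then obtain k where k: "k \<in> {1..d}" "x = w k" by blast
      have "p (u k) = (\<Sum>l\<in>{1..d}. if k = l then w l else 0)" unfolding p_def
        by (intro sum.cong refl) (simp only: u[OF k(1)] split: if_splits, simp)
      then show ?case using k R(2)[OF k(1)] by simp
    qed
  qed
  have inv: "\<And>a x. a \<in> K \<Longrightarrow> x \<in> V \<Longrightarrow> \<rho> a x \<in> V"
    using V by (auto simp: irreducible_rep_def invariant_subspace_def)
  have injR: "inj_on R V" using pR by (metis inj_onI)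
  have "bij_betw (\<lambda>x. S (p x)) (R ` V) (S ` V)"
    unfolding bij_betw_def
  proof
    show "inj_on (\<lambda>x. S (p x)) (R ` V)" using S(2) by (auto simp: inj_on_def pR)
    show "(\<lambda>x. S (p x)) ` R ` V = S ` V" by (auto simp: image_image pR)
  qed
  moreover have "S (p (\<rho> a y)) = \<rho> a (S (p y))" if "a \<in> K" "y \<in> R ` V" for a y
    using that inv eqS by (auto simp: eqR[symmetric] pR)
  moreover have "linear (\<lambda>x. S (p x))" using linear_compose[OF p S(1)] by (simp add: o_def)
  ultimately have "equivalence_map \<rho> K (R ` V) (S ` V) (\<lambda>x. S (p x))" by (simp add: equivalence_map_def)
  moreover have "S (p (u k)) = v k" if k: "k \<in> {1..d}" for k
  proof -
    have "w k \<in> V" using k w by (metis imageI span_base)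
    then show ?thesis using pR[of "w k"] R(2)[OF k] S(3)[OF k] by simp
  qed
  ultimately show ?thesis by blast
qed

lemma span_orthogonal:
  assumes "\<And>x y. x \<in> S \<Longrightarrow> y \<in> T \<Longrightarrow> Q x y = 0" and xy: "x \<in> span S" "y \<in> span T"
  shows "Q x y = 0"
proof -
  have "span T \<subseteq> {y. Q x y = 0}" if "x \<in> S" for x
    by (rule span_minimal) (use assms(1) that in \<open>auto simp: subspace_def bilinear_rzero[OF Q_bil] bilinear_radd[OF Q_bil] bilinear_rmul[OF Q_bil]\<close>)
  then have "span S \<subseteq> {x. Q x y = 0}"
    by (intro span_minimal) (use xy in \<open>auto simp: subspace_def bilinear_lzero[OF Q_bil] bilinear_ladd[OF Q_bil] bilinear_lmul[OF Q_bil]\<close>)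
  then show ?thesis using xy by blast
qed

end

context isotropy_rep
begin

text \<open>Each new summand is the image of \<open>P 1\<close> under \<open>R i\<close>, a
  combination of the equivalences of \<open>P 1\<close> with the old summands, and its properties
  are transported from \<open>P 1\<close>. The row relations of \<open>U\<close> give
  orthonormality, the column relations recover the old summands in the span.\<close>

lemma rotated_decomposition:
  fixes U :: "nat \<Rightarrow> nat \<Rightarrow> real"
  assumes row: "\<And>i j. i \<in> {1..r} \<Longrightarrow> j \<in> {1..r} \<Longrightarrow> (\<Sum>k\<in>{1..r}. U i k * U j k) = (if i = j then 1 else 0)"
    and col: "\<And>i j. i \<in> {1..r} \<Longrightarrow> j \<in> {1..r} \<Longrightarrow> (\<Sum>k\<in>{1..r}. U k i * U k j) = (if i = j then 1 else 0)"
    and Y'_def: "\<And>i k. Y' i k = (\<Sum>j\<in>{1..r}. U i j *\<^sub>R Y j k)"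
    and P'_def: "\<And>i. P' i = (if i \<le> r then span (Y' i ` {1..d}) else P i)"
  shows "isotropy_decomposition A G K Q m r d P' Y'"
proof -
  have "\<exists>T. \<forall>j\<in>{1..r}. equivalence_map \<rho> K (P 1) (P j) (T j) \<and> (\<forall>k\<in>{1..d}. T j (Y 1 k) = Y j k)"
    using decD(14)[OF r_sub(3)] by (intro bchoice) blast
  then obtain T where T: "\<And>j. j \<in> {1..r} \<Longrightarrow> equivalence_map \<rho> K (P 1) (P j) (T j)"
    "\<And>j k. j \<in> {1..r} \<Longrightarrow> k \<in> {1..d} \<Longrightarrow> T j (Y 1 k) = Y j k" by blast
  have Tl: "linear (T j)" and Te: "\<And>a x. a \<in> K \<Longrightarrow> x \<in> P 1 \<Longrightarrow> T j (\<rho> a x) = \<rho> a (T j x)" if "j \<in> {1..r}" for j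
    using T(1)[OF that] by (auto simp: equivalence_map_def)
  define R where "R i x = (\<Sum>j\<in>{1..r}. U i j *\<^sub>R T j x)" for i x
  have Rl: "linear (R i)" for i unfolding R_def
    by (intro linear_compose_sum ballI linear_compose_scale_right Tl)
  have RY: "R i (Y 1 k) = Y' i k" if "k \<in> {1..d}" for i k unfolding R_def Y'_def
    by (intro sum.cong refl) (simp only: T(2) that)
  have Re: "R i (\<rho> a x) = \<rho> a (R i x)" if "a \<in> K" "x \<in> P 1" for i a x
    unfolding R_def linear_sum[OF rho_linear] linear_cmul[OF rho_linear]
    by (intro sum.cong refl) (simp only: Te that)
  have QY': "Q (Y' i k) (Y' j l) = (if i = j \<and> k = l then 1 else 0)"
    if i: "i \<in> {1..r}" "j \<in> {1..r}" and k: "k \<in> {1..d}" "l \<in> {1..d}" for i j k l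
  proof -
    have "Q (Y' i k) (Y' j l) = (\<Sum>p\<in>{1..r}. \<Sum>q\<in>{1..r}. U i p * (U j q * Q (Y p k) (Y q l)))"
      unfolding Y'_def
      by (simp add: bilinear_sum_left[OF Q_bil] bilinear_sum_right[OF Q_bil] bilinear_lmul[OF Q_bil] bilinear_rmul[OF Q_bil] sum_distrib_left)
        (subst sum.swap, simp add: mult.left_commute)
    also have "\<dots> = (\<Sum>p\<in>{1..r}. \<Sum>q\<in>{1..r}. if p = q then (if k = l then U i p * U j q else 0) else 0)"
      by (intro sum.cong refl) (simp only: Q_YY k, simp)
    also have "\<dots> = (if k = l then \<Sum>p\<in>{1..r}. U i p * U j p else 0)" by simp
    finally show ?thesis by (simp only: row[OF i]) simp
  qed
  have sp1: "span (Y 1 ` {1..d}) = P 1" by (rule decD(13)[OF r_sub(3)])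
  have R1: "R i ` P 1 = P' i" if i: "i \<in> {1..r}" for i
  proof -
    have "R i ` P 1 = span (R i ` Y 1 ` {1..d})" unfolding sp1[symmetric] by (rule linear_span_image[OF Rl, symmetric])
    also have "R i ` Y 1 ` {1..d} = Y' i ` {1..d}" unfolding image_image by (intro image_cong refl) (rule RY)
    finally show ?thesis using i by (simp add: P'_def)
  qed
  have irr1: "irreducible_rep \<rho> K (P 1)" using decD(3)[OF r_sub(1)[OF r_sub(3)]] .
  have Ri: "inj_on (R i) (P 1)" if i: "i \<in> {1..r}" for i
  proof -
    have pos: "Q (R i x) (Y' i k) = Q x (Y 1 k)" if x: "x \<in> P 1" and k: "k \<in> {1..d}" for x k
    proof -
      have "x \<in> span (Y 1 ` {1..d})" using x sp1 by simp
      then show ?thesis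
      proof (induction rule: span_induct)
        case base
        show "subspace {x. Q (R i x) (Y' i k) = Q x (Y 1 k)}"
          by (auto simp: subspace_def linear_0[OF Rl] linear_add[OF Rl] linear_cmul[OF Rl] bilinear_lzero[OF Q_bil]
            bilinear_ladd[OF Q_bil] bilinear_lmul[OF Q_bil])
      next
        case (step x)
        then obtain l where l: "l \<in> {1..d}" "x = Y 1 l" by blast
        then show ?case using RY[OF l(1)] QY'[OF i i l(1) k] decD(12)[OF r_sub(3) l(1) k] by simp
      qed
    qed
    show ?thesis
    proof (rule inj_onI)
      fix x y assume x: "x \<in> P 1" and y: "y \<in> P 1" and e: "R i x = R i y"
      have "Q x b = Q y b" if "b \<in> Y 1 ` {1..d}" for b
        using that pos[OF x] pos[OF y] e by auto
      moreover have o: "onb Q (Y 1 ` {1..d}) (P 1)" using Bi[OF r_sub(1)[OF r_sub(3)]] decD(1) by (simp add: Bi_def)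
      ultimately have "(\<Sum>b\<in>Y 1 ` {1..d}. Q x b *\<^sub>R b) = (\<Sum>b\<in>Y 1 ` {1..d}. Q y b *\<^sub>R b)" by simp
      then show "x = y" using onb_expand[OF Q o x] onb_expand[OF Q o y] by simp
    qed
  qed
  have orth': "orthogonal_rep \<rho> K (P' i)" and dim': "dim (P' i) = d" if i: "i \<in> {1..r}" for i
  proof -
    show "orthogonal_rep \<rho> K (P' i)"
      using transport_orthogonal[OF decD(10)[OF r_sub(3)] Rl Ri[OF i] Re] R1[OF i] by simp
    have sp: "span (P 1) = P 1" using P_inv(2)[OF r_sub(1)[OF r_sub(3)]] span_eq_iff by blast
    then have "dim (R i ` P 1) = dim (P 1)" by (intro dim_image_eq[OF Rl]) (unfold sp, rule Ri[OF i])
    then show "dim (P' i) = d" using R1[OF i] decD(11)[OF r_sub(3)] by simp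
  qed
  have P'r: "P' i = P i" if "i \<in> {r<..m}" for i using that by (simp add: P'_def)
  have cases: "i \<in> {1..r} \<or> i \<in> {r<..m}" if "i \<in> {1..m}" for i using that by auto
  have Y'pp: "Y' i k \<in> span (\<Union>j\<in>{1..r}. P j)" if "k \<in> {1..d}" for i k
    unfolding Y'_def by (intro span_sum span_scale span_base) (use Y_in that in blast)
  have sub1: "P' i \<subseteq> span (\<Union>j\<in>{1..r}. P j)" if "i \<in> {1..r}" for i
  proof -
    have "P' i = span (Y' i ` {1..d})" using that by (simp add: P'_def)
    also have "\<dots> \<subseteq> span (\<Union>j\<in>{1..r}. P j)" using Y'pp by (intro span_minimal subspace_span image_subsetI)
    finally show ?thesis .
  qed
  have sub2: "span (\<Union>j\<in>{1..r}. P j) \<subseteq> pp" using decD(2) by (intro span_mono UN_mono) auto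
  have eqv: "\<exists>S. equivalence_map \<rho> K (P' i) (P' j) S \<and> (\<forall>k\<in>{1..d}. S (Y' i k) = Y' j k)"
    if i: "i \<in> {1..r}" "j \<in> {1..r}" for i j
  proof -
    have "\<exists>S. equivalence_map \<rho> K (R i ` P 1) (R j ` P 1) S \<and> (\<forall>k\<in>{1..d}. S (Y' i k) = Y' j k)"
      by (rule transport_equivalence[OF irr1 sp1 Rl _ Rl Ri[OF i(2)]])
        (use RY Re QY'[OF i(1) i(1)] in \<open>simp_all del: atLeastAtMost_iff One_nat_def\<close>)
    then show ?thesis unfolding R1[OF i(1)] R1[OF i(2)] .
  qed
  have e1: "\<exists>S. equivalence_map \<rho> K (P 1) (P' 1) S"
  proof -
    have "equivalence_map \<rho> K (P 1) (P' 1) (R 1)"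
      unfolding equivalence_map_def bij_betw_def using Rl Ri[OF r_sub(3)] R1[OF r_sub(3)] Re by simp
    then show ?thesis by blast
  qed
  show ?thesis
    unfolding isotropy_decomposition_def
  proof (intro conjI ballI impI)
    show "1 \<le> r" "r \<le> m" by (rule decD)+
    show "irreducible_rep \<rho> K (P' i)" if "i \<in> {1..m}" for i
      using cases[OF that] orth' P'r decD(3)[OF that] by (auto simp: orthogonal_rep_def simp del: atLeastAtMost_iff)
    show "Q X Z = 0" if "i \<in> {1..m}" "X \<in> kk" "Z \<in> P' i" for i X Z
      using cases[OF that(1)]
    proof
      assume "i \<in> {1..r}"
      then show ?thesis using kk_pp[OF that(2)] sub1 sub2 that(3) by blast
    next
      assume "i \<in> {r<..m}"
      then show ?thesis using decD(4)[OF that(1,2)] that(3) P'r by simp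
    qed
    have 1: "Q X Z = 0" if i: "i \<in> {1..r}" and j: "j \<in> {1..m}" and ij: "i \<noteq> j" and X: "X \<in> P' i" and Z: "Z \<in> P' j" for i j X Z
      using cases[OF j]
    proof
      assume jr: "j \<in> {1..r}"
      have "X \<in> span (Y' i ` {1..d})" "Z \<in> span (Y' j ` {1..d})" using X Z i jr by (simp_all add: P'_def)
      then show ?thesis by (rule span_orthogonal[rotated 1]) (use QY'[OF i jr] ij in auto)
    next
      assume jr: "j \<in> {r<..m}"
      have "X \<in> span (\<Union>p\<in>{1..r}. P p)" "Z \<in> span (P j)" using X Z sub1[OF i] P'r[OF jr] span_base by auto
      then show ?thesis
      proof (rule span_orthogonal[rotated 1])
        fix x y assume "x \<in> (\<Union>p\<in>{1..r}. P p)" and y: "y \<in> P j"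
        then obtain p where p: "p \<in> {1..r}" "x \<in> P p" by blast
        then have "p \<noteq> j" using jr by auto
        then show "Q x y = 0" using decD(5)[OF r_sub(1)[OF p(1)] j _ p(2) y] by blast
      qed
    qed
    show "Q X Z = 0" if "i \<in> {1..m}" "j \<in> {1..m}" "i \<noteq> j" "X \<in> P' i" "Z \<in> P' j" for i j X Z
    proof (cases "i \<le> r \<or> j \<le> r")
      case True
      then show ?thesis using 1[of i j X Z] 1[of j i Z X] that Q_sym[of X Z] by auto
    next
      case False
      then show ?thesis using decD(5)[OF that(1,2,3)] that by (simp add: P'_def)
    qed
    show "span (kk \<union> (\<Union>i\<in>{1..m}. P' i)) = UNIV"
    proof -
      let ?S = "span (kk \<union> (\<Union>i\<in>{1..m}. P' i))"
      have "P j \<subseteq> ?S" if j: "j \<in> {1..m}" for j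
        using cases[OF j]
      proof
        assume "j \<in> {r<..m}"
        then have "P j = P' j" using P'r by simp
        then show ?thesis using j span_superset[of "kk \<union> (\<Union>i\<in>{1..m}. P' i)"] by blast
      next
        assume jr: "j \<in> {1..r}"
        have "Y j k \<in> ?S" if k: "k \<in> {1..d}" for k
        proof -
          have "(\<Sum>i\<in>{1..r}. U i j *\<^sub>R Y' i k) = (\<Sum>i\<in>{1..r}. \<Sum>l\<in>{1..r}. (U i j * U i l) *\<^sub>R Y l k)"
            by (simp add: Y'_def scaleR_sum_right)
          also have "\<dots> = (\<Sum>l\<in>{1..r}. (\<Sum>i\<in>{1..r}. U i j * U i l) *\<^sub>R Y l k)"
            by (subst sum.swap) (simp add: scaleR_sum_left)
          also have "\<dots> = (\<Sum>l\<in>{1..r}. if j = l then Y l k else 0)"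
            by (intro sum.cong refl) (simp only: col jr, simp)
          also have "\<dots> = Y j k" using jr by simp
          finally have Yjk: "Y j k = (\<Sum>i\<in>{1..r}. U i j *\<^sub>R Y' i k)" by simp
          have "Y' i k \<in> ?S" if i: "i \<in> {1..r}" for i
          proof -
            have "Y' i k \<in> P' i" using i k by (simp add: P'_def span_base)
            then show ?thesis using r_sub(1)[OF i] by (blast intro: span_base)
          qed
          then show ?thesis unfolding Yjk by (intro span_sum span_scale)
        qed
        then show ?thesis unfolding decD(13)[OF jr, symmetric] by (intro span_minimal subspace_span) blast
      qed
      then have "span (kk \<union> (\<Union>i\<in>{1..m}. P i)) \<subseteq> ?S"
        by (intro span_minimal subspace_span) (auto intro: span_base simp del: atLeastAtMost_iff)
      then show ?thesis using decD(6) by blast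
    qed
    show "equivalent_reps \<rho> K (P' i) (P' j)" if "i \<in> {1..r}" "j \<in> {1..r}" for i j
      using eqv[OF that] by (auto simp: equivalent_reps_def)
    show "\<not> equivalent_reps \<rho> K (P' 1) (P' l)" if "l \<in> {r<..m}" for l
      using e1 decD(8)[OF that] P'r[OF that] equivalence_map_compose unfolding equivalent_reps_def by metis
    show "\<not> equivalent_reps \<rho> K (P' l) (P' l')" if "l \<in> {r<..m}" "l' \<in> {r<..m}" "l \<noteq> l'" for l l'
      using decD(9)[OF that] P'r that by simp
    show "orthogonal_rep \<rho> K (P' i)" "dim (P' i) = d" if "i \<in> {1..r}" for i by (rule orth'[OF that], rule dim'[OF that])
    show "Q (Y' i k) (Y' i l) = (if k = l then 1 else 0)" if "i \<in> {1..r}" "k \<in> {1..d}" "l \<in> {1..d}" for i k l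
      using QY'[OF that(1,1,2,3)] by simp
    show "span (Y' i ` {1..d}) = P' i" if "i \<in> {1..r}" for i using that by (simp add: P'_def)
    show "\<exists>T. equivalence_map \<rho> K (P' i) (P' j) T \<and> (\<forall>k\<in>{1..d}. T (Y' i k) = Y' j k)" if "i \<in> {1..r}" "j \<in> {1..r}" for i j
      by (rule eqv[OF that])
  qed
qed

end

section \<open>Einstein metrics of cohomogeneity one\<close>

locale einstein_decomposition = cohomogeneity_one_action A G B g \<phi> K I c \<Lambda>
  for A :: "('g::t2_space, 'l::euclidean_space) chart set" and G :: "'g monoid"
    and B :: "('m::t2_space, 'e::euclidean_space) chart set" and g \<phi> K I c \<Lambda> +
  fixes Q :: "'l \<Rightarrow> 'l \<Rightarrow> real" and m r d :: nat and P :: "nat \<Rightarrow> 'l set" and Y :: "nat \<Rightarrow> nat \<Rightarrow> 'l"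
  assumes biinv: "bi_invariant A G Q" and decomp: "isotropy_decomposition A G K Q m r d P Y"
begin

lemma lie_algebra_K: "t \<in> I \<Longrightarrow> X \<in> lie_algebra_of A G K \<longleftrightarrow> \<alpha> t X = 0"
  using isotropy_algebra[OF curve(3)] by blast

sublocale isotropy_rep A G K Q m r d P Y
proof (intro isotropy_rep.intro orthogonal_action.intro isotropy_rep_axioms.intro)
  show "inner_product_form Q" using biinv by (simp add: bi_invariant_def)
  show "linear (Ad A G a)" for a by (rule Ad_linear)
  show "Q (Ad A G a x) (Ad A G a y) = Q x y" for a x y using biinv carrier by (simp add: bi_invariant_def)
  obtain t where t: "t \<in> I" using I by blast
  have "lie_algebra_of A G K = {X. \<alpha> t X = 0}" using lie_algebra_K[OF t] by blast
  then show "subspace (lie_algebra_of A G K)"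
    using linear_subspace_kernel[OF action_field_linear] by simp
  show "isotropy_decomposition A G K Q m r d P Y" by (rule decomp)
qed

definition "Hf t X Z = H X Z t"
definition "dHf t X Z = dH X Z t"

lemma g_ip: "inner_product_form (g p)"
  using riem by (simp add: riemannian_metric_def)

lemma Hf_bilinear: "bilinear (Hf t)"
  unfolding Hf_def H_eq
  by (simp add: bilinear_def linear_iff linear_add[OF action_field_linear] linear_cmul[OF action_field_linear]
      bilinear_ladd[OF inner_product_formD(1)[OF g_ip]] bilinear_radd[OF inner_product_formD(1)[OF g_ip]]
      bilinear_lmul[OF inner_product_formD(1)[OF g_ip]] bilinear_rmul[OF inner_product_formD(1)[OF g_ip]])

text \<open>Invariance holds because \<open>K\<close> fixes \<open>c t\<close>, and positivity on
  the complement because the kernel of the action field is \<open>kk\<close>.\<close>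

lemma pform_Hf: assumes t: "t \<in> I" shows "pform (Hf t)"
  unfolding pform_def iform_def
proof (intro conjI allI ballI impI)
  show "bilinear (Hf t)" by (rule Hf_bilinear)
  show "Hf t x y = Hf t y x" for x y
    unfolding Hf_def H_eq by (rule inner_product_formD(2)[OF g_ip])
  show "Hf t (\<rho> a x) (\<rho> a y) = Hf t x y" if "a \<in> K" for a x y
  proof -
    have "\<phi> a (c t) = c t" using that curve(3)[OF t] by (auto simp: stabilizer_def)
    then show ?thesis using action_field_isometry[of a "c t" x y] by (simp add: Hf_def H_eq)
  qed
  show "Hf t X Z = 0" if "X \<in> kk" for X Z
    using lie_algebra_K[OF t] that by (simp add: Hf_def H_eq bilinear_lzero[OF inner_product_formD(1)[OF g_ip]])
  show "Hf t X X > 0" if X: "X \<in> pp" "X \<noteq> 0" for X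
  proof -
    have "\<alpha> t X \<noteq> 0"
    proof
      assume "\<alpha> t X = 0"
      then have "Q X X = 0" using kk_pp[OF _ X(1)] lie_algebra_K[OF t] by blast
      then show False using X Q_zero by simp
    qed
    then show ?thesis unfolding Hf_def H_eq by (rule inner_product_formD(3)[OF g_ip])
  qed
qed

lemma principal: assumes t: "t \<in> I" shows "dim (range (\<alpha> t)) + 1 = DIM('e)"
proof -
  have "c t \<in> orbit G \<phi> (c t)" unfolding orbit_def using carrier[of "\<one>\<^bsub>G\<^esub>"] act_one[of "c t"] by force
  then have "principal_point G \<phi> (c t)" using normal t unfolding normal_curve_def by blast
  then show ?thesis using cohom by (simp add: cohomogeneity_one_def)
qed

text \<open>An orthonormal basis of the tangent space of the orbit is lifted to the complement;
  applying \<open>pr\<close> does not change the action field. Codimension one lets the velocity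
  complete the basis.\<close>

lemma frame_exists:
  assumes t: "t \<in> I"
  shows "\<exists>(E :: 'e \<Rightarrow> 'l) S. frame_at t E S \<and> (\<forall>z\<in>S. E z \<in> pp) \<and> (\<forall>X\<in>pp. X = (\<Sum>z\<in>S. Hf t X (E z) *\<^sub>R E z))"
proof -
  let ?g = "g (c t)" and ?T = "vel t"
  have R: "subspace (range (\<alpha> t))" using linear_subspace_image[OF action_field_linear] subspace_UNIV by blast
  obtain S where S: "onb ?g S (range (\<alpha> t))" using onb_exists[OF g_ip R] by blast
  have fin: "finite S" using S by (simp add: onb_def)
  have ST: "?g ?T z = 0" "?g z ?T = 0" if "z \<in> S" for z
    using onb_mem[OF S that] curve(2)[OF t] inner_product_formD(2)[OF g_ip, of "c t" z ?T] by auto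
  have TT: "?g ?T ?T = 1" by (rule curve(1)[OF t])
  have TS: "?T \<notin> S" using ST TT by force
  have "?T \<notin> range (\<alpha> t)" using curve(2)[OF t] TT by (metis rangeE zero_neq_one)
  then have "?T \<notin> span (range (\<alpha> t))" using R span_eq_iff by blast
  then have "dim (insert ?T (range (\<alpha> t))) = DIM('e)" using principal[OF t] by (simp add: dim_insert)
  then have "span (insert ?T (range (\<alpha> t))) = UNIV" by (simp add: dim_eq_full)
  moreover have "span (insert ?T S) = span (insert ?T (range (\<alpha> t)))"
    using S R by (simp add: onb_def span_insert) (metis span_eq_iff)
  ultimately have "onb ?g (insert ?T S) UNIV"
    using S fin ST TT TS by (auto simp: onb_def)
  from onb_expand[OF g_ip this UNIV_I]
  have ex: "v = ?g v ?T *\<^sub>R ?T + (\<Sum>z\<in>S. ?g v z *\<^sub>R z)" for v using fin TS by simp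
  have "\<exists>X. X \<in> pp \<and> \<alpha> t X = z" if z: "z \<in> S" for z
  proof -
    obtain X where X: "\<alpha> t X = z" using onb_mem[OF S z] by blast
    have "\<alpha> t (X - pr X) = 0" using pr_diff lie_algebra_K[OF t] by blast
    then have "\<alpha> t (pr X) = z" using X by (simp add: linear_diff[OF action_field_linear])
    then show ?thesis using pr_pp by blast
  qed
  then obtain E where E: "\<And>z. z \<in> S \<Longrightarrow> E z \<in> pp" "\<And>z. z \<in> S \<Longrightarrow> \<alpha> t (E z) = z" by metis
  have "X = (\<Sum>z\<in>S. Hf t X (E z) *\<^sub>R E z)" if X: "X \<in> pp" for X
  proof -
    have "\<alpha> t X = (\<Sum>z\<in>S. ?g (\<alpha> t X) z *\<^sub>R z)"
      using ex[of "\<alpha> t X"] curve(2)[OF t, of X] inner_product_formD(2)[OF g_ip, of "c t" ?T] by simp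
    also have "\<dots> = \<alpha> t (\<Sum>z\<in>S. Hf t X (E z) *\<^sub>R E z)"
      by (simp add: linear_sum[OF action_field_linear] linear_cmul[OF action_field_linear] Hf_def H_eq E(2))
    finally have "\<alpha> t (X - (\<Sum>z\<in>S. Hf t X (E z) *\<^sub>R E z)) = 0" by (simp add: linear_diff[OF action_field_linear])
    then have k: "X - (\<Sum>z\<in>S. Hf t X (E z) *\<^sub>R E z) \<in> kk" using lie_algebra_K[OF t] by blast
    have "X - (\<Sum>z\<in>S. Hf t X (E z) *\<^sub>R E z) \<in> pp" using X E(1) by (intro span_diff span_sum span_scale) auto
    then show ?thesis using kk_pp[OF k] Q_zero by (metis eq_iff_diff_eq_0)
  qed
  moreover have "frame_at t E S" unfolding frame_at_def using fin ex by (simp add: E(2))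
  ultimately show ?thesis using E(1) by blast
qed

lemma H_has_deriv: assumes t: "t \<in> I" shows "(H X Z has_real_derivative dH X Z t) (at t)"
  using frame_exists[OF t] H_deriv[OF t] by blast

lemma dH_eqI:
  assumes t: "t \<in> I" and "\<And>s. s \<in> I \<Longrightarrow> H X Z s = f s" and "(f has_real_derivative D) (at t)"
  shows "dH X Z t = D"
  using has_field_derivative_transform_within_open[OF H_has_deriv[OF t] I(1) t] assms DERIV_unique by metis

text \<open>The identities satisfied by \<open>Hf\<close> hold at all times in the open set
  \<open>I\<close>, so they pass to the derivative.\<close>

lemma dHf_iform: assumes t: "t \<in> I" shows "iform (dHf t)" "X \<in> kk \<Longrightarrow> dHf t X Z = 0"
proof -
  note d = H_has_deriv[OF t]
  note b = Hf_bilinear[unfolded Hf_def]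
  show "X \<in> kk \<Longrightarrow> dHf t X Z = 0" unfolding dHf_def
    by (rule dH_eqI[OF t _ DERIV_const]) (use pformD(4)[OF pform_Hf] in \<open>simp add: Hf_def\<close>)
  have sym: "dHf t x y = dHf t y x" for x y unfolding dHf_def
    by (rule dH_eqI[OF t _ d]) (use pformD(3)[OF pform_Hf] in \<open>simp add: Hf_def\<close>)
  have "dHf t (x + x') y = dHf t x y + dHf t x' y" for x x' y unfolding dHf_def
    by (rule dH_eqI[OF t _ DERIV_add[OF d d]]) (use bilinear_ladd[OF Hf_bilinear] in \<open>simp add: Hf_def\<close>)
  moreover have "dHf t (a *\<^sub>R x) y = a * dHf t x y" for x a y unfolding dHf_def
    by (rule dH_eqI[OF t _ DERIV_cmult[OF d]]) (use bilinear_lmul[OF Hf_bilinear] in \<open>simp add: Hf_def\<close>)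
  ultimately have "bilinear (dHf t)" unfolding bilinear_def linear_iff using sym by (metis real_scaleR_def)
  moreover have "dHf t (\<rho> a x) (\<rho> a y) = dHf t x y" if a: "a \<in> K" for a x y unfolding dHf_def
    by (rule dH_eqI[OF t _ d]) (use pformD(1)[OF pform_Hf] a in \<open>simp add: Hf_def iform_def\<close>)
  ultimately show "iform (dHf t)" using sym by (simp add: iform_def)
qed

text \<open>The bracket is the derivative of \<open>Ad\<close>, and its skewness is read off from
  the commutator of action fields, which sees it modulo \<open>kk\<close> only. That suffices, as
  brackets are always paired with or projected to the complement.\<close>

lemma br_skew: "br X Z + br Z X \<in> kk"
proof -
  obtain t where t: "t \<in> I" using I by blast
  let ?\<kappa> = "chart_at B (c t)" and ?x = "cmap (chart_at B (c t)) (c t)"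
  have x: "?x \<in> dm ?\<kappa>" using B.chart_at(2) by blast
  have "- V ?\<kappa> (br Z X) ?x + - V ?\<kappa> (br X Z) ?x = 0"
    unfolding V_bracket[OF B.chart_at(1) x, symmetric] by simp
  then have "- (V ?\<kappa> (br Z X) ?x + V ?\<kappa> (br X Z) ?x) = 0" by simp
  then have "V ?\<kappa> (br Z X) ?x + V ?\<kappa> (br X Z) ?x = 0" by (simp only: neg_equal_0_iff_equal)
  moreover have "\<alpha> t W = V ?\<kappa> W ?x" for W
    using action_field_chart[OF B.chart_at, of "c t" W] by (simp add: B.tconv_chart_at)
  ultimately have "\<alpha> t (br X Z + br Z X) = 0" by (simp add: linear_add[OF action_field_linear] add.commute)
  then show ?thesis using lie_algebra_K[OF t] by blast
qed

lemma Q_br_self: "Q (br Z X) X = 0"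
  using bi_invariant_br[OF biinv, of Z X X] Q_sym[of X "br Z X"] by simp

lemma Q_br: assumes X': "X' \<in> pp" shows "Q (br Z X) X' = Q Z (br X X')"
proof -
  have "Q (br X Z + br Z X) X' = 0" by (rule kk_pp[OF br_skew X'])
  then show ?thesis using bi_invariant_br[OF biinv, of X Z X'] by (simp add: bilinear_ladd[OF Q_bil])
qed

lemma commutator_zero:
  assumes t: "t \<in> I"
  shows "(\<Sum>i\<in>{1..r}. \<Sum>j\<in>{1..r}. (\<Sum>l\<in>{1..r}. dual (Hf t) (Y i 1) (Y l 1) * dHf t (Y l 1) (Y j 1)) *\<^sub>R
    Zvec A G K m d P Y i j) = 0"
proof -
  define N where "N i j = (\<Sum>l\<in>{1..r}. dual (Hf t) (Y i 1) (Y l 1) * dHf t (Y l 1) (Y j 1))" for i j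
  note h = pform_Hf[OF t] and \<eta> = dHf_iform[OF t]
  obtain E :: "'e \<Rightarrow> 'l" and S where E: "frame_at t E S" "\<And>z. z \<in> S \<Longrightarrow> E z \<in> pp"
    "\<And>X. X \<in> pp \<Longrightarrow> X = (\<Sum>z\<in>S. Hf t X (E z) *\<^sub>R E z)" using frame_exists[OF t] by blast
  have fin: "finite S" using E(1) by (simp add: frame_at_def)
  have bl: "bilinear (\<lambda>X X'. f (br Z X) X')" if f: "bilinear f" for f :: "'l \<Rightarrow> 'l \<Rightarrow> real" and Z
    by (simp add: bilinear_def linear_iff bilinear_radd[OF br_bilinear] bilinear_rmul[OF br_bilinear]
        bilinear_ladd[OF f] bilinear_radd[OF f] bilinear_lmul[OF f] bilinear_rmul[OF f])
  have b1: "bilinear (\<lambda>X X'. Hf t (br W X) X')" and b2: "bilinear (\<lambda>X X'. dHf t (br W X) X')" for W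
    by (rule bl[OF Hf_bilinear], rule bl[OF iform_bil[OF \<eta>(1)]])
  \<comment> \<open>The trace of an adjoint map, zero because the map is skew for \<open>Q\<close>;
    it removes the second term of the mixed equation.\<close>
  have 0: "(\<Sum>i\<in>S. H (br W (E i)) (E i) t) = 0" for W
    using frame_sum[OF h b1[of W] fin E(2,3)] trace_dual[OF h, of "br W"]
    by (simp add: Hf_def[symmetric] Q_br_self)
  have "(\<Sum>b\<in>BB. \<Sum>c\<in>BB. dual (Hf t) b c * dHf t (br Z b) c) = 0" for Z
    using frame_sum[OF h b2[of Z] fin E(2,3)] einstein_mixed[OF t E(1), of Z]
    by (simp add: 0 dHf_def[symmetric])
  then have T: "(\<Sum>i\<in>{1..r}. \<Sum>j\<in>{1..r}. N i j * (\<Sum>k\<in>{1..d}. Q (br Z (Y i k)) (Y j k))) = 0" for Z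
    using trace_commutator[OF iform_dual[OF h] \<eta>(1) \<eta>(2) Q_br_self[of Z]] unfolding N_def by simp
  define W where "W = (\<Sum>i\<in>{1..r}. \<Sum>j\<in>{1..r}. N i j *\<^sub>R (\<Sum>k\<in>{1..d}. br (Y i k) (Y j k)))"
  have Ypp: "Y i k \<in> pp" if "i \<in> {1..r}" "k \<in> {1..d}" for i k
    using Y_in[OF that] r_sub(1)[OF that(1)] by (blast intro: span_base)
  \<comment> \<open>Bi-invariance isolates \<open>Z\<close> in one argument of \<open>Q\<close>, and
    nondegeneracy then eliminates it.\<close>
  have "Q Z W = 0" for Z
  proof -
    have "Q Z W = (\<Sum>i\<in>{1..r}. \<Sum>j\<in>{1..r}. N i j * (\<Sum>k\<in>{1..d}. Q Z (br (Y i k) (Y j k))))"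
      by (simp add: W_def bilinear_sum_right[OF Q_bil] bilinear_rmul[OF Q_bil])
    also have "\<dots> = (\<Sum>i\<in>{1..r}. \<Sum>j\<in>{1..r}. N i j * (\<Sum>k\<in>{1..d}. Q (br Z (Y i k)) (Y j k)))"
      by (intro sum.cong refl arg_cong2[of _ _ _ _ "(*)"]) (rule Q_br[OF Ypp, symmetric])
    finally show ?thesis using T by simp
  qed
  then have "W = 0" using Q_zero by blast
  then have "pr W = 0" by (simp add: linear_0[OF pr_linear])
  then show ?thesis
    by (simp add: W_def N_def Zvec_def p_part_pr linear_sum[OF pr_linear] linear_cmul[OF pr_linear])
qed

lemma Zvec_skew: "Zvec A G K m d P Y i j = - Zvec A G K m d P Y j i"
proof -
  have "pr (br X Z) + pr (br Z X) = 0" for X Z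
    using pr_kk[OF br_skew, of X Z] by (simp add: linear_add[OF pr_linear])
  then have "pr (br X Z) = - pr (br Z X)" for X Z by (simp add: eq_neg_iff_add_eq_0)
  then have "(\<Sum>k\<in>{1..d}. pr (br (Y i k) (Y j k))) = (\<Sum>k\<in>{1..d}. - pr (br (Y j k) (Y i k)))"
    by (intro sum.cong refl)
  then show ?thesis by (simp add: Zvec_def p_part_pr sum_negf)
qed

lemma commutes_with_derivative:
  fixes \<iota> :: "nat \<Rightarrow> 'n::finite"
  assumes dim: "dim (span {Zvec A G K m d P Y i j | i j. 1 \<le> i \<and> i < j \<and> j \<le> r}) = r * (r - 1) div 2"
    and t: "t \<in> I" and \<iota>: "inj_on \<iota> {1..r}"
  shows "adm (emb \<iota> r (\<lambda>i j. H (Y i 1) (Y j 1) t)) (emb \<iota> r (\<lambda>i j. dH (Y i 1) (Y j 1) t)) = 0"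
  using commute_dual[OF pform_Hf[OF t] dHf_iform(1)[OF t] \<iota>]
    skew_family_symmetric[OF dim Zvec_skew commutator_zero[OF t]]
  by (simp add: Hf_def dHf_def)

end

section \<open>The Einstein equation as a polynomial differential system\<close>

lemma bilinear_prod: "linear f \<Longrightarrow> linear g \<Longrightarrow> bilinear (\<lambda>x y. f x * (g y :: real))"
  by (simp add: bilinear_def linear_iff algebra_simps)

lemma bilinear_sum_forms: "(\<And>i. i \<in> S \<Longrightarrow> bilinear (F i)) \<Longrightarrow> bilinear (\<lambda>x y. \<Sum>i\<in>S. F i x y)"
  by (simp add: bilinear_def linear_compose_sum)

lemma bilinear_cmult: "bilinear F \<Longrightarrow> bilinear (\<lambda>x y. a * (F x y :: real))"
  by (simp add: bilinear_def linear_iff algebra_simps)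

lemma bilinear_linear: "bilinear F \<Longrightarrow> linear (F x)" "bilinear F \<Longrightarrow> linear (\<lambda>x. F x y)"
  by (simp_all add: bilinear_def)

lemma kosf_linear:
  assumes br: "bilinear br" and h: "bilinear (h :: 'l::real_vector \<Rightarrow> 'l \<Rightarrow> real)"
  shows "linear (\<lambda>X. kosf br h X a b)" "linear (\<lambda>X. kosf br h a X b)" "linear (\<lambda>X. kosf br h a b X)"
    "linear (\<lambda>X. Dkosf br h X a b c)" "linear (\<lambda>X. Dkosf br h a b c X)"
  by (simp_all add: linear_iff kosf_def Dkosf_def Dhf_def bilinear_ladd[OF br] bilinear_radd[OF br] bilinear_lmul[OF br]
      bilinear_rmul[OF br] bilinear_ladd[OF h] bilinear_radd[OF h] bilinear_lmul[OF h] bilinear_rmul[OF h] field_simps)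

context einstein_decomposition
begin

text \<open>The derivative of an inverse matrix. \<open>sharp\<close> solves a linear system with
  differentiable coefficients, so it is differentiable, and differentiating the system gives its
  derivative.\<close>

lemma dual_deriv:
  assumes t: "t \<in> I" and b: "b \<in> BB" and y0: "y0 \<in> BB"
  shows "((\<lambda>s. dual (Hf s) b y0) has_real_derivative
    - (\<Sum>b'\<in>BB. \<Sum>c'\<in>BB. dual (Hf t) b b' * (dual (Hf t) y0 c' * dHf t b' c'))) (at t)"
proof -
  define z where "z s = sharp (Hf s) b" for s
  have fd: "((\<lambda>s. full (Hf s) X Z) has_derivative (\<lambda>v. dHf t X Z * v)) (at t)" for X Z
  proof -
    have "((\<lambda>s. H X Z s + Q (X - pr X) (Z - pr Z)) has_real_derivative dH X Z t) (at t)"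
      using DERIV_add[OF H_has_deriv[OF t] DERIV_const] by simp
    then show ?thesis by (simp add: full_def Hf_def dHf_def has_field_derivative_def)
  qed
  note fb = full_bilinear[OF pform_Hf]
  have zdiff: "z differentiable (at t)"
  proof (rule linear_system_differentiable[OF I(1) t, where L = "\<lambda>s v. \<Sum>w\<in>Basis. full (Hf s) v w *\<^sub>R w" and F = "\<lambda>s. \<Sum>w\<in>Basis. Q b w *\<^sub>R w"])
    show "linear (\<lambda>v. \<Sum>w\<in>Basis. full (Hf s) v w *\<^sub>R w)" if "s \<in> I" for s
      by (intro linearI) (simp_all add: bilinear_ladd[OF fb[OF that]] bilinear_lmul[OF fb[OF that]] scaleR_add_left sum.distrib scaleR_sum_right)
    show "(\<lambda>s. \<Sum>w\<in>Basis. full (Hf s) v w *\<^sub>R w) differentiable (at t)" for v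
    proof -
      have "(\<lambda>s. full (Hf s) v w) differentiable (at t)" for w using fd unfolding differentiable_def by blast
      then show ?thesis by (intro differentiable_sum differentiable_scaleR differentiable_const finite_Basis ballI) auto
    qed
    show "inj (\<lambda>v. \<Sum>w\<in>Basis. full (Hf t) v w *\<^sub>R w)"
    proof (rule injI)
      fix x y assume e: "(\<Sum>w\<in>Basis. full (Hf t) x w *\<^sub>R w) = (\<Sum>w\<in>Basis. full (Hf t) y w *\<^sub>R w)"
      have "full (Hf t) x w = full (Hf t) y w" if "w \<in> Basis" for w
        using arg_cong[OF e, of "\<lambda>v. v \<bullet> w"] that by simp
      then have "full (Hf t) x w = full (Hf t) y w" for w
        using linear_expand[OF bilinear_linear(1)[OF fb[OF t]], of x w] linear_expand[OF bilinear_linear(1)[OF fb[OF t]], of y w] by simp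
      then show "x = y" using inner_product_form_eqI[OF full_ip[OF pform_Hf[OF t]]] by blast
    qed
    show "(\<Sum>w\<in>Basis. full (Hf s) (z s) w *\<^sub>R w) = (\<Sum>w\<in>Basis. Q b w *\<^sub>R w)" if "s \<in> I" for s
      by (simp add: z_def sharp(1)[OF pform_Hf[OF that]])
  qed simp
  then obtain D where D: "(z has_derivative D) (at t)" by (auto simp: differentiable_def)
  have "dHf t (z t) w * v + full (Hf t) (D v) w = 0" for w v
  proof -
    have "((\<lambda>s. full (Hf s) (z s) w) has_derivative (\<lambda>v. dHf t (z t) w * v + full (Hf t) (D v) w + full (Hf t) (z t) 0)) (at t)"
      using has_derivative_bilinear_field[OF I(1) t fb fd D has_derivative_const[of w]] .
    moreover have "((\<lambda>s. full (Hf s) (z s) w) has_derivative (\<lambda>v. 0)) (at t)"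
      by (rule has_derivative_transform_within_open[OF has_derivative_const I(1) t, of "Q b w"])
        (simp add: z_def sharp(1)[OF pform_Hf])
    ultimately have "(\<lambda>v. dHf t (z t) w * v + full (Hf t) (D v) w + full (Hf t) (z t) 0) = (\<lambda>v. 0)"
      by (rule has_derivative_unique)
    from fun_cong[OF this, of v] show ?thesis by (simp add: bilinear_rzero[OF fb[OF t]])
  qed
  \<comment> \<open>This test vector turns the term with the unknown derivative \<open>D v\<close>
    into \<open>Q (D v) y0\<close>.\<close>
  from this[of "sharp (Hf t) y0"]
  have Dv: "Q (D v) y0 = - (dHf t (sharp (Hf t) b) (sharp (Hf t) y0)) * v" for v
    using sharp(1)[OF pform_Hf[OF t], of y0 "D v"] inner_product_formD(2)[OF full_ip[OF pform_Hf[OF t]], of "D v" "sharp (Hf t) y0"]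
      Q_sym[of y0 "D v"] by (simp add: z_def add_eq_0_iff algebra_simps)
  have "((\<lambda>s. Q (z s) y0) has_derivative (\<lambda>v. Q (D v) y0)) (at t)"
    by (rule bounded_linear.has_derivative[OF _ D])
      (use bilinear_linear(2)[OF Q_bil] linear_conv_bounded_linear in blast)
  then have "((\<lambda>s. dual (Hf s) b y0) has_real_derivative - dHf t (sharp (Hf t) b) (sharp (Hf t) y0)) (at t)"
    unfolding has_field_derivative_def dual_def z_def[symmetric] by (rule has_derivative_eq_rhs) (simp add: Dv z_def fun_eq_iff)
  moreover have "dHf t (sharp (Hf t) b) (sharp (Hf t) y0) = (\<Sum>b'\<in>BB. \<Sum>c'\<in>BB. dual (Hf t) b b' * (dual (Hf t) y0 c' * dHf t b' c'))"
    unfolding sharp_contr[OF pform_Hf[OF t] BB_pp[OF b]] sharp_contr[OF pform_Hf[OF t] BB_pp[OF y0]] contr_def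
    using iform_bil[OF dHf_iform(1)[OF t]]
    by (simp add: bilinear_sum_left bilinear_sum_right bilinear_lmul bilinear_rmul sum_distrib_left)
  ultimately show ?thesis by simp
qed

text \<open>The entries run over all of \<open>BB\<close>, since the Ricci tensor couples the
  equivalent summands with the others.\<close>

definition "UU = (\<lambda>(b, c). H b c) ` (BB \<times> BB) \<union> (\<lambda>(b, c). dH b c) ` (BB \<times> BB)
  \<union> (\<lambda>(b, c) t. dual (Hf t) b c) ` (BB \<times> BB)"

text \<open>Agreement is asked for on \<open>I\<close> only, where the orbit metrics are invariant
  forms.\<close>

definition "pol f \<longleftrightarrow> (\<exists>p\<in>poly_alg UU. \<forall>t\<in>I. f t = p t)"

lemma UU_mem:
  assumes "b \<in> BB" "x \<in> BB"
  shows "H b x \<in> UU" "dH b x \<in> UU" "(\<lambda>t. dual (Hf t) b x) \<in> UU"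
  using assms unfolding UU_def by force+

lemma pol_gen: "u \<in> UU \<Longrightarrow> pol u" unfolding pol_def using poly_alg.gen by blast
lemma pol_const: "pol (\<lambda>t. a)" unfolding pol_def by (rule bexI[of _ "\<lambda>t. a"]) (auto intro: poly_alg.const)

lemma pol_binary:
  assumes "\<And>p q. p \<in> poly_alg UU \<Longrightarrow> q \<in> poly_alg UU \<Longrightarrow> (\<lambda>t. F (p t) (q t)) \<in> poly_alg UU" "pol f" "pol h"
  shows "pol (\<lambda>t. F (f t) (h t))"
proof -
  obtain p q where "p \<in> poly_alg UU" "q \<in> poly_alg UU" "\<And>t. t \<in> I \<Longrightarrow> f t = p t" "\<And>t. t \<in> I \<Longrightarrow> h t = q t"
    using assms(2,3) unfolding pol_def by blast
  then show ?thesis using assms(1) unfolding pol_def by (intro bexI[of _ "\<lambda>t. F (p t) (q t)"]) auto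
qed

lemmas pol_add = pol_binary[where F = "(+)", OF poly_alg.add]
  and pol_mult = pol_binary[where F = "(*)", OF poly_alg.mult]
  and pol_diff = pol_binary[where F = "(-)", OF poly_alg_diff]
lemma pol_minus: "pol f \<Longrightarrow> pol (\<lambda>t. - f t)"
  by (rule pol_binary[where F = "\<lambda>x y. - x", OF poly_alg_minus])
lemma pol_divide: "pol f \<Longrightarrow> pol (\<lambda>t. f t / a)"
  by (rule pol_binary[where F = "\<lambda>x y. x / a", OF poly_alg_divide])

lemma pol_sum: assumes "\<And>j. j \<in> S \<Longrightarrow> pol (f j)" shows "pol (\<lambda>t. \<Sum>j\<in>S. f j t)"
proof -
  obtain p where "\<And>j. j \<in> S \<Longrightarrow> p j \<in> poly_alg UU \<and> (\<forall>t\<in>I. f j t = p j t)"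
    using assms unfolding pol_def by metis
  then show ?thesis unfolding pol_def by (intro bexI[OF _ poly_alg_sum[of S p]]) auto
qed

text \<open>A form vanishing on \<open>kk\<close> factors through the projection to the complement,
  so its value at arbitrary vectors is a fixed linear combination of its entries in
  \<open>BB\<close>.\<close>

lemma pol_form:
  assumes f: "\<And>t. t \<in> I \<Longrightarrow> iform (f t)" and k: "\<And>t X Z. t \<in> I \<Longrightarrow> X \<in> kk \<Longrightarrow> f t X Z = 0"
    and u: "\<And>b c. b \<in> BB \<Longrightarrow> c \<in> BB \<Longrightarrow> pol (\<lambda>t. f t b c)"
  shows "pol (\<lambda>t. f t X Z)"
proof -
  have "f t X Z = (\<Sum>b\<in>BB. \<Sum>c\<in>BB. Q X b * (Q Z c * f t b c))" if t: "t \<in> I" for t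
  proof -
    note bil = iform_bil[OF f[OF t]]
    have "f t X Z = f t (pr X) (pr Z)"
      using kills_pr[OF bil k[OF t], of X Z] kills_pr[OF bil k[OF t], of Z "pr X"] iform_sym[OF f[OF t]] by metis
    then show ?thesis
      by (simp add: pr_def bilinear_sum_left[OF bil] bilinear_sum_right[OF bil] bilinear_lmul[OF bil] bilinear_rmul[OF bil] sum_distrib_left)
        (subst sum.swap, simp add: mult.left_commute)
  qed
  moreover have "pol (\<lambda>t. \<Sum>b\<in>BB. \<Sum>c\<in>BB. Q X b * (Q Z c * f t b c))"
    by (intro pol_sum pol_mult pol_const u)
  ultimately show ?thesis unfolding pol_def by auto
qed

lemma pol_Hf: "pol (\<lambda>t. Hf t X Z)"
proof (rule pol_form)
  have "(\<lambda>t. Hf t b x) = H b x" for b x by (simp add: fun_eq_iff Hf_def)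
  then show "pol (\<lambda>t. Hf t b x)" if "b \<in> BB" "x \<in> BB" for b x using pol_gen[OF UU_mem(1)] that by simp
qed (use pformD(1,4)[OF pform_Hf] in auto)

lemma pol_dHf: "pol (\<lambda>t. dHf t X Z)"
proof (rule pol_form)
  have "(\<lambda>t. dHf t b x) = dH b x" for b x by (simp add: fun_eq_iff dHf_def)
  then show "pol (\<lambda>t. dHf t b x)" if "b \<in> BB" "x \<in> BB" for b x using pol_gen[OF UU_mem(2)] that by simp
qed (use dHf_iform in auto)

lemma pol_kosf: "pol (\<lambda>t. kosf br (Hf t) X Z W)"
  unfolding kosf_def by (intro pol_divide pol_add pol_diff pol_minus pol_Hf)

lemma pol_Dkosf: "pol (\<lambda>t. Dkosf br (Hf t) X Z W W')"
  unfolding Dkosf_def Dhf_def by (intro pol_divide pol_add pol_diff pol_minus pol_Hf)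

text \<open>The trace of a form with respect to the metric at time \<open>t\<close>, which by
  \<open>frame_sum\<close> equals the sum over any orthonormal frame.\<close>

definition "BS t F = (\<Sum>b\<in>BB. \<Sum>c\<in>BB. dual (Hf t) b c * F b c)"

lemma pol_BS: "(\<And>b c. pol (\<lambda>t. F t b c)) \<Longrightarrow> pol (\<lambda>t. BS t (F t))"
  unfolding BS_def by (intro pol_sum pol_mult pol_gen[OF UU_mem(3)])

lemma BS_bilinear: "(\<And>b c. bilinear (F b c)) \<Longrightarrow> bilinear (\<lambda>x y. BS t (\<lambda>b c. F b c x y))"
  unfolding BS_def by (intro bilinear_sum_forms bilinear_cmult)

text \<open>The right hand side of \<open>einstein_tangential\<close> with its frame sums replaced
  by traces.\<close>

definition "einstein_rhs X Z t =
     2 * (BS t (\<lambda>U W. Dkosf br (Hf t) U Z X W)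
         - BS t (\<lambda>U W. BS t (\<lambda>U' W'. kosf br (Hf t) Z X U' * kosf br (Hf t) U W W'))
         - dHf t X Z * BS t (dHf t) / 4
         - BS t (\<lambda>U W. BS t (\<lambda>U' W'. kosf br (Hf t) U Z U' * kosf br (Hf t) W' X W))
         + BS t (\<lambda>U W. dHf t Z U * dHf t X W) / 4)
     + BS t (\<lambda>U W. dHf t Z U * dHf t X W) / 2 - 2 * \<Lambda> * Hf t X Z"

lemma pol_einstein_rhs: "pol (einstein_rhs X Z)"
  unfolding einstein_rhs_def[abs_def]
  by (intro pol_add pol_diff pol_mult pol_divide pol_BS pol_const pol_kosf pol_Dkosf pol_Hf pol_dHf)

lemma dH_has_deriv: assumes t: "t \<in> I" shows "(dH X Z has_real_derivative einstein_rhs X Z t) (at t)"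
proof -
  obtain E :: "'e \<Rightarrow> 'l" and S where E: "frame_at t E S" "\<And>z. z \<in> S \<Longrightarrow> E z \<in> pp"
    "\<And>X. X \<in> pp \<Longrightarrow> X = (\<Sum>z\<in>S. Hf t X (E z) *\<^sub>R E z)" using frame_exists[OF t] by blast
  have fin: "finite S" using E(1) by (simp add: frame_at_def)
  have fs: "(\<Sum>z\<in>S. F (E z) (E z)) = BS t F" if "bilinear F" for F
    unfolding BS_def by (rule frame_sum[OF pform_Hf[OF t] that fin E(2,3)])
  note h = Hf_bilinear[of t] and \<eta> = iform_bil[OF dHf_iform(1)[OF t]]
  note kl = kosf_linear[OF br_bilinear h]
  let ?k = "kosf br (Hf t)"
  have kb: "bilinear (\<lambda>U W. ?k U W a)" "bilinear (\<lambda>U W. Dkosf br (Hf t) U Z X W)" for a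
    by (simp_all add: bilinear_def kl)
  have H: "(\<lambda>X Y. H X Y t) = Hf t" by (simp add: fun_eq_iff Hf_def[symmetric])
  have e1: "(\<Sum>z\<in>S. Dkosf br (Hf t) (E z) Z X (E z)) = BS t (\<lambda>U W. Dkosf br (Hf t) U Z X W)"
    by (rule fs[OF kb(2)])
  \<comment> \<open>In a double sum the inner frame is eliminated first; the result is bilinear in
    the outer frame vector, which permits the second elimination.\<close>
  have "(\<Sum>j\<in>S. ?k Z X (E j) * ?k (E i) (E i) (E j)) = BS t (\<lambda>U' W'. ?k Z X U' * ?k (E i) (E i) W')" for i
    by (rule fs) (intro bilinear_prod kl)
  moreover have "bilinear (\<lambda>U W. BS t (\<lambda>U' W'. ?k Z X U' * ?k U W W'))"
    by (intro BS_bilinear bilinear_cmult kb)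
  ultimately have e2: "(\<Sum>i\<in>S. \<Sum>j\<in>S. ?k Z X (E j) * ?k (E i) (E i) (E j))
      = BS t (\<lambda>U W. BS t (\<lambda>U' W'. ?k Z X U' * ?k U W W'))"
    using fs[of "\<lambda>U W. BS t (\<lambda>U' W'. ?k Z X U' * ?k U W W')"] by simp
  have e3: "(\<Sum>i\<in>S. dHf t X Z * dHf t (E i) (E i) / 4) = dHf t X Z * BS t (dHf t) / 4"
    unfolding fs[OF \<eta>, symmetric] by (simp add: sum_distrib_left sum_divide_distrib)
  have "(\<Sum>j\<in>S. ?k (E i) Z (E j) * ?k (E j) X (E i)) = BS t (\<lambda>U' W'. ?k (E i) Z U' * ?k W' X (E i))" for i
    by (rule fs) (intro bilinear_prod kl)
  moreover have "bilinear (\<lambda>U W. BS t (\<lambda>U' W'. ?k U Z U' * ?k W' X W))"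
    by (intro BS_bilinear bilinear_prod kl)
  ultimately have e4: "(\<Sum>i\<in>S. \<Sum>j\<in>S. ?k (E i) Z (E j) * ?k (E j) X (E i))
      = BS t (\<lambda>U W. BS t (\<lambda>U' W'. ?k U Z U' * ?k W' X W))"
    using fs[of "\<lambda>U W. BS t (\<lambda>U' W'. ?k U Z U' * ?k W' X W)"] by simp
  have e6: "(\<Sum>i\<in>S. dHf t Z (E i) * dHf t X (E i)) = BS t (\<lambda>U W. dHf t Z U * dHf t X W)"
    by (rule fs) (intro bilinear_prod bilinear_linear(1)[OF \<eta>])
  then have e5: "(\<Sum>i\<in>S. dHf t Z (E i) * dHf t X (E i) / 4) = BS t (\<lambda>U W. dHf t Z U * dHf t X W) / 4"
    by (simp flip: sum_divide_distrib)
  show ?thesis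
    using einstein_tangential[OF t E(1), of X Z]
    unfolding H dHf_def[symmetric] Hf_def[symmetric] sum.distrib sum_subtractf e1 e2 e3 e4 e5 e6 einstein_rhs_def .
qed

text \<open>The system closes because the Einstein equation is of second order in \<open>H\<close>
  and the derivative of the inverse involves only the inverse and \<open>dH\<close>.\<close>

lemma poly_system_UU: "poly_system UU I"
proof
  show "finite UU" using BB_fin by (simp add: UU_def)
  show "open I" by (rule I)
  show "connected I" using I(2) is_interval_connected by blast
  fix u assume "u \<in> UU"
  then consider b c where "b \<in> BB" "c \<in> BB" "u = H b c" | b c where "b \<in> BB" "c \<in> BB" "u = dH b c"
    | b c where "b \<in> BB" "c \<in> BB" "u = (\<lambda>t. dual (Hf t) b c)"
    unfolding UU_def by auto
  then have "\<exists>u'. pol u' \<and> (\<forall>t\<in>I. (u has_real_derivative u' t) (at t))"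
  proof cases
    case (1 b c)
    then show ?thesis using H_has_deriv pol_gen[OF UU_mem(2)] by blast
  next
    case (2 b c)
    then show ?thesis using dH_has_deriv pol_einstein_rhs by blast
  next
    case (3 b c)
    have "pol (\<lambda>t. - (\<Sum>b'\<in>BB. \<Sum>c'\<in>BB. dual (Hf t) b b' * (dual (Hf t) c c' * dHf t b' c')))"
      by (intro pol_minus pol_sum pol_mult pol_gen[OF UU_mem(3)] pol_dHf 3)
    then show ?thesis using dual_deriv 3 by blast
  qed
  then show "\<exists>u'\<in>poly_alg UU. \<forall>t\<in>I. (u has_real_derivative u' t) (at t)"
    unfolding pol_def by (metis (no_types, lifting))
qed

end

text \<open>An index type for the equivalent summands, of which there are at most \<open>DIM('l)\<close>.\<close>

typedef (overloaded) 'l basis_index = "Basis :: 'l::euclidean_space set"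
  using nonempty_Basis by blast

lemma card_basis_index: "card (UNIV :: 'l::euclidean_space basis_index set) = DIM('l)"
  by (rule type_definition.card[OF type_definition_basis_index])

instance basis_index :: (euclidean_space) finite
proof
  have "card (UNIV :: 'a basis_index set) > 0" unfolding card_basis_index by simp
  then show "finite (UNIV :: 'a basis_index set)" by (rule card_ge_0_finite)
qed

lemma onb_independent:
  assumes Q: "inner_product_form Q" and B: "onb Q B W"
  shows "independent B"
proof (rule independent_if_scalars_zero)
  show fin: "finite B" using B by (simp add: onb_def)
  fix f x assume s: "(\<Sum>b\<in>B. f b *\<^sub>R b) = 0" and x: "x \<in> B"
  note bil = inner_product_formD(1)[OF Q]
  have "0 = Q (\<Sum>b\<in>B. f b *\<^sub>R b) x" by (simp add: s bilinear_lzero[OF bil])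
  also have "\<dots> = (\<Sum>b\<in>B. if b = x then f b else 0)"
    unfolding bilinear_sum_left[OF bil] bilinear_lmul[OF bil]
    by (intro sum.cong refl) (use B x in \<open>auto simp: onb_def\<close>)
  also have "\<dots> = f x" using fin x by simp
  finally show "f x = 0" by simp
qed

section \<open>Diagonalization by a constant rotation\<close>

context einstein_decomposition
begin

lemma Y_BB: assumes i: "i \<in> {1..r}" shows "Y i 1 \<in> BB"
proof -
  have "Y i 1 \<in> Bi i" using i d_pos by (simp add: Bi_def)
  then show ?thesis using r_sub(1)[OF i] unfolding BB_def by blast
qed

lemma index_map: "\<exists>\<iota> :: nat \<Rightarrow> 'l basis_index. inj_on \<iota> {1..r}"
proof -
  have inj: "inj_on (\<lambda>i. Y i 1) {1..r}"
  proof (rule inj_onI)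
    fix i j assume ij: "i \<in> {1..r}" "j \<in> {1..r}" "Y i 1 = Y j 1"
    then show "i = j" using Q_YY[OF ij(1,2) d_pos d_pos] Q_YY[OF ij(2,2) d_pos d_pos] by (auto split: if_splits)
  qed
  have "(\<lambda>i. Y i 1) ` {1..r} \<subseteq> BB"
    using Y_BB by blast
  then have "independent ((\<lambda>i. Y i 1) ` {1..r})" using onb_independent[OF Q BB] independent_mono by blast
  then have "card ((\<lambda>i. Y i 1) ` {1..r}) \<le> DIM('l)" using independent_bound by blast
  then have "card {1..r} \<le> card (UNIV :: 'l basis_index set)"
    unfolding card_basis_index using card_image[OF inj] by simp
  then show ?thesis using card_le_inj[of "{1..r}" "UNIV :: 'l basis_index set"] by auto
qed

text \<open>One matrix \<open>U\<close> diagonalizes the commuting family for all times, hence is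
  constant. It rotates the summand index and leaves the index within a summand alone, so the blocks
  of the metric stay scalar in the new bases.\<close>

lemma diagonalizable:
  assumes dim: "dim (span {Zvec A G K m d P Y i j | i j. 1 \<le> i \<and> i < j \<and> j \<le> r}) = r * (r - 1) div 2"
  shows "globally_diagonalizable A G B g \<phi> K I c Q m r d"
proof -
  obtain \<iota> :: "nat \<Rightarrow> 'l basis_index" where \<iota>: "inj_on \<iota> {1..r}" using index_map by blast
  interpret poly_system UU I by (rule poly_system_UU)
  let ?h = "\<lambda>t i j. H (Y i 1) (Y j 1) t"
  have hsym: "?h t i j = ?h t j i" if "t \<in> I" for t i j
    using pformD(3)[OF pform_Hf[OF that]] by (simp add: Hf_def)
  have entry: "emb \<iota> r f $ p $ q = f (inv_into {1..r} \<iota> p) (inv_into {1..r} \<iota> q)"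
    "inv_into {1..r} \<iota> p \<in> {1..r}" "inv_into {1..r} \<iota> q \<in> {1..r}"
    if "p \<in> \<iota> ` {1..r}" "q \<in> \<iota> ` {1..r}" for f :: "nat \<Rightarrow> nat \<Rightarrow> real" and p q
    using that inv_into_into[OF that(1)] inv_into_into[OF that(2)] by (auto simp: emb_def)
  have entry0: "emb \<iota> r f $ p $ q = 0" if "\<not> (p \<in> \<iota> ` {1..r} \<and> q \<in> \<iota> ` {1..r})" for f :: "nat \<Rightarrow> nat \<Rightarrow> real" and p q
    using that by (auto simp: emb_def)
  have "adm (emb \<iota> r (?h s)) (emb \<iota> r (?h t)) = 0" if s: "s \<in> I" and t: "t \<in> I" for s t
  proof (rule commuting_curve[OF I(3) _ _ _ s t, where S = "\<lambda>t. emb \<iota> r (?h t)"])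
    show "(\<lambda>t. emb \<iota> r (?h t) $ p $ q) \<in> poly_alg UU" for p q
    proof (cases "p \<in> \<iota> ` {1..r} \<and> q \<in> \<iota> ` {1..r}")
      case True
      then show ?thesis using entry[of p q] UU_mem(1)[OF Y_BB Y_BB] poly_alg.gen by simp
    next
      case False
      then show ?thesis unfolding entry0[OF False] by (intro poly_alg.const)
    qed
    show "transpose (emb \<iota> r (?h t)) = emb \<iota> r (?h t)" if "t \<in> I" for t
      unfolding transpose_def emb_def using hsym[OF that] by (simp add: vec_eq_iff)
    fix t D assume t: "t \<in> I" and D: "((\<lambda>t. emb \<iota> r (?h t)) has_vector_derivative D) (at t)"
    have "((\<lambda>t. emb \<iota> r (?h t)) has_vector_derivative emb \<iota> r (\<lambda>i j. dH (Y i 1) (Y j 1) t)) (at t)"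
    proof (rule matrix_has_vector_derivative)
      fix p q
      show "((\<lambda>t. emb \<iota> r (?h t) $ p $ q) has_real_derivative emb \<iota> r (\<lambda>i j. dH (Y i 1) (Y j 1) t) $ p $ q) (at t)"
      proof (cases "p \<in> \<iota> ` {1..r} \<and> q \<in> \<iota> ` {1..r}")
        case True
        then show ?thesis using entry(1)[of p q] H_has_deriv[OF t] by simp
      next
        case False
        then show ?thesis unfolding entry0[OF False] by simp
      qed
    qed
    then have "D = emb \<iota> r (\<lambda>i j. dH (Y i 1) (Y j 1) t)" using D vector_derivative_unique_at by blast
    then show "adm (emb \<iota> r (?h t)) D = 0" using commutes_with_derivative[OF dim t \<iota>] by simp
  qed
  note comm = this
  have "\<exists>U. (\<forall>i\<in>{1..r}. \<forall>j\<in>{1..r}. (\<Sum>k\<in>{1..r}. U i k * U j k) = (if i = j then 1 else 0)) \<and>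
     (\<forall>i\<in>{1..r}. \<forall>j\<in>{1..r}. (\<Sum>k\<in>{1..r}. U k i * U k j) = (if i = j then 1 else 0)) \<and>
     (\<forall>t\<in>I. \<forall>i\<in>{1..r}. \<forall>j\<in>{1..r}. i \<noteq> j \<longrightarrow> (\<Sum>k\<in>{1..r}. \<Sum>l\<in>{1..r}. U i k * ?h t k l * U j l) = 0)"
  proof (rule simultaneous_diagonalization[OF \<iota>])
    show "?h t i j = ?h t j i" if "t \<in> I" for t i j by (rule hsym[OF that])
    show "adm (emb \<iota> r (?h s)) (emb \<iota> r (?h t)) = 0" if "s \<in> I" "t \<in> I" for s t by (rule comm[OF that])
  qed
  then obtain U where U': "\<forall>i\<in>{1..r}. \<forall>j\<in>{1..r}. (\<Sum>k\<in>{1..r}. U i k * U j k) = (if i = j then 1 else 0)"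
    "\<forall>i\<in>{1..r}. \<forall>j\<in>{1..r}. (\<Sum>k\<in>{1..r}. U k i * U k j) = (if i = j then 1 else 0)"
    "\<forall>t\<in>I. \<forall>i\<in>{1..r}. \<forall>j\<in>{1..r}. i \<noteq> j \<longrightarrow> (\<Sum>k\<in>{1..r}. \<Sum>l\<in>{1..r}. U i k * ?h t k l * U j l) = 0"
    by (elim exE conjE)
  note U = U'(1,2)[THEN bspec, THEN bspec] U'(3)[THEN bspec, THEN bspec, THEN bspec, THEN mp]
  define Y' where "Y' i k = (\<Sum>j\<in>{1..r}. U i j *\<^sub>R Y j k)" for i k
  define P' where "P' i = (if i \<le> r then span (Y' i ` {1..d}) else P i)" for i
  define h' where "h' i j t = (\<Sum>p\<in>{1..r}. \<Sum>q\<in>{1..r}. U i p * ?h t p q * U j q)" for i j t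
  have "isotropy_decomposition A G K Q m r d P' Y'"
    by (rule rotated_decomposition[OF U(1,2) Y'_def P'_def])
  moreover have "orbit_metric A G B g \<phi> c t (Y' i k) (Y' j l) = (if k = l then h' i j t else 0)"
    if t: "t \<in> I" and k: "k \<in> {1..d}" "l \<in> {1..d}" for t i j k l
  proof -
    note bil = Hf_bilinear[of t]
    have "orbit_metric A G B g \<phi> c t (Y' i k) (Y' j l) = Hf t (Y' i k) (Y' j l)" by (simp add: Hf_def H_def)
    also have "\<dots> = (\<Sum>p\<in>{1..r}. \<Sum>q\<in>{1..r}. U i p * (U j q * Hf t (Y p k) (Y q l)))"
      unfolding Y'_def
      by (simp add: bilinear_sum_left[OF bil] bilinear_sum_right[OF bil] bilinear_lmul[OF bil] bilinear_rmul[OF bil] sum_distrib_left)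
        (subst sum.swap, simp add: mult.left_commute)
    also have "\<dots> = (\<Sum>p\<in>{1..r}. \<Sum>q\<in>{1..r}. if k = l then U i p * ?h t p q * U j q else 0)"
      by (intro sum.cong refl) (simp only: iform_Y[OF pformD(1)[OF pform_Hf[OF t]] _ _ k], simp add: Hf_def)
    finally show ?thesis by (simp add: h'_def)
  qed
  moreover have "h' i j t = 0" if "t \<in> I" "i \<in> {1..r}" "j \<in> {1..r}" "i \<noteq> j" for i j t
    unfolding h'_def using U(3)[OF that] .
  ultimately show ?thesis unfolding globally_diagonalizable_def by blast
qed

end

theorem theorem3p4:
  fixes G :: "'g::{t2_space,second_countable_topology} monoid"
    and A :: "('g, 'l::euclidean_space) chart set"
    and B :: "('m::{t2_space,second_countable_topology}, 'e::euclidean_space) chart set"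
    and g :: "'m \<Rightarrow> 'e \<Rightarrow> 'e \<Rightarrow> real"
    and \<phi> :: "'g \<Rightarrow> 'm \<Rightarrow> 'm"
    and K :: "'g set" and I :: "real set" and c :: "real \<Rightarrow> 'm"
    and Q :: "'l \<Rightarrow> 'l \<Rightarrow> real"
    and m r d :: nat and P :: "nat \<Rightarrow> 'l set" and Y :: "nat \<Rightarrow> nat \<Rightarrow> 'l"
  assumes "lie_group A G" and "compact (UNIV :: 'g set)" and "connected (UNIV :: 'g set)"
    and "smooth_atlas B" and "connected (UNIV :: 'm set)"
    and "riemannian_metric B g" and "einstein B g"
    and "cohomogeneity_one A G B g \<phi>"
    and "normal_curve A G B g \<phi> K I c"
    and "bi_invariant A G Q"
    and "isotropy_decomposition A G K Q m r d P Y"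
    and "dim (span {Zvec A G K m d P Y i j | i j. 1 \<le> i \<and> i < j \<and> j \<le> r}) = r * (r - 1) div 2"
  shows "globally_diagonalizable A G B g \<phi> K I c Q m r d"
proof -
  obtain \<Lambda> where \<Lambda>: "\<And>p v w. ricci B g p v w = \<Lambda> * g p v w" using assms(7) by (auto simp: einstein_def)
  have "smooth_isometric_action A G B g \<phi>" using assms(8) by (simp add: cohomogeneity_one_def)
  then have "einstein_decomposition A G B g \<phi> K I c \<Lambda> Q m r d P Y"
    using assms \<Lambda> by (intro einstein_decomposition.intro cohomogeneity_one_action.intro isometric_action.intro
        cohomogeneity_one_action_axioms.intro einstein_decomposition_axioms.intro)
  then show ?thesis using assms(12) by (rule einstein_decomposition.diagonalizable)
qed

end
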